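(* Let $\mathcal W_{0h}$ be the span of the functions (i) $\phi_{\Omega^{(\ell)};i,j}$, $i,j=3,4,\ldots,p+k(p-r)-3$, $\ell=1,\ldots,P$; (ii) $\phi_{\Gamma^{(s)};i,j}$, $i=0,1,2$, $j=5-i,6-i,\ldots,n_i+i-6$, $s=1,\ldots,E$; (iii) $\phi_{\mathbf v^{(\rho)};m}$, $m=1,\ldots,\dim\ker H^{(\rho)}$, $\rho=1,\ldots,V$. Then $\mathcal W_{0h}\subseteq\mathcal V_{0h}$, and the functions in (i)–(iii) form a basis of $\mathcal W_{0h}$.
   Context: Spline spaces: Let $p\ge5$, $k\ge0$ integers, $h=\frac1{k+1}$, and if $k\ge1$ let $2\le r\le p-3$; assume $k\ge\frac{9-p}{p-r-2}$. For integers $p'\ge1$, $0\le r'\le p'-1$, $\mathcal S^{p',r'}_h([0,1])$ is the spline space of degree $p'$ with open knot vector where $0,1$ have multiplicity $p'+1$ and inner knots $mh$, $m=1,\ldots,k$, multiplicity $p'-r'$ (polynomials if $k=0$); B-splines $N^{p',r'}_i$, $i=0,\ldots,p'+k(p'-r')$; $N^{p,r}_{i,j}(\xi_1,\xi_2)=N^{p,r}_i(\xi_1)N^{p,r}_j(\xi_2)$ span $\mathcal S^{p,r}_h([0,1]^2)$. Multi-patch domain: $\Omega=\bigcup_{\ell=1}^P\Omega^{(\ell)}\subset\mathbb R^2$, $P\ge2$, each $\Omega^{(\ell)}=\mathbf F^{(\ell)}([0,1]^2)$ a strictly convex quadrilateral with $\mathbf F^{(\ell)}$ bilinear, bijective,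 regular; disjoint interiors; two patches meet in nothing, one common vertex or a whole common edge; deleting any vertex does not disconnect $\Omega$. $\Gamma^{(1)},\ldots,\Gamma^{(E)}$ are the common (non-boundary) edges and $\mathbf v^{(1)},\ldots,\mathbf v^{(V)}$ are the inner and boundary vertices of valency (number of patch edges emanating) at least 3. $\mathcal V_h=\{\phi\in C^2(\Omega):\phi|_{\Omega^{(\ell)}}\circ\mathbf F^{(\ell)}\in\mathcal S^{p,r}_h([0,1]^2)\ \forall\ell\}$, $\mathcal V_{0h}=\{\phi\in\mathcal V_h:\phi=\partial\phi/\partial\mathbf n=\Delta\phi=0\text{ on }\partial\Omega\}$. Patch functions: $\phi_{\Omega^{(\ell)};i,j}=N^{p,r}_{i,j}\circ(\mathbf F^{(\ell)})^{-1}$ on $\Omega^{(\ell)}$, $0$ elsewhere. Two-patch edge functions: for bilinear parameterizations $\mathbf G^{(a)},\mathbf G^{(b)}$ of adjacent patches with $\mathbf G^{(a)}(0,\xi)=\mathbf G^{(b)}(0,\xi)$, for $\tau\in\{a,b\}$: $\bar\alpha^{(\tau)}(\xi)=\det[D_{\xi_1}\mathbf G^{(\tau)}(0,\xi),D_\xi\mathbf G^{(\tau)}(0,\xi)]$, $\alpha^{(\tau)}=c_1\bar\alpha^{(\tau)}$ with $c_1$ minimizing $\|\alpha^{(a)}+1\|^2_{L^2(0,1)}+\|\alpha^{(b)}-1\|^2_{L^2(0,1)}$, $\beta^{(\tau)}(\xi)=\frac{D_{\xi_1}\mathbf G^{(\tau)}(0,\xi)\cdot D_\xi\mathbf G^{(\tau)}(0,\xi)}{\|D_\xi\mathbf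 G^{(\tau)}(0,\xi)\|^2}$, $d_\alpha=\max(\deg\alpha^{(a)},\deg\alpha^{(b)})\in\{0,1\}$, $n_0=\dim\mathcal S^{p,r+2}_h$, $n_1=\dim\mathcal S^{p-d_\alpha,r+1}_h$, $n_2=\dim\mathcal S^{p-2d_\alpha,r}_h$ (on $[0,1]$); $M_0=\sum_{i=0}^2N^{p,r}_i$, $M_1=\frac hp(N^{p,r}_1+2N^{p,r}_2)$, $M_2=\frac{h^2}{p(p-1)}N^{p,r}_2$; $g^{(\tau)}_{0,j}(\xi_1,\xi_2)=N^{p,r+2}_j(\xi_2)M_0(\xi_1)+\beta^{(\tau)}(\xi_2)(N^{p,r+2}_j)'(\xi_2)M_1(\xi_1)+(\beta^{(\tau)}(\xi_2))^2(N^{p,r+2}_j)''(\xi_2)M_2(\xi_1)$, $g^{(\tau)}_{1,j}=\frac ph\big(\alpha^{(\tau)}(\xi_2)N^{p-d_\alpha,r+1}_j(\xi_2)M_1(\xi_1)+2\alpha^{(\tau)}(\xi_2)\beta^{(\tau)}(\xi_2)(N^{p-d_\alpha,r+1}_j)'(\xi_2)M_2(\xi_1)\big)$, $g^{(\tau)}_{2,j}=\frac{p(p-1)}{h^2}(\alpha^{(\tau)}(\xi_2))^2N^{p-2d_\alpha,r}_j(\xi_2)M_2(\xi_1)$. Edge functions: for $\Gamma^{(s)}=\Omega^{(\ell)}\cap\Omega^{(\ell')}$ with (after linear reparameterization) $\mathbf F^{(\ell)}(0,\xi)=\mathbf F^{(\ell')}(0,\xi)$, $\phi_{\Gamma^{(s)};i,j}=g^{(a)}_{i,j}\circ(\mathbf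 F^{(\ell)})^{-1}$ on $\Omega^{(\ell)}$, $=g^{(b)}_{i,j}\circ(\mathbf F^{(\ell')})^{-1}$ on $\Omega^{(\ell')}$ (with $\mathbf G^{(a)}=\mathbf F^{(\ell)}$, $\mathbf G^{(b)}=\mathbf F^{(\ell')}$), $0$ elsewhere; $n_i$ refer to this edge. Vertex functions: for a vertex $\mathbf v=\mathbf v^{(\rho)}$, let $\nu$ be the number of patches containing it, labelled counterclockwise $\Omega^{(0)},\ldots,\Omega^{(\nu-1)}$ and (re)parameterized so $\mathbf F^{(\ell)}(\mathbf 0)=\mathbf v$ and $\Gamma^{(\ell+1)}:=\Omega^{(\ell)}\cap\Omega^{(\ell+1)}=\mathbf F^{(\ell)}(\{0\}\times[0,1])=\mathbf F^{(\ell+1)}([0,1]\times\{0\})$ (indices mod $\nu$ for an inner vertex); for a boundary vertex $\Gamma^{(0)}=\mathbf F^{(0)}([0,1]\times\{0\})$, $\Gamma^{(\nu)}=\mathbf F^{(\nu-1)}(\{0\}\times[0,1])$. For interior $\Gamma^{(\ell+1)}$, $g^{(\ell)}_{\Gamma^{(\ell+1)};i,j}:=g^{(a)}_{i,j}$, $g^{(\ell+1)}_{\Gamma^{(\ell+1)};i,j}:=g^{(b)}_{i,j}$ for $\mathbf G^{(a)}=\mathbf F^{(\ell)}$, $\mathbf G^{(b)}=\mathbf F^{(\ell+1)}\circ\sigma$, $\sigma(\xi_1,\xi_2)=(\xi_2,\xi_1)$. With real coefficients, $f^{\Gamma^{(\ell)}}_\ell(\xi_1,\xi_2)=\sum_{i=0}^2\sum_{j=0}^{4-i}a^{\Gamma^{(\ell)}}_{i,j}g^{(\ell)}_{\Gamma^{(\ell)};i,j}(\xi_2,\xi_1)$,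 $f^{\Gamma^{(\ell+1)}}_\ell(\xi_1,\xi_2)=\sum_{i=0}^2\sum_{j=0}^{4-i}a^{\Gamma^{(\ell+1)}}_{i,j}g^{(\ell)}_{\Gamma^{(\ell+1)};i,j}(\xi_1,\xi_2)$, $f^{\Omega^{(\ell)}}_\ell=\sum_{i,j=0}^2a^{(\ell)}_{i,j}N^{p,r}_{i,j}$, $f_\ell=f^{\Gamma^{(\ell)}}_\ell+f^{\Gamma^{(\ell+1)}}_\ell-f^{\Omega^{(\ell)}}_\ell$ (for a boundary vertex the terms at $\Gamma^{(0)},\Gamma^{(\nu)}$ carry coefficients $a^{\Gamma^{(0)}}_{i,j},a^{\Gamma^{(\nu)}}_{i,j}$), and $\phi_{\mathbf v}=f_\ell\circ(\mathbf F^{(\ell)})^{-1}$ on $\Omega^{(\ell)}$, $0$ elsewhere. $H^{(\rho)}$ is the matrix of the homogeneous linear system in all these coefficients consisting of $\partial^i_{\xi_1}\partial^j_{\xi_2}(f^{\Gamma^{(\ell+1)}}_\ell-f^{\Gamma^{(\ell)}}_\ell)(\mathbf 0)=0$ and $\partial^i_{\xi_1}\partial^j_{\xi_2}(f^{\Gamma^{(\ell+1)}}_\ell-f^{\Omega^{(\ell)}}_\ell)(\mathbf 0)=0$ ($0\le i,j\le2$, $0\le\ell\le\nu-1$), and, for a boundary vertex, also $a^{\Gamma^{(0)}}_{i,j}=a^{\Gamma^{(\nu)}}_{i,j}=0$ ($0\le i\le2$, $0\le j\le4-i$) and $a^{(\ell)}_{i,j}=0$ ($0\le i,j\le 2$,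 all $\ell$). For a chosen basis of $\ker H^{(\rho)}$, $\phi_{\mathbf v^{(\rho)};m}$ is the function $\phi_{\mathbf v}$ given by the $m$-th basis vector. *)

theory Defs
  imports "HOL-Analysis.Analysis"
begin

type_synonym pt = "real \<times> real"

definition unitsq :: "pt set" where
  "unitsq = {0..1::real} \<times> {0..1::real}"

definition sqcorners :: "pt set" where
  "sqcorners = {(0,0), (1,0), (1,1), (0,1)}"

definition sqsides :: "pt set set" where
  "sqsides = {closed_segment (0,0) (1,0), closed_segment (1,0) (1,1),
              closed_segment (1,1) (0,1), closed_segment (0,1) (0,0)}"

definition sqsym :: "(pt \<Rightarrow> pt) set" where
  "sqsym = {(\<lambda>(x,y). (x,y)), (\<lambda>(x,y). (1-x,y)), (\<lambda>(x,y). (x,1-y)), (\<lambda>(x,y). (1-x,1-y)),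
            (\<lambda>(x,y). (y,x)), (\<lambda>(x,y). (1-y,x)), (\<lambda>(x,y). (y,1-x)), (\<lambda>(x,y). (1-y,1-x))}"

definition pdx :: "(pt \<Rightarrow> real) \<Rightarrow> pt \<Rightarrow> real" where
  "pdx f x = deriv (\<lambda>t. f (t, snd x)) (fst x)"

definition pdy :: "(pt \<Rightarrow> real) \<Rightarrow> pt \<Rightarrow> real" where
  "pdy f x = deriv (\<lambda>t. f (fst x, t)) (snd x)"

definition dpart :: "nat \<Rightarrow> nat \<Rightarrow> (pt \<Rightarrow> real) \<Rightarrow> pt \<Rightarrow> real" where
  "dpart i j f = (pdx ^^ i) ((pdy ^^ j) f)"

definition pd1v :: "(pt \<Rightarrow> pt) \<Rightarrow> pt \<Rightarrow> pt" where
  "pd1v G x = vector_derivative (\<lambda>t. G (t, snd x)) (at (fst x))"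

definition pd2v :: "(pt \<Rightarrow> pt) \<Rightarrow> pt \<Rightarrow> pt" where
  "pd2v G x = vector_derivative (\<lambda>t. G (fst x, t)) (at (snd x))"

definition det2 :: "pt \<Rightarrow> pt \<Rightarrow> real" where
  "det2 u v = fst u * snd v - snd u * fst v"

definition jdet :: "(pt \<Rightarrow> pt) \<Rightarrow> pt \<Rightarrow> real" where
  "jdet G x = det2 (pd1v G x) (pd2v G x)"

text \<open>Open knot vector of S^{p',r'}_h, h = 1/(k+1): 0 and 1 of multiplicity p'+1,
  isin knots m h (m=1..k) of multiplicity p'-r'.\<close>
definition knot :: "nat \<Rightarrow> nat \<Rightarrow> nat \<Rightarrow> nat \<Rightarrow> real" where
  "knot p r k j = (if j \<le> p then 0 else if p + 1 + k * (p - r) \<le> j then 1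
                   else real ((j - (p + 1)) div (p - r) + 1) / real (k + 1))"

text \<open>Cox--de Boor recursion (with the convention 0/0 = 0). The pieces on the first
  and last knot spans are extended polynomially beyond [0,1], so that derivatives
  at 0 and 1 are the one-sided derivatives.\<close>
fun bsp :: "nat \<Rightarrow> nat \<Rightarrow> nat \<Rightarrow> nat \<Rightarrow> nat \<Rightarrow> real \<Rightarrow> real" where
  "bsp p r k 0 i x =
     (let a = knot p r k i; b = knot p r k (Suc i) in
       if a < b \<and> (a \<le> x \<or> a = 0) \<and> (x < b \<or> b = 1) then 1 else 0)"
| "bsp p r k (Suc q) i x =
     (x - knot p r k i) / (knot p r k (i + q + 1) - knot p r k i) * bsp p r k q i x
     + (knot p r k (i + q + 2) - x) / (knot p r k (i + q + 2) - knot p r k (i + 1))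
       * bsp p r k q (Suc i) x"

definition Nsp :: "nat \<Rightarrow> nat \<Rightarrow> nat \<Rightarrow> nat \<Rightarrow> real \<Rightarrow> real" where
  "Nsp p r k i x = bsp p r k p i x"

definition dimS :: "nat \<Rightarrow> nat \<Rightarrow> nat \<Rightarrow> nat" where
  "dimS p r k = p + 1 + k * (p - r)"

definition hh :: "nat \<Rightarrow> real" where
  "hh k = 1 / real (k + 1)"

definition inS2 :: "nat \<Rightarrow> nat \<Rightarrow> nat \<Rightarrow> (pt \<Rightarrow> real) \<Rightarrow> bool" where
  "inS2 p r k f \<longleftrightarrow> (\<exists>c. \<forall>\<xi>\<in>unitsq.
      f \<xi> = (\<Sum>i\<le>p + k*(p-r). \<Sum>j\<le>p + k*(p-r). c i j * Nsp p r k i (fst \<xi>) * Nsp p r k j (snd \<xi>)))"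

definition bilinear_map :: "(pt \<Rightarrow> pt) \<Rightarrow> bool" where
  "bilinear_map G \<longleftrightarrow> (\<exists>a b c d. \<forall>x y. G (x,y) = a + x *\<^sub>R b + y *\<^sub>R c + (x*y) *\<^sub>R d)"

definition strictly_convex_quad :: "(pt \<Rightarrow> pt) \<Rightarrow> bool" where
  "strictly_convex_quad G \<longleftrightarrow> G ` unitsq = convex hull (G ` sqcorners) \<and> card (G ` sqcorners) = 4
     \<and> (\<forall>c\<in>G ` sqcorners. c \<notin> convex hull (G ` sqcorners - {c}))"

definition dom :: "nat \<Rightarrow> (nat \<Rightarrow> pt \<Rightarrow> pt) \<Rightarrow> pt set" where
  "dom P F = (\<Union>l\<in>{1..P}. F l ` unitsq)"

definition corners :: "nat \<Rightarrow> (nat \<Rightarrow> pt \<Rightarrow> pt) \<Rightarrow> pt set" where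
  "corners P F = (\<Union>l\<in>{1..P}. F l ` sqcorners)"

definition multipatch :: "nat \<Rightarrow> (nat \<Rightarrow> pt \<Rightarrow> pt) \<Rightarrow> bool" where
  "multipatch P F \<longleftrightarrow> P \<ge> 2
   \<and> (\<forall>l\<in>{1..P}. bilinear_map (F l) \<and> inj_on (F l) unitsq
        \<and> (\<forall>\<xi>\<in>unitsq. jdet (F l) \<xi> \<noteq> 0) \<and> strictly_convex_quad (F l))
   \<and> (\<forall>l\<in>{1..P}. \<forall>l'\<in>{1..P}. l \<noteq> l' \<longrightarrow>
        interior (F l ` unitsq) \<inter> interior (F l' ` unitsq) = {}
      \<and> (F l ` unitsq \<inter> F l' ` unitsq = {}
         \<or> (\<exists>v. v \<in> F l ` sqcorners \<and> v \<in> F l' ` sqcorners \<and> F l ` unitsq \<inter> F l' ` unitsq = {v})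
         \<or> (\<exists>s\<in>sqsides. \<exists>s'\<in>sqsides. F l ` s = F l' ` s' \<and> F l ` unitsq \<inter> F l' ` unitsq = F l ` s)))
   \<and> connected (dom P F)
   \<and> (\<forall>v\<in>corners P F. connected (dom P F - {v}))"

definition commonEdges :: "nat \<Rightarrow> (nat \<Rightarrow> pt \<Rightarrow> pt) \<Rightarrow> (nat \<times> nat) set" where
  "commonEdges P F = {(l,l'). 1 \<le> l \<and> l < l' \<and> l' \<le> P \<and>
      (\<exists>s\<in>sqsides. \<exists>s'\<in>sqsides. F l ` s = F l' ` s' \<and> F l ` unitsq \<inter> F l' ` unitsq = F l ` s)}"

definition valency :: "nat \<Rightarrow> (nat \<Rightarrow> pt \<Rightarrow> pt) \<Rightarrow> pt \<Rightarrow> nat" where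
  "valency P F v = card {e. \<exists>l\<in>{1..P}. \<exists>s\<in>sqsides. e = F l ` s \<and> v \<in> F l ` (s \<inter> sqcorners)}"

definition vertSet :: "nat \<Rightarrow> (nat \<Rightarrow> pt \<Rightarrow> pt) \<Rightarrow> pt set" where
  "vertSet P F = {v \<in> corners P F. 3 \<le> valency P F v}"

definition D2set :: "(pt \<Rightarrow> real) \<Rightarrow> (pt \<Rightarrow> real) set" where
  "D2set f = {pdx f, pdy f, pdx (pdx f), pdx (pdy f), pdy (pdx f), pdy (pdy f)}"

definition C2_dom :: "pt set \<Rightarrow> (pt \<Rightarrow> real) \<Rightarrow> bool" where
  "C2_dom \<Omega> f \<longleftrightarrow> continuous_on \<Omega> f
    \<and> (\<forall>g\<in>{f, pdx f, pdy f}. \<forall>x\<in>interior \<Omega>.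
          (\<lambda>t. g (t, snd x)) differentiable (at (fst x)) \<and> (\<lambda>t. g (fst x, t)) differentiable (at (snd x)))
    \<and> (\<forall>g\<in>D2set f. \<exists>G. continuous_on \<Omega> G \<and> (\<forall>x\<in>interior \<Omega>. G x = g x))"

definition ext :: "pt set \<Rightarrow> (pt \<Rightarrow> real) \<Rightarrow> pt \<Rightarrow> real" where
  "ext \<Omega> g x = Lim (at x within interior \<Omega>) g"

definition Vh :: "nat \<Rightarrow> nat \<Rightarrow> nat \<Rightarrow> nat \<Rightarrow> (nat \<Rightarrow> pt \<Rightarrow> pt) \<Rightarrow> (pt \<Rightarrow> real) set" where
  "Vh p r k P F = {f. C2_dom (dom P F) f \<and> (\<forall>l\<in>{1..P}. inS2 p r k (f \<circ> F l))}"

definition V0h :: "nat \<Rightarrow> nat \<Rightarrow> nat \<Rightarrow> nat \<Rightarrow> (nat \<Rightarrow> pt \<Rightarrow> pt) \<Rightarrow> (pt \<Rightarrow> real) set" where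
  "V0h p r k P F = {f \<in> Vh p r k P F. \<forall>x\<in>frontier (dom P F).
      f x = 0
    \<and> ext (dom P F) (pdx (pdx f)) x + ext (dom P F) (pdy (pdy f)) x = 0
    \<and> (x \<notin> corners P F \<longrightarrow> (\<forall>l\<in>{1..P}. x \<in> F l ` unitsq \<longrightarrow>
         (\<forall>n::pt. norm n = 1 \<and> (\<forall>q\<in>F l ` unitsq. n \<bullet> (q - x) \<le> 0) \<longrightarrow>
            ext (dom P F) (pdx f) x * fst n + ext (dom P F) (pdy f) x * snd n = 0)))}"

definition pfun :: "nat \<Rightarrow> nat \<Rightarrow> nat \<Rightarrow> (pt \<Rightarrow> pt) \<Rightarrow> nat \<Rightarrow> nat \<Rightarrow> pt \<Rightarrow> real" where
  "pfun p r k G i j x = (if x \<in> G ` unitsq then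
      (let \<xi> = inv_into unitsq G x in Nsp p r k i (fst \<xi>) * Nsp p r k j (snd \<xi>)) else 0)"

definition abar :: "(pt \<Rightarrow> pt) \<Rightarrow> real \<Rightarrow> real" where
  "abar G t = det2 (pd1v G (0,t)) (pd2v G (0,t))"

definition beta :: "(pt \<Rightarrow> pt) \<Rightarrow> real \<Rightarrow> real" where
  "beta G t = (pd1v G (0,t) \<bullet> pd2v G (0,t)) / (norm (pd2v G (0,t)))\<^sup>2"

definition Jc :: "(pt \<Rightarrow> pt) \<Rightarrow> (pt \<Rightarrow> pt) \<Rightarrow> real \<Rightarrow> real" where
  "Jc Ga Gb c = integral {0..1} (\<lambda>t. (c * abar Ga t + 1)\<^sup>2) + integral {0..1} (\<lambda>t. (c * abar Gb t - 1)\<^sup>2)"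

definition c1 :: "(pt \<Rightarrow> pt) \<Rightarrow> (pt \<Rightarrow> pt) \<Rightarrow> real" where
  "c1 Ga Gb = (THE c. \<forall>c'. Jc Ga Gb c \<le> Jc Ga Gb c')"

text \<open>\<open>tau = True\<close> stands for (a), \<open>tau = False\<close> for (b).\<close>
definition alpha :: "(pt \<Rightarrow> pt) \<Rightarrow> (pt \<Rightarrow> pt) \<Rightarrow> bool \<Rightarrow> real \<Rightarrow> real" where
  "alpha Ga Gb tau t = c1 Ga Gb * abar (if tau then Ga else Gb) t"

text \<open>d_alpha = max of the degrees of the (at most linear) polynomials alpha^(a), alpha^(b).\<close>
definition dal :: "(pt \<Rightarrow> pt) \<Rightarrow> (pt \<Rightarrow> pt) \<Rightarrow> nat" where
  "dal Ga Gb = (if (\<forall>x\<in>{0..1}. \<forall>y\<in>{0..1}. alpha Ga Gb True x = alpha Ga Gb True y)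
                 \<and> (\<forall>x\<in>{0..1}. \<forall>y\<in>{0..1}. alpha Ga Gb False x = alpha Ga Gb False y) then 0 else 1)"

definition M0 :: "nat \<Rightarrow> nat \<Rightarrow> nat \<Rightarrow> real \<Rightarrow> real" where
  "M0 p r k x = (\<Sum>i\<le>2. Nsp p r k i x)"

definition M1 :: "nat \<Rightarrow> nat \<Rightarrow> nat \<Rightarrow> real \<Rightarrow> real" where
  "M1 p r k x = hh k / real p * (Nsp p r k 1 x + 2 * Nsp p r k 2 x)"

definition M2 :: "nat \<Rightarrow> nat \<Rightarrow> nat \<Rightarrow> real \<Rightarrow> real" where
  "M2 p r k x = (hh k)\<^sup>2 / (real p * (real p - 1)) * Nsp p r k 2 x"

definition gfun :: "nat \<Rightarrow> nat \<Rightarrow> nat \<Rightarrow> (pt \<Rightarrow> pt) \<Rightarrow> (pt \<Rightarrow> pt) \<Rightarrow> bool \<Rightarrow> nat \<Rightarrow> nat \<Rightarrow> pt \<Rightarrow> real" where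
  "gfun p r k Ga Gb tau i j \<xi> =
    (let x1 = fst \<xi>; x2 = snd \<xi>; G = (if tau then Ga else Gb);
         al = alpha Ga Gb tau x2; be = beta G x2; d = dal Ga Gb in
     if i = 0 then
        Nsp p (r+2) k j x2 * M0 p r k x1
        + be * deriv (Nsp p (r+2) k j) x2 * M1 p r k x1
        + be\<^sup>2 * deriv (deriv (Nsp p (r+2) k j)) x2 * M2 p r k x1
     else if i = 1 then
        real p / hh k * (al * Nsp (p-d) (r+1) k j x2 * M1 p r k x1
          + 2 * al * be * deriv (Nsp (p-d) (r+1) k j) x2 * M2 p r k x1)
     else if i = 2 then
        real p * (real p - 1) / (hh k)\<^sup>2 * al\<^sup>2 * Nsp (p - 2*d) r k j x2 * M2 p r k x1
     else 0)"

definition nE :: "nat \<Rightarrow> nat \<Rightarrow> nat \<Rightarrow> (pt \<Rightarrow> pt) \<Rightarrow> (pt \<Rightarrow> pt) \<Rightarrow> nat \<Rightarrow> nat" where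
  "nE p r k Ga Gb i = (let d = dal Ga Gb in
     if i = 0 then dimS p (r+2) k else if i = 1 then dimS (p-d) (r+1) k else dimS (p-2*d) r k)"

definition efun :: "nat \<Rightarrow> nat \<Rightarrow> nat \<Rightarrow> (pt \<Rightarrow> pt) \<Rightarrow> (pt \<Rightarrow> pt) \<Rightarrow> nat \<Rightarrow> nat \<Rightarrow> pt \<Rightarrow> real" where
  "efun p r k Ga Gb i j x =
     (if x \<in> Ga ` unitsq then gfun p r k Ga Gb True i j (inv_into unitsq Ga x)
      else if x \<in> Gb ` unitsq then gfun p r k Ga Gb False i j (inv_into unitsq Gb x)
      else 0)"

text \<open>Coefficients: \<open>CE e i j\<close> = a^{Gamma^(e)}_{i,j}, \<open>CP l i j\<close> = a^{(l)}_{i,j}.\<close>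
datatype vcoef = CE nat nat nat | CP nat nat nat

fun validV :: "bool \<Rightarrow> nat \<Rightarrow> vcoef \<Rightarrow> bool" where
  "validV isin \<nu> (CE e i j) = (i \<le> 2 \<and> j \<le> 4 - i \<and> (if isin then e < \<nu> else e \<le> \<nu>))"
| "validV isin \<nu> (CP l i j) = (l < \<nu> \<and> i \<le> 2 \<and> j \<le> 2)"

definition enxt :: "bool \<Rightarrow> nat \<Rightarrow> nat \<Rightarrow> nat" where
  "enxt isin \<nu> l = (if isin then (l + 1) mod \<nu> else l + 1)"

text \<open>g^{(l)}_{Gamma^(l); i,j} (from the pair G_{l-1}, G_l o sigma, part (b));
  boundary edges carry only zero coefficients, the function is irrelevant there.\<close>
definition gprevV :: "nat \<Rightarrow> nat \<Rightarrow> nat \<Rightarrow> bool \<Rightarrow> nat \<Rightarrow> (nat \<Rightarrow> pt \<Rightarrow> pt) \<Rightarrow> nat \<Rightarrow> nat \<Rightarrow> nat \<Rightarrow> pt \<Rightarrow> real" where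
  "gprevV p r k isin \<nu> Gs l i j = (if \<not> isin \<and> l = 0 then (\<lambda>_. 0)
      else gfun p r k (Gs ((l + \<nu> - 1) mod \<nu>)) (Gs l \<circ> prod.swap) False i j)"

definition gnextV :: "nat \<Rightarrow> nat \<Rightarrow> nat \<Rightarrow> bool \<Rightarrow> nat \<Rightarrow> (nat \<Rightarrow> pt \<Rightarrow> pt) \<Rightarrow> nat \<Rightarrow> nat \<Rightarrow> nat \<Rightarrow> pt \<Rightarrow> real" where
  "gnextV p r k isin \<nu> Gs l i j = (if \<not> isin \<and> l + 1 = \<nu> then (\<lambda>_. 0)
      else gfun p r k (Gs l) (Gs ((l + 1) mod \<nu>) \<circ> prod.swap) True i j)"

definition fGprev :: "nat \<Rightarrow> nat \<Rightarrow> nat \<Rightarrow> bool \<Rightarrow> nat \<Rightarrow> (nat \<Rightarrow> pt \<Rightarrow> pt) \<Rightarrow> (vcoef \<Rightarrow> real) \<Rightarrow> nat \<Rightarrow> pt \<Rightarrow> real" where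
  "fGprev p r k isin \<nu> Gs a l \<xi> =
     (\<Sum>i\<le>2. \<Sum>j\<le>4-i. a (CE l i j) * gprevV p r k isin \<nu> Gs l i j (snd \<xi>, fst \<xi>))"

definition fGnext :: "nat \<Rightarrow> nat \<Rightarrow> nat \<Rightarrow> bool \<Rightarrow> nat \<Rightarrow> (nat \<Rightarrow> pt \<Rightarrow> pt) \<Rightarrow> (vcoef \<Rightarrow> real) \<Rightarrow> nat \<Rightarrow> pt \<Rightarrow> real" where
  "fGnext p r k isin \<nu> Gs a l \<xi> =
     (\<Sum>i\<le>2. \<Sum>j\<le>4-i. a (CE (enxt isin \<nu> l) i j) * gnextV p r k isin \<nu> Gs l i j \<xi>)"

definition fOm :: "nat \<Rightarrow> nat \<Rightarrow> nat \<Rightarrow> (vcoef \<Rightarrow> real) \<Rightarrow> nat \<Rightarrow> pt \<Rightarrow> real" where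
  "fOm p r k a l \<xi> = (\<Sum>i\<le>2. \<Sum>j\<le>2. a (CP l i j) * Nsp p r k i (fst \<xi>) * Nsp p r k j (snd \<xi>))"

definition fV :: "nat \<Rightarrow> nat \<Rightarrow> nat \<Rightarrow> bool \<Rightarrow> nat \<Rightarrow> (nat \<Rightarrow> pt \<Rightarrow> pt) \<Rightarrow> (vcoef \<Rightarrow> real) \<Rightarrow> nat \<Rightarrow> pt \<Rightarrow> real" where
  "fV p r k isin \<nu> Gs a l \<xi> = fGprev p r k isin \<nu> Gs a l \<xi> + fGnext p r k isin \<nu> Gs a l \<xi> - fOm p r k a l \<xi>"

definition kerH :: "nat \<Rightarrow> nat \<Rightarrow> nat \<Rightarrow> bool \<Rightarrow> nat \<Rightarrow> (nat \<Rightarrow> pt \<Rightarrow> pt) \<Rightarrow> (vcoef \<Rightarrow> real) set" where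
  "kerH p r k isin \<nu> Gs = {a.
     (\<forall>c. \<not> validV isin \<nu> c \<longrightarrow> a c = 0)
   \<and> (\<forall>l<\<nu>. \<forall>i\<le>2. \<forall>j\<le>2.
        dpart i j (\<lambda>\<xi>. fGnext p r k isin \<nu> Gs a l \<xi> - fGprev p r k isin \<nu> Gs a l \<xi>) (0,0) = 0
      \<and> dpart i j (\<lambda>\<xi>. fGnext p r k isin \<nu> Gs a l \<xi> - fOm p r k a l \<xi>) (0,0) = 0)
   \<and> (\<not> isin \<longrightarrow> (\<forall>i j. a (CE 0 i j) = 0 \<and> a (CE \<nu> i j) = 0) \<and> (\<forall>l i j. a (CP l i j) = 0))}"

definition vfun :: "nat \<Rightarrow> nat \<Rightarrow> nat \<Rightarrow> bool \<Rightarrow> nat \<Rightarrow> (nat \<Rightarrow> pt \<Rightarrow> pt) \<Rightarrow> (vcoef \<Rightarrow> real) \<Rightarrow> pt \<Rightarrow> real" where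
  "vfun p r k isin \<nu> Gs a x =
     (if \<exists>l<\<nu>. x \<in> Gs l ` unitsq then
        (let l = (LEAST l. l < \<nu> \<and> x \<in> Gs l ` unitsq) in
           fV p r k isin \<nu> Gs a l (inv_into unitsq (Gs l) x))
      else 0)"

definition lin_indep :: "'i set \<Rightarrow> ('i \<Rightarrow> 'a \<Rightarrow> real) \<Rightarrow> bool" where
  "lin_indep I b \<longleftrightarrow> (\<forall>c. (\<forall>y. (\<Sum>i\<in>I. c i * b i y) = 0) \<longrightarrow> (\<forall>i\<in>I. c i = 0))"

definition fspan :: "'i set \<Rightarrow> ('i \<Rightarrow> 'a \<Rightarrow> real) \<Rightarrow> ('a \<Rightarrow> real) set" where
  "fspan I b = {f. \<exists>c. f = (\<lambda>y. \<Sum>i\<in>I. c i * b i y)}"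

definition basis_of :: "('a \<Rightarrow> real) set \<Rightarrow> 'i set \<Rightarrow> ('i \<Rightarrow> 'a \<Rightarrow> real) \<Rightarrow> bool" where
  "basis_of K I b \<longleftrightarrow> finite I \<and> (\<forall>i\<in>I. b i \<in> K) \<and> lin_indep I b \<and> K \<subseteq> fspan I b"

datatype bidx = IP nat nat nat | IE "nat \<times> nat" nat nat | IV pt nat


definition GV :: "(nat \<Rightarrow> pt \<Rightarrow> pt) \<Rightarrow> (pt \<Rightarrow> nat \<Rightarrow> nat) \<Rightarrow> (pt \<Rightarrow> nat \<Rightarrow> pt \<Rightarrow> pt) \<Rightarrow> pt \<Rightarrow> nat \<Rightarrow> pt \<Rightarrow> pt" where
  "GV F Lv psiV v l = F (Lv v l) \<circ> psiV v l"

definition Iset :: "nat \<Rightarrow> nat \<Rightarrow> nat \<Rightarrow> nat \<Rightarrow> (nat \<Rightarrow> pt \<Rightarrow> pt)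
    \<Rightarrow> (nat \<times> nat \<Rightarrow> nat) \<Rightarrow> (nat \<times> nat \<Rightarrow> nat) \<Rightarrow> (nat \<times> nat \<Rightarrow> pt \<Rightarrow> pt) \<Rightarrow> (nat \<times> nat \<Rightarrow> pt \<Rightarrow> pt)
    \<Rightarrow> (pt \<Rightarrow> nat) \<Rightarrow> bidx set" where
  "Iset p r k P F eA eB psiA psiB mV =
     {IP l i j | l i j. l \<in> {1..P} \<and> i \<in> {3..p + k*(p-r) - 3} \<and> j \<in> {3..p + k*(p-r) - 3}}
   \<union> {IE s i j | s i j. s \<in> commonEdges P F \<and> i \<le> 2 \<and>
        j \<in> {5 - i .. nE p r k (F (eA s) \<circ> psiA s) (F (eB s) \<circ> psiB s) i + i - 6}}
   \<union> {IV v m | v m. v \<in> vertSet P F \<and> m \<in> {1..mV v}}"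

fun fam :: "nat \<Rightarrow> nat \<Rightarrow> nat \<Rightarrow> nat \<Rightarrow> (nat \<Rightarrow> pt \<Rightarrow> pt)
    \<Rightarrow> (nat \<times> nat \<Rightarrow> nat) \<Rightarrow> (nat \<times> nat \<Rightarrow> nat) \<Rightarrow> (nat \<times> nat \<Rightarrow> pt \<Rightarrow> pt) \<Rightarrow> (nat \<times> nat \<Rightarrow> pt \<Rightarrow> pt)
    \<Rightarrow> (pt \<Rightarrow> nat) \<Rightarrow> (pt \<Rightarrow> nat \<Rightarrow> nat) \<Rightarrow> (pt \<Rightarrow> nat \<Rightarrow> pt \<Rightarrow> pt) \<Rightarrow> (pt \<Rightarrow> nat \<Rightarrow> vcoef \<Rightarrow> real)
    \<Rightarrow> bidx \<Rightarrow> pt \<Rightarrow> real" where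
  "fam p r k P F eA eB psiA psiB nu Lv psiV bV (IP l i j) = pfun p r k (F l) i j"
| "fam p r k P F eA eB psiA psiB nu Lv psiV bV (IE s i j) =
     efun p r k (F (eA s) \<circ> psiA s) (F (eB s) \<circ> psiB s) i j"
| "fam p r k P F eA eB psiA psiB nu Lv psiV bV (IV v m) =
     vfun p r k (v \<in> interior (dom P F)) (nu v) (GV F Lv psiV v) (bV v m)"

definition edge_data :: "nat \<Rightarrow> (nat \<Rightarrow> pt \<Rightarrow> pt) \<Rightarrow> (nat \<times> nat) \<Rightarrow> nat \<Rightarrow> nat \<Rightarrow> (pt \<Rightarrow> pt) \<Rightarrow> (pt \<Rightarrow> pt) \<Rightarrow> bool" where
  "edge_data P F s la lb pa pb \<longleftrightarrow> {la, lb} = {fst s, snd s} \<and> pa \<in> sqsym \<and> pb \<in> sqsym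
     \<and> (\<forall>t\<in>{0..1}. F la (pa (0,t)) = F lb (pb (0,t)))"

text \<open>Admissible (counterclockwise) labelling/reparameterization at a vertex, and a
  basis of ker H.\<close>
definition vertex_data :: "nat \<Rightarrow> nat \<Rightarrow> nat \<Rightarrow> nat \<Rightarrow> (nat \<Rightarrow> pt \<Rightarrow> pt) \<Rightarrow> pt \<Rightarrow> nat
     \<Rightarrow> (nat \<Rightarrow> nat) \<Rightarrow> (nat \<Rightarrow> pt \<Rightarrow> pt) \<Rightarrow> nat \<Rightarrow> (nat \<Rightarrow> vcoef \<Rightarrow> real) \<Rightarrow> bool" where
  "vertex_data p r k P F v \<nu> L psi m b \<longleftrightarrow>
     (let G = (\<lambda>l. F (L l) \<circ> psi l); isin = (v \<in> interior (dom P F)) in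
       bij_betw L {..<\<nu>} {l\<in>{1..P}. v \<in> F l ` unitsq}
     \<and> (\<forall>l<\<nu>. psi l \<in> sqsym \<and> G l (0,0) = v \<and> jdet (G l) (0,0) > 0)
     \<and> (\<forall>l<\<nu>. (isin \<or> l + 1 < \<nu>) \<longrightarrow> (\<forall>t\<in>{0..1}. G l (0,t) = G ((l+1) mod \<nu>) (t,0)))
     \<and> basis_of (kerH p r k isin \<nu> G) {1..m} b)"

end

theory Submission
  imports Defs "HOL-Computational_Algebra.Polynomial"
begin

text \<open>
  Every generating function is given on each patch by a
  tensor-product spline, and these pieces have equal physical jets of order two wherever patches
  meet. The functions are therefore of class C2 on the whole plane and vanish outside the domain,
  which makes the homogeneous boundary conditions automatic. Across an edge the jets agree because,
  for both values of \<open>\<tau>\<close>, \<open>g\<close> has the transversal derivatives \<open>\<phi>\<^sub>0\<close>, \<open>\<beta> \<phi>\<^sub>0' + \<alpha> \<phi>\<^sub>1\<close>,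
  \<open>\<beta>\<^sup>2 \<phi>\<^sub>0'' + 2 \<alpha> \<beta> \<phi>\<^sub>1' + \<alpha>\<^sup>2 \<phi>\<^sub>2\<close>, with trace functions \<open>\<phi>\<^sub>0, \<phi>\<^sub>1, \<phi>\<^sub>2\<close> common to the two patches,
  and \<open>\<alpha>\<close>, \<open>\<beta>\<close> are the components of the transversal direction in a frame attached to the edge.

  Linear independence: along an edge emanating from a vertex, the transversal derivative of order \<open>s\<close>
  of every function not attached to that vertex vanishes at the vertex to order \<open>5 - s\<close>, which forces
  the coefficients of a vanishing vertex combination to be zero. Without vertex functions, only the
  functions of an edge have nonzero jets in its interior, and the independence of univariate B-splines
  removes the edge functions and then the patch functions.
\<close>

section \<open>Polynomial pieces of B-splines\<close>

text \<open>The bound on k says exactly n_0 >= 10: the five trace indices belonging to one end of an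
  edge and the five of the other end are disjoint. Hence whatever belongs to one end vanishes at the
  other to order 5 - s in its s-th transversal derivative; n_1 >= 9 and n_2 >= 8 follow. Membership
  in S^{p,r} is an obstacle because of terms such as
  \<open>\<beta>\<^sup>2 \<phi>\<^sub>0''\<close>. Splines are therefore treated as piecewise
  polynomials whose jump at m h is divisible by (x - m h)^(r+1). Products, derivatives and
  reflections become algebra, and B-splines return through a spanning theorem proved by eliminating
  leading terms. The equations of \<open>kerH\<close> hold at one point only, yet control whole
  sides: a sum of M_s(x) C_s(y), s = 0, 1, 2, has three coefficient functions, and their 2-jets at 0
  are its derivatives at the corner. At a vertex several patches meet and each inverse
  parameterization is one-sided. Differentiability is proved within each closed patch and assembled
  over a finite closed cover of the plane that includes the closure of the complement.\<close>

lemma poly_extI: "(\<And>x. poly p x = poly q x) \<Longrightarrow> p = q" for p q :: "real poly"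
  by (simp add: poly_eq_poly_eq_iff[symmetric] fun_eq_iff)

text \<open>Cox-de Boor recursion run on polynomials: the piece of the B-spline on the span from m h
  to (m+1) h. Knots are \<open>K i\<close> times h with integer \<open>K i\<close>, so that knots
  are compared in nat. The convention 0/0 = 0 carries over.\<close>

fun bpc :: "(nat \<Rightarrow> nat) \<Rightarrow> real \<Rightarrow> nat \<Rightarrow> nat \<Rightarrow> nat \<Rightarrow> real poly" where
  "bpc K h m 0 i = (if K i \<le> m \<and> m < K (Suc i) then 1 else 0)"
| "bpc K h m (Suc q) i =
     smult (1 / (real (K (i+q+1)) * h - real (K i) * h)) ([:- (real (K i) * h), 1:] * bpc K h m q i)
   + smult (1 / (real (K (i+q+2)) * h - real (K (i+1)) * h)) ([:real (K (i+q+2)) * h, -1:] * bpc K h m q (i+1))"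

text \<open>B-spline divided by the length of its support, the scaling in which the derivative is a
  plain difference.\<close>

definition bn :: "(nat \<Rightarrow> nat) \<Rightarrow> real \<Rightarrow> nat \<Rightarrow> nat \<Rightarrow> nat \<Rightarrow> real poly" where
  "bn K h m q i = smult (1 / (real (K (i+q+1)) * h - real (K i) * h)) (bpc K h m q i)"

lemma bpc_Suc_bn:
  "bpc K h m (Suc q) i = [:- (real (K i) * h), 1:] * bn K h m q i
     + [:real (K (i+q+2)) * h, -1:] * bn K h m q (i+1)"
  by (simp add: bn_def)

declare bpc.simps(2) [simp del]

lemma bpc_support:
  assumes "mono K" "m < K i \<or> K (i+q+1) \<le> m"
  shows "bpc K h m q i = 0"
  using assms(2)
proof (induction q arbitrary: i)
  case (Suc q)
  have a: "K i \<le> K (i+1)" "K (i+q+1) \<le> K (i+q+2)"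
    using assms(1) by (auto intro!: monoD[OF assms(1)])
  have "bpc K h m q i = 0" using a Suc.prems by (intro Suc.IH) auto
  moreover have "bpc K h m q (i+1) = 0" using a Suc.prems by (intro Suc.IH) auto
  ultimately show ?case by (simp add: bpc.simps(2))
qed auto

lemma bpc_degree: "degree (bpc K h m q i) \<le> q"
proof (induction q arbitrary: i)
  case (Suc q)
  have *: "degree ([:a, b:] * bpc K h m q j) \<le> Suc q" for a b j
    using degree_mult_le[of "[:a,b:]" "bpc K h m q j"] Suc.IH[of j] by (auto split: if_splits)
  show ?case
    by (simp only: bpc.simps(2)) (intro degree_add_le order.trans[OF degree_smult_le] *)
qed auto

text \<open>Undoing the division is sound even for coinciding end knots, because the support is then
  empty and the piece is zero.\<close>

lemma bn_scale:
  assumes "mono K" "h > 0"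
  shows "smult (real (K (i+q+1)) * h - real (K i) * h) (bn K h m q i) = bpc K h m q i"
proof (cases "K (i+q+1) = K i")
  case True
  then have "bpc K h m q i = 0" by (intro bpc_support[OF assms(1)]) auto
  then show ?thesis by (simp add: bn_def)
next
  case False
  then show ?thesis using assms(2) by (simp add: bn_def)
qed

lemma bn_degenerate: "K (i+q+1) = K i \<Longrightarrow> bn K h m q i = 0"
  by (simp add: bn_def)

text \<open>The classical derivative formula, by induction through the recursion. Differentiating
  the products leaves linear factors times derivatives of \<open>b1\<close>; A and B trade each of
  these for values of \<open>b1\<close> and \<open>b0\<close>, and the two terms
  \<open>b0 (i+1)\<close> cancel.\<close>

lemma bpc_pderiv:
  assumes "mono K" "h > 0"
  shows "pderiv (bpc K h m (Suc q) i) = smult (real (Suc q)) (bn K h m q i - bn K h m q (i+1))"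
proof (induction q arbitrary: i)
  case 0
  have "pderiv (bn K h m 0 j) = 0" for j
    by (simp add: bn_def pderiv_smult)
  then show ?case
    by (simp only: bpc_Suc_bn pderiv_mult pderiv_add) (simp add: pderiv_pCons)
next
  case (Suc q)
  define T where "T j = real (K j) * h" for j
  define b1 where "b1 j = bn K h m (Suc q) j" for j
  define b0 where "b0 j = bn K h m q j" for j
  have sc: "smult (T (j+q+2) - T j) (b1 j) = bpc K h m (Suc q) j" for j
    using bn_scale[OF assms, of j "Suc q" m] by (simp add: T_def b1_def)
  have rec: "bpc K h m (Suc q) j = [:- T j, 1:] * b0 j + [:T (j+q+2), -1:] * b0 (j+1)" for j
    by (simp add: bpc_Suc_bn T_def b0_def)
  have dsc: "smult (T (j+q+2) - T j) (pderiv (b1 j)) = smult (real (Suc q)) (b0 j - b0 (j+1))" for j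
    using arg_cong[OF sc[of j], of pderiv] Suc.IH[of j] by (simp add: pderiv_smult b0_def)
  \<comment> \<open>Coinciding end knots: there is nothing to divide by, but every term of A and B
    vanishes.\<close>
  have deg: "b1 j = 0" "b0 (j+1) = 0" "b0 j = 0" if "T (j+q+2) - T j = 0" for j
  proof -
    have e: "K (j+q+2) = K j" using that assms(2) by (simp add: T_def)
    moreover have "K j \<le> K (j+1)" "K (j+1) \<le> K (j+q+2)" "K j \<le> K (j+q+1)" "K (j+q+1) \<le> K (j+q+2)"
      using assms(1) by (auto intro!: monoD[OF assms(1)])
    ultimately have "K (j+1+q+1) = K (j+1)" "K (j+q+1) = K j" by auto
    then show "b1 j = 0" "b0 (j+1) = 0" "b0 j = 0"
      using e by (auto simp: b1_def b0_def intro!: bn_degenerate)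
  qed
  have A: "[:- T j, 1:] * pderiv (b1 j) = smult (real (Suc q)) (b1 j - b0 (j+1))" for j
  proof (cases "T (j+q+2) - T j = 0")
    case False
    have "smult (T (j+q+2) - T j) ([:- T j, 1:] * pderiv (b1 j))
        = [:- T j, 1:] * smult (real (Suc q)) (b0 j - b0 (j+1))"
      by (subst dsc[of j, symmetric]) simp
    also have "\<dots> = smult (real (Suc q)) (smult (T (j+q+2) - T j) (b1 j) - smult (T (j+q+2) - T j) (b0 (j+1)))"
      unfolding sc rec by (rule poly_extI) (simp add: algebra_simps)
    finally have "smult (T (j+q+2) - T j) ([:- T j, 1:] * pderiv (b1 j))
       = smult (T (j+q+2) - T j) (smult (real (Suc q)) (b1 j - b0 (j+1)))"
      by (simp add: smult_diff_right mult.commute)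
    with False show ?thesis by (metis smult_cancel)
  qed (use deg in simp)
  have B: "[:T (j+q+2), -1:] * pderiv (b1 j) = smult (real (Suc q)) (b0 j - b1 j)" for j
  proof (cases "T (j+q+2) - T j = 0")
    case False
    have "smult (T (j+q+2) - T j) ([:T (j+q+2), -1:] * pderiv (b1 j))
        = [:T (j+q+2), -1:] * smult (real (Suc q)) (b0 j - b0 (j+1))"
      by (subst dsc[of j, symmetric]) simp
    also have "\<dots> = smult (real (Suc q)) (smult (T (j+q+2) - T j) (b0 j) - smult (T (j+q+2) - T j) (b1 j))"
      unfolding sc rec by (rule poly_extI) (simp add: algebra_simps)
    finally have "smult (T (j+q+2) - T j) ([:T (j+q+2), -1:] * pderiv (b1 j))
       = smult (T (j+q+2) - T j) (smult (real (Suc q)) (b0 j - b1 j))"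
      by (simp add: smult_diff_right mult.commute)
    with False show ?thesis by (metis smult_cancel)
  qed (use deg in simp)
  have "bpc K h m (Suc (Suc q)) i = [:- T i, 1:] * b1 i + [:T (i+q+3), -1:] * b1 (i+1)"
    by (simp add: bpc_Suc_bn T_def b1_def eval_nat_numeral)
  then have "pderiv (bpc K h m (Suc (Suc q)) i) = b1 i - b1 (i+1)
       + [:- T i, 1:] * pderiv (b1 i) + [:T ((i+1)+q+2), -1:] * pderiv (b1 (i+1))"
    by (simp only: pderiv_mult pderiv_add) (simp add: pderiv_pCons eval_nat_numeral)
  also have "\<dots> = b1 i - b1 (i+1) + smult (real (Suc q)) (b1 i - b0 (i+1))
       + smult (real (Suc q)) (b0 (i+1) - b1 (i+1))"
    by (simp only: A B)
  also have "\<dots> = smult (real (Suc (Suc q))) (b1 i - b1 (i+1))"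
    by (rule poly_extI) (simp add: algebra_simps)
  finally show ?case by (simp add: b1_def)
qed

section \<open>Jumps of the pieces across a knot\<close>

lemma bpc_value_left:
  assumes "mono K" "h > 0" "K i < m" "K (i+1) = m" "K (i+q+1) = m"
  shows "poly (bpc K h (m-1) q i) (real m * h) = 1"
  using assms(5)
proof (induction q)
  case 0
  then show ?case using assms(3,4) by auto
next
  case (Suc q)
  have "K (i+1) \<le> K (i+q+1)" "K (i+q+1) \<le> K (i + Suc q + 1)"
    using assms(1) by (auto intro!: monoD[OF assms(1)])
  then have e: "K (i+q+1) = m" using Suc.prems assms(4) by auto
  have z: "bpc K h (m-1) q (i+1) = 0"
    using assms by (intro bpc_support) auto
  have "real m * h - real (K i) * h \<noteq> 0" using assms(2,3) by auto
  moreover have "K (Suc (i+q)) = m" using e by simp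
  ultimately show ?case using Suc.IH[OF e] z by (simp add: bpc.simps(2))
qed

text \<open>Next to a (q+1)-fold knot at the end of its support a B-spline of degree q has value 1;
  by \<open>bpc_continuous\<close> this is the only source of discontinuity.\<close>

lemma bpc_value_right:
  assumes "mono K" "h > 0" "K i = m" "K (i+q) = m" "m < K (i+q+1)"
  shows "poly (bpc K h m q i) (real m * h) = 1"
  using assms(3-5)
proof (induction q arbitrary: i)
  case (Suc q)
  have "K i \<le> K (i+1)" "K (i+1) \<le> K (i + Suc q)" "K i \<le> K (i+q+1)" "K (i+q+1) \<le> K (i+Suc q)"
    using assms(1) by (auto intro!: monoD[OF assms(1)])
  then have e: "K (i+1) = m" "K (i+q+1) = m" using Suc.prems by auto
  have z: "bpc K h m q i = 0"
    using assms e by (intro bpc_support) auto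
  have IH: "poly (bpc K h m q (i+1)) (real m * h) = 1"
    using Suc.prems e by (intro Suc.IH) auto
  have "real (K (i+q+2)) * h - real m * h \<noteq> 0" using assms(2) Suc.prems(3) by (auto simp: eval_nat_numeral)
  then show ?case using IH z e by (simp add: bpc.simps(2))
qed auto

text \<open>By induction on the degree. The delicate case is a (q+1)-fold knot m strictly inside the
  support of a B-spline of degree q + 1: one lower-degree function drops from 1 to 0, its neighbour
  rises from 0 to 1, both with weight 1, so the jumps cancel.\<close>

lemma bpc_continuous:
  assumes "mono K" "h > 0" "m \<ge> 1"
    "\<not> (K i = m \<and> K (i+q) = m)" "\<not> (K (i+1) = m \<and> K (i+1+q) = m)"
  shows "poly (bpc K h m q i - bpc K h (m-1) q i) (real m * h) = 0"
  using assms(4,5)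
proof (induction q arbitrary: i)
  case 0
  then show ?case using assms(3) by auto
next
  case (Suc q)
  define z where "z = real m * h"
  define d where "d j = poly (bpc K h m q j - bpc K h (m-1) q j) z / (real (K (j+q+1)) * h - real (K j) * h)" for j
  have rec: "poly (bpc K h m (Suc q) i - bpc K h (m-1) (Suc q) i) z
     = (z - real (K i) * h) * d i + (real (K (i+q+2)) * h - z) * d (i+1)"
    by (simp add: bpc.simps(2) d_def algebra_simps add_divide_distrib diff_divide_distrib)
  have mo: "K i \<le> K (i+1)" "K (i+1) \<le> K (i+q+1)" "K (i+q+1) \<le> K (i+q+2)" "K (i+q) \<le> K (i+q+1)" "K (i+1) \<le> K (i+2)"
    "K (i+2) \<le> K (i+q+2)" "K i \<le> K (i+q)"
    using assms(1) by (auto intro!: monoD[OF assms(1)])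
  show ?case
  proof (cases "K (i+1) = m \<and> K (i+q+1) = m")
    case False
    have 1: "(z - real (K i) * h) * d i = 0"
    proof (cases "K i = m \<and> K (i+q) = m")
      case True then show ?thesis by (simp add: z_def)
    next
      case F: False
      have "poly (bpc K h m q i - bpc K h (m-1) q i) (real m * h) = 0"
        using F False by (intro Suc.IH) (auto simp: add.commute add.left_commute)
      then show ?thesis by (simp add: d_def z_def)
    qed
    have 2: "(real (K (i+q+2)) * h - z) * d (i+1) = 0"
    proof (cases "K (i+2) = m \<and> K (i+q+2) = m")
      case True then show ?thesis by (simp add: z_def)
    next
      case F: False
      have "poly (bpc K h m q (i+1) - bpc K h (m-1) q (i+1)) (real m * h) = 0"
        using F False by (intro Suc.IH) (auto simp: add.commute add.left_commute eval_nat_numeral)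
      then show ?thesis by (simp add: d_def z_def)
    qed
    show ?thesis using rec unfolding 1 2 by (simp only: z_def add_0)
  next
    case True
    then have lt: "K i < m" "m < K (i+q+2)"
      using mo Suc.prems by (auto simp: eval_nat_numeral)
    have a: "poly (bpc K h (m-1) q i) z = 1" "bpc K h m q i = 0"
      using bpc_value_left[OF assms(1,2) lt(1), of q] True bpc_support[OF assms(1), of m i q h]
      by (auto simp: z_def)
    have b: "poly (bpc K h m q (i+1)) z = 1" "bpc K h (m-1) q (i+1) = 0"
      using bpc_value_right[OF assms(1,2), of "i+1" m q] True lt(2) bpc_support[OF assms(1), of "m-1" "i+1" q h] assms(3)
      by (auto simp: z_def eval_nat_numeral add.commute add.left_commute)
    have nz: "real m * h - real (K i) * h \<noteq> 0" "real (K (i+q+2)) * h - real m * h \<noteq> 0"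
      using lt assms(2) by auto
    have "K (Suc (i+q)) = m" using True by simp
    then show ?thesis using rec a b True nz
      by (simp add: z_def d_def)
  qed
qed

text \<open>In characteristic 0 differentiation lowers the order of a root by exactly one, so a zero
  of D at z adds one to the multiplicity known for its derivative.\<close>

lemma linear_power_dvd_pderiv:
  fixes D :: "real poly"
  assumes "[:-z,1:]^s dvd pderiv D" "poly D z = 0"
  shows "[:-z,1:]^(Suc s) dvd D"
proof (cases "D = 0")
  case False
  have ne: "pderiv D \<noteq> 0"
  proof
    assume "pderiv D = 0"
    then have "degree D = 0" by (simp add: pderiv_eq_0_iff)
    then obtain c where "D = [:c:]" by (meson degree_eq_zeroE)
    with assms(2) False show False by simp
  qed
  have "order z D = Suc (order z (pderiv D))"
    using order_pderiv[OF False, of z] assms(2) by blast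
  moreover have "s \<le> order z (pderiv D)"
    using assms(1) ne by (simp add: order_divides)
  ultimately have "Suc s \<le> order z D" by simp
  then show ?thesis using False by (simp only: order_divides) simp
qed simp

text \<open>Smoothness C^(s-1) at the knot m in divisibility form; the hypothesis forbids q + 2 - s
  consecutive knots of the support equal to m. The derivative formula lowers s and q by one, and
  continuity supplies the lost root.\<close>

lemma bpc_jump_dvd:
  assumes "mono K" "h > 0" "m \<ge> 1" "s \<le> q + 1"
    "\<And>j. i \<le> j \<Longrightarrow> j \<le> i + s \<Longrightarrow> \<not> (K j = m \<and> K (j + q + 1 - s) = m)"
  shows "[:- (real m * h), 1:] ^ s dvd bpc K h m q i - bpc K h (m-1) q i"
  using assms(4,5)
proof (induction q arbitrary: i s)
  case 0
  show ?case
  proof (cases "s = 0")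
    case False
    then have s: "s = 1" using 0 by simp
    have "K i \<noteq> m" "K (i+1) \<noteq> m" using 0(2)[of i] 0(2)[of "i+1"] s by auto
    then have "bpc K h m 0 i - bpc K h (m-1) 0 i = 0" using assms(3) by auto
    then show ?thesis by (simp only: dvd_0_right)
  qed simp
next
  case (Suc q)
  show ?case
  proof (cases s)
    case (Suc t)
    note s = this
    have 1: "[:- (real m * h), 1:] ^ t dvd bpc K h m q j - bpc K h (m-1) q j" if "j = i \<or> j = i+1" for j
    proof (rule Suc.IH)
      show "t \<le> q + 1" using Suc.prems s by simp
      fix j' assume "j \<le> j'" "j' \<le> j + t"
      then show "\<not> (K j' = m \<and> K (j' + q + 1 - t) = m)"
        using Suc.prems(2)[of j'] that s by (auto simp: Suc_diff_le)
    qed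
    have 2: "[:- (real m * h), 1:] ^ t dvd bn K h m q j - bn K h (m-1) q j" if "j = i \<or> j = i+1" for j
      using 1[OF that] by (simp add: bn_def smult_diff_right[symmetric] dvd_smult)
    have "pderiv (bpc K h m (Suc q) i - bpc K h (m-1) (Suc q) i) =
       smult (real (Suc q)) ((bn K h m q i - bn K h (m-1) q i) - (bn K h m q (i+1) - bn K h (m-1) q (i+1)))"
      unfolding pderiv_diff bpc_pderiv[OF assms(1,2)] by (simp add: smult_diff_right)
    moreover have "[:- (real m * h), 1:] ^ t dvd \<dots>"
      by (intro dvd_smult dvd_diff 2) auto
    ultimately have d: "[:- (real m * h), 1:] ^ t dvd pderiv (bpc K h m (Suc q) i - bpc K h (m-1) (Suc q) i)"
      by simp
    have c: "poly (bpc K h m (Suc q) i - bpc K h (m-1) (Suc q) i) (real m * h) = 0"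
    proof (rule bpc_continuous[OF assms(1-3)])
      have *: False if "K j = m" "K (j + Suc q) = m" "j = i \<or> j = i+1" for j
      proof -
        have "K j \<le> K (j + Suc q + 1 - s)" "K (j + Suc q + 1 - s) \<le> K (j + Suc q)"
          using assms(1) s Suc.prems(1) by (auto intro!: monoD[OF assms(1)])
        then show False using Suc.prems(2)[of j] that s by auto
      qed
      show "\<not> (K i = m \<and> K (i + Suc q) = m)" "\<not> (K (i+1) = m \<and> K (i + 1 + Suc q) = m)"
        using * by blast+
    qed
    show ?thesis unfolding s using linear_power_dvd_pderiv[OF d c] .
  qed simp
qed

text \<open>Here c is the multiplicity of the first knot within the support, and q + 1 - c is the
  exact order of vanishing there. Positivity of the cofactor is carried along because the recursion
  adds two terms of the same order, which must not cancel.\<close>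

lemma bpc_left_order:
  assumes "mono K" "h > 0" "K i = m" "K (i+c-1) = m" "m < K (i+c)" "1 \<le> c" "c \<le> q+1"
  shows "\<exists>u. bpc K h m q i = [:- (real m * h), 1:]^(q+1-c) * u \<and> poly u (real m * h) > 0"
  using assms(3-7)
proof (induction q arbitrary: i c)
  case 0
  then have "c = 1" by simp
  then show ?case using 0 by (intro exI[of _ 1]) auto
next
  case (Suc q)
  define z where "z = real m * h"
  have mo: "K i \<le> K (i+1)" "K (i+1) \<le> K (i+q+1)" "K (i+q+1) \<le> K (i+q+2)" "c \<le> q+1 \<Longrightarrow> K (i+c) \<le> K (i+q+1)" "K (i+c) \<le> K (i+q+2)"
    using assms(1) Suc.prems by (auto intro!: monoD[OF assms(1)])
  have pos1: "real (K (i+q+1)) * h - z > 0" if "c \<le> q+1" using mo that Suc.prems assms(2) by (auto simp: z_def)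
  show ?case
  proof (cases "c = 1")
    case True
    have "bpc K h m q (i+1) = 0" using True Suc.prems by (intro bpc_support assms) auto
    moreover obtain u where u: "bpc K h m q i = [:- z, 1:]^(q+1-1) * u" "poly u z > 0"
      using Suc.IH[of i 1] Suc.prems True by (auto simp: z_def)
    ultimately have "bpc K h m (Suc q) i = [:- z, 1:]^(Suc q + 1 - c) * smult (1 / (real (K (i+q+1)) * h - z)) u"
      using True Suc.prems(1) by (intro poly_extI) (simp add: bpc.simps(2) z_def algebra_simps)
    moreover have "poly (smult (1 / (real (K (i+q+1)) * h - z)) u) z > 0" using u(2) pos1 True by simp
    ultimately show ?thesis unfolding z_def by blast
  next
    case False
    then have c2: "c \<ge> 2" using Suc.prems by simp
    have "K i \<le> K (i+1)" "K (i+1) \<le> K (i+c-1)" using assms(1) c2 by (auto intro!: monoD[OF assms(1)])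
    then have K1: "K (i+1) = m" using Suc.prems by simp
    have "i + 1 + (c - 1) - 1 = i+c-1" "i + 1 + (c-1) = i + c" "1 \<le> c - 1" "c - 1 \<le> q + 1"
      using c2 Suc.prems(5) by auto
    then obtain u2 where u2: "bpc K h m q (i+1) = [:- z, 1:]^(q+1-(c-1)) * u2" "poly u2 z > 0"
      using Suc.IH[of "i+1" "c-1"] Suc.prems(2,3) K1 unfolding z_def by metis
    have ex: "q + 1 - (c - 1) = Suc q + 1 - c" using c2 by simp
    define w2 where "w2 = smult (1 / (real (K (i+q+2)) * h - z)) ([:real (K (i+q+2)) * h, -1:] * u2)"
    have pos2: "real (K (i+q+2)) * h - z > 0" using mo Suc.prems assms(2) by (auto simp: z_def)
    have w2: "poly w2 z > 0" using u2 pos2 by (simp add: w2_def)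
    show ?thesis
    proof (cases "c \<le> q + 1")
      case True
      obtain u1 where u1: "bpc K h m q i = [:- z, 1:]^(q+1-c) * u1" "poly u1 z > 0"
        using Suc.IH[of i c] Suc.prems True by (auto simp: z_def)
      define w1 where "w1 = smult (1 / (real (K (i+q+1)) * h - z)) u1"
      have w1: "poly w1 z > 0" using u1 pos1 True by (simp add: w1_def)
      have "Suc q + 1 - c = Suc (q + 1 - c)" using True by simp
      then have "bpc K h m (Suc q) i = [:- z, 1:]^(Suc q + 1 - c) * (w1 + w2)"
        unfolding bpc.simps(2) u1 u2 ex w1_def w2_def Suc.prems(1) K1 z_def[symmetric]
        by (intro poly_extI) (simp add: algebra_simps diff_divide_distrib add_divide_distrib)
      moreover have "poly (w1 + w2) z > 0" using w1 w2 by simp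
      ultimately show ?thesis unfolding z_def by blast
    next
      case F: False
      then have "c = q + 2" using Suc.prems by simp
      then have "bpc K h m q i = 0" using Suc.prems by (intro bpc_support assms) auto
      then have "bpc K h m (Suc q) i = [:- z, 1:]^(Suc q + 1 - c) * w2"
        unfolding bpc.simps(2) u2 ex w2_def Suc.prems(1) K1 z_def[symmetric]
        by (intro poly_extI) (simp add: algebra_simps)
      then show ?thesis using w2 unfolding z_def by blast
    qed
  qed
qed

text \<open>Counterpart at the right end of a span; a lower bound on the order suffices for all
  later uses.\<close>

lemma bpc_right_order:
  assumes "mono K" "K (i+s) \<le> m" "s \<le> q" "K (i+q+1) \<le> m+1"
  shows "[:- (real (m+1) * h), 1:]^s dvd bpc K h m q i"
  using assms(2-4)
proof (induction q arbitrary: i s)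
  case (Suc q)
  show ?case
  proof (cases "K (i + Suc q + 1) \<le> m \<or> s = 0")
    case True
    then show ?thesis using bpc_support[OF assms(1), of m i "Suc q" h] by auto
  next
    case False
    then have e: "K (i+q+2) = m+1" using Suc.prems by (auto simp: eval_nat_numeral)
    obtain t where t: "s = Suc t" using False by (cases s) auto
    have mo: "K (i+q+1) \<le> K (i+q+2)" using assms(1) by (auto intro!: monoD[OF assms(1)])
    have 1: "[:- (real (m+1) * h), 1:]^s dvd bpc K h m q i"
    proof (cases "s \<le> q")
      case True
      then show ?thesis using Suc.prems mo e by (intro Suc.IH) auto
    next
      case False
      then have "K (i+q+1) \<le> m" using Suc.prems by (auto simp: le_Suc_eq)
      then have "bpc K h m q i = 0" by (intro bpc_support assms) auto
      then show ?thesis by simp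
    qed
    have 2: "[:- (real (m+1) * h), 1:]^t dvd bpc K h m q (i+1)"
      using Suc.prems t e by (intro Suc.IH) (auto simp: eval_nat_numeral)
    have "[:real (K (i+q+2)) * h, -1:] = - [:- (real (m+1) * h), 1:]" using e by simp
    then have "[:- (real (m+1) * h), 1:]^s dvd [:real (K (i+q+2)) * h, -1:] * bpc K h m q (i+1)"
      unfolding t power_Suc using 2 by (simp only: mult_minus_left dvd_minus_iff) (intro mult_dvd_mono dvd_refl)
    then show ?thesis unfolding bpc.simps(2)
      by (intro dvd_add dvd_smult) (rule dvd_mult[OF 1])
  qed
qed simp

section \<open>Piecewise polynomials of prescribed smoothness\<close>

definition kn :: "nat \<Rightarrow> nat \<Rightarrow> nat \<Rightarrow> nat \<Rightarrow> nat" where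
  "kn p r k j = (if j \<le> p then 0 else if p + 1 + k * (p - r) \<le> j then k + 1
                 else (j - (p + 1)) div (p - r) + 1)"

text \<open>Clamped to 0..k: \<open>nat\<close> sends negative arguments to the first span and
  \<open>min\<close> keeps arguments beyond 1 on the last one, which reproduces the polynomial
  extension of \<open>bsp\<close> outside [0,1].\<close>

definition cell :: "nat \<Rightarrow> real \<Rightarrow> nat" where
  "cell k x = min k (nat \<lfloor>x * real (k + 1)\<rfloor>)"

lemma hh_pos: "hh k > 0" by (simp add: hh_def)

lemma knot_kn: "knot p r k j = real (kn p r k j) * hh k"
proof -
  have "real (k+1) > 0" by simp
  then show ?thesis by (auto simp: knot_def kn_def hh_def)
qed

lemma kn_le: "kn p r k j \<le> k + 1"
proof -
  have "(j - (p+1)) div (p-r) < k" if "p < j" "j < p + 1 + k * (p-r)"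
    using that by (intro less_mult_imp_div_less) auto
  then show ?thesis unfolding kn_def by (auto simp: not_le Suc_le_eq less_imp_le)
qed

lemma kn_mono: "mono (kn p r k)"
proof (rule monoI)
  fix i j :: nat assume ij: "i \<le> j"
  show "kn p r k i \<le> kn p r k j"
  proof (cases "p + 1 + k * (p - r) \<le> j \<or> j \<le> p")
    case True
    then show ?thesis using kn_le[of p r k i] ij by (auto simp: kn_def)
  next
    case False
    then show ?thesis using ij by (auto simp: kn_def intro!: div_le_mono)
  qed
qed

lemma cell_le: "cell k x \<le> k" by (simp add: cell_def)

lemma le_cell_iff:
  assumes "1 \<le> m" "m \<le> k"
  shows "m \<le> cell k x \<longleftrightarrow> real m * hh k \<le> x"
proof -
  have "m \<le> cell k x \<longleftrightarrow> int m \<le> \<lfloor>x * real (k+1)\<rfloor>"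
    using assms by (auto simp: cell_def le_nat_iff nat_le_iff)
  also have "\<dots> \<longleftrightarrow> real m \<le> x * real (k+1)" by (simp add: le_floor_iff)
  also have "\<dots> \<longleftrightarrow> real m * hh k \<le> x" unfolding hh_def by (simp add: field_simps)
  finally show ?thesis .
qed

text \<open>The clauses \<open>a = 0\<close> and \<open>b = 1\<close> in \<open>bsp\<close> are the
  clamping in \<open>cell\<close>. Hence the equation holds on the whole line, and derivatives at 0
  and 1 are ordinary two-sided ones.\<close>

lemma bsp_bpc: "bsp p r k q i x = poly (bpc (kn p r k) (hh k) (cell k x) q i) x"
proof (induction q arbitrary: i)
  case 0
  let ?u = "kn p r k i" and ?w = "kn p r k (Suc i)"
  have h: "hh k > 0" "hh k * (1 + real k) = 1" by (simp_all add: hh_def)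
  have A: "(?u \<le> cell k x) = (real ?u * hh k \<le> x \<or> real ?u * hh k = 0)" if "?u < ?w"
    using le_cell_iff[of ?u k x] that kn_le[of p r k "Suc i"] h by (cases "?u = 0") auto
  have B: "(cell k x < ?w) = (x < real ?w * hh k \<or> real ?w * hh k = 1)" if "?u < ?w"
  proof (cases "?w = k + 1")
    case True
    then show ?thesis using cell_le[of k x] h by (auto simp: algebra_simps)
  next
    case False
    then have "real ?w * hh k \<noteq> 1" using h by (auto simp: hh_def field_simps)
    then show ?thesis using le_cell_iff[of ?w k x] that kn_le[of p r k "Suc i"] False by (auto simp: not_le[symmetric])
  qed
  have C: "(real ?u * hh k < real ?w * hh k) = (?u < ?w)" using h by simp
  show ?case
    unfolding bsp.simps bpc.simps Let_def knot_kn C using A B by (cases "?u < ?w") auto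
next
  case (Suc q)
  then show ?case by (simp add: bpc.simps(2) knot_kn algebra_simps add_divide_distrib diff_divide_distrib)
qed

text \<open>Smoothness of order r at an inner knot is expressed by divisibility of the jump, so that
  closure under products and derivatives is a matter of polynomial algebra.\<close>

definition PSp :: "nat \<Rightarrow> nat \<Rightarrow> nat \<Rightarrow> (nat \<Rightarrow> real poly) \<Rightarrow> bool" where
  "PSp p r k Q \<longleftrightarrow> (\<forall>m\<le>k. degree (Q m) \<le> p)
     \<and> (\<forall>m\<in>{1..k}. [:- (real m * hh k), 1:] ^ Suc r dvd Q m - Q (m-1))"

definition pcw :: "nat \<Rightarrow> (nat \<Rightarrow> real poly) \<Rightarrow> real \<Rightarrow> real" where
  "pcw k Q x = poly (Q (cell k x)) x"

definition PS :: "nat \<Rightarrow> nat \<Rightarrow> nat \<Rightarrow> (real \<Rightarrow> real) set" where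
  "PS p r k = {pcw k Q | Q. PSp p r k Q}"

lemma PSI: "PSp p r k Q \<Longrightarrow> (\<And>x. f x = pcw k Q x) \<Longrightarrow> f \<in> PS p r k"
  unfolding PS_def by blast

lemma PSE:
  assumes "f \<in> PS p r k"
  obtains Q where "PSp p r k Q" "f = pcw k Q"
  using assms unfolding PS_def by blast

lemma PS_add: "f \<in> PS p r k \<Longrightarrow> g \<in> PS p r k \<Longrightarrow> (\<lambda>x. f x + g x) \<in> PS p r k"
  apply (elim PSE)
  subgoal for Q R
    apply (rule PSI[of _ _ _ "\<lambda>m. Q m + R m"])
     apply (auto simp: PSp_def pcw_def intro: degree_add_le)
    by (metis (no_types, lifting) add_diff_add atLeastAtMost_iff dvd_add One_nat_def)
  done

lemma PS_mult:
  assumes "f \<in> PS p r k" "g \<in> PS p' r k" "p + p' \<le> s"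
  shows "(\<lambda>x. f x * g x) \<in> PS s r k"
proof -
  obtain Q R where Q: "PSp p r k Q" "f = pcw k Q" and R: "PSp p' r k R" "g = pcw k R"
    using assms by (metis PSE)
  show ?thesis
  proof (rule PSI[of _ _ _ "\<lambda>m. Q m * R m"])
    have "degree (Q m * R m) \<le> s" if "m \<le> k" for m
      using that Q R assms(3) degree_mult_le[of "Q m" "R m"] unfolding PSp_def
      by (meson add_mono order.trans)
    moreover have "[:- (real m * hh k), 1:] ^ Suc r dvd Q m * R m - Q (m-1) * R (m-1)" if "m \<in> {1..k}" for m
    proof -
      have "Q m * R m - Q (m-1) * R (m-1) = (Q m - Q (m-1)) * R m + Q (m-1) * (R m - R (m-1))"
        by (simp add: algebra_simps)
      moreover have "[:- (real m * hh k), 1:] ^ Suc r dvd \<dots>"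
        using Q R that unfolding PSp_def by (intro dvd_add dvd_mult dvd_mult2) auto
      ultimately show ?thesis by simp
    qed
    ultimately show "PSp s r k (\<lambda>m. Q m * R m)" unfolding PSp_def by blast
  qed (simp add: Q R pcw_def)
qed

lemma PS_poly: "degree q \<le> p \<Longrightarrow> (\<lambda>x. poly q x) \<in> PS p r k"
  by (rule PSI[of _ _ _ "\<lambda>m. q"]) (auto simp: PSp_def pcw_def)

lemma PS_const: "(\<lambda>x. c) \<in> PS p r k"
  using PS_poly[of "[:c:]" p r k] by simp

lemma PS_scale: "f \<in> PS p r k \<Longrightarrow> (\<lambda>x. c * f x) \<in> PS p r k"
  using PS_mult[OF PS_const[of c 0 r k], of f p p] by simp

lemma PS_sum: "finite S \<Longrightarrow> (\<And>s. s \<in> S \<Longrightarrow> f s \<in> PS p r k) \<Longrightarrow> (\<lambda>x. \<Sum>s\<in>S. f s x) \<in> PS p r k"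
  by (induction S rule: finite_induct) (auto intro: PS_const PS_add)

lemma PS_mono:
  assumes "f \<in> PS p r k" "p \<le> p'" "k = 0 \<or> r' \<le> r"
  shows "f \<in> PS p' r' k"
proof -
  obtain Q where Q: "PSp p r k Q" "f = pcw k Q" using assms(1) by (rule PSE)
  have "PSp p' r' k Q"
    unfolding PSp_def
  proof (intro conjI ballI allI impI)
    fix m assume "m \<le> k" then show "degree (Q m) \<le> p'" using Q(1) assms(2) unfolding PSp_def by (meson order.trans)
  next
    fix m assume m: "m \<in> {1..k}"
    then have "Suc r' \<le> Suc r" using assms(3) by auto
    then have "[:- (real m * hh k), 1:] ^ Suc r' dvd [:- (real m * hh k), 1:] ^ Suc r" by (rule le_imp_power_dvd)
    then show "[:- (real m * hh k), 1:] ^ Suc r' dvd Q m - Q (m-1)" using Q(1) m unfolding PSp_def by (meson dvd_trans)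
  qed
  then show ?thesis using Q(2) unfolding PS_def by blast
qed

text \<open>Truncated-power form: the first piece plus the jumps, each switched on at its knot. It
  reduces continuity and differentiability to a single truncated polynomial.\<close>

lemma pcw_trunc:
  "pcw k Q x = poly (Q 0) x + (\<Sum>m\<in>{1..k}. if real m * hh k \<le> x then poly (Q m - Q (m-1)) x else 0)"
proof -
  have "(\<Sum>m\<in>{1..k}. if real m * hh k \<le> x then poly (Q m - Q (m-1)) x else 0)
      = (\<Sum>m\<in>{1..k}. if m \<le> cell k x then poly (Q m - Q (m-1)) x else 0)"
    by (intro sum.cong refl) (simp add: le_cell_iff)
  also have "\<dots> = (\<Sum>m\<in>{1..cell k x}. poly (Q m) x - poly (Q (m-1)) x)"
    using cell_le[of k x] by (intro sum.mono_neutral_cong_right) auto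
  also have "\<dots> = poly (Q (cell k x)) x - poly (Q 0) x"
    by (induction "cell k x" rule: nat.induct)
       (use sum_telescope''[of 0 "cell k x" "\<lambda>m. poly (Q m) x"] in simp_all)
  finally show ?thesis by (simp add: pcw_def)
qed

lemma isCont_trunc:
  fixes W :: "real poly"
  assumes "[:-z,1:] dvd W"
  shows "isCont (\<lambda>y. if z \<le> y then poly W y else 0) x"
proof -
  have "poly W z = 0" using assms by (simp add: poly_eq_0_iff_dvd)
  then have "(\<lambda>y. if z \<le> y then poly W y else 0) = (\<lambda>y. poly W (max y z))"
    by (auto simp: fun_eq_iff max_def)
  then show ?thesis by (auto intro!: continuous_intros)
qed

lemma DERIV_trunc:
  fixes W :: "real poly"
  assumes "[:-z,1:]^2 dvd W"
  shows "((\<lambda>y. if z \<le> y then poly W y else 0) has_real_derivative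
     (if z \<le> x then poly (pderiv W) x else 0)) (at x)"
proof -
  consider "x < z" | "x > z" | "x = z" by linarith
  then show ?thesis
  proof cases
    case 1
    have "((\<lambda>y. 0) has_real_derivative 0) (at x)" by simp
    then have "((\<lambda>y. if z \<le> y then poly W y else 0) has_real_derivative 0) (at x)"
      by (rule has_field_derivative_transform_within_open[where S="{..<z}"]) (use 1 in auto)
    then show ?thesis using 1 by simp
  next
    case 2
    have "(poly W has_real_derivative poly (pderiv W) x) (at x)" by (rule poly_DERIV)
    then have "((\<lambda>y. if z \<le> y then poly W y else 0) has_real_derivative poly (pderiv W) x) (at x)"
      by (rule has_field_derivative_transform_within_open[where S="{z<..}"]) (use 2 in auto)
    then show ?thesis using 2 by simp
  next
    case 3
    obtain w where w: "W = [:-z,1:]^2 * w" using assms by (auto elim: dvdE)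
    have d0: "poly (pderiv W) z = 0" unfolding w power2_eq_square by (simp only: pderiv_mult poly_add poly_mult) simp
    \<comment> \<open>Caratheodory's criterion: at a double root the slope function is again a
      truncated polynomial, continuous with value 0.\<close>
    have "\<exists>g. (\<forall>y. (if z \<le> y then poly W y else 0) - (if z \<le> z then poly W z else 0) = g y * (y - z)) \<and> isCont g z \<and> g z = 0"
    proof (intro exI conjI allI)
      show "isCont (\<lambda>y. if z \<le> y then poly ([:-z,1:] * w) y else 0) z"
        by (rule isCont_trunc) (rule dvd_triv_left)
    qed (auto simp: w power2_eq_square algebra_simps)
    then have "((\<lambda>y. if z \<le> y then poly W y else 0) has_real_derivative 0) (at z)"
      by (rule CARAT_DERIV[THEN iffD2])
    then show ?thesis using d0 3 by simp
  qed
qed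

lemma DERIV_pcw:
  assumes "\<And>m. m \<in> {1..k} \<Longrightarrow> [:- (real m * hh k), 1:]^2 dvd Q m - Q (m-1)"
  shows "(pcw k Q has_real_derivative pcw k (\<lambda>m. pderiv (Q m)) x) (at x)"
proof -
  have "((\<lambda>x. poly (Q 0) x + (\<Sum>m\<in>{1..k}. if real m * hh k \<le> x then poly (Q m - Q (m-1)) x else 0))
     has_real_derivative poly (pderiv (Q 0)) x + (\<Sum>m\<in>{1..k}. if real m * hh k \<le> x then poly (pderiv (Q m - Q (m-1))) x else 0)) (at x)"
    by (intro DERIV_add poly_DERIV DERIV_sum DERIV_trunc assms)
  then show ?thesis unfolding pcw_trunc[abs_def] pderiv_diff .
qed

lemma PS_isCont:
  assumes "f \<in> PS p r k"
  shows "isCont f x"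
proof -
  obtain Q where Q: "PSp p r k Q" "f = pcw k Q" using assms by (rule PSE)
  have d: "[:- (real m * hh k), 1:] dvd Q m - Q (m-1)" if "m \<in> {1..k}" for m
    using Q(1) that unfolding PSp_def by (metis dvd_mult_left power_Suc)
  show ?thesis unfolding Q(2) pcw_trunc[abs_def]
    by (intro continuous_add continuous_sum isCont_trunc d) auto
qed

lemma PS_continuous_on: "f \<in> PS p r k \<Longrightarrow> continuous_on S f"
  by (meson PS_isCont continuous_at_imp_continuous_on)

lemma PS_deriv_aux:
  assumes "f \<in> PS p r k" "k = 0 \<or> 1 \<le> r"
  shows "\<exists>g. g \<in> PS (p-1) (r-1) k \<and> (\<forall>x. (f has_real_derivative g x) (at x))"
proof -
  obtain Q where Q: "PSp p r k Q" "f = pcw k Q" using assms(1) by (rule PSE)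
  have d: "[:- (real m * hh k), 1:]^2 dvd Q m - Q (m-1)" if "m \<in> {1..k}" for m
  proof -
    have "2 \<le> Suc r" using that assms(2) by auto
    then have "[:- (real m * hh k), 1:]^2 dvd [:- (real m * hh k), 1:]^Suc r" by (rule le_imp_power_dvd)
    then show ?thesis using Q(1) that unfolding PSp_def by (meson dvd_trans)
  qed
  have "PSp (p-1) (r-1) k (\<lambda>m. pderiv (Q m))"
    unfolding PSp_def
  proof (intro conjI ballI allI impI)
    fix m assume "m \<le> k"
    then show "degree (pderiv (Q m)) \<le> p - 1" using Q(1) by (simp add: PSp_def degree_pderiv diff_le_mono)
  next
    fix m assume m: "m \<in> {1..k}"
    then have r: "r = Suc (r-1)" using assms(2) by auto
    have "[:- (real m * hh k), 1:] ^ Suc r dvd Q m - Q (m-1)" using Q(1) m unfolding PSp_def by blast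
    then obtain w where w: "Q m - Q (m-1) = [:- (real m * hh k), 1:] ^ Suc r * w" by (auto elim: dvdE)
    have "pderiv (Q m) - pderiv (Q (m-1)) = pderiv ([:- (real m * hh k), 1:] ^ Suc r * w)"
      by (simp only: pderiv_diff[symmetric] w)
    also have "[:- (real m * hh k), 1:] ^ r dvd \<dots>"
      unfolding pderiv_mult pderiv_power_Suc by (intro dvd_add) (auto intro: dvd_smult dvd_mult2 dvd_mult simp del: mult_pCons_left)
    finally show "[:- (real m * hh k), 1:] ^ Suc (r-1) dvd pderiv (Q m) - pderiv (Q (m-1))" using r by simp
  qed
  then show ?thesis using DERIV_pcw[OF d] Q(2) unfolding PS_def by blast
qed

lemma PS_DERIV:
  assumes "f \<in> PS p r k" "k = 0 \<or> 1 \<le> r"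
  shows "(f has_real_derivative deriv f x) (at x)"
  using PS_deriv_aux[OF assms] DERIV_imp_deriv by metis

lemma PS_deriv:
  assumes "f \<in> PS p r k" "k = 0 \<or> 1 \<le> r"
  shows "deriv f \<in> PS (p-1) (r-1) k"
proof -
  obtain g where "g \<in> PS (p-1) (r-1) k" "\<forall>x. (f has_real_derivative g x) (at x)"
    using PS_deriv_aux[OF assms] by blast
  moreover then have "deriv f = g" using DERIV_imp_deriv by blast
  ultimately show ?thesis by simp
qed

text \<open>Needed because patches are reparameterized by symmetries of the square. The span of 1 -
  x is k minus the span of x unless x is an inner knot, and there the two neighbouring pieces
  agree.\<close>

lemma PS_reflect:
  assumes "f \<in> PS p r k"
  shows "(\<lambda>x. f (1 - x)) \<in> PS p r k"
proof -
  obtain Q where Q: "PSp p r k Q" "f = pcw k Q" using assms by (rule PSE)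
  define R where "R m = pcompose (Q (k-m)) [:1,-1:]" for m
  have hk: "real (k+1) * hh k = 1" by (simp add: hh_def)
  show ?thesis
  proof (rule PSI[of _ _ _ R])
    show "PSp p r k R" unfolding PSp_def
    proof (intro conjI ballI allI impI)
      fix m assume "m \<le> k"
      have "degree (Q (k-m)) \<le> p" using Q(1) by (simp add: PSp_def)
      then show "degree (R m) \<le> p" using degree_pcompose_le[of "Q (k-m)" "[:1,-1::real:]"] by (simp add: R_def)
    next
      fix m assume m: "m \<in> {1..k}"
      then have e: "k - (m-1) = (k-m) + 1" by auto
      have "[:- (real (k-m+1) * hh k), 1:] ^ Suc r dvd Q (k-m+1) - Q (k-m+1-1)"
        using Q(1) m unfolding PSp_def by (metis atLeastAtMost_iff add.commute diff_le_mono2 e le_add1 diff_le_self)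
      then obtain w where w: "Q (k-m+1) - Q (k-m) = [:- (real (k-m+1) * hh k), 1:] ^ Suc r * w"
        by (auto elim: dvdE)
      have l: "1 - real (k-m+1) * hh k = real m * hh k" using hk m by (simp add: algebra_simps of_nat_diff)
      have "pcompose (Q (k-m+1) - Q (k-m)) [:1,-1:] = (- [:- (real m * hh k), 1:]) ^ Suc r * pcompose w [:1,-1:]"
        unfolding w
      proof (rule poly_extI)
        fix x
        have "poly [:- (real (k-m+1) * hh k), 1:] (1-x) = poly (- [:- (real m * hh k), 1:]) x"
          using l by (simp add: algebra_simps)
        moreover have "poly [:1,-1:] x = 1 - x" by simp
        ultimately show "poly (([:- (real (k-m+1) * hh k), 1:] ^ Suc r * w) \<circ>\<^sub>p [:1, -1:]) x
            = poly ((- [:- (real m * hh k), 1:]) ^ Suc r * w \<circ>\<^sub>p [:1, -1:]) x"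
          by (simp only: poly_pcompose poly_mult poly_power)
      qed
      moreover have "R m - R (m-1) = - pcompose (Q (k-m+1) - Q (k-m)) [:1,-1:]"
        unfolding R_def e by (simp add: pcompose_diff)
      moreover have "(- [:- (real m * hh k), 1:]) ^ Suc r = (-1)^Suc r * [:- (real m * hh k), 1:] ^ Suc r"
        by (rule power_minus)
      ultimately have "R m - R (m-1) = [:- (real m * hh k), 1:] ^ Suc r * (- ((-1)^Suc r * pcompose w [:1,-1:]))"
        by (simp only: mult_ac mult_minus_left mult_minus_right)
      then show "[:- (real m * hh k), 1:] ^ Suc r dvd R m - R (m-1)" by (rule dvdI)
    qed
  next
    fix x
    have *: "poly (Q m) (real m * hh k) = poly (Q (m-1)) (real m * hh k)" if "1 \<le> m" "m \<le> k" for m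
    proof -
      have "[:- (real m * hh k), 1:] dvd Q m - Q (m-1)"
        using Q(1) that unfolding PSp_def by (metis dvd_mult_left power_Suc atLeastAtMost_iff)
      then show ?thesis by (simp add: poly_eq_0_iff_dvd[symmetric])
    qed
    have "poly (Q (cell k (1-x))) (1-x) = poly (Q (k - cell k x)) (1-x)"
    proof -
      let ?m = "cell k x" and ?m' = "cell k (1-x)"
      have le: "?m \<le> k" "?m' \<le> k" by (auto simp: cell_le)
      have A: "j \<le> ?m \<longleftrightarrow> real j * hh k \<le> x" if "1 \<le> j" "j \<le> k" for j using le_cell_iff that by blast
      have B: "j \<le> ?m' \<longleftrightarrow> x \<le> 1 - real j * hh k" if "1 \<le> j" "j \<le> k" for j using le_cell_iff[OF that, of "1-x"] by auto
      have C: "1 - real j * hh k = real (k+1-j) * hh k" if "j \<le> k" for j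
        using hk that by (simp add: algebra_simps of_nat_diff)
      have lo: "k \<le> ?m + ?m'"
      proof (rule ccontr)
        assume "\<not> k \<le> ?m + ?m'"
        then have j: "1 \<le> ?m + 1" "?m + 1 \<le> k" "1 \<le> k - ?m" "k - ?m \<le> k" "\<not> k - ?m \<le> ?m'" by auto
        have "\<not> ?m + 1 \<le> ?m" by simp
        with A[OF j(1,2)] have "x < real (?m+1) * hh k" by simp
        moreover have "k + 1 - (k - ?m) = ?m + 1" using le by simp
        ultimately show False using B[OF j(3,4)] C[OF j(4)] j(5) by simp
      qed
      show ?thesis
      proof (cases "?m + ?m' = k")
        case True then have "k - ?m = ?m'" by simp
        then show ?thesis by simp
      next
        \<comment> \<open>The remaining possibility is that the two span numbers add up to k + 1,
          which pins x down to an inner knot.\<close>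
        case False
        with lo have g: "1 \<le> ?m'" "k + 1 - ?m' \<le> ?m" "1 \<le> ?m" using le by auto
        have x1: "x \<le> real (k+1-?m') * hh k" using B[OF g(1) le(2)] C[OF le(2)] by simp
        have "real ?m * hh k \<le> x" using A[OF g(3) le(1)] by simp
        with x1 have "real ?m * hh k \<le> real (k+1-?m') * hh k" by simp
        then have "?m \<le> k+1-?m'" using hh_pos[of k] by simp
        with g have e: "?m = k+1-?m'" by simp
        have "x = real ?m * hh k" using x1 \<open>real ?m * hh k \<le> x\<close> e by simp
        then have "1 - x = real ?m' * hh k" using C[OF le(1)] e le g by simp
        moreover have "k - ?m = ?m' - 1" using e g le by simp
        ultimately show ?thesis using *[OF g(1) le(2)] by simp
      qed
    qed
    then show "f (1-x) = pcw k R x" by (simp add: Q(2) pcw_def R_def poly_pcompose)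
  qed
qed

section \<open>Spanning, independence and endpoint behaviour of B-splines\<close>

definition Npc :: "nat \<Rightarrow> nat \<Rightarrow> nat \<Rightarrow> nat \<Rightarrow> nat \<Rightarrow> real poly" where
  "Npc p r k i m = bpc (kn p r k) (hh k) m p i"

lemma Nsp_pcw: "Nsp p r k i = pcw k (Npc p r k i)"
  by (simp add: fun_eq_iff Nsp_def bsp_bpc pcw_def Npc_def)

text \<open>Inner knots come in runs of length p - r, so a shift by p - r always leaves the
  run.\<close>

lemma kn_block:
  assumes "1 \<le> m" "m \<le> k" "p < j" "kn p r k j = m" "r < p"
  shows "kn p r k (j + (p - r)) \<noteq> m"
proof -
  have "j < p + 1 + k * (p-r)" using assms by (auto simp: kn_def split: if_splits)
  then have m: "m = (j - (p+1)) div (p-r) + 1" using assms by (simp add: kn_def)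
  have e: "j + (p-r) - (p+1) = (j - (p+1)) + (p-r)" using assms(3) by simp
  have "p - r \<noteq> 0" using assms(5) by simp
  then have "(j + (p-r) - (p+1)) div (p-r) = m"
    unfolding e m by (rule div_add_self2)
  moreover have "\<not> j + (p-r) \<le> p" using assms(3) by simp
  ultimately have "kn p r k (j + (p-r)) = k + 1 \<or> kn p r k (j + (p-r)) = m + 1" unfolding kn_def by metis
  then show ?thesis using assms(2) by auto
qed

lemma Npc_PSp:
  assumes "k \<ge> 1 \<longrightarrow> r < p"
  shows "PSp p r k (Npc p r k i)"
  unfolding PSp_def
proof (intro conjI ballI allI impI)
  fix m show "degree (Npc p r k i m) \<le> p" by (simp add: Npc_def bpc_degree)
next
  fix m assume m: "m \<in> {1..k}"
  then have rp: "r < p" using assms by auto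
  show "[:- (real m * hh k), 1:] ^ Suc r dvd Npc p r k i m - Npc p r k i (m-1)"
    unfolding Npc_def
  proof (rule bpc_jump_dvd[OF kn_mono hh_pos])
    fix j show "\<not> (kn p r k j = m \<and> kn p r k (j + p + 1 - Suc r) = m)"
      using kn_block[of m k p j r] m rp by (auto simp: kn_def)
  qed (use m rp in auto)
qed

lemma Nsp_PS: "k \<ge> 1 \<longrightarrow> r < p \<Longrightarrow> Nsp p r k i \<in> PS p r k"
  unfolding PS_def Nsp_pcw using Npc_PSp by blast

text \<open>Order of vanishing of the i-th B-spline at its first knot: i at the knot 0, and r + 1 +
  s for the s-th copy of an inner knot, s counted from 0. The pairs (first knot, order) increase
  lexicographically with i and exhaust the ways in which a spline of degree p and smoothness r can
  start.\<close>

definition oi :: "nat \<Rightarrow> nat \<Rightarrow> nat \<Rightarrow> nat" where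
  "oi p r i = (if i \<le> p then i else r + 1 + (i - (p + 1)) mod (p - r))"

lemma kn_mid: "j < k * (p - r) \<Longrightarrow> kn p r k (p + 1 + j) = j div (p - r) + 1"
  by (simp add: kn_def)

lemma index_cases:
  assumes "k \<ge> 1 \<longrightarrow> r < p" "i < dimS p r k"
  obtains "i \<le> p" | m s where "i = p + 1 + m * (p - r) + s" "s < p - r" "m < k" "r < p"
proof (cases "i \<le> p")
  case False
  define j where "j = i - (p+1)"
  have i: "i = p + 1 + j" using False by (simp add: j_def)
  then have j: "j < k * (p - r)" using assms(2) by (simp add: dimS_def)
  then have "r < p" by (cases "p - r = 0") auto
  moreover have "j = (j div (p-r)) * (p-r) + j mod (p-r)" by (rule div_mult_mod_eq[symmetric])
  moreover have "j mod (p-r) < p-r" using \<open>r < p\<close> by simp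
  moreover have "j div (p-r) < k" using j by (simp add: less_mult_imp_div_less)
  ultimately show ?thesis using that(2)[of "j div (p-r)" "j mod (p-r)"] i by (metis add.assoc)
qed

lemma block_lt: "m < k \<Longrightarrow> s < (d::nat) \<Longrightarrow> m * d + s < k * d"
  using mult_le_mono1[of "Suc m" k d] by simp

lemma kn_index:
  assumes "s < p - r" "m < k"
  shows "kn p r k (p + 1 + m * (p-r) + s) = m + 1" "oi p r (p + 1 + m * (p-r) + s) = r + 1 + s"
proof -
  show "kn p r k (p + 1 + m * (p-r) + s) = m + 1"
    using kn_mid[of "m * (p-r) + s" k p r] block_lt[OF assms(2,1)] assms by (simp add: add.assoc)
  show "oi p r (p + 1 + m * (p-r) + s) = r + 1 + s" using assms by (simp add: oi_def)
qed

lemma kn_first: "kn p r k (p+1) > 0" by (simp add: kn_def)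

text \<open>From position i on, the first knot is repeated p + 1 - i times at 0 and p - r - s times
  at an inner knot; \<open>bpc_left_order\<close> turns this multiplicity into the order.\<close>

lemma Npc_lead:
  assumes "k \<ge> 1 \<longrightarrow> r < p" "i < dimS p r k"
  shows "\<exists>u. Npc p r k i (kn p r k i) = [:- (real (kn p r k i) * hh k), 1:] ^ oi p r i * u
       \<and> poly u (real (kn p r k i) * hh k) > 0"
  using assms
proof (cases rule: index_cases)
  case 1
  have "p + 1 - (p + 1 - i) = oi p r i" using 1 by (simp add: oi_def)
  then show ?thesis unfolding Npc_def
    using bpc_left_order[OF kn_mono[of p r k] hh_pos[of k] refl, of i "p+1-i" p]
       1 kn_first[of p r k] by (auto simp: kn_def)
next
  case (2 m s)
  have k1: "kn p r k i = m + 1" "oi p r i = r + 1 + s" using kn_index[OF 2(2,3)] 2(1) by auto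
  have e1: "i + (p - r - s) - 1 = p + 1 + m * (p-r) + (p - r - 1)" using 2 by simp
  have k2: "kn p r k (i + (p - r - s) - 1) = m + 1" unfolding e1 using kn_index(1)[of "p-r-1" p r m k] 2 by simp
  have e2: "i + (p - r - s) = p + 1 + (m+1) * (p-r)" using 2 by simp
  have k3: "m + 1 < kn p r k (i + (p - r - s))" unfolding e2
  proof (cases "m + 1 < k")
    case True then show "m + 1 < kn p r k (p + 1 + (m+1)*(p-r))" using kn_index(1)[of 0 p r "m+1" k] 2 by simp
  next
    case False then have "m + 1 = k" using 2 by simp
    then show "m + 1 < kn p r k (p + 1 + (m+1)*(p-r))" using 2 by (simp add: kn_def)
  qed
  have "p + 1 - (p - r - s) = oi p r i" using k1 2 by simp
  then show ?thesis unfolding Npc_def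
    using bpc_left_order[OF kn_mono hh_pos k1(1) k2 k3, of p k] 2 k1 by simp
qed

lemma Npc_zero: "m < kn p r k i \<Longrightarrow> Npc p r k i m = 0"
  unfolding Npc_def by (intro bpc_support kn_mono) simp

text \<open>Enumeration behind the elimination: orders 0 to p on the first span, then r + 1 to p on
  each later one.\<close>

lemma index_step:
  assumes "k \<ge> 1 \<longrightarrow> r < p" "Suc i < dimS p r k"
  shows "(kn p r k (Suc i) = kn p r k i \<and> oi p r (Suc i) = Suc (oi p r i))
       \<or> (kn p r k (Suc i) = Suc (kn p r k i) \<and> oi p r i = p \<and> oi p r (Suc i) = Suc r)"
proof -
  have "i < dimS p r k" using assms(2) by simp
  with assms(1) show ?thesis
  proof (cases rule: index_cases)
    case 1
    show ?thesis
    proof (cases "i = p")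
      case True
      then have "k * (p-r) > 0" using assms(2) by (simp add: dimS_def)
      then have "0 < p - r" "0 < k" by (auto intro: Nat.gr0I)
      then show ?thesis using kn_index[of 0 p r 0 k] True by (simp add: kn_def oi_def)
    qed (use 1 in \<open>auto simp: kn_def oi_def\<close>)
  next
    case (2 m s)
    note i = kn_index[OF 2(2,3)]
    show ?thesis
    proof (cases "Suc s < p - r")
      case True
      then show ?thesis using i kn_index[OF True 2(3)] 2(1) by simp
    next
      case False
      then have s: "Suc s = p - r" using 2 by simp
      then have e: "Suc i = p + 1 + (m+1) * (p-r) + 0" using 2 by simp
      have "(m+1) * (p-r) < k * (p-r)" using assms(2) e by (simp add: dimS_def)
      then have "m + 1 < k" by (metis mult_less_cancel2)
      then show ?thesis unfolding e using i kn_index[of 0 p r "m+1" k] 2 s by auto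
    qed
  qed
qed

lemma index_last:
  assumes "k \<ge> 1 \<longrightarrow> r < p" "Suc i = dimS p r k"
  shows "kn p r k i = k \<and> oi p r i = p"
proof (cases "k = 0")
  case True then show ?thesis using assms by (simp add: dimS_def kn_def oi_def)
next
  case False
  then have rp: "r < p" "k \<ge> 1" using assms by auto
  obtain k' where k': "k = Suc k'" using False by (cases k) auto
  have "i = p + 1 + (k - 1) * (p-r) + (p - r - 1)" using assms(2) rp unfolding dimS_def k' by simp
  then show ?thesis using kn_index[of "p-r-1" p r "k-1" k] rp by simp
qed

lemma PSp_diff:
  assumes "PSp p r k Q" "PSp p r k R"
  shows "PSp p r k (\<lambda>m. Q m - smult c (R m))"
  unfolding PSp_def
proof (intro conjI ballI allI impI)
  fix m assume "m \<le> k"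
  then show "degree (Q m - smult c (R m)) \<le> p"
    using assms by (auto simp: PSp_def intro!: degree_diff_le order.trans[OF degree_smult_le])
next
  fix m assume m: "m \<in> {1..k}"
  have "Q m - smult c (R m) - (Q (m-1) - smult c (R (m-1))) = (Q m - Q (m-1)) - smult c (R m - R (m-1))"
    by (simp add: smult_diff_right)
  moreover have "[:- (real m * hh k), 1:] ^ Suc r dvd \<dots>"
    using assms m unfolding PSp_def by (blast intro: dvd_diff dvd_smult)
  ultimately show "[:- (real m * hh k), 1:] ^ Suc r dvd Q m - smult c (R m) - (Q (m-1) - smult c (R (m-1)))"
    by (simp only:)
qed

text \<open>Invariant of the elimination: what remains of a spline after the first i B-splines are
  removed starts no earlier, and with no lower order, than the i-th one. After all of them nothing
  is left.\<close>

definition lvl :: "nat \<Rightarrow> nat \<Rightarrow> nat \<Rightarrow> nat \<Rightarrow> (nat \<Rightarrow> real poly) \<Rightarrow> bool" where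
  "lvl p r k i Q \<longleftrightarrow> (if i < dimS p r k then
      (\<forall>m<kn p r k i. Q m = 0) \<and> [:- (real (kn p r k i) * hh k), 1:] ^ oi p r i dvd Q (kn p r k i)
    else (\<forall>m\<le>k. Q m = 0))"

lemma dvd_degree_zero:
  fixes q :: "real poly"
  assumes "[:-z,1:] ^ Suc p dvd q" "degree q \<le> p"
  shows "q = 0"
proof (rule ccontr)
  assume "q \<noteq> 0"
  then have "degree ([:-z,1:] ^ Suc p) \<le> degree q" using assms(1) by (intro dvd_imp_degree_le)
  then show False using assms(2) by (simp add: degree_linear_power del: power_Suc)
qed

text \<open>Exceeding order p on a span kills its piece, by degree. Smoothness then makes the next
  piece divisible by the power r + 1, which is the order of the first B-spline starting
  there.\<close>

lemma lvl_step:
  assumes "k \<ge> 1 \<longrightarrow> r < p" "i < dimS p r k" "PSp p r k Q" "lvl p r k i Q"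
    "[:- (real (kn p r k i) * hh k), 1:] ^ Suc (oi p r i) dvd Q (kn p r k i)"
  shows "lvl p r k (Suc i) Q"
proof -
  have z: "\<forall>m<kn p r k i. Q m = 0" using assms by (simp add: lvl_def)
  have knk: "kn p r k i \<le> k"
    using assms(1,2) by (cases rule: index_cases) (auto simp: kn_def dest: kn_index)
  show ?thesis
  proof (cases "Suc i < dimS p r k")
    case True
    from index_step[OF assms(1) True] show ?thesis
    proof
      assume "kn p r k (Suc i) = kn p r k i \<and> oi p r (Suc i) = Suc (oi p r i)"
      then show ?thesis using z assms True by (simp add: lvl_def)
    next
      assume a: "kn p r k (Suc i) = Suc (kn p r k i) \<and> oi p r i = p \<and> oi p r (Suc i) = Suc r"
      have q0: "Q (kn p r k i) = 0"
        using assms(3,5) a knk by (intro dvd_degree_zero[of _ p]) (auto simp: PSp_def)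
      have "kn p r k (Suc i) \<le> k"
        using assms(1) True by (cases rule: index_cases) (auto simp: kn_def dest: kn_index)
      then have "[:- (real (kn p r k (Suc i)) * hh k), 1:] ^ Suc r dvd Q (kn p r k (Suc i)) - Q (kn p r k (Suc i) - 1)"
        using assms(3) a unfolding PSp_def by (metis atLeastAtMost_iff le_add1 plus_1_eq_Suc)
      then show ?thesis using a z q0 True by (auto simp: lvl_def less_Suc_eq)
    qed
  next
    case False
    then have "Suc i = dimS p r k" using assms(2) by simp
    note l = index_last[OF assms(1) this]
    have q0: "Q (kn p r k i) = 0"
      using assms(3,5) l by (intro dvd_degree_zero[of _ p]) (auto simp: PSp_def)
    then show ?thesis using z l False by (auto simp: lvl_def le_less)
  qed
qed

lemma PSp_eliminate:
  assumes "k \<ge> 1 \<longrightarrow> r < p" "PSp p r k Q" "i \<le> dimS p r k"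
  shows "\<exists>c. PSp p r k (\<lambda>m. Q m - (\<Sum>j<i. smult (c j) (Npc p r k j m)))
     \<and> lvl p r k i (\<lambda>m. Q m - (\<Sum>j<i. smult (c j) (Npc p r k j m)))"
  using assms(3)
proof (induction i)
  case 0
  have "0 < dimS p r k" by (simp add: dimS_def)
  then show ?case using assms(2) by (simp add: lvl_def kn_def oi_def)
next
  case (Suc i)
  then obtain c where c: "PSp p r k (\<lambda>m. Q m - (\<Sum>j<i. smult (c j) (Npc p r k j m)))"
     "lvl p r k i (\<lambda>m. Q m - (\<Sum>j<i. smult (c j) (Npc p r k j m)))" by auto
  define R where "R m = Q m - (\<Sum>j<i. smult (c j) (Npc p r k j m))" for m
  have i: "i < dimS p r k" using Suc.prems by simp
  define z where "z = real (kn p r k i) * hh k"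
  obtain u where u: "Npc p r k i (kn p r k i) = [:- z, 1:] ^ oi p r i * u" "poly u z > 0"
    using Npc_lead[OF assms(1) i] unfolding z_def by blast
  have "[:- z, 1:] ^ oi p r i dvd R (kn p r k i)" using c(2) i unfolding lvl_def R_def z_def by simp
  then obtain w where w: "R (kn p r k i) = [:- z, 1:] ^ oi p r i * w" by (auto elim: dvdE)
  \<comment> \<open>Quotient of the leading coefficients, so that the subtraction raises the order
    of the root by one; the denominator is positive by \<open>Npc_lead\<close>.\<close>
  define a where "a = poly w z / poly u z"
  define R' where "R' m = R m - smult a (Npc p r k i m)" for m
  have P': "PSp p r k R'" unfolding R'_def using c(1) Npc_PSp[OF assms(1)] unfolding R_def by (rule PSp_diff)
  have "poly (w - smult a u) z = 0" using u(2) by (simp add: a_def)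
  then have "[:-z,1:] dvd w - smult a u" by (simp only: poly_eq_0_iff_dvd)
  then have d: "[:- z, 1:] ^ Suc (oi p r i) dvd R' (kn p r k i)"
    unfolding R'_def w u(1) power_Suc
    by (metis (no_types, lifting) dvd_refl mult.commute mult_dvd_mono mult_smult_right right_diff_distrib)
  have "lvl p r k i R'"
    using c(2) i Npc_zero[of _ p r k i] d unfolding lvl_def R_def[symmetric] z_def
    by (auto simp: R'_def intro: dvd_trans[OF le_imp_power_dvd[of "oi p r i" "Suc (oi p r i)"]] simp del: power_Suc)
  then have L': "lvl p r k (Suc i) R'" using lvl_step[OF assms(1) i P'] d unfolding z_def by blast
  have e: "R' = (\<lambda>m. Q m - (\<Sum>j<Suc i. smult ((c(i := a)) j) (Npc p r k j m)))"
    by (auto simp: R'_def R_def fun_eq_iff)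
  show ?case using P' L' unfolding e by blast
qed

lemma PS_span:
  assumes "k \<ge> 1 \<longrightarrow> r < p" "f \<in> PS p r k"
  shows "\<exists>c. \<forall>x. f x = (\<Sum>i<dimS p r k. c i * Nsp p r k i x)"
proof -
  obtain Q where Q: "PSp p r k Q" "f = pcw k Q" using assms(2) by (rule PSE)
  obtain c where c: "lvl p r k (dimS p r k) (\<lambda>m. Q m - (\<Sum>j<dimS p r k. smult (c j) (Npc p r k j m)))"
    using PSp_eliminate[OF assms(1) Q(1) order_refl] by blast
  then have "Q m = (\<Sum>j<dimS p r k. smult (c j) (Npc p r k j m))" if "m \<le> k" for m
    using that by (simp add: lvl_def)
  then have "f x = (\<Sum>i<dimS p r k. c i * Nsp p r k i x)" for x
    by (simp add: Q(2) pcw_def Nsp_pcw cell_le poly_sum)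
  then show ?thesis by blast
qed

section \<open>Linear independence of univariate B-splines\<close>

lemma poly_zero_on_interval:
  fixes q :: "real poly"
  assumes "a < b" "\<And>x. a < x \<Longrightarrow> x < b \<Longrightarrow> poly q x = 0"
  shows "q = 0"
proof (rule ccontr)
  assume "q \<noteq> 0"
  then have "finite {x. poly q x = 0}" by (rule poly_roots_finite)
  moreover have "{a<..<b} \<subseteq> {x. poly q x = 0}" using assms(2) by auto
  ultimately show False using infinite_Ioo[OF assms(1)] finite_subset by blast
qed

lemma cell_eqI:
  assumes "m \<le> k" "m = 0 \<or> real m * hh k \<le> x" "m = k \<or> x < real (m+1) * hh k"
  shows "cell k x = m"
proof (rule antisym)
  show "m \<le> cell k x" using assms le_cell_iff[of m k x] by (cases "m = 0") auto
  show "cell k x \<le> m"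
  proof (cases "m = k")
    case False
    then have "\<not> m + 1 \<le> cell k x" using assms le_cell_iff[of "m+1" k x] by auto
    then show ?thesis by simp
  qed (simp add: cell_le)
qed

lemma oi_less:
  assumes "k \<ge> 1 \<longrightarrow> r < p" "i < j" "j < dimS p r k" "kn p r k i = kn p r k j"
  shows "oi p r i < oi p r j"
proof -
  have ii: "i < dimS p r k" using assms by simp
  from assms(1,3) show ?thesis
  proof (cases rule: index_cases)
    case 1 then show ?thesis using assms by (simp add: oi_def)
  next
    case (2 m s)
    note J = this
    from assms(1) ii show ?thesis
    proof (cases rule: index_cases)
      case 1
      then show ?thesis using assms(4) kn_index(1)[OF J(2,3)] J(1) by (simp add: kn_def)
    next
      case (2 m' s')
      then show ?thesis using assms(2,4) kn_index[OF J(2,3)] kn_index[OF 2(2,3)] J(1) by simp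
    qed
  qed
qed

lemma kn_le_k: "k \<ge> 1 \<longrightarrow> r < p \<Longrightarrow> i < dimS p r k \<Longrightarrow> kn p r k i \<le> k"
  by (erule index_cases, assumption) (auto simp: kn_def dest: kn_index)

text \<open>Strong induction on i, argued on the span where the i-th B-spline starts: smaller
  indices already have coefficient 0, larger ones vanish at its left end to higher order or are
  identically zero on the span.\<close>

lemma Nsp_indep:
  assumes "k \<ge> 1 \<longrightarrow> r < p" "\<And>x. 0 < x \<Longrightarrow> x < 1 \<Longrightarrow> (\<Sum>i<dimS p r k. c i * Nsp p r k i x) = 0"
    and "i < dimS p r k"
  shows "c i = 0"
  using assms(3)
proof (induction i rule: less_induct)
  case (less i)
  define m where "m = kn p r k i"
  define z where "z = real m * hh k"
  have mk: "m \<le> k" using kn_le_k[OF assms(1) less.prems] by (simp add: m_def)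
  have S: "(\<Sum>j<dimS p r k. smult (c j) (Npc p r k j m)) = 0"
  proof (rule poly_zero_on_interval[of "real m * hh k" "real (m+1) * hh k"])
    show "real m * hh k < real (m+1) * hh k" using hh_pos[of k] by simp
    fix x assume x: "real m * hh k < x" "x < real (m+1) * hh k"
    have "real (m+1) * hh k \<le> 1" using mk by (simp add: hh_def)
    moreover have "0 \<le> real m * hh k" using hh_pos[of k] by simp
    ultimately have "0 < x" "x < 1" using x by linarith+
    moreover have "cell k x = m" using x mk by (intro cell_eqI) auto
    ultimately show "poly (\<Sum>j<dimS p r k. smult (c j) (Npc p r k j m)) x = 0"
      using assms(2)[of x] by (simp add: poly_sum Nsp_pcw pcw_def)
  qed
  obtain u where u: "Npc p r k i m = [:- z, 1:] ^ oi p r i * u" "poly u z > 0"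
    using Npc_lead[OF assms(1) less.prems] unfolding z_def m_def by blast
  have "[:-z,1:] ^ Suc (oi p r i) dvd smult (c j) (Npc p r k j m)" if "j \<in> {..<dimS p r k} - {i}" for j
  proof (cases "j < i")
    case True then show ?thesis using less.IH[of j] that by simp
  next
    case False
    then have j: "i < j" "j < dimS p r k" using that by auto
    have kk: "m \<le> kn p r k j" unfolding m_def using kn_mono j(1) by (auto intro: monoD)
    show ?thesis
    proof (cases "kn p r k j = m")
      case True
      then have "Suc (oi p r i) \<le> oi p r j" using oi_less[OF assms(1) j] by (simp add: m_def)
      then have "[:-z,1:] ^ Suc (oi p r i) dvd [:-z,1:] ^ oi p r j" by (rule le_imp_power_dvd)
      moreover have "[:-z,1:] ^ oi p r j dvd Npc p r k j m"
        using Npc_lead[OF assms(1) j(2)] True unfolding z_def by (metis dvd_triv_left)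
      ultimately show ?thesis by (meson dvd_smult dvd_trans)
    next
      case False
      then have "Npc p r k j m = 0" using kk by (intro Npc_zero) simp
      then show ?thesis by simp
    qed
  qed
  then have "[:-z,1:] ^ Suc (oi p r i) dvd (\<Sum>j\<in>{..<dimS p r k} - {i}. smult (c j) (Npc p r k j m))"
    by (rule dvd_sum)
  then obtain w where w: "(\<Sum>j\<in>{..<dimS p r k} - {i}. smult (c j) (Npc p r k j m)) = [:-z,1:] ^ Suc (oi p r i) * w"
    by (auto elim: dvdE)
  have "smult (c i) (Npc p r k i m) + [:-z,1:] ^ Suc (oi p r i) * w = 0"
    using S less.prems unfolding w[symmetric] by (simp add: sum.remove)
  then have "[:-z,1:] ^ oi p r i * (smult (c i) u + [:-z,1:] * w) = 0"
    unfolding u(1) power_Suc by (simp only: distrib_left mult_smult_right mult.assoc mult.left_commute)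
  then have "smult (c i) u + [:-z,1:] * w = 0" by simp
  then have "poly (smult (c i) u + [:-z,1:] * w) z = 0" by simp
  then show ?case using u(2) by simp
qed

text \<open>The factorization is required for all x < h, negative x included, so that
  differentiating at 0 stays within the same polynomial.\<close>

definition van0 :: "nat \<Rightarrow> nat \<Rightarrow> (real \<Rightarrow> real) \<Rightarrow> bool" where
  "van0 k e f \<longleftrightarrow> (\<exists>w::real poly. \<forall>x<hh k. f x = x ^ e * poly w x)"

definition van1 :: "nat \<Rightarrow> nat \<Rightarrow> (real \<Rightarrow> real) \<Rightarrow> bool" where
  "van1 k e f \<longleftrightarrow> van0 k e (\<lambda>x. f (1 - x))"

lemma cell_0: "x < hh k \<Longrightarrow> cell k x = 0"
  using hh_pos[of k] by (intro cell_eqI) (auto simp: hh_def)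

lemma cell_k: "1 - hh k < x \<Longrightarrow> cell k x = k"
proof (rule cell_eqI[OF order_refl disjI2 disjI1[OF refl]])
  assume "1 - hh k < x"
  moreover have "real k * hh k = 1 - hh k" by (simp add: hh_def field_simps)
  ultimately show "real k * hh k \<le> x" by simp
qed

lemma Nsp_lead0:
  assumes "k \<ge> 1 \<longrightarrow> r < p" "i \<le> p"
  shows "\<exists>w. (\<forall>x<hh k. Nsp p r k i x = x ^ i * poly w x) \<and> poly w 0 > 0"
proof -
  have k0: "kn p r k i = 0" "oi p r i = i" using assms(2) by (auto simp: kn_def oi_def)
  have "i < dimS p r k" using assms(2) by (simp add: dimS_def)
  from Npc_lead[OF assms(1) this] obtain u where u: "Npc p r k i 0 = [:0,1:]^i * u" "poly u 0 > 0"
    unfolding k0 by auto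
  have "Nsp p r k i x = x ^ i * poly u x" if "x < hh k" for x
    using cell_0[OF that] by (simp add: Nsp_pcw pcw_def u(1))
  with u(2) show ?thesis by blast
qed

lemma Nsp_van0:
  assumes "k \<ge> 1 \<longrightarrow> r < p"
  shows "van0 k i (Nsp p r k i)"
proof (cases "i \<le> p")
  case True then show ?thesis using Nsp_lead0[OF assms True] unfolding van0_def by blast
next
  case False
  then have "Npc p r k i 0 = 0" by (intro Npc_zero) (simp add: kn_def)
  then have "\<forall>x<hh k. Nsp p r k i x = x ^ i * poly 0 x" by (simp add: Nsp_pcw pcw_def cell_0)
  then show ?thesis unfolding van0_def by blast
qed

text \<open>The order s is the position counted from the last B-spline. For s > p the support ends
  before the last span, and the piece there is zero.\<close>

lemma Nsp_van1:
  assumes "k \<ge> 1 \<longrightarrow> r < p" "i < dimS p r k"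
  shows "van1 k (dimS p r k - 1 - i) (Nsp p r k i)"
proof -
  define s where "s = dimS p r k - 1 - i"
  have l: "kn p r k (i + s) = k" "i + s = dimS p r k - 1"
    using index_last[OF assms(1), of "dimS p r k - 1"] assms(2) by (auto simp: s_def)
  have "[:- 1, 1:]^s dvd Npc p r k i k"
  proof (cases "s \<le> p")
    case True
    have h1: "real (k+1) * hh k = 1" by (simp add: hh_def)
    show ?thesis unfolding Npc_def
      using bpc_right_order[OF kn_mono, of p r k i s k p "hh k"] l True kn_le[of p r k "i+p+1"] unfolding h1 by simp
  next
    case False
    then have "kn p r k (i + p + 1) \<le> kn p r k (i + s)" using kn_mono by (auto intro: monoD)
    then have "Npc p r k i k = 0" unfolding Npc_def using l by (intro bpc_support kn_mono) simp
    then show ?thesis by simp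
  qed
  then obtain u where u: "Npc p r k i k = [:-1,1:]^s * u" by (auto elim: dvdE)
  have "Nsp p r k i (1 - x) = x ^ s * poly (smult ((-1)^s) (pcompose u [:1,-1:])) x" if "x < hh k" for x
  proof -
    have "cell k (1 - x) = k" using that by (intro cell_k) simp
    then have "Nsp p r k i (1-x) = (-x)^s * poly u (1-x)" by (simp add: Nsp_pcw pcw_def u)
    also have "\<dots> = x ^ s * poly (smult ((-1)^s) (pcompose u [:1,-1:])) x"
      by (subst power_minus) (simp add: poly_pcompose)
    finally show ?thesis .
  qed
  then show ?thesis unfolding van1_def van0_def s_def by blast
qed

lemma van0_mono:
  assumes "van0 k e f" "e' \<le> e"
  shows "van0 k e' f"
proof -
  obtain w where w: "\<forall>x<hh k. f x = x ^ e * poly w x" using assms(1) unfolding van0_def by blast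
  have "x ^ e = x ^ e' * x ^ (e - e')" for x :: real
    using assms(2) by (metis le_add_diff_inverse power_add)
  then have "x ^ e * poly w x = x ^ e' * poly (monom 1 (e - e') * w) x" for x
    by (simp only: poly_mult poly_monom mult_1 mult.assoc)
  with w show ?thesis unfolding van0_def by metis
qed

lemma van0_add: "van0 k e f \<Longrightarrow> van0 k e g \<Longrightarrow> van0 k e (\<lambda>x. f x + g x)"
  unfolding van0_def
  by (elim exE) (rule_tac x="w+wa" in exI, auto simp: algebra_simps)

lemma van0_poly_mult: "van0 k e f \<Longrightarrow> van0 k e (\<lambda>x. poly q x * f x)"
  unfolding van0_def
  by (elim exE) (rule_tac x="q*w" in exI, auto simp: algebra_simps)

lemma van0_scale: "van0 k e f \<Longrightarrow> van0 k e (\<lambda>x. c * f x)"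
  using van0_poly_mult[of k e f "[:c:]"] by simp

lemma van0_zero: "van0 k e (\<lambda>x. 0)"
  unfolding van0_def by (rule exI[of _ 0]) simp

lemma van0_sum: "finite S \<Longrightarrow> (\<And>s. s \<in> S \<Longrightarrow> van0 k e (f s)) \<Longrightarrow> van0 k e (\<lambda>x. \<Sum>s\<in>S. f s x)"
  by (induction S rule: finite_induct) (auto intro: van0_zero van0_add)

lemma van0_deriv:
  assumes "van0 k (Suc e) f"
  shows "van0 k e (deriv f)"
proof -
  obtain w where w: "\<forall>x<hh k. f x = x ^ Suc e * poly w x" using assms(1) unfolding van0_def by blast
  have "deriv f x = x ^ e * poly (smult (real (Suc e)) w + [:0,1:] * pderiv w) x" if "x < hh k" for x
  proof (rule DERIV_imp_deriv)
    have "((\<lambda>x. x ^ Suc e * poly w x) has_real_derivative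
        (x ^ e * poly (smult (real (Suc e)) w + [:0,1:] * pderiv w) x)) (at x)"
      by (rule DERIV_cong[OF DERIV_mult[OF DERIV_pow poly_DERIV]]) (simp add: algebra_simps)
    then show "(f has_real_derivative (x ^ e * poly (smult (real (Suc e)) w + [:0,1:] * pderiv w) x)) (at x)"
      by (rule has_field_derivative_transform_within_open[where S="{..<hh k}"]) (use that w in auto)
  qed
  then show ?thesis unfolding van0_def by blast
qed

lemma van0_value: "van0 k (Suc e) f \<Longrightarrow> f 0 = 0"
  unfolding van0_def using hh_pos[of k] by force

lemma deriv_reflect:
  fixes f :: "real \<Rightarrow> real"
  assumes "(f has_real_derivative deriv f (1 - x)) (at (1 - x))"
  shows "deriv (\<lambda>x. f (1 - x)) x = - deriv f (1 - x)"
proof (rule DERIV_imp_deriv)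
  have "((\<lambda>x. 1 - x) has_real_derivative -1) (at x)" by (auto intro!: derivative_eq_intros)
  from DERIV_chain2[OF assms this] show "((\<lambda>x. f (1 - x)) has_real_derivative - deriv f (1 - x)) (at x)" by simp
qed

lemma van1_deriv:
  assumes "f \<in> PS p r k" "k = 0 \<or> 1 \<le> r" "van1 k (Suc e) f"
  shows "van1 k e (deriv f)"
proof -
  have "van0 k e (deriv (\<lambda>x. f (1 - x)))" using assms(3) unfolding van1_def by (rule van0_deriv)
  moreover have "deriv (\<lambda>x. f (1 - x)) x = - deriv f (1 - x)" for x
    by (intro deriv_reflect PS_DERIV[OF assms(1,2)])
  ultimately have "van0 k e (\<lambda>x. - 1 * (deriv (\<lambda>x. f (1 - x)) x))" by (intro van0_scale)
  then show ?thesis unfolding van1_def using \<open>\<And>x. deriv (\<lambda>x. f (1 - x)) x = - deriv f (1 - x)\<close> by simp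
qed

lemma van1_poly_mult: "van1 k e f \<Longrightarrow> van1 k e (\<lambda>x. poly q x * f x)"
  using van0_poly_mult[of k e "\<lambda>x. f (1 - x)" "pcompose q [:1,-1:]"] unfolding van1_def
  by (simp add: poly_pcompose)

lemma van1_mono: "van1 k e f \<Longrightarrow> e' \<le> e \<Longrightarrow> van1 k e' f"
  unfolding van1_def by (rule van0_mono)

lemma van1_scale: "van1 k e f \<Longrightarrow> van1 k e (\<lambda>x. c * f x)"
  unfolding van1_def by (rule van0_scale)

lemma van1_add: "van1 k e f \<Longrightarrow> van1 k e g \<Longrightarrow> van1 k e (\<lambda>x. f x + g x)"
  unfolding van1_def by (rule van0_add)

lemma van1_zero: "van1 k e (\<lambda>x. 0)"
  unfolding van1_def by (rule van0_zero)

lemma van1_sum: "finite S \<Longrightarrow> (\<And>s. s \<in> S \<Longrightarrow> van1 k e (f s)) \<Longrightarrow> van1 k e (\<lambda>x. \<Sum>s\<in>S. f s x)"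
  unfolding van1_def by (rule van0_sum)

lemma van1_value: "van1 k (Suc e) f \<Longrightarrow> f 1 = 0"
  unfolding van1_def by (drule van0_value) simp

lemma van0_jet:
  assumes "van0 k 3 f" "j \<le> 2"
  shows "(deriv ^^ j) f 0 = 0"
proof -
  have "van0 k (3 - j) ((deriv ^^ j) f)" using assms(2)
  proof (induction j)
    case (Suc j)
    moreover have "Suc (3 - Suc j) = 3 - j" using Suc.prems by simp
    ultimately have "van0 k (Suc (3 - Suc j)) ((deriv ^^ j) f)" by simp
    then show ?case by (simp add: van0_deriv)
  qed (use assms in simp)
  moreover have "3 - j = Suc (2 - j)" using assms(2) by simp
  ultimately show ?thesis by (metis van0_value)
qed

lemma PS_deriv_pow:
  assumes "f \<in> PS p r k" "k = 0 \<or> j \<le> r"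
  shows "(deriv ^^ j) f \<in> PS (p - j) (r - j) k"
  using assms(2)
proof (induction j)
  case (Suc j)
  then have "(deriv ^^ j) f \<in> PS (p - j) (r - j) k" by auto
  then have "deriv ((deriv ^^ j) f) \<in> PS (p - j - 1) (r - j - 1) k"
    using Suc.prems by (intro PS_deriv) auto
  then show ?case by simp
qed (use assms in simp)

lemma PS_DERIV_pow:
  assumes "f \<in> PS p r k" "k = 0 \<or> Suc j \<le> r"
  shows "((deriv ^^ j) f has_real_derivative (deriv ^^ Suc j) f x) (at x)"
proof -
  have "(deriv ^^ j) f \<in> PS (p - j) (r - j) k" using assms by (intro PS_deriv_pow) auto
  then have "((deriv ^^ j) f has_real_derivative deriv ((deriv ^^ j) f) x) (at x)"
    using assms(2) by (intro PS_DERIV) auto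
  then show ?thesis by simp
qed

lemma van1_jet:
  assumes "f \<in> PS p r k" "k = 0 \<or> 2 \<le> r" "van1 k 3 f" "j \<le> 2"
  shows "(deriv ^^ j) f 1 = 0"
proof -
  have "van1 k (3 - j) ((deriv ^^ j) f)" using assms(4)
  proof (induction j)
    case (Suc j)
    moreover have "Suc (3 - Suc j) = 3 - j" using Suc.prems by simp
    ultimately have "van1 k (Suc (3 - Suc j)) ((deriv ^^ j) f)" by simp
    moreover have "(deriv ^^ j) f \<in> PS (p - j) (r - j) k" using assms(1,2) Suc.prems by (intro PS_deriv_pow) auto
    ultimately show ?case using assms(2) Suc.prems by (auto intro!: van1_deriv)
  qed (use assms in simp)
  moreover have "3 - j = Suc (2 - j)" using assms(4) by simp
  ultimately show ?thesis by (metis van1_value)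
qed

text \<open>If the knot after 0 occurs at positions p + 1 to p + 3, the first three B-splines of
  degree p see only 0 and h as knots and are Bernstein polynomials. The two branches of the
  recursion, A and B, combine by Pascal's rule. The condition r <= p - 3 provides the three
  copies.\<close>

lemma bpc_Bernstein:
  assumes "\<And>j. j \<le> p \<Longrightarrow> K j = 0" "\<And>j. j \<in> {1..3} \<Longrightarrow> K (p + j) = 1" "h > 0" "i \<le> p" "p \<le> i + q" "i + q \<le> p + 2"
  shows "bpc K h 0 q i = smult (real (q choose (i + q - p)) / h ^ q) ([:0,1:] ^ (i + q - p) * [:h,-1:] ^ (p - i))"
  using assms(4-6)
proof (induction q arbitrary: i)
  case 0
  then have "i = p" by simp
  then show ?case using assms(1)[of p] assms(2)[of 1] by simp
next
  case (Suc q)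
  have K1: "K (p+1) = 1" "K (p+2) = 1" "K (p+3) = 1" using assms(2)[of 1] assms(2)[of 2] assms(2)[of 3] by auto
  define s where "s = i + Suc q - p"
  have s2: "s \<le> 2" using Suc.prems by (simp add: s_def)
  have isq: "i + Suc q = p + s" using Suc.prems by (simp add: s_def)
  have Ki: "K i = 0" using assms(1) Suc.prems by simp
  have Kr: "K (i + q + 2) = 1"
  proof -
    have "i + q + 2 = p + (s + 1)" using isq by simp
    moreover have "s + 1 \<in> {1..3}" using s2 by auto
    ultimately show ?thesis using assms(2)[of "s+1"] by simp
  qed
  have A: "smult (1 / (real (K (i+q+1)) * h - real (K i) * h)) ([:- (real (K i) * h), 1:] * bpc K h 0 q i)
     = smult (real (if s = 0 then 0 else q choose (s - 1)) / h ^ Suc q) ([:0,1:] ^ s * [:h,-1:] ^ (p - i))"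
  proof (cases "s = 0")
    case True
    then have "i + q + 1 = p" using isq by simp
    then have "K (i+q+1) = 0" using assms(1)[of p] by simp
    then show ?thesis using Ki True by simp
  next
    case False
    then have "i + q + 1 = p + s" "s \<in> {1..3}" using isq s2 by auto
    then have K: "K (i+q+1) = 1" using assms(2) by metis
    have iq: "i + q - p = s - 1" "p \<le> i + q" "i + q \<le> p + 2" using isq False s2 by auto
    obtain t where t: "s = Suc t" using False by (cases s) auto
    show ?thesis unfolding K Ki Suc.IH[OF Suc.prems(1) iq(2,3)] iq(1) t
      by (rule poly_extI) (simp add: field_simps)
  qed
  have B: "smult (1 / (real (K (i+q+2)) * h - real (K (i+1)) * h)) ([:real (K (i+q+2)) * h, -1:] * bpc K h 0 q (i+1))
     = smult (real (q choose s) / h ^ Suc q) ([:0,1:] ^ s * [:h,-1:] ^ (p - i))"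
  proof (cases "i = p")
    case True
    then have "s = Suc q" using isq by simp
    moreover have "K (i+1) = 1" using True K1 by simp
    ultimately show ?thesis using Kr by simp
  next
    case False
    then have j: "i + 1 \<le> p" "p \<le> i + 1 + q" "i + 1 + q \<le> p + 2" "i + 1 + q - p = s" using Suc.prems isq by auto
    have K: "K (i+1) = 0" using assms(1) j by simp
    obtain t where t: "p - i = Suc t" "p - (i+1) = t" using j(1) by (metis Suc_diff_Suc Suc_eq_plus1 Suc_le_lessD)
    show ?thesis unfolding K Kr Suc.IH[OF j(1-3)] j(4) t
      by (rule poly_extI) (simp add: field_simps)
  qed
  have C: "Suc q choose s = (if s = 0 then 0 else q choose (s - 1)) + (q choose s)"
    by (cases s) auto
  show ?case unfolding bpc.simps(2) A B s_def[symmetric] C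
    by (rule poly_extI) (simp add: add_divide_distrib ring_distribs)
qed

section \<open>Tensor-product splines\<close>

definition MM :: "nat \<Rightarrow> nat \<Rightarrow> nat \<Rightarrow> nat \<Rightarrow> real \<Rightarrow> real" where
  "MM p r k s = (if s = 0 then M0 p r k else if s = 1 then M1 p r k else M2 p r k)"

text \<open>For k >= 1 the first inner knot has p - r >= 3 copies; for k = 0 the end knot 1 takes
  its place.\<close>

lemma Nsp_Bernstein:
  assumes "k \<ge> 1 \<longrightarrow> r + 3 \<le> p" "i \<le> 2" "2 \<le> p" "x < hh k"
  shows "Nsp p r k i x = poly (smult (real (p choose i) / hh k ^ p) ([:0,1:] ^ i * [:hh k,-1:] ^ (p - i))) x"
proof -
  have K3: "kn p r k (p + j) = 1" if j: "j \<in> {1..3}" for j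
  proof (cases "k = 0")
    case False
    then have "3 \<le> p - r" "1 \<le> k" using assms(1) by auto
    then have "3 * 1 \<le> (p - r) * k" by (intro mult_mono) auto
    then have "3 \<le> k * (p - r)" by (simp add: mult.commute)
    then show ?thesis using kn_mid[of "j - 1" k p r] j \<open>3 \<le> p - r\<close> by (auto simp: div_eq_0_iff)
  qed (use j in \<open>auto simp: kn_def\<close>)
  have "bpc (kn p r k) (hh k) 0 p i = smult (real (p choose (i + p - p)) / hh k ^ p) ([:0,1:] ^ (i + p - p) * [:hh k,-1:] ^ (p - i))"
    by (rule bpc_Bernstein) (use assms K3 hh_pos[of k] in \<open>auto simp: kn_def\<close>)
  then show ?thesis using cell_0[OF assms(4)] by (simp add: Nsp_pcw pcw_def Npc_def)
qed

lemma Bernstein_jets: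
  fixes h :: real
  defines "q \<equiv> (\<lambda>p s. [:0,1:] ^ s * [:h,-1:] ^ (p - s))"
  assumes "p = n + 3"
  shows "poly (q p 0) 0 = h ^ (n+3)" "poly (pderiv (q p 0)) 0 = - (real n + 3) * h ^ (n+2)"
    "poly (pderiv (pderiv (q p 0))) 0 = (real n + 3) * (real n + 2) * h ^ (n+1)"
    "poly (q p 1) 0 = 0" "poly (pderiv (q p 1)) 0 = h ^ (n+2)"
    "poly (pderiv (pderiv (q p 1))) 0 = - 2 * (real n + 2) * h ^ (n+1)"
    "poly (q p 2) 0 = 0" "poly (pderiv (q p 2)) 0 = 0"
    "poly (pderiv (pderiv (q p 2))) 0 = 2 * h ^ (n+1)"
proof -
  have p: "[:h,-1:] ^ (p - 0) = [:h,-1:] ^ Suc (Suc (Suc n))" "[:h,-1:] ^ (p - 1) = [:h,-1:] ^ Suc (Suc n)"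
    "[:h,-1:] ^ (p - 2) = [:h,-1:] ^ Suc n" using assms(2) by (simp_all add: eval_nat_numeral)
  have d: "pderiv ([:h,-1:] ^ Suc m) = smult (- real (Suc m)) ([:h,-1:] ^ m)" for m
    by (simp add: pderiv_power_Suc pderiv_pCons del: power_Suc)
  have x: "pderiv ([:0,1::real:]) = 1" "pderiv ([:0,1::real:] ^ 2) = smult 2 [:0,1:]" "pderiv ([:0,1::real:] ^ 1) = 1"
    by (simp_all add: pderiv_pCons power2_eq_square)
  note simps = q_def p pderiv_mult pderiv_add pderiv_smult d x power_0 power_one_right mult_1_left pderiv_1
  show "poly (q p 0) 0 = h ^ (n+3)" "poly (q p 1) 0 = 0" "poly (q p 2) 0 = 0"
    unfolding q_def p by (simp_all add: eval_nat_numeral)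
  show "poly (pderiv (q p 0)) 0 = - (real n + 3) * h ^ (n+2)" "poly (pderiv (q p 1)) 0 = h ^ (n+2)" "poly (pderiv (q p 2)) 0 = 0"
    by (simp_all only: simps) (simp_all add: eval_nat_numeral algebra_simps)
  show "poly (pderiv (pderiv (q p 0))) 0 = (real n + 3) * (real n + 2) * h ^ (n+1)"
    "poly (pderiv (pderiv (q p 1))) 0 = - 2 * (real n + 2) * h ^ (n+1)"
    "poly (pderiv (pderiv (q p 2))) 0 = 2 * h ^ (n+1)"
    by (simp_all only: simps) (simp_all add: eval_nat_numeral algebra_simps)
qed

lemma deriv_pow_local_poly:
  fixes q :: "real poly"
  assumes "\<And>x. x < c \<Longrightarrow> f x = poly q x"
  shows "x < c \<Longrightarrow> (deriv ^^ j) f x = poly ((pderiv ^^ j) q) x"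
proof (induction j arbitrary: x)
  case (Suc j)
  have "(poly ((pderiv ^^ j) q) has_real_derivative poly (pderiv ((pderiv ^^ j) q)) x) (at x)" by (rule poly_DERIV)
  then have "((deriv ^^ j) f has_real_derivative poly (pderiv ((pderiv ^^ j) q)) x) (at x)"
    by (rule has_field_derivative_transform_within_open[where S="{..<c}"]) (use Suc in auto)
  then show ?case by (simp add: DERIV_imp_deriv)
qed (use assms in simp)

text \<open>The M_s are dual to the derivatives at 0 up to order two. The factors h/p and
  h^2/(p(p-1)) are dictated by the derivatives of the Bernstein polynomials.\<close>

lemma MM_jet:
  assumes "k \<ge> 1 \<longrightarrow> r + 3 \<le> p" "3 \<le> p" "s \<le> 2" "j \<le> 2"
  shows "(deriv ^^ j) (MM p r k s) 0 = (if s = j then 1 else 0)"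
proof -
  define h where "h = hh k"
  have h: "h > 0" using hh_pos by (simp add: h_def)
  obtain n where n: "p = n + 3" using assms(2) by (metis add.commute le_Suc_ex)
  define q where "q s = [:0,1:] ^ s * [:h,-1:] ^ (p - s)" for s
  define B where "B i = smult (real (p choose i) / h ^ p) (q i)" for i
  define M where "M = (if s = 0 then B 0 + B 1 + B 2 else if s = 1 then smult (h / real p) (B 1 + smult 2 (B 2))
     else smult (h\<^sup>2 / (real p * (real p - 1))) (B 2))"
  have N: "Nsp p r k i x = poly (B i) x" if "x < h" "i \<le> 2" for x i
    using Nsp_Bernstein[OF assms(1) that(2), of x] assms(2) that(1) by (simp add: B_def q_def h_def)
  have "MM p r k s x = poly M x" if "x < h" for x
    using N[OF that] unfolding MM_def M_def M0_def M1_def M2_def h_def[symmetric]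
    by (simp add: numeral_2_eq_2 atMost_Suc)
  then have J: "(deriv ^^ j) (MM p r k s) 0 = poly ((pderiv ^^ j) M) 0"
    using h by (intro deriv_pow_local_poly[of h]) auto
  note bj = Bernstein_jets[OF n, of h, folded q_def]
  have ch: "p choose 1 = p" "2 * real (p choose 2) = (real n + 3) * (real n + 2)"
    using n by (simp_all add: choose_two field_simps) (simp add: real_of_nat_div algebra_simps)?
  have pw: "h ^ p = h ^ (n+1) * (h * h)" "h ^ (n+2) = h ^ (n+1) * h" "h ^ (n+3) = h ^ (n+1) * (h * h)"
    using n by (simp_all add: power_add power2_eq_square eval_nat_numeral)
  have c2: "real (p choose 2) = (real n + 3) * (real n + 2) / 2" using ch(2) by simp
  have rp: "real p = real n + 3" using n by simp
  have nz: "3 + real n \<noteq> 0" "2 + real n \<noteq> 0" "h ^ (n+1) \<noteq> 0" "h \<noteq> 0" "real n + 3 \<noteq> 0" "real n + 2 \<noteq> 0" using h by auto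
  have dd: "(pderiv ^^ 0) M = M" "(pderiv ^^ 1) M = pderiv M" "(pderiv ^^ 2) M = pderiv (pderiv M)"
    by (simp_all add: numeral_2_eq_2)
  have s: "s = 0 \<or> s = 1 \<or> s = 2" and j: "j = 0 \<or> j = 1 \<or> j = 2" using assms by auto
  from j show ?thesis
  proof (elim disjE)
    assume j: "j = 0"
    show ?thesis using s unfolding J unfolding j dd unfolding M_def B_def
      by (elim disjE) (simp_all add: bj bj(4,5,6)[unfolded One_nat_def] ch c2 rp pw nz)
  next
    assume j: "j = 1"
    show ?thesis using s unfolding J unfolding j dd unfolding M_def B_def
      by (elim disjE) (simp_all add: pderiv_add pderiv_smult bj bj(4,5,6)[unfolded One_nat_def] ch c2 rp pw nz add_divide_distrib[symmetric])
  next
    assume j: "j = 2"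
    show ?thesis using s unfolding J unfolding j dd unfolding M_def B_def
      by (elim disjE) (simp_all add: pderiv_add pderiv_smult bj bj(4,5,6)[unfolded One_nat_def] ch c2 rp pw nz power2_eq_square divide_simps, auto simp: algebra_simps)
  qed
qed

section \<open>Finite sums of products of univariate splines\<close>

definition tens :: "nat \<Rightarrow> (nat \<Rightarrow> real \<Rightarrow> real) \<Rightarrow> (nat \<Rightarrow> real \<Rightarrow> real) \<Rightarrow> pt \<Rightarrow> real" where
  "tens n A B \<xi> = (\<Sum>s<n. A s (fst \<xi>) * B s (snd \<xi>))"

text \<open>The number of summands is left open and B-splines are not mentioned, so that closure
  under sums and symmetries is immediate; \<open>TS_inS2\<close> recovers coefficients in the
  tensor-product basis.\<close>

definition TS :: "nat \<Rightarrow> nat \<Rightarrow> nat \<Rightarrow> (pt \<Rightarrow> real) set" where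
  "TS p r k = {tens n A B | n A B. \<forall>s<n. A s \<in> PS p r k \<and> B s \<in> PS p r k}"

lemma TSE:
  assumes "\<phi> \<in> TS p r k"
  obtains n A B where "\<And>s. s < n \<Longrightarrow> A s \<in> PS p r k" "\<And>s. s < n \<Longrightarrow> B s \<in> PS p r k" "\<phi> = tens n A B"
  using assms unfolding TS_def by blast

lemma TSI: "(\<And>s. s < n \<Longrightarrow> A s \<in> PS p r k) \<Longrightarrow> (\<And>s. s < n \<Longrightarrow> B s \<in> PS p r k) \<Longrightarrow> tens n A B \<in> TS p r k"
  unfolding TS_def by blast

lemma tens_add: "tens n A B \<xi> + tens m C D \<xi>
   = tens (n + m) (\<lambda>s. if s < n then A s else C (s - n)) (\<lambda>s. if s < n then B s else D (s - n)) \<xi>"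
  by (induction m) (simp_all add: tens_def)

lemma TS_prod: "f \<in> PS p r k \<Longrightarrow> g \<in> PS p r k \<Longrightarrow> (\<lambda>\<xi>. f (fst \<xi>) * g (snd \<xi>)) \<in> TS p r k"
  using TSI[of 1 "\<lambda>_. f" p r k "\<lambda>_. g"] by (simp add: tens_def[abs_def])

lemma TS_add: "\<phi> \<in> TS p r k \<Longrightarrow> \<psi> \<in> TS p r k \<Longrightarrow> (\<lambda>\<xi>. \<phi> \<xi> + \<psi> \<xi>) \<in> TS p r k"
  by (elim TSE) (auto simp: tens_add intro!: TSI)

lemma TS_cmul: "\<phi> \<in> TS p r k \<Longrightarrow> (\<lambda>\<xi>. c * \<phi> \<xi>) \<in> TS p r k"
proof (elim TSE)
  fix n A B assume *: "\<And>s. s < n \<Longrightarrow> A s \<in> PS p r k" "\<And>s. s < n \<Longrightarrow> B s \<in> PS p r k" "\<phi> = tens n A B"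
  have "(\<lambda>\<xi>. c * \<phi> \<xi>) = tens n (\<lambda>s x. c * A s x) B"
    by (simp add: *(3) tens_def[abs_def] sum_distrib_left mult.assoc)
  then show ?thesis using * by (auto intro!: TSI PS_scale)
qed

lemma TS_zero: "(\<lambda>\<xi>. 0) \<in> TS p r k"
  using TSI[of 0] by (simp add: tens_def[abs_def])

lemma TS_sum: "finite S \<Longrightarrow> (\<And>s. s \<in> S \<Longrightarrow> \<phi> s \<in> TS p r k) \<Longrightarrow> (\<lambda>\<xi>. \<Sum>s\<in>S. \<phi> s \<xi>) \<in> TS p r k"
  by (induction S rule: finite_induct) (auto intro: TS_zero TS_add)

lemma pdx_tens:
  assumes "\<And>s x. s < n \<Longrightarrow> (A s has_real_derivative A' s x) (at x)"
  shows "pdx (tens n A B) = tens n A' B"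
  unfolding pdx_def tens_def fun_eq_iff
  by (intro allI DERIV_imp_deriv) (auto intro!: derivative_eq_intros assms)

lemma pdy_tens:
  assumes "\<And>s x. s < n \<Longrightarrow> (B s has_real_derivative B' s x) (at x)"
  shows "pdy (tens n A B) = tens n A B'"
  unfolding pdy_def tens_def fun_eq_iff
  by (intro allI DERIV_imp_deriv) (auto intro!: derivative_eq_intros assms sum.cong)

lemma TS_diff: "\<phi> \<in> TS p r k \<Longrightarrow> \<psi> \<in> TS p r k \<Longrightarrow> (\<lambda>\<xi>. \<phi> \<xi> - \<psi> \<xi>) \<in> TS p r k"
  using TS_add[OF _ TS_cmul[of \<psi> p r k "-1"], of \<phi>] by simp

text \<open>Three switches replace eight cases: exchange of the coordinates (s), performed first,
  then reflection of the first (e) and of the second coordinate (f).\<close>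

lemma sqsym_generated:
  assumes "\<sigma> \<in> sqsym"
  shows "\<exists>e f s. \<forall>x y. \<sigma> (x, y) = (if s then ((if e then 1 - y else y), (if f then 1 - x else x))
      else ((if e then 1 - x else x), (if f then 1 - y else y)))"
proof -
  have *: "\<exists>e f s. \<forall>x y. \<sigma> (x, y) = (if s then ((if e then 1 - y else y), (if f then 1 - x else x))
      else ((if e then 1 - x else x), (if f then 1 - y else y)))"
    if "\<forall>x y. \<sigma> (x, y) = (if s then ((if e then 1 - y else y), (if f then 1 - x else x))
      else ((if e then 1 - x else x), (if f then 1 - y else y)))" for e f s
    using that by blast
  show ?thesis
    using assms unfolding sqsym_def
    using *[of False False False] *[of False True False] *[of False False True] *[of False True True]
      *[of True False False] *[of True True False] *[of True False True] *[of True True True]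
    by (elim insertE emptyE) simp_all
qed

lemma pd_zero_open:
  assumes "\<And>\<xi>. \<xi> \<in> {0<..<1} \<times> {0<..<1} \<Longrightarrow> f \<xi> = (0::real)" "\<xi> \<in> {0<..<1::real} \<times> {0<..<1::real}"
  shows "pdx f \<xi> = 0" "pdy f \<xi> = 0"
proof -
  have "((\<lambda>t. f (t, snd \<xi>)) has_real_derivative 0) (at (fst \<xi>))"
    by (rule has_field_derivative_transform_within_open[OF DERIV_const[of 0], where S="{0<..<1}"]) (use assms in auto)
  then show "pdx f \<xi> = 0" unfolding pdx_def by (rule DERIV_imp_deriv)
  have "((\<lambda>t. f (fst \<xi>, t)) has_real_derivative 0) (at (snd \<xi>))"
    by (rule has_field_derivative_transform_within_open[OF DERIV_const[of 0], where S="{0<..<1}"]) (use assms in auto)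
  then show "pdy f \<xi> = 0" unfolding pdy_def by (rule DERIV_imp_deriv)
qed

lemma unitsq_closure: "unitsq = closure ({0<..<1} \<times> {0<..<1})"
  unfolding unitsq_def by (simp add: closure_Times)

lemma TS_inS2:
  assumes "k \<ge> 1 \<longrightarrow> r < p" "\<phi> \<in> TS p r k" "\<And>\<xi>. \<xi> \<in> unitsq \<Longrightarrow> f \<xi> = \<phi> \<xi>"
  shows "inS2 p r k f"
proof -
  obtain n A B where 1: "\<And>s. s < n \<Longrightarrow> A s \<in> PS p r k" "\<And>s. s < n \<Longrightarrow> B s \<in> PS p r k" "\<phi> = tens n A B"
    using assms(2) by (rule TSE) blast
  have "\<forall>s. \<exists>c. s < n \<longrightarrow> (\<forall>x. A s x = (\<Sum>i<dimS p r k. c i * Nsp p r k i x))"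
    using PS_span[OF assms(1) 1(1)] by metis
  then obtain a where a: "\<And>s x. s < n \<Longrightarrow> A s x = (\<Sum>i<dimS p r k. a s i * Nsp p r k i x)" by metis
  have "\<forall>s. \<exists>c. s < n \<longrightarrow> (\<forall>x. B s x = (\<Sum>i<dimS p r k. c i * Nsp p r k i x))"
    using PS_span[OF assms(1) 1(2)] by metis
  then obtain b where b: "\<And>s x. s < n \<Longrightarrow> B s x = (\<Sum>i<dimS p r k. b s i * Nsp p r k i x)" by metis
  have d: "{..p + k*(p-r)} = {..<dimS p r k}" by (auto simp: dimS_def)
  have "f \<xi> = (\<Sum>i\<le>p + k*(p-r). \<Sum>j\<le>p + k*(p-r). (\<Sum>s<n. a s i * b s j) * Nsp p r k i (fst \<xi>) * Nsp p r k j (snd \<xi>))"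
    if "\<xi> \<in> unitsq" for \<xi>
  proof -
    have "f \<xi> = (\<Sum>s<n. (\<Sum>i<dimS p r k. a s i * Nsp p r k i (fst \<xi>)) * (\<Sum>j<dimS p r k. b s j * Nsp p r k j (snd \<xi>)))"
      using assms(3)[OF that] a b by (simp add: 1(3) tens_def)
    also have "\<dots> = (\<Sum>s<n. \<Sum>i<dimS p r k. \<Sum>j<dimS p r k. a s i * b s j * Nsp p r k i (fst \<xi>) * Nsp p r k j (snd \<xi>))"
      by (simp add: sum_product mult_ac)
    also have "\<dots> = (\<Sum>i<dimS p r k. \<Sum>s<n. \<Sum>j<dimS p r k. a s i * b s j * Nsp p r k i (fst \<xi>) * Nsp p r k j (snd \<xi>))"
      by (rule sum.swap)
    also have "\<dots> = (\<Sum>i<dimS p r k. \<Sum>j<dimS p r k. \<Sum>s<n. a s i * b s j * Nsp p r k i (fst \<xi>) * Nsp p r k j (snd \<xi>))"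
      by (intro sum.cong refl sum.swap)
    finally show ?thesis unfolding d by (simp add: sum_distrib_right)
  qed
  then show ?thesis unfolding inS2_def by (intro exI[of _ "\<lambda>i j. \<Sum>s<n. a s i * b s j"]) blast
qed

locale smooth_spline =
  fixes p r k :: nat
  assumes smooth: "k = 0 \<or> 2 \<le> r"
begin

lemma dpart_tens:
  assumes "\<And>s. s < n \<Longrightarrow> A s \<in> PS p r k" "\<And>s. s < n \<Longrightarrow> B s \<in> PS p r k" "i \<le> 2" "j \<le> 2"
  shows "dpart i j (tens n A B) = tens n (\<lambda>s. (deriv ^^ i) (A s)) (\<lambda>s. (deriv ^^ j) (B s))"
proof -
  have 1: "(pdy ^^ j) (tens n A B) = tens n A (\<lambda>s. (deriv ^^ j) (B s))" using assms(4)
  proof (induction j)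
    case (Suc j)
    have "pdy (tens n A (\<lambda>s. (deriv ^^ j) (B s))) = tens n A (\<lambda>s. (deriv ^^ Suc j) (B s))"
      using Suc.prems smooth by (intro pdy_tens PS_DERIV_pow[OF assms(2)]) auto
    then show ?case using Suc by simp
  qed simp
  have "(pdx ^^ i) (tens n A B) = tens n (\<lambda>s. (deriv ^^ i) (A s)) B" for B using assms(3)
  proof (induction i)
    case (Suc i)
    have "pdx (tens n (\<lambda>s. (deriv ^^ i) (A s)) B) = tens n (\<lambda>s. (deriv ^^ Suc i) (A s)) B"
      using Suc.prems smooth by (intro pdx_tens PS_DERIV_pow[OF assms(1)]) auto
    then show ?case using Suc by simp
  qed simp
  with 1 show ?thesis by (simp add: dpart_def)
qed

lemma dpart_add:
  assumes "\<phi> \<in> TS p r k" "\<psi> \<in> TS p r k" "i \<le> 2" "j \<le> 2"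
  shows "dpart i j (\<lambda>\<xi>. \<phi> \<xi> + \<psi> \<xi>) \<xi> = dpart i j \<phi> \<xi> + dpart i j \<psi> \<xi>"
proof -
  obtain n A B where 1: "\<And>s. s < n \<Longrightarrow> A s \<in> PS p r k" "\<And>s. s < n \<Longrightarrow> B s \<in> PS p r k" "\<phi> = tens n A B"
    using assms(1) by (rule TSE) blast
  obtain m C D where 2: "\<And>s. s < m \<Longrightarrow> C s \<in> PS p r k" "\<And>s. s < m \<Longrightarrow> D s \<in> PS p r k" "\<psi> = tens m C D"
    using assms(2) by (rule TSE) blast
  have e: "(\<lambda>\<xi>. \<phi> \<xi> + \<psi> \<xi>) = tens (n+m) (\<lambda>s. if s < n then A s else C (s - n)) (\<lambda>s. if s < n then B s else D (s - n))"
    by (simp add: 1(3) 2(3) tens_add fun_eq_iff)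
  have 3: "dpart i j (\<lambda>\<xi>. \<phi> \<xi> + \<psi> \<xi>)
      = tens (n+m) (\<lambda>s. (deriv ^^ i) (if s < n then A s else C (s - n))) (\<lambda>s. (deriv ^^ j) (if s < n then B s else D (s - n)))"
    unfolding e by (rule dpart_tens) (use 1 2 assms in auto)
  have 4: "dpart i j \<phi> = tens n (\<lambda>s. (deriv ^^ i) (A s)) (\<lambda>s. (deriv ^^ j) (B s))"
    unfolding 1(3) by (rule dpart_tens) (use 1 assms in auto)
  have 5: "dpart i j \<psi> = tens m (\<lambda>s. (deriv ^^ i) (C s)) (\<lambda>s. (deriv ^^ j) (D s))"
    unfolding 2(3) by (rule dpart_tens) (use 2 assms in auto)
  show ?thesis unfolding 3 4 5 tens_add by (simp add: if_distrib)
qed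

lemma dpart_cmul:
  assumes "\<phi> \<in> TS p r k" "i \<le> 2" "j \<le> 2"
  shows "dpart i j (\<lambda>\<xi>. c * \<phi> \<xi>) \<xi> = c * dpart i j \<phi> \<xi>"
proof -
  obtain n A B where 1: "\<And>s. s < n \<Longrightarrow> A s \<in> PS p r k" "\<And>s. s < n \<Longrightarrow> B s \<in> PS p r k" "\<phi> = tens n A B"
    using assms(1) by (rule TSE) blast
  have 4: "dpart i j \<phi> = tens n (\<lambda>s. (deriv ^^ i) (A s)) (\<lambda>s. (deriv ^^ j) (B s))"
    unfolding 1(3) by (rule dpart_tens) (use 1 assms in auto)
  have d: "(deriv ^^ i) (\<lambda>x. c * f x) = (\<lambda>x. c * (deriv ^^ i) f x)" if "f \<in> PS p r k" for f
    using assms(2)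
  proof (induction i)
    case (Suc i)
    then have "(deriv ^^ Suc i) (\<lambda>x. c * f x) = deriv (\<lambda>x. c * (deriv ^^ i) f x)" by simp
    also have "\<dots> = (\<lambda>x. c * (deriv ^^ Suc i) f x)"
      using Suc.prems smooth that
      by (intro ext DERIV_imp_deriv DERIV_cmult PS_DERIV_pow) auto
    finally show ?case .
  qed simp
  have e: "(\<lambda>\<xi>. c * \<phi> \<xi>) = tens n (\<lambda>s x. c * A s x) B"
    by (simp add: 1(3) tens_def[abs_def] sum_distrib_left mult.assoc)
  have "dpart i j (\<lambda>\<xi>. c * \<phi> \<xi>) = tens n (\<lambda>s. (deriv ^^ i) (\<lambda>x. c * A s x)) (\<lambda>s. (deriv ^^ j) (B s))"
    unfolding e by (rule dpart_tens) (use 1 assms in \<open>auto intro: PS_scale\<close>)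
  then show ?thesis unfolding 4 tens_def using d[OF 1(1)] by (simp add: sum_distrib_left mult.assoc)
qed

lemma dpart_zero: "i \<le> 2 \<Longrightarrow> j \<le> 2 \<Longrightarrow> dpart i j (\<lambda>\<xi>. 0) \<xi> = 0"
  using dpart_cmul[OF TS_zero, of i j 0] by simp

lemma dpart_sum:
  assumes "finite S" "\<And>s. s \<in> S \<Longrightarrow> \<phi> s \<in> TS p r k" "i \<le> 2" "j \<le> 2"
  shows "dpart i j (\<lambda>\<xi>. \<Sum>s\<in>S. \<phi> s \<xi>) \<xi> = (\<Sum>s\<in>S. dpart i j (\<phi> s) \<xi>)"
  using assms(1,2)
proof (induction S rule: finite_induct)
  case empty then show ?case using assms by (simp add: dpart_zero)
next
  case (insert x S)
  have "dpart i j (\<lambda>\<xi>. \<phi> x \<xi> + (\<Sum>s\<in>S. \<phi> s \<xi>)) \<xi> = dpart i j (\<phi> x) \<xi> + dpart i j (\<lambda>\<xi>. \<Sum>s\<in>S. \<phi> s \<xi>) \<xi>"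
    by (rule dpart_add) (use insert assms in \<open>auto intro: TS_sum\<close>)
  then show ?case using insert by simp
qed

lemma dpart_diff:
  assumes "\<phi> \<in> TS p r k" "\<psi> \<in> TS p r k" "i \<le> 2" "j \<le> 2"
  shows "dpart i j (\<lambda>\<xi>. \<phi> \<xi> - \<psi> \<xi>) \<xi> = dpart i j \<phi> \<xi> - dpart i j \<psi> \<xi>"
  using dpart_add[OF assms(1) TS_cmul[OF assms(2), of "-1"] assms(3,4)] dpart_cmul[OF assms(2-4), of "-1"] by simp

lemma dpart_prod:
  assumes "f \<in> PS p r k" "g \<in> PS p r k" "i \<le> 2" "j \<le> 2"
  shows "dpart i j (\<lambda>\<xi>. f (fst \<xi>) * g (snd \<xi>)) \<xi> = (deriv ^^ i) f (fst \<xi>) * (deriv ^^ j) g (snd \<xi>)"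
proof -
  have e: "(\<lambda>\<xi>. f (fst \<xi>) * g (snd \<xi>)) = tens 1 (\<lambda>_. f) (\<lambda>_. g)" by (simp add: tens_def[abs_def])
  show ?thesis unfolding e by (subst dpart_tens) (use assms in \<open>auto simp: tens_def\<close>)
qed

lemma dpart_continuous:
  assumes "\<phi> \<in> TS p r k" "i \<le> 2" "j \<le> 2"
  shows "continuous_on S (dpart i j \<phi>)"
proof -
  obtain n A B where 1: "\<And>s. s < n \<Longrightarrow> A s \<in> PS p r k" "\<And>s. s < n \<Longrightarrow> B s \<in> PS p r k" "\<phi> = tens n A B"
    using assms(1) by (rule TSE) blast
  have 4: "dpart i j \<phi> = tens n (\<lambda>s. (deriv ^^ i) (A s)) (\<lambda>s. (deriv ^^ j) (B s))"
    unfolding 1(3) by (rule dpart_tens) (use 1 assms in auto)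
  have c: "continuous_on T ((deriv ^^ i) f)" if "f \<in> PS p r k" "i \<le> 2" for f i T
    using PS_deriv_pow[OF that(1), of i] smooth that(2) by (intro PS_continuous_on[of _ "p-i" "r-i" k]) auto
  show ?thesis unfolding 4 tens_def[abs_def]
    by (intro continuous_intros continuous_on_compose2[OF c[OF 1(1), of _ i UNIV]] continuous_on_compose2[OF c[OF 1(2), of _ j UNIV]])
       (use assms in auto)
qed

lemma dpart_has_derivative:
  assumes "\<phi> \<in> TS p r k" "i \<le> 1" "j \<le> 1"
  shows "(dpart i j \<phi> has_derivative (\<lambda>v. dpart (Suc i) j \<phi> \<xi> * fst v + dpart i (Suc j) \<phi> \<xi> * snd v)) (at \<xi> within S)"
proof -
  obtain n A B where 1: "\<And>s. s < n \<Longrightarrow> A s \<in> PS p r k" "\<And>s. s < n \<Longrightarrow> B s \<in> PS p r k" "\<phi> = tens n A B"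
    using assms(1) by (rule TSE) blast
  have 4: "dpart i j \<phi> = tens n (\<lambda>s. (deriv ^^ i) (A s)) (\<lambda>s. (deriv ^^ j) (B s))" if "i \<le> 2" "j \<le> 2" for i j
    unfolding 1(3) by (rule dpart_tens) (use 1 that in auto)
  have A: "((\<lambda>\<xi>. (deriv ^^ i) (A s) (fst \<xi>)) has_derivative (\<lambda>v. (deriv ^^ Suc i) (A s) (fst \<xi>) * fst v)) (at \<xi> within S)" if "s < n" for s
  proof -
    have D: "((deriv ^^ i) (A s) has_derivative (\<lambda>v. (deriv ^^ Suc i) (A s) (fst \<xi>) * v)) (at (fst \<xi>))"
      using PS_DERIV_pow[OF 1(1)[OF that], of i "fst \<xi>"] smooth assms unfolding has_field_derivative_def by auto
    show ?thesis by (rule has_derivative_compose[OF has_derivative_fst[OF has_derivative_ident] D])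
  qed
  have B: "((\<lambda>\<xi>. (deriv ^^ j) (B s) (snd \<xi>)) has_derivative (\<lambda>v. (deriv ^^ Suc j) (B s) (snd \<xi>) * snd v)) (at \<xi> within S)" if "s < n" for s
  proof -
    have D: "((deriv ^^ j) (B s) has_derivative (\<lambda>v. (deriv ^^ Suc j) (B s) (snd \<xi>) * v)) (at (snd \<xi>))"
      using PS_DERIV_pow[OF 1(2)[OF that], of j "snd \<xi>"] smooth assms unfolding has_field_derivative_def by auto
    show ?thesis by (rule has_derivative_compose[OF has_derivative_snd[OF has_derivative_ident] D])
  qed
  have "((\<lambda>\<xi>. \<Sum>s<n. (deriv ^^ i) (A s) (fst \<xi>) * (deriv ^^ j) (B s) (snd \<xi>)) has_derivative
     (\<lambda>v. \<Sum>s<n. (deriv ^^ i) (A s) (fst \<xi>) * ((deriv ^^ Suc j) (B s) (snd \<xi>) * snd v) + (deriv ^^ Suc i) (A s) (fst \<xi>) * fst v * (deriv ^^ j) (B s) (snd \<xi>))) (at \<xi> within S)"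
    by (intro has_derivative_sum has_derivative_mult A B) auto
  moreover have "(\<lambda>v::pt. \<Sum>s<n. (deriv ^^ i) (A s) (fst \<xi>) * ((deriv ^^ Suc j) (B s) (snd \<xi>) * snd v) + (deriv ^^ Suc i) (A s) (fst \<xi>) * fst v * (deriv ^^ j) (B s) (snd \<xi>))
     = (\<lambda>v. dpart (Suc i) j \<phi> \<xi> * fst v + dpart i (Suc j) \<phi> \<xi> * snd v)"
    using assms 4[of "Suc i" j] 4[of i "Suc j"]
    by (simp add: tens_def sum.distrib sum_distrib_right sum_distrib_left algebra_simps del: funpow.simps)
  ultimately show ?thesis using 4[of i j] assms by (simp add: tens_def[abs_def])
qed

lemma deriv_pow_reflect:
  assumes "f \<in> PS p r k" "i \<le> 2"
  shows "(deriv ^^ i) (\<lambda>x. f (1 - x)) = (\<lambda>x. (-1) ^ i * (deriv ^^ i) f (1 - x))"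
  using assms(2)
proof (induction i)
  case (Suc i)
  have "(deriv ^^ Suc i) (\<lambda>x. f (1 - x)) = deriv (\<lambda>x. (-1) ^ i * (deriv ^^ i) f (1 - x))"
    using Suc by simp
  also have "\<dots> = (\<lambda>x. (-1) ^ Suc i * (deriv ^^ Suc i) f (1 - x))"
  proof (intro ext DERIV_imp_deriv)
    fix x
    have "((\<lambda>x. 1 - x) has_real_derivative -1) (at x)" by (auto intro!: derivative_eq_intros)
    moreover have "((deriv ^^ i) f has_real_derivative (deriv ^^ Suc i) f (1-x)) (at (1-x))"
      using Suc.prems smooth by (intro PS_DERIV_pow[OF assms(1)]) auto
    ultimately have "((\<lambda>x. (deriv ^^ i) f (1 - x)) has_real_derivative (deriv ^^ Suc i) f (1-x) * -1) (at x)"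
      by (intro DERIV_chain2[of "(deriv ^^ i) f"])
    then show "((\<lambda>x. (-1) ^ i * (deriv ^^ i) f (1 - x)) has_real_derivative (-1) ^ Suc i * (deriv ^^ Suc i) f (1 - x)) (at x)"
      by (rule DERIV_cong[OF DERIV_cmult]) simp
  qed
  finally show ?case .
qed simp

lemma TS_swap:
  assumes "\<phi> \<in> TS p r k"
  shows "(\<lambda>\<xi>. \<phi> (snd \<xi>, fst \<xi>)) \<in> TS p r k"
    and "i \<le> 2 \<Longrightarrow> j \<le> 2 \<Longrightarrow> dpart i j (\<lambda>\<xi>. \<phi> (snd \<xi>, fst \<xi>)) \<xi> = dpart j i \<phi> (snd \<xi>, fst \<xi>)"
proof -
  obtain n A B where 1: "\<And>s. s < n \<Longrightarrow> A s \<in> PS p r k" "\<And>s. s < n \<Longrightarrow> B s \<in> PS p r k" "\<phi> = tens n A B"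
    using assms(1) by (rule TSE) blast
  have e: "(\<lambda>\<xi>. \<phi> (snd \<xi>, fst \<xi>)) = tens n B A" unfolding 1(3) by (simp add: tens_def fun_eq_iff mult.commute)
  show "(\<lambda>\<xi>. \<phi> (snd \<xi>, fst \<xi>)) \<in> TS p r k" unfolding e using 1 by (intro TSI)
  assume ij: "i \<le> 2" "j \<le> 2"
  show "dpart i j (\<lambda>\<xi>. \<phi> (snd \<xi>, fst \<xi>)) \<xi> = dpart j i \<phi> (snd \<xi>, fst \<xi>)"
  proof -
    have 2: "dpart i j (tens n B A) = tens n (\<lambda>s. (deriv ^^ i) (B s)) (\<lambda>s. (deriv ^^ j) (A s))"
      by (rule dpart_tens) (use 1 ij in auto)
    have 3: "dpart j i (tens n A B) = tens n (\<lambda>s. (deriv ^^ j) (A s)) (\<lambda>s. (deriv ^^ i) (B s))"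
      by (rule dpart_tens) (use 1 ij in auto)
    show ?thesis unfolding e unfolding 1(3) 2 3 by (simp add: tens_def mult.commute)
  qed
qed

lemma TS_reflect_x:
  assumes "\<phi> \<in> TS p r k"
  shows "(\<lambda>\<xi>. \<phi> (1 - fst \<xi>, snd \<xi>)) \<in> TS p r k"
    and "i \<le> 2 \<Longrightarrow> j \<le> 2 \<Longrightarrow> dpart i j (\<lambda>\<xi>. \<phi> (1 - fst \<xi>, snd \<xi>)) \<xi> = (-1)^i * dpart i j \<phi> (1 - fst \<xi>, snd \<xi>)"
proof -
  obtain n A B where 1: "\<And>s. s < n \<Longrightarrow> A s \<in> PS p r k" "\<And>s. s < n \<Longrightarrow> B s \<in> PS p r k" "\<phi> = tens n A B"
    using assms(1) by (rule TSE) blast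
  have e: "(\<lambda>\<xi>. \<phi> (1 - fst \<xi>, snd \<xi>)) = tens n (\<lambda>s x. A s (1 - x)) B" unfolding 1(3) by (simp add: tens_def fun_eq_iff)
  have R: "\<And>s. s < n \<Longrightarrow> (\<lambda>x. A s (1 - x)) \<in> PS p r k" using 1(1) by (rule PS_reflect)
  show "(\<lambda>\<xi>. \<phi> (1 - fst \<xi>, snd \<xi>)) \<in> TS p r k" unfolding e using 1 R by (intro TSI)
  assume ij: "i \<le> 2" "j \<le> 2"
  show "dpart i j (\<lambda>\<xi>. \<phi> (1 - fst \<xi>, snd \<xi>)) \<xi> = (-1)^i * dpart i j \<phi> (1 - fst \<xi>, snd \<xi>)"
  proof -
    have 2: "dpart i j (tens n (\<lambda>s x. A s (1 - x)) B) = tens n (\<lambda>s. (deriv ^^ i) (\<lambda>x. A s (1 - x))) (\<lambda>s. (deriv ^^ j) (B s))"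
      by (rule dpart_tens) (use 1 R ij in auto)
    have 3: "dpart i j (tens n A B) = tens n (\<lambda>s. (deriv ^^ i) (A s)) (\<lambda>s. (deriv ^^ j) (B s))"
      by (rule dpart_tens) (use 1 ij in auto)
    show ?thesis unfolding e unfolding 1(3) 2 3
      using deriv_pow_reflect[OF 1(1) ij(1)] by (simp add: tens_def sum_distrib_left mult.assoc)
  qed
qed

lemma TS_reflect_y:
  assumes "\<phi> \<in> TS p r k"
  shows "(\<lambda>\<xi>. \<phi> (fst \<xi>, 1 - snd \<xi>)) \<in> TS p r k"
    and "i \<le> 2 \<Longrightarrow> j \<le> 2 \<Longrightarrow> dpart i j (\<lambda>\<xi>. \<phi> (fst \<xi>, 1 - snd \<xi>)) \<xi> = (-1)^j * dpart i j \<phi> (fst \<xi>, 1 - snd \<xi>)"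
  using TS_swap(1)[OF TS_reflect_x(1)[OF TS_swap(1)[OF assms]]]
    TS_swap(2)[OF TS_reflect_x(1)[OF TS_swap(1)[OF assms]], of i j \<xi>]
    TS_reflect_x(2)[OF TS_swap(1)[OF assms], of j i "(snd \<xi>, fst \<xi>)"]
    TS_swap(2)[OF assms, of j i "(1 - snd \<xi>, fst \<xi>)"]
  by simp_all

text \<open>Reflections produce the signs. Whether the two orders of differentiation are exchanged
  is read off from the image of the left side, which is vertical iff its ends have the same first
  coordinate.\<close>

lemma TS_sqsym:
  assumes "\<phi> \<in> TS p r k" "\<sigma> \<in> sqsym"
  shows "\<phi> \<circ> \<sigma> \<in> TS p r k"
    and "\<exists>\<epsilon>. (\<forall>i j. \<bar>\<epsilon> i j\<bar> = 1) \<and>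
      (fst (\<sigma> (0,0)) = fst (\<sigma> (0,1)) \<and> (\<forall>i\<le>2. \<forall>j\<le>2. \<forall>\<xi>. dpart i j (\<phi> \<circ> \<sigma>) \<xi> = \<epsilon> i j * dpart i j \<phi> (\<sigma> \<xi>))
     \<or> snd (\<sigma> (0,0)) = snd (\<sigma> (0,1)) \<and> (\<forall>i\<le>2. \<forall>j\<le>2. \<forall>\<xi>. dpart i j (\<phi> \<circ> \<sigma>) \<xi> = \<epsilon> i j * dpart j i \<phi> (\<sigma> \<xi>)))"
proof -
  obtain e f s where \<sigma>: "\<And>x y. \<sigma> (x, y) = (if s then ((if e then 1 - y else y), (if f then 1 - x else x))
      else ((if e then 1 - x else x), (if f then 1 - y else y)))"
    using sqsym_generated[OF assms(2)] by meson
  define \<phi>1 where "\<phi>1 = (if e then (\<lambda>\<xi>. \<phi> (1 - fst \<xi>, snd \<xi>)) else \<phi>)"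
  define \<phi>2 where "\<phi>2 = (if f then (\<lambda>\<xi>. \<phi>1 (fst \<xi>, 1 - snd \<xi>)) else \<phi>1)"
  have T1: "\<phi>1 \<in> TS p r k" using assms TS_reflect_x by (simp add: \<phi>1_def)
  have T2: "\<phi>2 \<in> TS p r k" using T1 TS_reflect_y by (simp add: \<phi>2_def)
  have c: "\<phi> \<circ> \<sigma> = (if s then (\<lambda>\<xi>. \<phi>2 (snd \<xi>, fst \<xi>)) else \<phi>2)"
    by (auto simp: fun_eq_iff \<phi>1_def \<phi>2_def \<sigma>)
  show "\<phi> \<circ> \<sigma> \<in> TS p r k" unfolding c using T2 TS_swap by simp
  have D2: "dpart i j \<phi>2 \<xi> = (if f then (-1)^j else 1) * ((if e then (-1)^i else 1) *
      dpart i j \<phi> ((if e then 1 - fst \<xi> else fst \<xi>), (if f then 1 - snd \<xi> else snd \<xi>)))" if "i \<le> 2" "j \<le> 2" for i j \<xi>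
    using that TS_reflect_y(2)[OF T1 that] TS_reflect_x(2)[OF assms(1) that] by (simp add: \<phi>1_def \<phi>2_def)
  show "\<exists>\<epsilon>. (\<forall>i j. \<bar>\<epsilon> i j\<bar> = 1) \<and>
      (fst (\<sigma> (0,0)) = fst (\<sigma> (0,1)) \<and> (\<forall>i\<le>2. \<forall>j\<le>2. \<forall>\<xi>. dpart i j (\<phi> \<circ> \<sigma>) \<xi> = \<epsilon> i j * dpart i j \<phi> (\<sigma> \<xi>))
     \<or> snd (\<sigma> (0,0)) = snd (\<sigma> (0,1)) \<and> (\<forall>i\<le>2. \<forall>j\<le>2. \<forall>\<xi>. dpart i j (\<phi> \<circ> \<sigma>) \<xi> = \<epsilon> i j * dpart j i \<phi> (\<sigma> \<xi>)))"
  proof (cases s)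
    case True
    show ?thesis
      by (rule exI[of _ "\<lambda>i j. (if f then (-1)^i else 1) * (if e then (-1)^j else 1)"])
         (use True in \<open>auto simp: c TS_swap(2)[OF T2] D2 \<sigma> abs_mult power_abs\<close>)
  next
    case False
    show ?thesis
      by (rule exI[of _ "\<lambda>i j. (if f then (-1)^j else 1) * (if e then (-1)^i else 1)"])
         (use False in \<open>auto simp: c D2 \<sigma> abs_mult power_abs\<close>)
  qed
qed

text \<open>The derivatives vanish in the open square and are continuous, so the information reaches
  the sides and corners.\<close>

lemma TS_zero_open:
  assumes "\<phi> \<in> TS p r k" "\<And>\<xi>. \<xi> \<in> {0<..<1} \<times> {0<..<1} \<Longrightarrow> \<phi> \<xi> = 0" "\<xi> \<in> unitsq" "i \<le> 2" "j \<le> 2"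
  shows "dpart i j \<phi> \<xi> = 0"
proof -
  have Y: "(pdy ^^ j) \<phi> \<eta> = 0" if "\<eta> \<in> {0<..<1} \<times> {0<..<1}" for \<eta> j
    using that by (induction j arbitrary: \<eta>) (use assms(2) pd_zero_open in auto)
  have X: "(pdx ^^ i) ((pdy ^^ j) \<phi>) \<eta> = 0" if "\<eta> \<in> {0<..<1} \<times> {0<..<1}" for \<eta> i
    using that by (induction i arbitrary: \<eta>) (use Y pd_zero_open in auto)
  show ?thesis
  proof (rule continuous_constant_on_closure[of "{0<..<1} \<times> {0<..<1}"])
    show "continuous_on (closure ({0<..<1} \<times> {0<..<1})) (dpart i j \<phi>)"
      using assms by (intro dpart_continuous)
  qed (use X assms in \<open>auto simp: dpart_def unitsq_closure\<close>)
qed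

end

section \<open>Bilinear patches\<close>

definition opensq :: "pt set" where "opensq = {0<..<1} \<times> {0<..<1}"

text \<open>The twist: the mixed second derivative, constant for bilinear G.\<close>

definition tw :: "(pt \<Rightarrow> pt) \<Rightarrow> pt" where "tw G = pd1v G (0,1) - pd1v G (0,0)"

definition patch :: "(pt \<Rightarrow> pt) \<Rightarrow> bool" where
  "patch G \<longleftrightarrow> bilinear_map G \<and> inj_on G unitsq \<and> (\<forall>\<xi>\<in>unitsq. jdet G \<xi> \<noteq> 0)"

lemma opensq_unitsq: "opensq \<subseteq> unitsq" by (auto simp: opensq_def unitsq_def)

lemma interior_unitsq: "interior unitsq = opensq"
  by (simp add: opensq_def unitsq_def interior_Times)

lemma compact_unitsq: "compact unitsq" by (simp add: unitsq_def compact_Times)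

lemma bilinear_pd:
  assumes "\<And>x y. G (x,y) = a + x *\<^sub>R b + y *\<^sub>R c + (x*y) *\<^sub>R d"
  shows "pd1v G \<xi> = b + snd \<xi> *\<^sub>R d" "pd2v G \<xi> = c + fst \<xi> *\<^sub>R d" "tw G = d"
proof -
  have 1: "pd1v G \<xi> = b + snd \<xi> *\<^sub>R d" for \<xi>
    unfolding pd1v_def assms
    by (rule vector_derivative_at) (auto intro!: derivative_eq_intros simp: has_vector_derivative_def algebra_simps)
  show "pd1v G \<xi> = b + snd \<xi> *\<^sub>R d" by (rule 1)
  show "tw G = d" unfolding tw_def 1 by simp
  show "pd2v G \<xi> = c + fst \<xi> *\<^sub>R d"
    unfolding pd2v_def assms
    by (rule vector_derivative_at) (auto intro!: derivative_eq_intros simp: has_vector_derivative_def algebra_simps)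
qed

lemma bilinear_mapE:
  assumes "bilinear_map G"
  obtains a b c d where "\<And>x y. G (x,y) = a + x *\<^sub>R b + y *\<^sub>R c + (x*y) *\<^sub>R d"
  using assms unfolding bilinear_map_def by blast

lemma bilinear_expand:
  assumes "bilinear_map G"
  shows "G \<eta> = G \<xi> + (fst \<eta> - fst \<xi>) *\<^sub>R pd1v G \<xi> + (snd \<eta> - snd \<xi>) *\<^sub>R pd2v G \<xi>
    + ((fst \<eta> - fst \<xi>) * (snd \<eta> - snd \<xi>)) *\<^sub>R tw G"
proof -
  obtain a b c d where G: "\<And>x y. G (x,y) = a + x *\<^sub>R b + y *\<^sub>R c + (x*y) *\<^sub>R d"
    using assms by (rule bilinear_mapE) blast
  show ?thesis unfolding bilinear_pd[OF G]
    by (cases \<eta>; cases \<xi>) (simp add: G algebra_simps)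
qed

lemma pd_affine:
  assumes "bilinear_map G"
  shows "pd1v G \<eta> = pd1v G \<xi> + (snd \<eta> - snd \<xi>) *\<^sub>R tw G" "pd2v G \<eta> = pd2v G \<xi> + (fst \<eta> - fst \<xi>) *\<^sub>R tw G"
proof -
  obtain a b c d where G: "\<And>x y. G (x,y) = a + x *\<^sub>R b + y *\<^sub>R c + (x*y) *\<^sub>R d"
    using assms by (rule bilinear_mapE) blast
  show "pd1v G \<eta> = pd1v G \<xi> + (snd \<eta> - snd \<xi>) *\<^sub>R tw G" "pd2v G \<eta> = pd2v G \<xi> + (fst \<eta> - fst \<xi>) *\<^sub>R tw G"
    unfolding bilinear_pd[OF G] by (simp_all add: algebra_simps)
qed

lemma bilinear_has_derivative:
  assumes "bilinear_map G"
  shows "(G has_derivative (\<lambda>v. fst v *\<^sub>R pd1v G \<xi> + snd v *\<^sub>R pd2v G \<xi>)) (at \<xi>)"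
proof -
  obtain a b c d where G: "\<And>x y. G (x,y) = a + x *\<^sub>R b + y *\<^sub>R c + (x*y) *\<^sub>R d"
    using assms by (rule bilinear_mapE) blast
  have e: "G = (\<lambda>\<xi>. a + fst \<xi> *\<^sub>R b + snd \<xi> *\<^sub>R c + (fst \<xi> * snd \<xi>) *\<^sub>R d)"
    using G by (auto simp: fun_eq_iff)
  show ?thesis unfolding bilinear_pd[OF G] unfolding e
    by (auto intro!: derivative_eq_intros simp: algebra_simps)
qed

lemma bilinear_continuous_on: "bilinear_map G \<Longrightarrow> continuous_on S G"
  by (meson bilinear_has_derivative has_derivative_continuous continuous_at_imp_continuous_on)

lemma cramer:
  assumes "det2 u v \<noteq> 0"
  shows "(det2 w v / det2 u v) *\<^sub>R u + (det2 u w / det2 u v) *\<^sub>R v = w"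
proof -
  have "det2 w v * fst u + det2 u w * fst v = fst w * det2 u v"
    "det2 w v * snd u + det2 u w * snd v = snd w * det2 u v"
    by (simp_all add: det2_def algebra_simps)
  then show ?thesis using assms by (simp add: prod_eq_iff add_divide_distrib[symmetric])
qed

text \<open>Surjectivity of the derivative at the one point suffices for the image of a
  neighbourhood to be a neighbourhood; Cramer's rule gives the right inverse.\<close>

lemma bilinear_open_image:
  assumes "bilinear_map G" "jdet G \<xi> \<noteq> 0" "\<xi> \<in> interior T"
  shows "G \<xi> \<in> interior (G ` T)"
proof (rule sussmann_open_mapping[OF open_UNIV bilinear_continuous_on[OF assms(1)] UNIV_I bilinear_has_derivative[OF assms(1)]])
  let ?g = "\<lambda>w. (det2 w (pd2v G \<xi>) / jdet G \<xi>, det2 (pd1v G \<xi>) w / jdet G \<xi>)"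
  show "bounded_linear ?g"
    unfolding linear_conv_bounded_linear[symmetric] det2_def
    by (rule linearI) (simp_all add: algebra_simps add_divide_distrib diff_divide_distrib)
  show "(\<lambda>v. fst v *\<^sub>R pd1v G \<xi> + snd v *\<^sub>R pd2v G \<xi>) \<circ> ?g = id"
    using cramer[OF assms(2)[unfolded jdet_def]] by (simp add: fun_eq_iff jdet_def)
qed (use assms in auto)

lemma patch_interior: "patch G \<Longrightarrow> \<xi> \<in> opensq \<Longrightarrow> G \<xi> \<in> interior (G ` unitsq)"
  using opensq_unitsq by (intro bilinear_open_image) (auto simp: patch_def interior_unitsq)

lemma patch_compact: "patch G \<Longrightarrow> compact (G ` unitsq)"
  by (intro compact_continuous_image compact_unitsq bilinear_continuous_on) (simp add: patch_def)

lemma patch_closure: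
  assumes "patch G"
  shows "G ` unitsq \<subseteq> closure (interior (G ` unitsq))"
proof -
  have "G ` closure opensq \<subseteq> closure (G ` opensq)"
    using assms by (intro image_closure_subset bilinear_continuous_on closed_closure closure_subset) (auto simp: patch_def)
  also have "\<dots> \<subseteq> closure (interior (G ` unitsq))"
    using patch_interior[OF assms] by (intro closure_mono) auto
  finally show ?thesis by (simp add: unitsq_closure opensq_def)
qed

text \<open>A patch lies in the closure of its interior, and an open set that meets a closure meets
  the set itself.\<close>

lemma interior_disjoint_patch:
  assumes "patch H" "open U" "U \<inter> interior (H ` unitsq) = {}"
  shows "U \<inter> H ` unitsq = {}"
proof -
  have "U \<inter> closure (interior (H ` unitsq)) = {}"
    using assms by (simp add: open_Int_closure_eq_empty)
  then show ?thesis using patch_closure[OF assms(1)] by auto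
qed

text \<open>Interior points of C close to x would fall into A or B, against disjointness of the
  interiors. This later excludes a third patch at a point inside a common edge.\<close>

lemma three_patches:
  assumes "patch A" "patch B" "patch C" "x \<in> interior (A ` unitsq \<union> B ` unitsq)" "x \<in> C ` unitsq"
    "interior (C ` unitsq) \<inter> interior (A ` unitsq) = {}" "interior (C ` unitsq) \<inter> interior (B ` unitsq) = {}"
  shows False
proof -
  have "x \<in> closure (interior (C ` unitsq))" using patch_closure[OF assms(3)] assms(5) by auto
  then have "interior (A ` unitsq \<union> B ` unitsq) \<inter> interior (C ` unitsq) \<noteq> {}"
    using assms(4) open_Int_closure_eq_empty[OF open_interior] by blast
  then obtain y where y: "y \<in> A ` unitsq \<union> B ` unitsq" "y \<in> interior (C ` unitsq)"
    using interior_subset by blast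
  then show False
    using interior_disjoint_patch[OF assms(1) open_interior assms(6)] interior_disjoint_patch[OF assms(2) open_interior assms(7)]
    by auto
qed

text \<open>The determinant is the signed distance from the line through the left side, up to a
  constant factor. As \<open>abar\<close> keeps its sign on [0,1], the sign of
  \<open>fst \<xi>\<close> decides on which side of this line a point lies.\<close>

lemma bilinear_side:
  assumes "bilinear_map G"
  shows "det2 (G \<xi> - G (0,0)) (pd2v G (0,0)) = fst \<xi> * abar G (snd \<xi>)"
proof -
  obtain a b c d where G: "\<And>x y. G (x,y) = a + x *\<^sub>R b + y *\<^sub>R c + (x*y) *\<^sub>R d"
    using assms by (rule bilinear_mapE) blast
  show ?thesis unfolding abar_def bilinear_pd[OF G]
    by (cases \<xi>) (simp add: G det2_def algebra_simps)
qed

lemma affine_same_sign: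
  fixes u v :: real
  assumes "\<And>t. t \<in> {0..1} \<Longrightarrow> u + t * v \<noteq> 0" "s \<in> {0..1}" "t \<in> {0..1}"
  shows "(u + s * v) * (u + t * v) > 0"
proof (rule ccontr)
  assume "\<not> ?thesis"
  then have n: "(u + s * v) * (u + t * v) < 0" using assms by (meson linorder_neqE_linordered_idom mult_eq_0_iff)
  define f where "f x = u + x * v" for x
  have c: "continuous_on S f" for S unfolding f_def by (intro continuous_intros)
  have conn: "connected (f ` {0..1})" by (intro connected_continuous_image c connected_Icc)
  have "(f s < 0 \<and> f t > 0) \<or> (f s > 0 \<and> f t < 0)" using n by (auto simp: f_def mult_less_0_iff)
  then have "0 \<in> f ` {0..1}"
    using connectedD_interval[OF conn, of "f s" "f t" 0] connectedD_interval[OF conn, of "f t" "f s" 0] assms(2,3) by auto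
  then show False using assms(1) by (auto simp: f_def)
qed

lemma abar_affine:
  assumes "bilinear_map G"
  shows "abar G t = abar G 0 + t * (abar G 1 - abar G 0)"
proof -
  obtain a b c d where G: "\<And>x y. G (x,y) = a + x *\<^sub>R b + y *\<^sub>R c + (x*y) *\<^sub>R d"
    using assms by (rule bilinear_mapE) blast
  show ?thesis unfolding abar_def bilinear_pd[OF G] by (simp add: det2_def algebra_simps)
qed

lemma abar_jdet: "abar G t = jdet G (0,t)" by (simp add: abar_def jdet_def)

lemma abar_same_sign:
  assumes "patch G" "s \<in> {0..1}" "t \<in> {0..1}"
  shows "abar G s * abar G t > 0"
proof -
  have b: "bilinear_map G" using assms by (simp add: patch_def)
  have "abar G 0 + t * (abar G 1 - abar G 0) \<noteq> 0" if "t \<in> {0..1}" for t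
    using abar_affine[OF b, of t] assms(1) that unfolding patch_def abar_jdet by (auto simp: unitsq_def)
  from affine_same_sign[OF this assms(2,3)] show ?thesis using abar_affine[OF b, of s] abar_affine[OF b, of t] by simp
qed

lemma common_edge_direction:
  assumes "bilinear_map A" "bilinear_map B" "\<And>t. t \<in> {0..1} \<Longrightarrow> A (0,t) = B (0,t)"
  shows "pd2v A (0,t) = pd2v B (0,t)"
proof -
  have "A (0,1) = A (0,0) + pd2v A (0,0)" "B (0,1) = B (0,0) + pd2v B (0,0)"
    using bilinear_expand[OF assms(1), of "(0,1)" "(0,0)"] bilinear_expand[OF assms(2), of "(0,1)" "(0,0)"] by auto
  then have "pd2v A (0,0) = pd2v B (0,0)" using assms(3)[of 0] assms(3)[of 1] by simp
  then show ?thesis using pd_affine(2)[OF assms(1), of "(0,t)" "(0,0)"] pd_affine(2)[OF assms(2), of "(0,t)" "(0,0)"] by simp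
qed

text \<open>Both maps are followed across the edge onto the strip \<open>T\<close>, where the first
  parameter may be negative. Equal signs of \<open>abar\<close> would put points just inside A into
  the interior of B. With opposite signs, a point near the edge with negative parameter for A has a
  positive one for B.\<close>

lemma common_edge:
  assumes "patch A" "patch B" "\<And>t. t \<in> {0..1} \<Longrightarrow> A (0,t) = B (0,t)"
    "interior (A ` unitsq) \<inter> interior (B ` unitsq) = {}" "0 < t" "t < 1"
  shows "abar A t * abar B t < 0" "A (0,t) \<in> interior (A ` unitsq \<union> B ` unitsq)"
proof -
  have b: "bilinear_map A" "bilinear_map B" using assms by (auto simp: patch_def)
  define T where "T = {-1<..<1::real} \<times> {0<..<1::real}"
  define lam where "lam z = det2 (z - A (0,0)) (pd2v A (0,0))" for z
  have A0: "A (0,0) = B (0,0)" using assms(3)[of 0] by simp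
  have e: "pd2v A (0,0) = pd2v B (0,0)" using common_edge_direction[OF b assms(3)] by simp
  have lA: "lam (A \<xi>) = fst \<xi> * abar A (snd \<xi>)" for \<xi> unfolding lam_def by (rule bilinear_side[OF b(1)])
  have lB: "lam (B \<xi>) = fst \<xi> * abar B (snd \<xi>)" for \<xi> unfolding lam_def A0 e by (rule bilinear_side[OF b(2)])
  have j: "jdet A (0,t) \<noteq> 0" "jdet B (0,t) \<noteq> 0" using assms by (auto simp: patch_def unitsq_def)
  have oT: "open T" by (simp add: T_def open_Times)
  have tT: "(0,t) \<in> interior T" using assms(5,6) by (simp add: interior_open[OF oT]) (simp add: T_def)
  \<comment> \<open>Every point of \<open>U\<close> has parameters in \<open>T\<close> under both
    maps, so its position relative to the edge line can be computed twice.\<close>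
  define U where "U = interior (A ` T) \<inter> interior (B ` T)"
  have oU: "open U" by (simp add: U_def open_Int)
  have xU: "A (0,t) \<in> U" unfolding U_def
    using bilinear_open_image[OF b(1) j(1) tT] bilinear_open_image[OF b(2) j(2) tT] assms(3)[of t] assms(5,6) by simp
  have UA: "\<exists>\<xi>\<in>T. z = A \<xi>" if "z \<in> U" for z using that interior_subset[of "A ` T"] by (auto simp: U_def)
  have UB: "\<exists>\<xi>\<in>T. z = B \<xi>" if "z \<in> U" for z using that interior_subset[of "B ` T"] by (auto simp: U_def)
  have sA: "abar A s * abar A t > 0" if "0 < s" "s < 1" for s using abar_same_sign[OF assms(1)] that assms(5,6) by auto
  have sB: "abar B s * abar B t > 0" if "0 < s" "s < 1" for s using abar_same_sign[OF assms(2)] that assms(5,6) by auto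
  have TU: "\<xi> \<in> unitsq" if "\<xi> \<in> T" "fst \<xi> \<ge> 0" for \<xi> using that by (auto simp: T_def unitsq_def)
  show neg: "abar A t * abar B t < 0"
  proof (rule ccontr)
    assume "\<not> ?thesis"
    then have pos: "abar A t * abar B t > 0" using j unfolding abar_jdet by (meson linorder_neqE_linordered_idom mult_eq_0_iff)
    have "isCont (\<lambda>s. A (s,t)) 0"
      by (rule continuous_at_compose[unfolded comp_def, of 0 "\<lambda>s. (s,t)" A])
         (use bilinear_continuous_on[OF b(1), of UNIV] in \<open>auto intro!: continuous_intros simp: continuous_on_eq_continuous_at\<close>)
    then have "\<forall>\<^sub>F s in at 0. A (s,t) \<in> U"
      using oU xU by (auto simp: continuous_at dest: topological_tendstoD)
    then obtain \<delta> where \<delta>: "\<delta> > 0" "\<And>s. s \<noteq> 0 \<Longrightarrow> \<bar>s\<bar> < \<delta> \<Longrightarrow> A (s,t) \<in> U"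
      unfolding eventually_at by auto
    define s where "s = min (\<delta>/2) (1/2)"
    have s: "0 < s" "s < 1" "A (s,t) \<in> U" using \<delta>(1) \<delta>(2)[of s] by (auto simp: s_def)
    obtain \<eta> where \<eta>: "\<eta> \<in> T" "A (s,t) = B \<eta>" using UB[OF s(3)] by auto
    have "fst \<eta> * abar B (snd \<eta>) = s * abar A t" using lA[of "(s,t)"] lB[of \<eta>] \<eta>(2) by simp
    then have "fst \<eta> * (abar B (snd \<eta>) * abar B t) = s * (abar A t * abar B t)" by (metis mult.assoc)
    moreover have "0 < s * (abar A t * abar B t)" using s pos by simp
    moreover have "abar B (snd \<eta>) * abar B t > 0" using sB[of "snd \<eta>"] \<eta>(1) by (auto simp: T_def)
    ultimately have "fst \<eta> > 0" by (metis zero_less_mult_pos2)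
    then have "\<eta> \<in> opensq" using \<eta>(1) by (auto simp: T_def opensq_def)
    then have "A (s,t) \<in> interior (B ` unitsq)" using patch_interior[OF assms(2)] \<eta>(2) by simp
    moreover have "A (s,t) \<in> interior (A ` unitsq)" using patch_interior[OF assms(1)] s assms(5,6) by (simp add: opensq_def)
    ultimately show False using assms(4) by blast
  qed
  have "z \<in> A ` unitsq \<union> B ` unitsq" if z: "z \<in> U" for z
  proof -
    obtain \<xi> where \<xi>: "\<xi> \<in> T" "z = A \<xi>" using UA[OF z] by auto
    obtain \<eta> where \<eta>: "\<eta> \<in> T" "z = B \<eta>" using UB[OF z] by auto
    show ?thesis
    proof (cases "fst \<xi> \<ge> 0")
      case True then show ?thesis using \<xi> TU by blast
    next
      case False
      have "fst \<xi> * abar A (snd \<xi>) = fst \<eta> * abar B (snd \<eta>)" using lA[of \<xi>] lB[of \<eta>] \<xi>(2) \<eta>(2) by simp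
      then have "fst \<xi> * (abar A (snd \<xi>) * abar A t) * (abar A t * abar B t) = fst \<eta> * (abar B (snd \<eta>) * abar B t) * (abar A t * abar A t)"
        by (simp add: mult_ac)
      moreover have "fst \<xi> * (abar A (snd \<xi>) * abar A t) * (abar A t * abar B t) > 0"
        by (rule mult_neg_neg[OF mult_neg_pos neg]) (use False sA[of "snd \<xi>"] \<xi>(1) in \<open>auto simp: T_def\<close>)
      moreover have "abar B (snd \<eta>) * abar B t > 0" using sB[of "snd \<eta>"] \<eta>(1) by (auto simp: T_def)
      moreover have "abar A t * abar A t > 0" using neg by (auto simp: mult_less_0_iff zero_less_mult_iff)
      ultimately have "fst \<eta> > 0" by (metis zero_less_mult_pos2)
      then show ?thesis using \<eta> TU by (metis UnI2 image_eqI less_imp_le)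
    qed
  qed
  then have "U \<subseteq> A ` unitsq \<union> B ` unitsq" by blast
  then show "A (0,t) \<in> interior (A ` unitsq \<union> B ` unitsq)"
    using xU oU by (meson interiorI)
qed

text \<open>The functional equals S c^2 - 2 c D + 2, where D is the mean of \<open>abar B\<close>
  minus the mean of \<open>abar A\<close>. The mean of an affine function is its value at 1/2, so
  opposite signs there make D, and with it the minimizer D / S, nonzero.\<close>

lemma c1_nonzero:
  assumes "bilinear_map A" "bilinear_map B" "abar A (1/2) * abar B (1/2) < 0"
  shows "c1 A B \<noteq> 0"
proof -
  define Q :: "real \<Rightarrow> real \<Rightarrow> real" where "Q u v = u\<^sup>2 + u * v + v\<^sup>2 / 3" for u v
  have I: "integral {0..1} (\<lambda>t. (c * (u + t * v) + e)\<^sup>2) = c\<^sup>2 * Q u v + 2 * c * e * (u + v / 2) + e\<^sup>2" for c e u v :: real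
  proof (rule integral_unique)
    define P where "P t = (c * u + e)\<^sup>2 * t + (c * u + e) * (c * v) * t\<^sup>2 + (c * v)\<^sup>2 * t ^ 3 / 3" for t
    have "((\<lambda>t. (c * (u + t * v) + e)\<^sup>2) has_integral
       (P 1 - P 0)) {0..1}" unfolding P_def
      by (rule fundamental_theorem_of_calculus)
         (auto intro!: derivative_eq_intros simp: has_real_derivative_iff_has_vector_derivative[symmetric] power2_eq_square algebra_simps)
    then show "((\<lambda>t. (c * (u + t * v) + e)\<^sup>2) has_integral c\<^sup>2 * Q u v + 2 * c * e * (u + v / 2) + e\<^sup>2) {0..1}"
      by (simp add: P_def Q_def power2_eq_square algebra_simps)
  qed
  define ua where "ua = abar A 0" define va where "va = abar A 1 - abar A 0"
  define ub where "ub = abar B 0" define vb where "vb = abar B 1 - abar B 0"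
  have fa: "abar A t = ua + t * va" and fb: "abar B t = ub + t * vb" for t
    using abar_affine[OF assms(1), of t] abar_affine[OF assms(2), of t] by (simp_all add: ua_def va_def ub_def vb_def)
  define S where "S = Q ua va + Q ub vb"
  define D where "D = (ub + vb / 2) - (ua + va / 2)"
  have J: "Jc A B c = S * c\<^sup>2 - 2 * c * D + 2" for c
    unfolding Jc_def fa fb using I[of c ua va 1] I[of c ub vb "-1"] by (simp add: S_def D_def algebra_simps)
  have h: "(ua + va/2) * (ub + vb/2) < 0" using assms(3) fa[of "1/2"] fb[of "1/2"] by simp
  \<comment> \<open>Mean square as squared mean plus variance, which shows that S is
    positive.\<close>
  have Qsq: "Q u v = (u + v/2)\<^sup>2 + v\<^sup>2/12" for u v by (simp add: Q_def power2_eq_square algebra_simps)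
  have Dn: "D \<noteq> 0" using h by (auto simp: D_def mult_less_0_iff)
  have "ua + va/2 \<noteq> 0" using h by auto
  then have Sp: "S > 0" unfolding S_def Qsq by (smt (verit) divide_nonneg_nonneg zero_le_power2 zero_less_power2)
  have K: "Jc A B c - Jc A B (D / S) = S * (c - D/S)\<^sup>2" for c
    unfolding J using Sp by (simp add: field_simps power2_eq_square)
  have "c1 A B = D / S" unfolding c1_def
  proof (rule the_equality)
    show "\<forall>c'. Jc A B (D/S) \<le> Jc A B c'"
      using K Sp by (metis diff_ge_0_iff_ge less_imp_le mult_nonneg_nonneg zero_le_power2)
    fix c assume "\<forall>c'. Jc A B c \<le> Jc A B c'"
    then have "S * (c - D/S)\<^sup>2 \<le> 0" using K[of c] by (metis diff_le_0_iff_le)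
    then have "(c - D/S)\<^sup>2 \<le> 0" using Sp by (simp add: mult_le_0_iff)
    then show "c = D/S" by simp
  qed
  then show ?thesis using Dn Sp by simp
qed

section \<open>Second-order jets and gluing\<close>

lemma sqsymI:
  assumes "\<And>x y. \<sigma> (x, y) = (if s then ((if e then 1 - y else y), (if f then 1 - x else x))
      else ((if e then 1 - x else x), (if f then 1 - y else y)))"
  shows "\<sigma> \<in> sqsym"
proof -
  have "\<sigma> = (\<lambda>(x,y). if s then ((if e then 1 - y else y), (if f then 1 - x else x))
      else ((if e then 1 - x else x), (if f then 1 - y else y)))" using assms by auto
  then show ?thesis unfolding sqsym_def by (cases s; cases e; cases f) simp_all
qed

lemma sqsym_comp:
  assumes "\<sigma> \<in> sqsym" "\<tau> \<in> sqsym"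
  shows "\<sigma> \<circ> \<tau> \<in> sqsym"
proof -
  obtain e f s where 1: "\<And>x y. \<sigma> (x, y) = (if s then ((if e then 1 - y else y), (if f then 1 - x else x))
      else ((if e then 1 - x else x), (if f then 1 - y else y)))" using sqsym_generated[OF assms(1)] by meson
  obtain e' f' s' where 2: "\<And>x y. \<tau> (x, y) = (if s' then ((if e' then 1 - y else y), (if f' then 1 - x else x))
      else ((if e' then 1 - x else x), (if f' then 1 - y else y)))" using sqsym_generated[OF assms(2)] by meson
  show ?thesis
    by (rule sqsymI[where s="s \<noteq> s'" and e="e \<noteq> (if s then f' else e')" and f="f \<noteq> (if s then e' else f')"])
       (simp add: 1 2)
qed

lemma sqsym_inverse:
  assumes "\<sigma> \<in> sqsym"
  shows "\<exists>\<tau>\<in>sqsym. \<forall>\<xi>. \<sigma> (\<tau> \<xi>) = \<xi> \<and> \<tau> (\<sigma> \<xi>) = \<xi>"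
proof -
  obtain e f s where 1: "\<And>x y. \<sigma> (x, y) = (if s then ((if e then 1 - y else y), (if f then 1 - x else x))
      else ((if e then 1 - x else x), (if f then 1 - y else y)))" using sqsym_generated[OF assms(1)] by meson
  define \<tau> where "\<tau> = (\<lambda>(x,y). if s then ((if f then 1 - y else y), (if e then 1 - x else x))
      else ((if e then 1 - x else x), (if f then 1 - y else y::real)))"
  have "\<tau> \<in> sqsym"
    by (rule sqsymI[where s=s and e="if s then f else e" and f="if s then e else f"]) (simp add: \<tau>_def)
  moreover have "\<forall>\<xi>. \<sigma> (\<tau> \<xi>) = \<xi> \<and> \<tau> (\<sigma> \<xi>) = \<xi>" by (auto simp: \<tau>_def 1)
  ultimately show ?thesis by blast
qed

lemma sqsym_mem:
  assumes "\<sigma> \<in> sqsym"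
  shows "\<sigma> \<xi> \<in> unitsq \<longleftrightarrow> \<xi> \<in> unitsq" "\<sigma> \<xi> \<in> opensq \<longleftrightarrow> \<xi> \<in> opensq"
proof -
  obtain e f s where 1: "\<And>x y. \<sigma> (x, y) = (if s then ((if e then 1 - y else y), (if f then 1 - x else x))
      else ((if e then 1 - x else x), (if f then 1 - y else y)))" using sqsym_generated[OF assms(1)] by meson
  show "\<sigma> \<xi> \<in> unitsq \<longleftrightarrow> \<xi> \<in> unitsq" "\<sigma> \<xi> \<in> opensq \<longleftrightarrow> \<xi> \<in> opensq"
    by (cases \<xi>; auto simp: 1 unitsq_def opensq_def split: if_splits)+
qed

lemma sqsym_image:
  assumes "\<sigma> \<in> sqsym"
  shows "\<sigma> ` unitsq = unitsq"
proof
  show "\<sigma> ` unitsq \<subseteq> unitsq" using sqsym_mem(1)[OF assms] by blast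
  obtain \<tau> where \<tau>: "\<tau> \<in> sqsym" "\<And>\<xi>. \<sigma> (\<tau> \<xi>) = \<xi>" using sqsym_inverse[OF assms] by blast
  show "unitsq \<subseteq> \<sigma> ` unitsq"
  proof
    fix \<xi> assume "\<xi> \<in> unitsq"
    then have "\<tau> \<xi> \<in> unitsq" using sqsym_mem(1)[OF \<tau>(1)] by blast
    then show "\<xi> \<in> \<sigma> ` unitsq" using \<tau>(2)[of \<xi>] by (metis imageI)
  qed
qed

lemma patch_reflect_x:
  assumes "patch G"
  shows "patch (\<lambda>\<xi>. G (1 - fst \<xi>, snd \<xi>))"
proof -
  obtain a b c d where G: "\<And>x y. G (x,y) = a + x *\<^sub>R b + y *\<^sub>R c + (x*y) *\<^sub>R d"
    using assms bilinear_mapE unfolding patch_def by metis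
  have R: "\<And>x y. G (1 - fst (x,y), snd (x,y)) = (a + b) + x *\<^sub>R (- b) + y *\<^sub>R (c + d) + (x*y) *\<^sub>R (- d)"
    by (simp add: G algebra_simps)
  have J: "jdet (\<lambda>\<xi>. G (1 - fst \<xi>, snd \<xi>)) \<xi> = - jdet G (1 - fst \<xi>, snd \<xi>)" for \<xi>
    unfolding jdet_def bilinear_pd[OF R] bilinear_pd[OF G] by (simp add: det2_def algebra_simps)
  show ?thesis unfolding patch_def
  proof (intro conjI)
    show "bilinear_map (\<lambda>\<xi>. G (1 - fst \<xi>, snd \<xi>))" unfolding bilinear_map_def using R by blast
    show "inj_on (\<lambda>\<xi>. G (1 - fst \<xi>, snd \<xi>)) unitsq"
    proof (rule inj_onI)
      fix \<xi> \<eta> assume *: "\<xi> \<in> unitsq" "\<eta> \<in> unitsq" "G (1 - fst \<xi>, snd \<xi>) = G (1 - fst \<eta>, snd \<eta>)"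
      then have "(1 - fst \<xi>, snd \<xi>) \<in> unitsq" "(1 - fst \<eta>, snd \<eta>) \<in> unitsq" by (auto simp: unitsq_def)
      then have "(1 - fst \<xi>, snd \<xi>) = (1 - fst \<eta>, snd \<eta>)" using assms * unfolding patch_def by (meson inj_onD)
      then show "\<xi> = \<eta>" by (simp add: prod_eq_iff)
    qed
    show "\<forall>\<xi>\<in>unitsq. jdet (\<lambda>\<xi>. G (1 - fst \<xi>, snd \<xi>)) \<xi> \<noteq> 0"
      unfolding J using assms unfolding patch_def by (auto simp: unitsq_def)
  qed
qed

lemma swap_pd:
  assumes "bilinear_map G"
  shows "bilinear_map (\<lambda>\<xi>. G (snd \<xi>, fst \<xi>))" "pd1v (\<lambda>\<xi>. G (snd \<xi>, fst \<xi>)) \<xi> = pd2v G (snd \<xi>, fst \<xi>)"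
    "pd2v (\<lambda>\<xi>. G (snd \<xi>, fst \<xi>)) \<xi> = pd1v G (snd \<xi>, fst \<xi>)" "tw (\<lambda>\<xi>. G (snd \<xi>, fst \<xi>)) = tw G"
proof -
  obtain a b c d where G: "\<And>x y. G (x,y) = a + x *\<^sub>R b + y *\<^sub>R c + (x*y) *\<^sub>R d"
    using assms by (rule bilinear_mapE) blast
  have R: "\<And>x y. G (snd (x,y), fst (x,y)) = a + x *\<^sub>R c + y *\<^sub>R b + (x*y) *\<^sub>R d"
    by (simp add: G algebra_simps)
  show "bilinear_map (\<lambda>\<xi>. G (snd \<xi>, fst \<xi>))" unfolding bilinear_map_def using R by blast
  show "pd1v (\<lambda>\<xi>. G (snd \<xi>, fst \<xi>)) \<xi> = pd2v G (snd \<xi>, fst \<xi>)"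
    "pd2v (\<lambda>\<xi>. G (snd \<xi>, fst \<xi>)) \<xi> = pd1v G (snd \<xi>, fst \<xi>)" "tw (\<lambda>\<xi>. G (snd \<xi>, fst \<xi>)) = tw G"
    unfolding bilinear_pd[OF R] bilinear_pd[OF G] by simp_all
qed

lemma patch_swap:
  assumes "patch G"
  shows "patch (\<lambda>\<xi>. G (snd \<xi>, fst \<xi>))"
proof -
  have b: "bilinear_map G" using assms by (simp add: patch_def)
  have J: "jdet (\<lambda>\<xi>. G (snd \<xi>, fst \<xi>)) \<xi> = - jdet G (snd \<xi>, fst \<xi>)" for \<xi>
    unfolding jdet_def swap_pd[OF b] by (simp add: det2_def)
  show ?thesis unfolding patch_def
  proof (intro conjI)
    show "bilinear_map (\<lambda>\<xi>. G (snd \<xi>, fst \<xi>))" by (rule swap_pd[OF b])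
    show "inj_on (\<lambda>\<xi>. G (snd \<xi>, fst \<xi>)) unitsq"
    proof (rule inj_onI)
      fix \<xi> \<eta> assume *: "\<xi> \<in> unitsq" "\<eta> \<in> unitsq" "G (snd \<xi>, fst \<xi>) = G (snd \<eta>, fst \<eta>)"
      then have "(snd \<xi>, fst \<xi>) \<in> unitsq" "(snd \<eta>, fst \<eta>) \<in> unitsq" by (auto simp: unitsq_def)
      then have "(snd \<xi>, fst \<xi>) = (snd \<eta>, fst \<eta>)" using assms * unfolding patch_def by (meson inj_onD)
      then show "\<xi> = \<eta>" by (simp add: prod_eq_iff)
    qed
    show "\<forall>\<xi>\<in>unitsq. jdet (\<lambda>\<xi>. G (snd \<xi>, fst \<xi>)) \<xi> \<noteq> 0"
      unfolding J using assms unfolding patch_def by (auto simp: unitsq_def)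
  qed
qed

lemma patch_sqsym:
  assumes "patch G" "\<sigma> \<in> sqsym"
  shows "patch (G \<circ> \<sigma>)"
proof -
  obtain e f s where \<sigma>: "\<And>x y. \<sigma> (x, y) = (if s then ((if e then 1 - y else y), (if f then 1 - x else x))
      else ((if e then 1 - x else x), (if f then 1 - y else y)))"
    using sqsym_generated[OF assms(2)] by meson
  define G1 where "G1 = (if e then (\<lambda>\<xi>. G (1 - fst \<xi>, snd \<xi>)) else G)"
  define G2 where "G2 = (if f then (\<lambda>\<xi>. G1 (fst \<xi>, 1 - snd \<xi>)) else G1)"
  have P1: "patch G1" using assms patch_reflect_x by (simp add: G1_def)
  have "patch (\<lambda>\<xi>. G1 (fst \<xi>, 1 - snd \<xi>))"
    using patch_swap[OF patch_reflect_x[OF patch_swap[OF P1]]] by simp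
  then have P2: "patch G2" using P1 by (simp add: G2_def)
  have "G \<circ> \<sigma> = (if s then (\<lambda>\<xi>. G2 (snd \<xi>, fst \<xi>)) else G2)"
    by (auto simp: fun_eq_iff G1_def G2_def \<sigma>)
  then show ?thesis using P2 patch_swap by simp
qed

lemma image_sqsym: "\<sigma> \<in> sqsym \<Longrightarrow> (G \<circ> \<sigma>) ` unitsq = G ` unitsq"
  by (simp only: image_comp[symmetric] sqsym_image)

type_synonym jet = "real \<times> real \<times> real \<times> real \<times> real \<times> real"

text \<open>The chain rule up to order two at \<open>G \<xi>\<close>: value, gradient and Hessian in physical coordinates
  against the partial derivatives in the parameter domain. For bilinear \<open>G\<close> the only second
  derivative of \<open>G\<close> is the constant twist.\<close>

definition jetat :: "(pt \<Rightarrow> pt) \<Rightarrow> (pt \<Rightarrow> real) \<Rightarrow> pt \<Rightarrow> jet \<Rightarrow> bool" where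
  "jetat G \<phi> \<xi> J \<longleftrightarrow> (case J of (v, g1, g2, h11, h12, h22) \<Rightarrow>
     let a = fst (pd1v G \<xi>); b = snd (pd1v G \<xi>); c = fst (pd2v G \<xi>); d = snd (pd2v G \<xi>) in
     \<phi> \<xi> = v \<and> dpart 1 0 \<phi> \<xi> = g1 * a + g2 * b \<and> dpart 0 1 \<phi> \<xi> = g1 * c + g2 * d
     \<and> dpart 2 0 \<phi> \<xi> = h11 * a * a + 2 * h12 * a * b + h22 * b * b
     \<and> dpart 1 1 \<phi> \<xi> = h11 * a * c + h12 * (a * d + b * c) + h22 * b * d + g1 * fst (tw G) + g2 * snd (tw G)
     \<and> dpart 0 2 \<phi> \<xi> = h11 * c * c + 2 * h12 * c * d + h22 * d * d)"

text \<open>The chain rule solved for the physical jet. The explicit quotients by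
  \<open>jdet\<close> give uniqueness of the jet and, later, continuity of the physical
  derivatives.\<close>

lemma jet_explicit:
  assumes "jetat G \<phi> \<xi> (v, g1, g2, h11, h12, h22)" "jdet G \<xi> \<noteq> 0"
  defines "a \<equiv> fst (pd1v G \<xi>)" and "b \<equiv> snd (pd1v G \<xi>)" and "c \<equiv> fst (pd2v G \<xi>)" and "d \<equiv> snd (pd2v G \<xi>)"
  defines "k \<equiv> dpart 1 1 \<phi> \<xi> - g1 * fst (tw G) - g2 * snd (tw G)"
  shows "v = \<phi> \<xi>" "g1 = (dpart 1 0 \<phi> \<xi> * d - dpart 0 1 \<phi> \<xi> * b) / jdet G \<xi>"
    "g2 = (dpart 0 1 \<phi> \<xi> * a - dpart 1 0 \<phi> \<xi> * c) / jdet G \<xi>"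
    "h11 = (dpart 2 0 \<phi> \<xi> * d * d - 2 * k * b * d + dpart 0 2 \<phi> \<xi> * b * b) / (jdet G \<xi>)\<^sup>2"
    "h12 = (- dpart 2 0 \<phi> \<xi> * c * d + k * (a * d + b * c) - dpart 0 2 \<phi> \<xi> * a * b) / (jdet G \<xi>)\<^sup>2"
    "h22 = (dpart 2 0 \<phi> \<xi> * c * c - 2 * k * a * c + dpart 0 2 \<phi> \<xi> * a * a) / (jdet G \<xi>)\<^sup>2"
proof -
  have J: "jdet G \<xi> = a * d - b * c" by (simp add: jdet_def det2_def a_def b_def c_def d_def)
  have E: "\<phi> \<xi> = v" "dpart 1 0 \<phi> \<xi> = g1 * a + g2 * b" "dpart 0 1 \<phi> \<xi> = g1 * c + g2 * d"
     "dpart 2 0 \<phi> \<xi> = h11 * a * a + 2 * h12 * a * b + h22 * b * b"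
     "k = h11 * a * c + h12 * (a * d + b * c) + h22 * b * d"
     "dpart 0 2 \<phi> \<xi> = h11 * c * c + 2 * h12 * c * d + h22 * d * d"
    using assms(1) by (simp_all add: jetat_def Let_def a_def b_def c_def d_def k_def)
  have nz: "a * d - b * c \<noteq> 0" using assms(2) J by simp
  show "v = \<phi> \<xi>" using E by simp
  show "g1 = (dpart 1 0 \<phi> \<xi> * d - dpart 0 1 \<phi> \<xi> * b) / jdet G \<xi>"
    unfolding J E nonzero_eq_divide_eq[OF nz] by (simp add: algebra_simps)
  show "g2 = (dpart 0 1 \<phi> \<xi> * a - dpart 1 0 \<phi> \<xi> * c) / jdet G \<xi>"
    unfolding J E nonzero_eq_divide_eq[OF nz] by (simp add: algebra_simps)
  have nz2: "(a * d - b * c)\<^sup>2 \<noteq> 0" using nz by simp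
  show "h11 = (dpart 2 0 \<phi> \<xi> * d * d - 2 * k * b * d + dpart 0 2 \<phi> \<xi> * b * b) / (jdet G \<xi>)\<^sup>2"
    unfolding J E nonzero_eq_divide_eq[OF nz2] by (simp add: algebra_simps power2_eq_square)
  show "h12 = (- dpart 2 0 \<phi> \<xi> * c * d + k * (a * d + b * c) - dpart 0 2 \<phi> \<xi> * a * b) / (jdet G \<xi>)\<^sup>2"
    unfolding J E nonzero_eq_divide_eq[OF nz2] by (simp add: algebra_simps power2_eq_square)
  show "h22 = (dpart 2 0 \<phi> \<xi> * c * c - 2 * k * a * c + dpart 0 2 \<phi> \<xi> * a * a) / (jdet G \<xi>)\<^sup>2"
    unfolding J E nonzero_eq_divide_eq[OF nz2] by (simp add: algebra_simps power2_eq_square)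
qed

lemma jetat_unique:
  assumes "jetat G \<phi> \<xi> J" "jetat G \<phi> \<xi> J'" "jdet G \<xi> \<noteq> 0"
  shows "J = J'"
proof -
  obtain v g1 g2 h11 h12 h22 where J: "J = (v, g1, g2, h11, h12, h22)" by (metis prod.collapse)
  obtain v' g1' g2' h11' h12' h22' where J': "J' = (v', g1', g2', h11', h12', h22')" by (metis prod.collapse)
  note e = jet_explicit[OF assms(1)[unfolded J] assms(3)] and e' = jet_explicit[OF assms(2)[unfolded J'] assms(3)]
  have 1: "v = v'" "g1 = g1'" "g2 = g2'" using e(1-3) e'(1-3) by simp_all
  moreover have "h11 = h11'" "h12 = h12'" "h22 = h22'" using e(4-6) e'(4-6) unfolding 1 by simp_all
  ultimately show ?thesis by (simp add: J J')
qed

text \<open>The zero 2-jet in parameter coordinates. By linearity of the chain rule it yields the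
  zero physical jet under every G, so it can be discussed without the geometry.\<close>

definition zj :: "(pt \<Rightarrow> real) \<Rightarrow> pt \<Rightarrow> bool" where
  "zj \<phi> \<xi> \<longleftrightarrow> (\<forall>i j. i + j \<le> 2 \<longrightarrow> dpart i j \<phi> \<xi> = 0)"

lemma jetat_zj: "zj \<phi> \<xi> \<Longrightarrow> jetat G \<phi> \<xi> 0"
proof -
  assume z: "zj \<phi> \<xi>"
  have "dpart 0 0 \<phi> \<xi> = 0" "dpart 1 0 \<phi> \<xi> = 0" "dpart 0 1 \<phi> \<xi> = 0" "dpart 2 0 \<phi> \<xi> = 0" "dpart 1 1 \<phi> \<xi> = 0" "dpart 0 2 \<phi> \<xi> = 0"
    using z unfolding zj_def by auto
  moreover have "dpart 0 0 \<phi> \<xi> = \<phi> \<xi>" by (simp add: dpart_def)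
  ultimately show ?thesis by (simp add: jetat_def Let_def zero_prod_def)
qed

context smooth_spline
begin

lemma jetat_add:
  assumes "\<phi> \<in> TS p r k" "\<psi> \<in> TS p r k" "jetat G \<phi> \<xi> J" "jetat G \<psi> \<xi> J'"
  shows "jetat G (\<lambda>\<xi>. \<phi> \<xi> + \<psi> \<xi>) \<xi> (J + J')"
proof -
  obtain v g1 g2 h11 h12 h22 where J: "J = (v, g1, g2, h11, h12, h22)" by (metis prod.collapse)
  obtain v' g1' g2' h11' h12' h22' where J': "J' = (v', g1', g2', h11', h12', h22')" by (metis prod.collapse)
  show ?thesis using assms(3,4) unfolding J J'
    by (simp add: jetat_def Let_def dpart_add[OF assms(1,2)] algebra_simps)
qed

lemma jetat_cmul:
  assumes "\<phi> \<in> TS p r k" "jetat G \<phi> \<xi> J"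
  shows "jetat G (\<lambda>\<xi>. c * \<phi> \<xi>) \<xi> (c *\<^sub>R J)"
proof -
  obtain v g1 g2 h11 h12 h22 where J: "J = (v, g1, g2, h11, h12, h22)" by (metis prod.collapse)
  show ?thesis using assms(2) unfolding J
    by (simp add: jetat_def Let_def dpart_cmul[OF assms(1)] algebra_simps)
qed

lemma zj_zero: "zj (\<lambda>\<xi>. 0) \<xi>" unfolding zj_def using dpart_zero by auto

lemma jetat_sum:
  assumes "finite S" "\<And>s. s \<in> S \<Longrightarrow> \<phi> s \<in> TS p r k" "\<And>s. s \<in> S \<Longrightarrow> jetat G (\<phi> s) \<xi> (J s)"
  shows "jetat G (\<lambda>\<xi>. \<Sum>s\<in>S. \<phi> s \<xi>) \<xi> (\<Sum>s\<in>S. J s)"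
  using assms
proof (induction S rule: finite_induct)
  case empty then show ?case using jetat_zj[OF zj_zero] by simp
next
  case (insert x S)
  have "jetat G (\<lambda>\<xi>. \<phi> x \<xi> + (\<Sum>s\<in>S. \<phi> s \<xi>)) \<xi> (J x + (\<Sum>s\<in>S. J s))"
    using insert by (intro jetat_add) (auto intro: TS_sum)
  then show ?case using insert by simp
qed

lemma jetat_swap:
  assumes "\<phi> \<in> TS p r k" "bilinear_map G" "jetat (\<lambda>\<xi>. G (snd \<xi>, fst \<xi>)) \<phi> \<xi> J"
  shows "jetat G (\<lambda>\<xi>. \<phi> (snd \<xi>, fst \<xi>)) (snd \<xi>, fst \<xi>) J"
proof -
  obtain v g1 g2 h11 h12 h22 where J: "J = (v, g1, g2, h11, h12, h22)" by (metis prod.collapse)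
  show ?thesis using assms(3) unfolding J
    by (simp add: jetat_def Let_def TS_swap(2)[OF assms(1)] swap_pd[OF assms(2)] algebra_simps)
qed

lemma zj_add: "\<phi> \<in> TS p r k \<Longrightarrow> \<psi> \<in> TS p r k \<Longrightarrow> zj \<phi> \<xi> \<Longrightarrow> zj \<psi> \<xi> \<Longrightarrow> zj (\<lambda>\<xi>. \<phi> \<xi> + \<psi> \<xi>) \<xi>"
  unfolding zj_def by (auto simp: dpart_add)

lemma zj_diff: "\<phi> \<in> TS p r k \<Longrightarrow> \<psi> \<in> TS p r k \<Longrightarrow> zj \<phi> \<xi> \<Longrightarrow> zj \<psi> \<xi> \<Longrightarrow> zj (\<lambda>\<xi>. \<phi> \<xi> - \<psi> \<xi>) \<xi>"
  unfolding zj_def by (auto simp: dpart_diff)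

end

section \<open>Gluing patchwise functions to a C2 function on the plane\<close>

definition C2plane :: "(pt \<Rightarrow> real) \<Rightarrow> bool" where
  "C2plane f \<longleftrightarrow> (\<exists>f1 f2 f11 f12 f22.
      (\<forall>x. (f has_derivative (\<lambda>v. f1 x * fst v + f2 x * snd v)) (at x))
    \<and> (\<forall>x. (f1 has_derivative (\<lambda>v. f11 x * fst v + f12 x * snd v)) (at x))
    \<and> (\<forall>x. (f2 has_derivative (\<lambda>v. f12 x * fst v + f22 x * snd v)) (at x))
    \<and> continuous_on UNIV f11 \<and> continuous_on UNIV f12 \<and> continuous_on UNIV f22)"

lemma bounded_linear_2: "bounded_linear (\<lambda>v::pt. a * fst v + b * snd v)"
  unfolding linear_conv_bounded_linear[symmetric] by (rule linearI) (simp_all add: algebra_simps)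

text \<open>Members of the cover that miss x contribute the trivial filter, the others are joined as
  suprema of filters; any number of patches may meet at x.\<close>

lemma has_derivative_closed_cover:
  fixes f :: "pt \<Rightarrow> real"
  assumes "finite \<C>" "\<Union>\<C> = UNIV" "\<And>S. S \<in> \<C> \<Longrightarrow> closed S" "bounded_linear D"
    "\<And>S. S \<in> \<C> \<Longrightarrow> x \<in> S \<Longrightarrow> (f has_derivative D) (at x within S)"
  shows "(f has_derivative D) (at x)"
proof -
  have *: "(f has_derivative D) (at x within S)" if "S \<in> \<C>" for S
  proof (cases "x \<in> S")
    case False
    then have "\<not> x islimpt S" using assms(3)[OF that] closed_limpt by blast
    then have "at x within S = bot" by (simp add: trivial_limit_within)
    then show ?thesis using assms(4) by (simp add: has_derivative_def)
  qed (use assms that in auto)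
  have "(f has_derivative D) (at x within \<Union>\<D>)" if "\<D> \<subseteq> \<C>" for \<D>
    using finite_subset[OF that assms(1)] that
  proof (induction \<D> rule: finite_induct)
    case empty then show ?case using assms(4) by (simp add: has_derivative_def)
  next
    case (insert S \<D>)
    then have "(f has_derivative D) (at x within \<Union>\<D>)" "(f has_derivative D) (at x within S)" using * by auto
    then show ?case unfolding Union_insert has_derivative_within unfolding at_within_union by (auto intro: filterlim_sup)
  qed
  from this[of \<C>] show ?thesis using assms(2) by simp
qed

lemma patch_inverse_continuous_on:
  assumes "patch G"
  shows "continuous_on (G ` unitsq) (inv_into unitsq G)"
proof (rule continuous_on_inv)
  show "continuous_on unitsq G" using assms by (auto simp: patch_def intro: bilinear_continuous_on)
  show "\<forall>x\<in>unitsq. inv_into unitsq G (G x) = x" using assms by (auto simp: patch_def)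
qed (rule compact_unitsq)

lemma patch_inverse_continuous:
  assumes "patch G" "\<And>\<eta>. \<eta> \<in> unitsq \<Longrightarrow> f (G \<eta>) = u \<eta>" "continuous_on unitsq (u :: pt \<Rightarrow> real)"
  shows "continuous_on (G ` unitsq) f"
proof -
  have c: "continuous_on (G ` unitsq) (inv_into unitsq G)"
    by (rule patch_inverse_continuous_on[OF assms(1)])
  have "continuous_on (G ` unitsq) (\<lambda>x. u (inv_into unitsq G x))"
    by (rule continuous_on_compose2[OF assms(3) c], rule image_subsetI, rule inv_into_into)
  moreover have "f x = u (inv_into unitsq G x)" if "x \<in> G ` unitsq" for x
    using assms(2)[of "inv_into unitsq G x"] that by (simp add: f_inv_into_f inv_into_into)
  ultimately show ?thesis by (metis (no_types, lifting) continuous_on_cong)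
qed

text \<open>One-sided chain rule for the inverse of G on the closed patch, sides and corners
  included. Injectivity of the derivative M gives c |w| <= |M w|, and the remainder of a bilinear
  map is exactly the twist times a product of increments, hence quadratic in w.\<close>

lemma patch_transport_derivative:
  assumes "patch G" "\<xi> \<in> unitsq" "(u has_derivative (\<lambda>w. u1 * fst w + u2 * snd w)) (at \<xi> within unitsq)"
    "U1 * fst (pd1v G \<xi>) + U2 * snd (pd1v G \<xi>) = u1" "U1 * fst (pd2v G \<xi>) + U2 * snd (pd2v G \<xi>) = u2"
    "\<And>\<eta>. \<eta> \<in> unitsq \<Longrightarrow> f (G \<eta>) = u \<eta>"
  shows "(f has_derivative (\<lambda>v. U1 * fst v + U2 * snd v)) (at (G \<xi>) within G ` unitsq)"
proof -
  have b: "bilinear_map G" and j: "jdet G \<xi> \<noteq> 0" and inj: "inj_on G unitsq" using assms(1,2) by (auto simp: patch_def)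
  define M where "M w = fst w *\<^sub>R pd1v G \<xi> + snd w *\<^sub>R pd2v G \<xi>" for w :: pt
  have linM: "linear M" by (rule linearI) (simp_all add: M_def algebra_simps)
  have injM: "inj M"
  proof (subst linear_injective_0[OF linM], intro allI impI)
    fix w assume "M w = 0"
    then have "det2 (M w) (pd2v G \<xi>) = 0" "det2 (pd1v G \<xi>) (M w) = 0" by (simp_all add: det2_def)
    moreover have "det2 (M w) (pd2v G \<xi>) = fst w * jdet G \<xi>" "det2 (pd1v G \<xi>) (M w) = snd w * jdet G \<xi>"
      by (simp_all add: M_def det2_def jdet_def algebra_simps)
    ultimately show "w = 0" using j by (simp add: prod_eq_iff)
  qed
  obtain c where c: "c > 0" "\<And>w. c * norm w \<le> norm (M w)"
    using linear_inj_bounded_below_pos[OF linM injM] by (metis mult.commute)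
  define E where "E = norm (tw G)"
  define K where "K = \<bar>U1 * fst (tw G) + U2 * snd (tw G)\<bar>"
  have ge0: "E \<ge> 0" "K \<ge> 0" by (simp_all add: E_def K_def)
  show ?thesis unfolding has_derivative_within_alt
  proof (intro conjI allI impI bounded_linear_2)
    fix e :: real assume e: "e > 0"
    have "e * c / 4 > 0" using e c(1) by simp
    then obtain d1 where d1: "d1 > 0"
      "\<And>\<eta>. \<eta> \<in> unitsq \<Longrightarrow> norm (\<eta> - \<xi>) < d1 \<Longrightarrow> norm (u \<eta> - u \<xi> - (u1 * fst (\<eta> - \<xi>) + u2 * snd (\<eta> - \<xi>))) \<le> (e * c / 4) * norm (\<eta> - \<xi>)"
      using assms(3) unfolding has_derivative_within_alt by blast
    \<comment> \<open>Three demands on |w|: \<open>d1\<close> controls the remainder of u; the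
      second bound keeps the twist term below half of the lower bound for M w, so that |w| is
      bounded by a multiple of |y - G \<xi>|; the third makes the twist term in the new remainder
      small. Adding 1 avoids zero denominators.\<close>
    define \<rho> where "\<rho> = min d1 (min (c / (2 * (E + 1))) (e * c / (4 * (K + 1))))"
    have \<rho>: "\<rho> > 0" using d1 c e ge0 by (simp add: \<rho>_def)
    have cont: "continuous_on (G ` unitsq) (inv_into unitsq G)"
      by (rule patch_inverse_continuous_on[OF assms(1)])
    then obtain d where d: "d > 0" "\<And>y. y \<in> G ` unitsq \<Longrightarrow> dist y (G \<xi>) < d \<Longrightarrow> dist (inv_into unitsq G y) (inv_into unitsq G (G \<xi>)) < \<rho>"
      unfolding continuous_on_iff using assms(2) \<rho> by (metis image_eqI)
    show "\<exists>d>0. \<forall>y\<in>G ` unitsq. norm (y - G \<xi>) < d \<longrightarrow>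
        norm (f y - f (G \<xi>) - (U1 * fst (y - G \<xi>) + U2 * snd (y - G \<xi>))) \<le> e * norm (y - G \<xi>)"
    proof (intro exI[of _ d] conjI ballI impI d(1))
      fix y assume y: "y \<in> G ` unitsq" "norm (y - G \<xi>) < d"
      then obtain \<eta> where \<eta>: "\<eta> \<in> unitsq" "y = G \<eta>" by auto
      define w where "w = \<eta> - \<xi>"
      have "dist \<eta> \<xi> < \<rho>" using d(2)[OF y(1)] y(2) \<eta> assms(2) inj by (simp add: dist_norm inv_into_f_f)
      then have w: "norm w < \<rho>" by (simp add: w_def dist_norm)
      have ex: "y - G \<xi> = M w + (fst w * snd w) *\<^sub>R tw G"
        using bilinear_expand[OF b, of \<eta> \<xi>] \<eta>(2) by (simp add: M_def w_def)
      have ww: "\<bar>fst w * snd w\<bar> \<le> norm w * norm w"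
        unfolding abs_mult using norm_fst_le[of "fst w" "snd w"] norm_snd_le[of "snd w" "fst w"] by (intro mult_mono) auto
      have "norm w * (E + 1) \<le> c / 2"
      proof -
        have "norm w \<le> c / (2 * (E + 1))" using w by (simp add: \<rho>_def)
        then have "norm w * (E + 1) \<le> c / (2 * (E + 1)) * (E + 1)" using ge0 by (intro mult_right_mono) auto
        also have "\<dots> = c / 2" using ge0 by (simp add: field_simps)
        finally show ?thesis .
      qed
      moreover have "norm w * (E + 1) = norm w * E + norm w" by (simp add: algebra_simps)
      ultimately have wE: "norm w * E \<le> c / 2" using norm_ge_zero[of w] by linarith
      have wK: "norm w * K \<le> e * c / 4"
      proof -
        have "norm w \<le> e * c / (4 * (K + 1))" using w by (simp add: \<rho>_def)
        then have "norm w * (K + 1) \<le> e * c / (4 * (K + 1)) * (K + 1)" using ge0 by (intro mult_right_mono) auto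
        also have "\<dots> = e * c / 4" using ge0 by (simp add: field_simps)
        finally have "norm w * (K + 1) \<le> e * c / 4" .
        moreover have "norm w * (K + 1) = norm w * K + norm w" by (simp add: algebra_simps)
        ultimately show ?thesis using norm_ge_zero[of w] by linarith
      qed
      have low: "c / 2 * norm w \<le> norm (y - G \<xi>)"
      proof -
        have "norm ((fst w * snd w) *\<^sub>R tw G) \<le> norm w * norm w * E"
          using ww ge0 by (simp add: E_def mult_right_mono)
        also have "\<dots> \<le> c / 2 * norm w" using mult_right_mono[OF wE norm_ge_zero[of w]] by (simp add: mult_ac)
        finally have "norm ((fst w * snd w) *\<^sub>R tw G) \<le> c / 2 * norm w" .
        moreover have "norm (M w) - norm ((fst w * snd w) *\<^sub>R tw G) \<le> norm (y - G \<xi>)"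
          unfolding ex by (metis norm_diff_ineq)
        ultimately show ?thesis using c(2)[of w] by (simp add: algebra_simps)
      qed
      have id: "f y - f (G \<xi>) - (U1 * fst (y - G \<xi>) + U2 * snd (y - G \<xi>))
          = (u \<eta> - u \<xi> - (u1 * fst w + u2 * snd w)) - (fst w * snd w) * (U1 * fst (tw G) + U2 * snd (tw G))"
        unfolding ex using assms(6)[OF \<eta>(1)] assms(6)[OF assms(2)] \<eta>(2)
        by (simp add: M_def assms(4,5)[symmetric] algebra_simps)
      have "norm (f y - f (G \<xi>) - (U1 * fst (y - G \<xi>) + U2 * snd (y - G \<xi>)))
         \<le> norm (u \<eta> - u \<xi> - (u1 * fst w + u2 * snd w)) + \<bar>fst w * snd w\<bar> * K"
        unfolding id K_def by (metis (no_types) abs_mult norm_triangle_ineq4 real_norm_def)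
      also have "\<dots> \<le> (e * c / 4) * norm w + norm w * norm w * K"
        using d1(2)[OF \<eta>(1)] w ww ge0 by (intro add_mono mult_right_mono) (auto simp: w_def \<rho>_def)
      also have "\<dots> \<le> (e * c / 4) * norm w + (e * c / 4) * norm w"
        using mult_right_mono[OF wK norm_ge_zero[of w]] by (simp add: mult_ac)
      also have "\<dots> = e * (c / 2 * norm w)" by simp
      also have "\<dots> \<le> e * norm (y - G \<xi>)" using low e by (intro mult_left_mono) auto
      finally show "norm (f y - f (G \<xi>) - (U1 * fst (y - G \<xi>) + U2 * snd (y - G \<xi>))) \<le> e * norm (y - G \<xi>)" .
    qed
  qed
qed

context smooth_spline
begin

text \<open>The quotients are the physical first derivatives as functions of the parameters.
  Differentiating the frame creates twist terms, which cancel against those in the mixed derivative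
  of \<phi>.\<close>

lemma jet_gradient_derivative:
  assumes "patch G" "\<phi> \<in> TS p r k" "\<xi> \<in> unitsq" "jetat G \<phi> \<xi> (v, g1, g2, h11, h12, h22)"
  shows "((\<lambda>\<eta>. (dpart 1 0 \<phi> \<eta> * snd (pd2v G \<eta>) - dpart 0 1 \<phi> \<eta> * snd (pd1v G \<eta>)) / jdet G \<eta>)
      has_derivative (\<lambda>w. (h11 * fst (pd1v G \<xi>) + h12 * snd (pd1v G \<xi>)) * fst w
           + (h11 * fst (pd2v G \<xi>) + h12 * snd (pd2v G \<xi>)) * snd w)) (at \<xi> within S)" (is ?A)
    and "((\<lambda>\<eta>. (dpart 0 1 \<phi> \<eta> * fst (pd1v G \<eta>) - dpart 1 0 \<phi> \<eta> * fst (pd2v G \<eta>)) / jdet G \<eta>)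
      has_derivative (\<lambda>w. (h12 * fst (pd1v G \<xi>) + h22 * snd (pd1v G \<xi>)) * fst w
           + (h12 * fst (pd2v G \<xi>) + h22 * snd (pd2v G \<xi>)) * snd w)) (at \<xi> within S)" (is ?B)
proof -
  have b: "bilinear_map G" and j: "jdet G \<xi> \<noteq> 0" using assms(1,3) by (auto simp: patch_def)
  define e1 e2 where "e1 = fst (tw G)" and "e2 = snd (tw G)"
  define a b' c d where "a = fst (pd1v G \<xi>)" and "b' = snd (pd1v G \<xi>)" and "c = fst (pd2v G \<xi>)" and "d = snd (pd2v G \<xi>)"
  have D1: "((\<lambda>\<eta>. fst (pd1v G \<eta>)) has_derivative (\<lambda>w. snd w * e1)) (at \<xi> within S)"
    "((\<lambda>\<eta>. snd (pd1v G \<eta>)) has_derivative (\<lambda>w. snd w * e2)) (at \<xi> within S)"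
    "((\<lambda>\<eta>. fst (pd2v G \<eta>)) has_derivative (\<lambda>w. fst w * e1)) (at \<xi> within S)"
    "((\<lambda>\<eta>. snd (pd2v G \<eta>)) has_derivative (\<lambda>w. fst w * e2)) (at \<xi> within S)"
  proof -
    have 1: "(\<lambda>\<eta>. fst (pd1v G \<eta>)) = (\<lambda>\<eta>. a + (snd \<eta> - snd \<xi>) * e1)" "(\<lambda>\<eta>. snd (pd1v G \<eta>)) = (\<lambda>\<eta>. b' + (snd \<eta> - snd \<xi>) * e2)"
      by (rule ext, subst pd_affine(1)[OF b, of _ \<xi>], simp add: a_def b'_def e1_def e2_def)+
    have 2: "(\<lambda>\<eta>. fst (pd2v G \<eta>)) = (\<lambda>\<eta>. c + (fst \<eta> - fst \<xi>) * e1)" "(\<lambda>\<eta>. snd (pd2v G \<eta>)) = (\<lambda>\<eta>. d + (fst \<eta> - fst \<xi>) * e2)"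
      by (rule ext, subst pd_affine(2)[OF b, of _ \<xi>], simp add: c_def d_def e1_def e2_def)+
    show "((\<lambda>\<eta>. fst (pd1v G \<eta>)) has_derivative (\<lambda>w. snd w * e1)) (at \<xi> within S)"
      "((\<lambda>\<eta>. snd (pd1v G \<eta>)) has_derivative (\<lambda>w. snd w * e2)) (at \<xi> within S)"
      "((\<lambda>\<eta>. fst (pd2v G \<eta>)) has_derivative (\<lambda>w. fst w * e1)) (at \<xi> within S)"
      "((\<lambda>\<eta>. snd (pd2v G \<eta>)) has_derivative (\<lambda>w. fst w * e2)) (at \<xi> within S)"
      unfolding 1 2 by (auto intro!: derivative_eq_intros)
  qed
  have P: "(dpart 1 0 \<phi> has_derivative (\<lambda>w. dpart 2 0 \<phi> \<xi> * fst w + dpart 1 1 \<phi> \<xi> * snd w)) (at \<xi> within S)"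
    "(dpart 0 1 \<phi> has_derivative (\<lambda>w. dpart 1 1 \<phi> \<xi> * fst w + dpart 0 2 \<phi> \<xi> * snd w)) (at \<xi> within S)"
    using dpart_has_derivative[OF assms(2), of 1 0 \<xi> S] dpart_has_derivative[OF assms(2), of 0 1 \<xi> S]
    by (simp_all add: numeral_2_eq_2)
  have Jf: "jdet G = (\<lambda>\<eta>. fst (pd1v G \<eta>) * snd (pd2v G \<eta>) - snd (pd1v G \<eta>) * fst (pd2v G \<eta>))"
    by (simp add: jdet_def det2_def fun_eq_iff)
  define J' where "J' w = a * (fst w * e2) + snd w * e1 * d - (b' * (fst w * e1) + snd w * e2 * c)" for w :: pt
  have JD: "(jdet G has_derivative J') (at \<xi> within S)"
    unfolding Jf J'_def a_def b'_def c_def d_def by (intro has_derivative_diff has_derivative_mult D1)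
  have J: "jdet G \<xi> = a * d - b' * c" by (simp add: jdet_def det2_def a_def b'_def c_def d_def)
  have E: "dpart 1 0 \<phi> \<xi> = g1 * a + g2 * b'" "dpart 0 1 \<phi> \<xi> = g1 * c + g2 * d"
     "dpart 2 0 \<phi> \<xi> = h11 * a * a + 2 * h12 * a * b' + h22 * b' * b'"
     "dpart 1 1 \<phi> \<xi> = h11 * a * c + h12 * (a * d + b' * c) + h22 * b' * d + g1 * e1 + g2 * e2"
     "dpart 0 2 \<phi> \<xi> = h11 * c * c + 2 * h12 * c * d + h22 * d * d"
    using assms(4) by (simp_all add: jetat_def Let_def a_def b'_def c_def d_def e1_def e2_def)
  \<comment> \<open>Quotient rule rephrased so that only polynomial identities remain: N = g J at
    the point and N' = g J' + L J give the derivative L.\<close>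
  have quot: "((\<lambda>\<eta>. N \<eta> / jdet G \<eta>) has_derivative L) (at \<xi> within S)"
    if N: "(N has_derivative N') (at \<xi> within S)" and e: "N \<xi> = g * jdet G \<xi>" "\<And>w. N' w = g * J' w + L w * jdet G \<xi>" for N N' L g
  proof -
    have "((\<lambda>\<eta>. N \<eta> / jdet G \<eta>) has_derivative (\<lambda>w. (N' w * jdet G \<xi> - N \<xi> * J' w) / (jdet G \<xi> * jdet G \<xi>))) (at \<xi> within S)"
      by (rule has_derivative_divide'[OF N JD j])
    moreover have "(N' w * jdet G \<xi> - N \<xi> * J' w) / (jdet G \<xi> * jdet G \<xi>) = L w" for w
      unfolding e using j by (simp add: field_simps)
    ultimately show ?thesis by simp
  qed
  show ?A
  proof (rule quot)
    show "((\<lambda>\<eta>. dpart 1 0 \<phi> \<eta> * snd (pd2v G \<eta>) - dpart 0 1 \<phi> \<eta> * snd (pd1v G \<eta>)) has_derivative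
      (\<lambda>w. dpart 1 0 \<phi> \<xi> * (fst w * e2) + (dpart 2 0 \<phi> \<xi> * fst w + dpart 1 1 \<phi> \<xi> * snd w) * snd (pd2v G \<xi>)
        - (dpart 0 1 \<phi> \<xi> * (snd w * e2) + (dpart 1 1 \<phi> \<xi> * fst w + dpart 0 2 \<phi> \<xi> * snd w) * snd (pd1v G \<xi>)))) (at \<xi> within S)"
      by (intro has_derivative_diff has_derivative_mult D1 P)
    show "dpart 1 0 \<phi> \<xi> * snd (pd2v G \<xi>) - dpart 0 1 \<phi> \<xi> * snd (pd1v G \<xi>) = g1 * jdet G \<xi>"
      unfolding J E a_def[symmetric] b'_def[symmetric] c_def[symmetric] d_def[symmetric] by (simp add: algebra_simps)
  next
    fix w show "dpart 1 0 \<phi> \<xi> * (fst w * e2) + (dpart 2 0 \<phi> \<xi> * fst w + dpart 1 1 \<phi> \<xi> * snd w) * snd (pd2v G \<xi>)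
        - (dpart 0 1 \<phi> \<xi> * (snd w * e2) + (dpart 1 1 \<phi> \<xi> * fst w + dpart 0 2 \<phi> \<xi> * snd w) * snd (pd1v G \<xi>))
       = g1 * J' w + ((h11 * fst (pd1v G \<xi>) + h12 * snd (pd1v G \<xi>)) * fst w
           + (h11 * fst (pd2v G \<xi>) + h12 * snd (pd2v G \<xi>)) * snd w) * jdet G \<xi>"
      unfolding J E J'_def a_def[symmetric] b'_def[symmetric] c_def[symmetric] d_def[symmetric] by algebra
  qed
  show ?B
  proof (rule quot)
    show "((\<lambda>\<eta>. dpart 0 1 \<phi> \<eta> * fst (pd1v G \<eta>) - dpart 1 0 \<phi> \<eta> * fst (pd2v G \<eta>)) has_derivative
      (\<lambda>w. dpart 0 1 \<phi> \<xi> * (snd w * e1) + (dpart 1 1 \<phi> \<xi> * fst w + dpart 0 2 \<phi> \<xi> * snd w) * fst (pd1v G \<xi>)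
        - (dpart 1 0 \<phi> \<xi> * (fst w * e1) + (dpart 2 0 \<phi> \<xi> * fst w + dpart 1 1 \<phi> \<xi> * snd w) * fst (pd2v G \<xi>)))) (at \<xi> within S)"
      by (intro has_derivative_diff has_derivative_mult D1 P)
    show "dpart 0 1 \<phi> \<xi> * fst (pd1v G \<xi>) - dpart 1 0 \<phi> \<xi> * fst (pd2v G \<xi>) = g2 * jdet G \<xi>"
      unfolding J E a_def[symmetric] b'_def[symmetric] c_def[symmetric] d_def[symmetric] by (simp add: algebra_simps)
  next
    fix w show "dpart 0 1 \<phi> \<xi> * (snd w * e1) + (dpart 1 1 \<phi> \<xi> * fst w + dpart 0 2 \<phi> \<xi> * snd w) * fst (pd1v G \<xi>)
        - (dpart 1 0 \<phi> \<xi> * (fst w * e1) + (dpart 2 0 \<phi> \<xi> * fst w + dpart 1 1 \<phi> \<xi> * snd w) * fst (pd2v G \<xi>))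
       = g2 * J' w + ((h12 * fst (pd1v G \<xi>) + h22 * snd (pd1v G \<xi>)) * fst w
           + (h12 * fst (pd2v G \<xi>) + h22 * snd (pd2v G \<xi>)) * snd w) * jdet G \<xi>"
      unfolding J E J'_def a_def[symmetric] b'_def[symmetric] c_def[symmetric] d_def[symmetric] by algebra
  qed
qed

text \<open>The last hypothesis carries the geometry: one physical jet per point, and a nonzero one
  only in the interior of the union. The second half makes the jet zero on the closure of the
  complement, the set that completes the patches to a closed cover of the plane.\<close>

lemma C2plane_glue:
  fixes I :: "'i set" and G :: "'i \<Rightarrow> pt \<Rightarrow> pt"
  assumes "finite I" "\<And>i. i \<in> I \<Longrightarrow> patch (G i)" "\<And>i. i \<in> I \<Longrightarrow> \<phi> i \<in> TS p r k"
    "\<And>i \<xi>. i \<in> I \<Longrightarrow> \<xi> \<in> unitsq \<Longrightarrow> f (G i \<xi>) = \<phi> i \<xi>"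
    "\<And>x. x \<notin> (\<Union>i\<in>I. G i ` unitsq) \<Longrightarrow> f x = 0"
    "\<And>x. x \<in> (\<Union>i\<in>I. G i ` unitsq) \<Longrightarrow> \<exists>J. (\<forall>i\<in>I. \<forall>\<xi>\<in>unitsq. G i \<xi> = x \<longrightarrow> jetat (G i) (\<phi> i) \<xi> J)
        \<and> (J \<noteq> 0 \<longrightarrow> x \<in> interior (\<Union>i\<in>I. G i ` unitsq))"
  shows "C2plane f"
proof -
  define Q where "Q = (\<Union>i\<in>I. G i ` unitsq)"
  define C where "C = closure (- Q)"
  have "\<exists>Jt. \<forall>x\<in>Q. (\<forall>i\<in>I. \<forall>\<xi>\<in>unitsq. G i \<xi> = x \<longrightarrow> jetat (G i) (\<phi> i) \<xi> (Jt x)) \<and> (Jt x \<noteq> 0 \<longrightarrow> x \<in> interior Q)"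
    by (rule bchoice) (use assms(6) in \<open>simp add: Q_def\<close>)
  then obtain J0 where J0: "\<And>x i \<xi>. x \<in> Q \<Longrightarrow> i \<in> I \<Longrightarrow> \<xi> \<in> unitsq \<Longrightarrow> G i \<xi> = x \<Longrightarrow> jetat (G i) (\<phi> i) \<xi> (J0 x)"
    "\<And>x. x \<in> Q \<Longrightarrow> J0 x \<noteq> 0 \<Longrightarrow> x \<in> interior Q" by metis
  define Jt where "Jt x = (if x \<in> Q then J0 x else 0)" for x
  have JC: "Jt x = 0" if "x \<in> C" for x
    using that J0(2)[of x] by (auto simp: Jt_def C_def closure_complement)
  define f1 f2 f11 f12 f22 where "f1 x = fst (snd (Jt x))" and "f2 x = fst (snd (snd (Jt x)))"
    and "f11 x = fst (snd (snd (snd (Jt x))))" and "f12 x = fst (snd (snd (snd (snd (Jt x)))))"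
    and "f22 x = snd (snd (snd (snd (snd (Jt x)))))" for x
  have jet: "jetat (G i) (\<phi> i) \<xi> (f (G i \<xi>), f1 (G i \<xi>), f2 (G i \<xi>), f11 (G i \<xi>), f12 (G i \<xi>), f22 (G i \<xi>))"
    if "i \<in> I" "\<xi> \<in> unitsq" for i \<xi>
  proof -
    have x: "G i \<xi> \<in> Q" using that by (auto simp: Q_def)
    have 1: "jetat (G i) (\<phi> i) \<xi> (Jt (G i \<xi>))" using J0(1)[OF x that refl] x by (simp add: Jt_def)
    have "Jt (G i \<xi>) = (fst (Jt (G i \<xi>)), f1 (G i \<xi>), f2 (G i \<xi>), f11 (G i \<xi>), f12 (G i \<xi>), f22 (G i \<xi>))"
      by (simp add: f1_def f2_def f11_def f12_def f22_def)
    moreover have "fst (Jt (G i \<xi>)) = f (G i \<xi>)"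
      using 1 assms(4)[OF that] unfolding jetat_def by (simp add: Let_def split: prod.splits)
    ultimately show ?thesis using 1 by metis
  qed
  have fC: "f x = 0" if "x \<in> C" for x
  proof (cases "x \<in> Q")
    case True
    then obtain i \<xi> where "i \<in> I" "\<xi> \<in> unitsq" "x = G i \<xi>" by (auto simp: Q_def)
    moreover have "J0 x = 0" using JC[OF that] True by (simp add: Jt_def)
    ultimately show ?thesis using J0(1)[OF True, of i \<xi>] assms(4)[of i \<xi>] by (simp add: jetat_def zero_prod_def Let_def)
  qed (use assms(5) Q_def in auto)
  have gC: "f1 x = 0" "f2 x = 0" "f11 x = 0" "f12 x = 0" "f22 x = 0" if "x \<in> C" for x
    using JC[OF that] by (simp_all add: f1_def f2_def f11_def f12_def f22_def)
  have nz: "jdet (G i) \<xi> \<noteq> 0" if "i \<in> I" "\<xi> \<in> unitsq" for i \<xi> using assms(2)[OF that(1)] that(2) by (simp add: patch_def)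
  define \<C> where "\<C> = insert C ((\<lambda>i. G i ` unitsq) ` I)"
  have fin: "finite \<C>" using assms(1) by (simp add: \<C>_def)
  have cov: "\<Union>\<C> = UNIV" using closure_subset[of "- Q"] by (auto simp: \<C>_def C_def Q_def)
  have cl: "closed S" if "S \<in> \<C>" for S
    using that assms(2) by (auto simp: \<C>_def C_def intro: compact_imp_closed patch_compact)
  have glue: "(u has_derivative (\<lambda>v. u1 x * fst v + u2 x * snd v)) (at x)"
    if "\<And>x. x \<in> C \<Longrightarrow> u x = 0 \<and> u1 x = 0 \<and> u2 x = 0"
      "\<And>i \<xi>. i \<in> I \<Longrightarrow> \<xi> \<in> unitsq \<Longrightarrow> (u has_derivative (\<lambda>v. u1 (G i \<xi>) * fst v + u2 (G i \<xi>) * snd v)) (at (G i \<xi>) within G i ` unitsq)"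
    for u u1 u2 :: "pt \<Rightarrow> real" and x
  proof (rule has_derivative_closed_cover[OF fin cov cl bounded_linear_2])
    fix S assume S: "S \<in> \<C>" "x \<in> S"
    show "(u has_derivative (\<lambda>v. u1 x * fst v + u2 x * snd v)) (at x within S)"
    proof (cases "S = C")
      case True
      have "((\<lambda>y. 0) has_derivative (\<lambda>v::pt. u1 x * fst v + u2 x * snd v)) (at x within S)"
        using that(1)[of x] S True by simp
      then show ?thesis by (rule has_derivative_transform[OF S(2), rotated]) (use that(1) True in auto)
    next
      case False
      then show ?thesis using S that(2) by (auto simp: \<C>_def)
    qed
  qed
  have contg: "continuous_on UNIV u" if "\<And>x. x \<in> C \<Longrightarrow> u x = 0" "\<And>i. i \<in> I \<Longrightarrow> continuous_on (G i ` unitsq) u" for u :: "pt \<Rightarrow> real"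
  proof -
    have "continuous_on C u" using that(1) by (metis continuous_on_cong continuous_on_const)
    then have "continuous_on (\<Union>S\<in>\<C>. S) u"
      using fin cl that(2) by (intro continuous_on_closed_Union) (auto simp: \<C>_def)
    then show ?thesis using cov by simp
  qed
  note ex = jet_explicit[OF jet nz]
  have pc: "continuous_on unitsq (\<lambda>\<xi>. fst (pd1v (G i) \<xi>))" "continuous_on unitsq (\<lambda>\<xi>. snd (pd1v (G i) \<xi>))"
    "continuous_on unitsq (\<lambda>\<xi>. fst (pd2v (G i) \<xi>))" "continuous_on unitsq (\<lambda>\<xi>. snd (pd2v (G i) \<xi>))"
    "continuous_on unitsq (jdet (G i))" if "i \<in> I" for i
  proof -
    have b: "bilinear_map (G i)" using assms(2)[OF that] by (simp add: patch_def)
    show p: "continuous_on unitsq (\<lambda>\<xi>. fst (pd1v (G i) \<xi>))" "continuous_on unitsq (\<lambda>\<xi>. snd (pd1v (G i) \<xi>))"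
      "continuous_on unitsq (\<lambda>\<xi>. fst (pd2v (G i) \<xi>))" "continuous_on unitsq (\<lambda>\<xi>. snd (pd2v (G i) \<xi>))"
    proof -
      have 1: "(\<lambda>\<eta>. pd1v (G i) \<eta>) = (\<lambda>\<eta>. pd1v (G i) 0 + (snd \<eta> - snd (0::pt)) *\<^sub>R tw (G i))"
        by (rule ext) (rule pd_affine(1)[OF b])
      have 2: "(\<lambda>\<eta>. pd2v (G i) \<eta>) = (\<lambda>\<eta>. pd2v (G i) 0 + (fst \<eta> - fst (0::pt)) *\<^sub>R tw (G i))"
        by (rule ext) (rule pd_affine(2)[OF b])
      have "continuous_on unitsq (\<lambda>\<eta>. pd1v (G i) \<eta>)" by (subst 1) (intro continuous_intros)
      then show "continuous_on unitsq (\<lambda>\<xi>. fst (pd1v (G i) \<xi>))" "continuous_on unitsq (\<lambda>\<xi>. snd (pd1v (G i) \<xi>))"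
        by (auto intro: continuous_intros)
      have "continuous_on unitsq (\<lambda>\<eta>. pd2v (G i) \<eta>)" by (subst 2) (intro continuous_intros)
      then show "continuous_on unitsq (\<lambda>\<xi>. fst (pd2v (G i) \<xi>))" "continuous_on unitsq (\<lambda>\<xi>. snd (pd2v (G i) \<xi>))"
        by (auto intro: continuous_intros)
    qed
    show "continuous_on unitsq (jdet (G i))" unfolding jdet_def[abs_def] det2_def by (intro continuous_intros p)
  qed
  have dc: "continuous_on unitsq (dpart m n (\<phi> i))" if "i \<in> I" "m \<le> 2" "n \<le> 2" for i m n
    using dpart_continuous[OF assms(3)[OF that(1)] that(2,3)] .
  show ?thesis unfolding C2plane_def
  proof (intro exI conjI allI)
    fix x
    show "(f has_derivative (\<lambda>v. f1 x * fst v + f2 x * snd v)) (at x)"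
    proof (rule glue)
      fix i \<xi> assume i: "i \<in> I" "\<xi> \<in> unitsq"
      have "(\<phi> i has_derivative (\<lambda>v. dpart 1 0 (\<phi> i) \<xi> * fst v + dpart 0 1 (\<phi> i) \<xi> * snd v)) (at \<xi> within unitsq)"
        using dpart_has_derivative[OF assms(3)[OF i(1)], of 0 0 \<xi> unitsq] by (simp add: dpart_def)
      then show "(f has_derivative (\<lambda>v. f1 (G i \<xi>) * fst v + f2 (G i \<xi>) * snd v)) (at (G i \<xi>) within G i ` unitsq)"
        by (rule patch_transport_derivative[OF assms(2)[OF i(1)] i(2)])
           (use jet[OF i] assms(4)[OF i(1)] in \<open>auto simp: jetat_def Let_def\<close>)
    qed (use fC gC in auto)
    show "(f1 has_derivative (\<lambda>v. f11 x * fst v + f12 x * snd v)) (at x)"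
    proof (rule glue)
      fix i \<xi> assume i: "i \<in> I" "\<xi> \<in> unitsq"
      show "(f1 has_derivative (\<lambda>v. f11 (G i \<xi>) * fst v + f12 (G i \<xi>) * snd v)) (at (G i \<xi>) within G i ` unitsq)"
        by (rule patch_transport_derivative[OF assms(2)[OF i(1)] i(2) jet_gradient_derivative(1)[OF assms(2)[OF i(1)] assms(3)[OF i(1)] i(2) jet[OF i]]])
           (use ex(2)[OF i(1) _ i(1)] in auto)
    qed (use gC in auto)
    show "(f2 has_derivative (\<lambda>v. f12 x * fst v + f22 x * snd v)) (at x)"
    proof (rule glue)
      fix i \<xi> assume i: "i \<in> I" "\<xi> \<in> unitsq"
      show "(f2 has_derivative (\<lambda>v. f12 (G i \<xi>) * fst v + f22 (G i \<xi>) * snd v)) (at (G i \<xi>) within G i ` unitsq)"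
        by (rule patch_transport_derivative[OF assms(2)[OF i(1)] i(2) jet_gradient_derivative(2)[OF assms(2)[OF i(1)] assms(3)[OF i(1)] i(2) jet[OF i]]])
           (use ex(3)[OF i(1) _ i(1)] in auto)
    qed (use gC in auto)
  next
    have g: "continuous_on unitsq (\<lambda>\<xi>. f1 (G i \<xi>))" "continuous_on unitsq (\<lambda>\<xi>. f2 (G i \<xi>))" if i: "i \<in> I" for i
    proof -
      have "continuous_on unitsq (\<lambda>\<xi>. (dpart 1 0 (\<phi> i) \<xi> * snd (pd2v (G i) \<xi>) - dpart 0 1 (\<phi> i) \<xi> * snd (pd1v (G i) \<xi>)) / jdet (G i) \<xi>)"
        using nz[OF i] by (intro continuous_intros pc dc i) auto
      then show "continuous_on unitsq (\<lambda>\<xi>. f1 (G i \<xi>))"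
        by (rule continuous_on_eq) (use ex(2)[OF i _ i] in auto)
      have "continuous_on unitsq (\<lambda>\<xi>. (dpart 0 1 (\<phi> i) \<xi> * fst (pd1v (G i) \<xi>) - dpart 1 0 (\<phi> i) \<xi> * fst (pd2v (G i) \<xi>)) / jdet (G i) \<xi>)"
        using nz[OF i] by (intro continuous_intros pc dc i) auto
      then show "continuous_on unitsq (\<lambda>\<xi>. f2 (G i \<xi>))"
        by (rule continuous_on_eq) (use ex(3)[OF i _ i] in auto)
    qed
    show "continuous_on UNIV f11"
    proof (rule contg)
      fix i assume i: "i \<in> I"
      show "continuous_on (G i ` unitsq) f11"
        by (rule patch_inverse_continuous[OF assms(2)[OF i]], rule ex(4)[OF i _ i], assumption, assumption)
           (use nz[OF i] in \<open>auto intro!: continuous_intros pc dc i g\<close>)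
    qed (use gC in auto)
    show "continuous_on UNIV f12"
    proof (rule contg)
      fix i assume i: "i \<in> I"
      show "continuous_on (G i ` unitsq) f12"
        by (rule patch_inverse_continuous[OF assms(2)[OF i]], rule ex(5)[OF i _ i], assumption, assumption)
           (use nz[OF i] in \<open>auto intro!: continuous_intros pc dc i g\<close>)
    qed (use gC in auto)
    show "continuous_on UNIV f22"
    proof (rule contg)
      fix i assume i: "i \<in> I"
      show "continuous_on (G i ` unitsq) f22"
        by (rule patch_inverse_continuous[OF assms(2)[OF i]], rule ex(6)[OF i _ i], assumption, assumption)
           (use nz[OF i] in \<open>auto intro!: continuous_intros pc dc i g\<close>)
    qed (use gC in auto)
  qed
qed

end

section \<open>Functions of class C2 and the boundary conditions\<close>

lemma has_derivative_partials:
  assumes "\<And>x. (f has_derivative (\<lambda>v. f1 x * fst v + f2 x * snd v)) (at x)"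
  shows "((\<lambda>t. f (t, y)) has_real_derivative f1 (x, y)) (at x)" "((\<lambda>t. f (x, t)) has_real_derivative f2 (x, y)) (at y)"
    "pdx f = f1" "pdy f = f2"
proof -
  have 1: "((\<lambda>t. f (t, y)) has_real_derivative f1 (x, y)) (at x)" for x y
  proof -
    have "((\<lambda>t. (t, y)) has_derivative (\<lambda>h. (h, 0))) (at x)" by (auto intro!: derivative_eq_intros)
    from has_derivative_compose[OF this assms] show ?thesis by (simp add: has_field_derivative_def mult_commute_abs)
  qed
  have 2: "((\<lambda>t. f (x, t)) has_real_derivative f2 (x, y)) (at y)" for x y
  proof -
    have "((\<lambda>t. (x, t)) has_derivative (\<lambda>h. (0, h))) (at y)" by (auto intro!: derivative_eq_intros)
    from has_derivative_compose[OF this assms] show ?thesis by (simp add: has_field_derivative_def mult_commute_abs)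
  qed
  show "((\<lambda>t. f (t, y)) has_real_derivative f1 (x, y)) (at x)" "((\<lambda>t. f (x, t)) has_real_derivative f2 (x, y)) (at y)"
    by (rule 1, rule 2)
  show "pdx f = f1" "pdy f = f2"
    using DERIV_imp_deriv[OF 1] DERIV_imp_deriv[OF 2] by (auto simp: pdx_def pdy_def fun_eq_iff)
qed

lemma C2plane_lincomb:
  assumes "C2plane f" "C2plane g"
  shows "C2plane (\<lambda>x. f x + c * g x)"
proof -
  obtain f1 f2 f11 f12 f22 where f:
    "\<And>x. (f has_derivative (\<lambda>v. f1 x * fst v + f2 x * snd v)) (at x)"
    "\<And>x. (f1 has_derivative (\<lambda>v. f11 x * fst v + f12 x * snd v)) (at x)"
    "\<And>x. (f2 has_derivative (\<lambda>v. f12 x * fst v + f22 x * snd v)) (at x)"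
    "continuous_on UNIV f11" "continuous_on UNIV f12" "continuous_on UNIV f22"
    using assms(1) unfolding C2plane_def by blast
  obtain g1 g2 g11 g12 g22 where g:
    "\<And>x. (g has_derivative (\<lambda>v. g1 x * fst v + g2 x * snd v)) (at x)"
    "\<And>x. (g1 has_derivative (\<lambda>v. g11 x * fst v + g12 x * snd v)) (at x)"
    "\<And>x. (g2 has_derivative (\<lambda>v. g12 x * fst v + g22 x * snd v)) (at x)"
    "continuous_on UNIV g11" "continuous_on UNIV g12" "continuous_on UNIV g22"
    using assms(2) unfolding C2plane_def by blast
  have L: "((\<lambda>x. u x + c * w x) has_derivative (\<lambda>v. (u1 x + c * w1 x) * fst v + (u2 x + c * w2 x) * snd v)) (at x)"
    if "(u has_derivative (\<lambda>v. u1 x * fst v + u2 x * snd v)) (at x)" "(w has_derivative (\<lambda>v. w1 x * fst v + w2 x * snd v)) (at x)"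
    for u w u1 u2 w1 w2 :: "pt \<Rightarrow> real" and x
    using has_derivative_add[OF that(1) has_derivative_mult_right[OF that(2), of c]]
    by (simp add: algebra_simps)
  show ?thesis unfolding C2plane_def
  proof (intro exI conjI allI)
    fix x
    show "((\<lambda>x. f x + c * g x) has_derivative (\<lambda>v. (f1 x + c * g1 x) * fst v + (f2 x + c * g2 x) * snd v)) (at x)"
      by (rule L[OF f(1) g(1)])
    show "((\<lambda>x. f1 x + c * g1 x) has_derivative (\<lambda>v. (f11 x + c * g11 x) * fst v + (f12 x + c * g12 x) * snd v)) (at x)"
      by (rule L[OF f(2) g(2)])
    show "((\<lambda>x. f2 x + c * g2 x) has_derivative (\<lambda>v. (f12 x + c * g12 x) * fst v + (f22 x + c * g22 x) * snd v)) (at x)"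
      by (rule L[OF f(3) g(3)])
  qed (intro continuous_intros f g)+
qed

lemma C2plane_zero: "C2plane (\<lambda>x. 0)"
  unfolding C2plane_def by (intro exI[of _ "\<lambda>x. 0"]) auto

lemma C2plane_sum: "finite S \<Longrightarrow> (\<And>s. s \<in> S \<Longrightarrow> C2plane (f s)) \<Longrightarrow> C2plane (\<lambda>x. \<Sum>s\<in>S. c s * f s x)"
proof (induction S rule: finite_induct)
  case (insert s S)
  have "C2plane (\<lambda>x. (\<Sum>s\<in>S. c s * f s x) + c s * f s x)"
    using insert by (intro C2plane_lincomb) auto
  then show ?case using insert by (simp add: add.commute)
qed (simp add: C2plane_zero)

lemma C2plane_continuous: "C2plane f \<Longrightarrow> continuous_on S f"
  unfolding C2plane_def
  by (elim exE conjE, rule continuous_at_imp_continuous_on, rule ballI, rule has_derivative_continuous, erule spec)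

lemma multipatch_patch:
  assumes "multipatch P F" "l \<in> {1..P}"
  shows "patch (F l)"
  using assms(1)[unfolded multipatch_def, THEN conjunct2, THEN conjunct1, rule_format, OF assms(2)]
  by (simp add: patch_def)

lemma multipatch_disjoint:
  assumes "multipatch P F" "l \<in> {1..P}" "l' \<in> {1..P}" "l \<noteq> l'"
  shows "interior (F l ` unitsq) \<inter> interior (F l' ` unitsq) = {}"
  by (rule assms(1)[unfolded multipatch_def, THEN conjunct2, THEN conjunct2, THEN conjunct1, rule_format, OF assms(2-4), THEN conjunct1])

lemma dom_closed:
  assumes "multipatch P F"
  shows "closed (dom P F)"
  unfolding dom_def using compact_imp_closed[OF patch_compact[OF multipatch_patch[OF assms]]]
  by (intro closed_UN) auto

lemma dom_closure_interior:
  assumes "multipatch P F"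
  shows "dom P F \<subseteq> closure (interior (dom P F))"
proof
  fix x assume "x \<in> dom P F"
  then obtain l where l: "l \<in> {1..P}" "x \<in> F l ` unitsq" by (auto simp: dom_def)
  then have "x \<in> closure (interior (F l ` unitsq))" using patch_closure[OF multipatch_patch[OF assms l(1)]] by blast
  moreover have "F l ` unitsq \<subseteq> dom P F" using l by (auto simp: dom_def)
  ultimately show "x \<in> closure (interior (dom P F))" by (meson closure_mono interior_mono subsetD)
qed

text \<open>The derivatives in the boundary conditions vanish on the open complement of the domain,
  hence on its frontier by continuity. Frontier points are limit points of the interior, so
  \<open>ext\<close> returns the actual value.\<close>

lemma V0hI:
  assumes "multipatch P F" "C2plane f" "\<And>x. x \<notin> dom P F \<Longrightarrow> f x = 0"
    "\<And>l. l \<in> {1..P} \<Longrightarrow> inS2 p r k (f \<circ> F l)"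
  shows "f \<in> V0h p r k P F"
proof -
  obtain f1 f2 f11 f12 f22 where f:
    "\<And>x. (f has_derivative (\<lambda>v. f1 x * fst v + f2 x * snd v)) (at x)"
    "\<And>x. (f1 has_derivative (\<lambda>v. f11 x * fst v + f12 x * snd v)) (at x)"
    "\<And>x. (f2 has_derivative (\<lambda>v. f12 x * fst v + f22 x * snd v)) (at x)"
    "continuous_on UNIV f11" "continuous_on UNIV f12" "continuous_on UNIV f22"
    using assms(2) unfolding C2plane_def by blast
  note d = has_derivative_partials[of f f1 f2, OF f(1)] has_derivative_partials[of f1 f11 f12, OF f(2)]
    has_derivative_partials[of f2 f12 f22, OF f(3)]
  have c: "continuous_on UNIV f" "continuous_on UNIV f1" "continuous_on UNIV f2"
    by (rule continuous_at_imp_continuous_on, rule ballI, rule has_derivative_continuous, rule f)+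
  have dif1: "(\<lambda>t. g (t, y)) differentiable at x" if "g = f \<or> g = f1 \<or> g = f2" for g x y
    unfolding real_differentiable_def using that d(1)[of y x] d(5)[of y x] d(9)[of y x] by auto
  have dif2: "(\<lambda>t. g (x, t)) differentiable at y" if "g = f \<or> g = f1 \<or> g = f2" for g x y
    unfolding real_differentiable_def using that d(2)[of x y] d(6)[of x y] d(10)[of x y] by auto
  have C2: "C2_dom (dom P F) f"
    unfolding C2_dom_def D2set_def d
  proof (intro conjI ballI)
    show "continuous_on (dom P F) f" using c(1) by (rule continuous_on_subset) simp
    fix g x assume "g \<in> {f, f1, f2}"
    then show "(\<lambda>t. g (t, snd x)) differentiable at (fst x)" "(\<lambda>t. g (fst x, t)) differentiable at (snd x)"
      by (auto intro!: dif1 dif2)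
  next
    fix g assume "g \<in> {f1, f2, f11, f12, f12, f22}"
    then have "continuous_on UNIV g" using c f(4-6) by auto
    then have "continuous_on (dom P F) g" by (rule continuous_on_subset) simp
    then show "\<exists>G. continuous_on (dom P F) G \<and> (\<forall>x\<in>interior (dom P F). G x = g x)" by blast
  qed
  have op: "open (- dom P F)" by (rule open_Compl[OF dom_closed[OF assms(1)]])
  have pz: "pdx g x = 0" "pdy g x = 0" if "\<And>x. x \<notin> dom P F \<Longrightarrow> g x = 0" "x \<notin> dom P F" for g x
  proof -
    have o1: "open {t. (t, snd x) \<in> - dom P F}"
      using open_vimage[OF op, of "\<lambda>t. (t, snd x)"] by (simp add: vimage_def continuous_on_Pair)
    have o2: "open {t. (fst x, t) \<in> - dom P F}"
      using open_vimage[OF op, of "\<lambda>t. (fst x, t)"] by (simp add: vimage_def continuous_on_Pair)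
    have "((\<lambda>t. g (t, snd x)) has_real_derivative 0) (at (fst x))"
      by (rule has_field_derivative_transform_within_open[OF DERIV_const[of 0] o1]) (use that in auto)
    then show "pdx g x = 0" unfolding pdx_def by (rule DERIV_imp_deriv)
    have "((\<lambda>t. g (fst x, t)) has_real_derivative 0) (at (snd x))"
      by (rule has_field_derivative_transform_within_open[OF DERIV_const[of 0] o2]) (use that in auto)
    then show "pdy g x = 0" unfolding pdy_def by (rule DERIV_imp_deriv)
  qed
  have z1: "f1 x = 0" "f2 x = 0" if "x \<notin> dom P F" for x
    using pz[of f x] assms(3) that unfolding d by simp_all
  have z2: "f11 x = 0" "f22 x = 0" if "x \<notin> dom P F" for x
    using pz(1)[of f1 x] pz(2)[of f2 x] z1 that unfolding d by simp_all
  have fr: "g x = 0" if "continuous_on UNIV g" "\<And>x. x \<notin> dom P F \<Longrightarrow> g x = 0" "x \<in> frontier (dom P F)" for g :: "pt \<Rightarrow> real" and x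
  proof (rule continuous_constant_on_closure[of "- dom P F" g])
    show "continuous_on (closure (- dom P F)) g" using that(1) by (rule continuous_on_subset) simp
    show "x \<in> closure (- dom P F)" using that(3) by (simp add: frontier_closures)
  qed (use that in auto)
  have ex: "ext (dom P F) g x = g x" if "continuous_on UNIV g" "x \<in> frontier (dom P F)" for g x
    unfolding ext_def
  proof (rule tendsto_Lim)
    have "x \<in> dom P F" using that(2) dom_closed[OF assms(1)] by (simp add: frontier_def)
    then have "x \<in> closure (interior (dom P F))" using dom_closure_interior[OF assms(1)] by blast
    moreover have "x \<notin> interior (dom P F)" using that(2) by (simp add: frontier_def)
    ultimately have "x islimpt interior (dom P F)" by (simp add: closure_def)
    then show "\<not> trivial_limit (at x within interior (dom P F))" by (simp add: trivial_limit_within)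
    have "(g \<longlongrightarrow> g x) (at x)" using that(1) unfolding continuous_on_def by blast
    then show "(g \<longlongrightarrow> g x) (at x within interior (dom P F))"
      by (rule tendsto_within_subset) simp
  qed
  show ?thesis unfolding V0h_def Vh_def
  proof (intro CollectI conjI ballI impI allI C2)
    fix x assume x: "x \<in> frontier (dom P F)"
    show "f x = 0" using fr[OF c(1) assms(3) x] .
    show "ext (dom P F) (pdx (pdx f)) x + ext (dom P F) (pdy (pdy f)) x = 0"
      unfolding d using ex[OF f(4) x] ex[OF f(6) x] fr[OF f(4) z2(1) x] fr[OF f(6) z2(2) x] by simp
    fix n :: pt
    show "ext (dom P F) (pdx f) x * fst n + ext (dom P F) (pdy f) x * snd n = 0"
      unfolding d using ex[OF c(2) x] ex[OF c(3) x] fr[OF c(2) z1(1) x] fr[OF c(3) z1(2) x] by simp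
  qed (use assms(4) in auto)
qed

text \<open>Patches outside the index set need an argument too: f vanishes in their interior, since
  patches do not overlap, and by continuity on the closed patch.\<close>

lemma (in smooth_spline) patchwise_C2plane:
  assumes mp: "multipatch P F"
    and I: "finite I" "inj_on L I" "\<And>i. i \<in> I \<Longrightarrow> L i \<in> {1..P}" "\<And>i. i \<in> I \<Longrightarrow> psi i \<in> sqsym"
    and "\<And>i. i \<in> I \<Longrightarrow> \<phi> i \<in> TS p r k"
    "\<And>i \<xi>. i \<in> I \<Longrightarrow> \<xi> \<in> unitsq \<Longrightarrow> f (F (L i) (psi i \<xi>)) = \<phi> i \<xi>"
    "\<And>x. x \<notin> (\<Union>i\<in>I. F (L i) ` unitsq) \<Longrightarrow> f x = 0"
    "\<And>x. x \<in> (\<Union>i\<in>I. F (L i) ` unitsq) \<Longrightarrow> \<exists>J. (\<forall>i\<in>I. \<forall>\<xi>\<in>unitsq. (F (L i) \<circ> psi i) \<xi> = x \<longrightarrow> jetat (F (L i) \<circ> psi i) (\<phi> i) \<xi> J)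
        \<and> (J \<noteq> 0 \<longrightarrow> x \<in> interior (\<Union>i\<in>I. F (L i) ` unitsq))"
  shows "C2plane f \<and> (\<forall>x. x \<notin> dom P F \<longrightarrow> f x = 0) \<and> (\<forall>l\<in>{1..P}. \<exists>\<phi>\<in>TS p r k. \<forall>\<xi>\<in>unitsq. f (F l \<xi>) = \<phi> \<xi>)"
proof (intro conjI allI impI ballI)
  have U: "(\<Union>i\<in>I. (F (L i) \<circ> psi i) ` unitsq) = (\<Union>i\<in>I. F (L i) ` unitsq)"
    by (rule SUP_cong[OF refl]) (rule image_sqsym[OF I(4)])
  show C2: "C2plane f"
  proof (rule C2plane_glue[of I "\<lambda>i. F (L i) \<circ> psi i" \<phi>])
    show "\<And>i. i \<in> I \<Longrightarrow> patch (F (L i) \<circ> psi i)"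
      using I by (intro patch_sqsym multipatch_patch[OF mp]) auto
    show "\<And>x. x \<notin> (\<Union>i\<in>I. (F (L i) \<circ> psi i) ` unitsq) \<Longrightarrow> f x = 0" unfolding U by (rule assms(8))
    show "\<And>x. x \<in> (\<Union>i\<in>I. (F (L i) \<circ> psi i) ` unitsq) \<Longrightarrow> \<exists>J. (\<forall>i\<in>I. \<forall>\<xi>\<in>unitsq. (F (L i) \<circ> psi i) \<xi> = x \<longrightarrow> jetat (F (L i) \<circ> psi i) (\<phi> i) \<xi> J)
        \<and> (J \<noteq> 0 \<longrightarrow> x \<in> interior (\<Union>i\<in>I. (F (L i) \<circ> psi i) ` unitsq))"
      unfolding U by (rule assms(9))
  qed (use assms(6,7) I(1) in auto)
  show "f x = 0" if "x \<notin> dom P F" for x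
    using that I(3) by (intro assms(8)) (auto simp: dom_def)
  fix l assume l: "l \<in> {1..P}"
  show "\<exists>\<phi>\<in>TS p r k. \<forall>\<xi>\<in>unitsq. f (F l \<xi>) = \<phi> \<xi>"
  proof (cases "l \<in> L ` I")
    case True
    then obtain i where i: "i \<in> I" "l = L i" by auto
    obtain \<tau> where \<tau>: "\<tau> \<in> sqsym" "\<And>\<xi>. psi i (\<tau> \<xi>) = \<xi>" using sqsym_inverse[OF I(4)[OF i(1)]] by blast
    have "f (F l \<xi>) = (\<phi> i \<circ> \<tau>) \<xi>" if "\<xi> \<in> unitsq" for \<xi>
      using assms(7)[OF i(1), of "\<tau> \<xi>"] \<tau> i that sqsym_mem(1)[OF \<tau>(1)] by simp
    moreover have "\<phi> i \<circ> \<tau> \<in> TS p r k" using TS_sqsym(1)[OF assms(6)[OF i(1)] \<tau>(1)] .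
    ultimately show ?thesis by blast
  next
    case False
    have z: "f x = 0" if "x \<in> interior (F l ` unitsq)" for x
    proof (rule assms(8), rule notI)
      assume "x \<in> (\<Union>i\<in>I. F (L i) ` unitsq)"
      then obtain i where i: "i \<in> I" "x \<in> F (L i) ` unitsq" by auto
      then have "L i \<noteq> l" using False by auto
      then have "interior (F l ` unitsq) \<inter> interior (F (L i) ` unitsq) = {}"
        using multipatch_disjoint[OF mp l I(3)[OF i(1)]] by auto
      then show False
        using interior_disjoint_patch[OF multipatch_patch[OF mp I(3)[OF i(1)]] open_interior] that i(2) by blast
    qed
    have "f x = 0" if "x \<in> F l ` unitsq" for x
    proof (rule continuous_constant_on_closure[of "interior (F l ` unitsq)" f])
      show "x \<in> closure (interior (F l ` unitsq))" using patch_closure[OF multipatch_patch[OF mp l]] that by blast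
    qed (use z C2plane_continuous[OF C2] in auto)
    then show ?thesis using TS_zero by (intro bexI[of _ "\<lambda>\<xi>. 0"]) auto
  qed
qed

section \<open>Two-patch edge functions\<close>

text \<open>The trace functions of the overview for the edge function with index (i,j); only the one
  with m = i is nonzero. They see the geometry through d alone and are therefore shared by the two
  patches.\<close>

definition gphi :: "nat \<Rightarrow> nat \<Rightarrow> nat \<Rightarrow> nat \<Rightarrow> nat \<Rightarrow> nat \<Rightarrow> nat \<Rightarrow> real \<Rightarrow> real" where
  "gphi p r k d i j m = (if m \<noteq> i then (\<lambda>t. 0) else if i = 0 then Nsp p (r+2) k j
     else if i = 1 then (\<lambda>t. real p / hh k * Nsp (p-d) (r+1) k j t)
     else if i = 2 then (\<lambda>t. real p * (real p - 1) / (hh k)\<^sup>2 * Nsp (p - 2*d) r k j t) else (\<lambda>t. 0))"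

text \<open>Coefficient of \<open>MM p r k s\<close> in \<open>gfun\<close>; by duality of the M_s
  at 0 it is also the transversal derivative of order s along the edge.\<close>

definition gc :: "nat \<Rightarrow> nat \<Rightarrow> nat \<Rightarrow> (pt \<Rightarrow> pt) \<Rightarrow> (pt \<Rightarrow> pt) \<Rightarrow> bool \<Rightarrow> nat \<Rightarrow> nat \<Rightarrow> nat \<Rightarrow> real \<Rightarrow> real" where
  "gc p r k A B tau i j s t = (let G = (if tau then A else B); al = alpha A B tau t; be = beta G t; \<phi> = gphi p r k (dal A B) i j in
     if s = 0 then \<phi> 0 t else if s = 1 then be * deriv (\<phi> 0) t + al * \<phi> 1 t
     else be\<^sup>2 * deriv (deriv (\<phi> 0)) t + 2 * al * be * deriv (\<phi> 1) t + al\<^sup>2 * \<phi> 2 t)"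

definition MT :: "nat \<Rightarrow> nat \<Rightarrow> nat \<Rightarrow> (nat \<Rightarrow> real \<Rightarrow> real) \<Rightarrow> pt \<Rightarrow> real" where
  "MT p r k C \<xi> = (\<Sum>s\<le>2. MM p r k s (fst \<xi>) * C s (snd \<xi>))"

text \<open>Truncated subtraction covers e = 0, where only a polynomial first piece is
  claimed.\<close>

lemma van0_deriv': "van0 k e f \<Longrightarrow> van0 k (e - 1) (deriv f)"
proof (cases e)
  case 0
  assume "van0 k e f"
  then obtain w where w: "\<forall>x<hh k. f x = poly w x" using 0 unfolding van0_def by auto
  have "deriv f x = poly (pderiv w) x" if "x < hh k" for x
    using deriv_pow_local_poly[of "hh k" f w x 1] w that by simp
  then show ?thesis using 0 unfolding van0_def by auto
qed (simp add: van0_deriv)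

lemma van1_deriv':
  assumes "f \<in> PS p r k" "k = 0 \<or> 1 \<le> r" "van1 k e f"
  shows "van1 k (e - 1) (deriv f)"
proof -
  have e: "deriv (\<lambda>x. f (1 - x)) x = - deriv f (1 - x)" for x
    by (intro deriv_reflect PS_DERIV[OF assms(1,2)])
  have "van0 k (e - 1) (deriv (\<lambda>x. f (1 - x)))" using assms(3) unfolding van1_def by (rule van0_deriv')
  then have "van0 k (e - 1) (\<lambda>x. - 1 * (deriv (\<lambda>x. f (1 - x)) x))" by (rule van0_scale)
  then show ?thesis unfolding van1_def e by simp
qed

lemma deriv_zero_fun: "deriv (\<lambda>t::real. 0::real) = (\<lambda>t. 0)"
  by (simp add: fun_eq_iff)

lemma beta_affine:
  assumes "bilinear_map G"
  shows "beta G t = poly [:beta G 0, beta G 1 - beta G 0:] t"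
proof -
  obtain a b c d where G: "\<And>x y. G (x,y) = a + x *\<^sub>R b + y *\<^sub>R c + (x*y) *\<^sub>R d"
    using assms by (rule bilinear_mapE) blast
  show ?thesis unfolding beta_def bilinear_pd[OF G]
    by (simp add: inner_left_distrib add_divide_distrib algebra_simps)
qed

lemma alpha_affine:
  assumes "bilinear_map A" "bilinear_map B"
  shows "alpha A B tau t = poly [:alpha A B tau 0, alpha A B tau 1 - alpha A B tau 0:] t"
proof -
  define G where "G = (if tau then A else B)"
  have "bilinear_map G" using assms by (simp add: G_def)
  then have "alpha A B tau t = c1 A B * (abar G 0 + t * (abar G 1 - abar G 0))"
    using abar_affine[of G t] by (simp add: alpha_def G_def[symmetric])
  then show ?thesis by (simp add: alpha_def G_def[symmetric] algebra_simps)
qed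

lemma alpha_const:
  assumes "dal A B = 0"
  shows "alpha A B tau 1 = alpha A B tau 0"
proof -
  have "(\<forall>x\<in>{0..1}. \<forall>y\<in>{0..1}. alpha A B True x = alpha A B True y) \<and> (\<forall>x\<in>{0..1}. \<forall>y\<in>{0..1}. alpha A B False x = alpha A B False y)"
    using assms unfolding dal_def by (metis zero_neq_one)
  then show ?thesis by (cases tau) auto
qed

lemma dal_le: "dal A B \<le> 1" by (simp add: dal_def)

text \<open>The assumption \<open>big\<close> is the bound on k multiplied out over the integers;
  for k = 0 it reads p >= 9.\<close>

locale c2_spline =
  fixes p r k :: nat
  assumes p5: "5 \<le> p" and rk: "1 \<le> k \<longrightarrow> 2 \<le> r \<and> r \<le> p - 3"
    and big: "int k * (int p - int r - 2) \<ge> 9 - int p"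

sublocale c2_spline \<subseteq> smooth_spline
  using rk by unfold_locales auto

context c2_spline
begin

lemma rp: "1 \<le> k \<longrightarrow> r < p" "1 \<le> k \<longrightarrow> r + 3 \<le> p" "1 \<le> k \<longrightarrow> r + 2 < p"
  "d \<le> 1 \<Longrightarrow> 1 \<le> k \<longrightarrow> r + 1 < p - d" "d \<le> 1 \<Longrightarrow> 1 \<le> k \<longrightarrow> r < p - 2 * d"
  using rk p5 by auto

text \<open>The bound on k is n_0 >= 10. In the other two spaces the degree drops by at most one and
  two, while the multiplicity of the inner knots is no smaller than p - (r+2).\<close>

lemma dims: "10 \<le> dimS p (r+2) k" "d \<le> 1 \<Longrightarrow> 9 \<le> dimS (p-d) (r+1) k" "d \<le> 1 \<Longrightarrow> 8 \<le> dimS (p - 2*d) r k" "6 \<le> dimS p r k"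
proof -
  have b: "9 \<le> p + k * (p - (r + 2))"
  proof (cases "k = 0")
    case True then show ?thesis using big by simp
  next
    case False
    then have "int (p - (r+2)) = int p - int r - 2" using rp(3) by auto
    then have "int (k * (p - (r+2))) = int k * (int p - int r - 2)" by simp
    then show ?thesis using big by linarith
  qed
  then show "10 \<le> dimS p (r+2) k" by (simp add: dimS_def)
  have m: "k * (p - (r+2)) \<le> k * x" if "p - (r+2) \<le> x" for x using that by simp
  show "9 \<le> dimS (p-d) (r+1) k" if "d \<le> 1"
  proof -
    have "p - (r+2) \<le> p - d - (r+1)" "p - 1 \<le> p - d" using that by auto
    then show ?thesis using b m[of "p - d - (r+1)"] p5 unfolding dimS_def by linarith
  qed
  show "8 \<le> dimS (p - 2*d) r k" if "d \<le> 1"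
  proof -
    have "p - (r+2) \<le> p - 2*d - r" "p - 2 \<le> p - 2*d" using that by auto
    then show ?thesis using b m[of "p - 2*d - r"] p5 unfolding dimS_def by linarith
  qed
  show "6 \<le> dimS p r k" using p5 by (simp add: dimS_def)
qed

lemma MM_PS: "MM p r k s \<in> PS p r k"
proof -
  have N: "Nsp p r k i \<in> PS p r k" for i using rp(1) by (intro Nsp_PS) simp
  have "M0 p r k \<in> PS p r k" unfolding M0_def[abs_def] by (intro PS_sum N) auto
  moreover have "M1 p r k \<in> PS p r k" unfolding M1_def[abs_def] by (intro PS_scale PS_add N)
  moreover have "M2 p r k \<in> PS p r k" unfolding M2_def[abs_def] by (intro PS_scale N)
  ultimately show ?thesis by (simp add: MM_def)
qed

text \<open>Dimension at least 6 leaves order 6 - 1 - 2 = 3 at the far end, enough to kill 2-jets on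
  the opposite side.\<close>

lemma Nsp_van1_low: "i \<le> 2 \<Longrightarrow> van1 k 3 (Nsp p r k i)"
  using dims(4) rp(1) by (intro van1_mono[OF Nsp_van1]) auto

lemma MM_van1: "van1 k 3 (MM p r k s)"
proof -
  have "van1 k 3 (M0 p r k)" unfolding M0_def[abs_def] by (intro van1_sum Nsp_van1_low) auto
  moreover have "van1 k 3 (M1 p r k)" unfolding M1_def[abs_def] by (intro van1_scale van1_add Nsp_van1_low) auto
  moreover have "van1 k 3 (M2 p r k)" unfolding M2_def[abs_def] by (intro van1_scale Nsp_van1_low) auto
  ultimately show ?thesis by (simp add: MM_def)
qed

lemma MM_jet0: "s \<le> 2 \<Longrightarrow> j \<le> 2 \<Longrightarrow> (deriv ^^ j) (MM p r k s) 0 = (if s = j then 1 else 0)"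
  using rp(2) p5 by (intro MM_jet) auto

lemma MT_TS: "(\<And>s. s \<le> 2 \<Longrightarrow> C s \<in> PS p r k) \<Longrightarrow> MT p r k C \<in> TS p r k"
  unfolding MT_def[abs_def] by (intro TS_sum TS_prod MM_PS) auto

lemma dpart_MT:
  assumes "\<And>s. s \<le> 2 \<Longrightarrow> C s \<in> PS p r k" "a \<le> 2" "b \<le> 2"
  shows "dpart a b (MT p r k C) \<xi> = (\<Sum>s\<le>2. (deriv ^^ a) (MM p r k s) (fst \<xi>) * (deriv ^^ b) (C s) (snd \<xi>))"
proof -
  have "dpart a b (MT p r k C) \<xi> = (\<Sum>s\<le>2. dpart a b (\<lambda>\<xi>. MM p r k s (fst \<xi>) * C s (snd \<xi>)) \<xi>)"
    unfolding MT_def[abs_def] by (rule dpart_sum) (use assms in \<open>auto intro: TS_prod MM_PS\<close>)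
  also have "\<dots> = (\<Sum>s\<le>2. (deriv ^^ a) (MM p r k s) (fst \<xi>) * (deriv ^^ b) (C s) (snd \<xi>))"
    by (intro sum.cong refl dpart_prod MM_PS assms) auto
  finally show ?thesis .
qed

lemma dpart_MT_0:
  assumes "\<And>s. s \<le> 2 \<Longrightarrow> C s \<in> PS p r k" "a \<le> 2" "b \<le> 2"
  shows "dpart a b (MT p r k C) (0, t) = (deriv ^^ b) (C a) t"
proof -
  have "dpart a b (MT p r k C) (0,t) = (\<Sum>s\<le>2. (if s = a then 1 else 0) * (deriv ^^ b) (C s) t)"
    by (subst dpart_MT) (use assms in \<open>auto intro!: sum.cong simp: MM_jet0\<close>)
  also have "\<dots> = (\<Sum>s\<le>2. if s = a then (deriv ^^ b) (C s) t else 0)" by (intro sum.cong) auto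
  also have "\<dots> = (deriv ^^ b) (C a) t" using assms(2) by (simp add: sum.delta)
  finally show ?thesis .
qed

lemma zj_MT_right:
  assumes "\<And>s. s \<le> 2 \<Longrightarrow> C s \<in> PS p r k"
  shows "zj (MT p r k C) (1, y)"
  unfolding zj_def
proof (intro allI impI)
  fix i j :: nat assume ij: "i + j \<le> 2"
  then have "(deriv ^^ i) (MM p r k s) 1 = 0" for s
    using smooth by (intro van1_jet[OF MM_PS _ MM_van1]) auto
  then show "dpart i j (MT p r k C) (1, y) = 0" using ij by (subst dpart_MT[OF assms]) auto
qed

lemma zj_MT_line:
  assumes "\<And>s. s \<le> 2 \<Longrightarrow> C s \<in> PS p r k" "\<And>s j. s \<le> 2 \<Longrightarrow> j \<le> 2 \<Longrightarrow> (deriv ^^ j) (C s) y = 0"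
  shows "zj (MT p r k C) (x, y)"
  unfolding zj_def
proof (intro allI impI)
  fix i j :: nat assume ij: "i + j \<le> 2"
  then show "dpart i j (MT p r k C) (x, y) = 0" by (subst dpart_MT[OF assms(1)]) (use assms(2) in auto)
qed

lemma zj_MT_bottom:
  assumes "\<And>s. s \<le> 2 \<Longrightarrow> C s \<in> PS p r k" "\<And>s. s \<le> 2 \<Longrightarrow> van0 k 3 (C s)"
  shows "zj (MT p r k C) (x, 0)"
  by (rule zj_MT_line[OF assms(1)]) (use van0_jet[OF assms(2)] in auto)

lemma zj_MT_top:
  assumes "\<And>s. s \<le> 2 \<Longrightarrow> C s \<in> PS p r k" "\<And>s. s \<le> 2 \<Longrightarrow> van1 k 3 (C s)"
  shows "zj (MT p r k C) (x, 1)"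
  by (rule zj_MT_line[OF assms(1)]) (use van1_jet[OF assms(1) smooth assms(2)] in auto)

lemma gphi_PS:
  assumes "d \<le> 1"
  shows "gphi p r k d i j 0 \<in> PS p (r+2) k" "gphi p r k d i j 1 \<in> PS (p-d) (r+1) k" "gphi p r k d i j 2 \<in> PS (p-2*d) r k"
proof -
  show "gphi p r k d i j 0 \<in> PS p (r+2) k"
    unfolding gphi_def using Nsp_PS[of k "r+2" p j] rp(3) by (auto intro: PS_const)
  show "gphi p r k d i j 1 \<in> PS (p-d) (r+1) k"
    unfolding gphi_def using PS_scale[OF Nsp_PS[OF rp(4)[OF assms]], of "real p / hh k" j] by (auto intro: PS_const)
  show "gphi p r k d i j 2 \<in> PS (p-2*d) r k"
    unfolding gphi_def using PS_scale[OF Nsp_PS[OF rp(5)[OF assms]], of "real p * (real p - 1) / (hh k)\<^sup>2" j] by (auto intro: PS_const)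
qed

lemma gphi_deriv_PS:
  assumes "d \<le> 1"
  shows "deriv (gphi p r k d i j 0) \<in> PS (p-1) (r+1) k" "deriv (deriv (gphi p r k d i j 0)) \<in> PS (p-2) r k"
    "deriv (gphi p r k d i j 1) \<in> PS (p-d-1) r k"
proof -
  show 1: "deriv (gphi p r k d i j 0) \<in> PS (p-1) (r+1) k" using PS_deriv[OF gphi_PS(1)[OF assms, of i j]] by simp
  show "deriv (deriv (gphi p r k d i j 0)) \<in> PS (p-2) r k" using PS_deriv[OF 1] by (simp add: numeral_2_eq_2)
  show "deriv (gphi p r k d i j 1) \<in> PS (p-d-1) r k" using PS_deriv[OF gphi_PS(2)[OF assms, of i j]] by simp
qed

lemma alpha_PS:
  assumes "bilinear_map A" "bilinear_map B"
  shows "alpha A B tau \<in> PS (dal A B) r k"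
proof -
  have e: "alpha A B tau = poly [:alpha A B tau 0, alpha A B tau 1 - alpha A B tau 0:]"
    using alpha_affine[OF assms] by blast
  have "degree [:alpha A B tau 0, alpha A B tau 1 - alpha A B tau 0:] \<le> dal A B"
    using alpha_const[of A B tau] dal_le[of A B] by (cases "dal A B = 0") auto
  then show ?thesis by (subst e) (rule PS_poly)
qed

lemma beta_PS:
  assumes "bilinear_map G"
  shows "beta G \<in> PS 1 r k"
proof -
  have e: "beta G = poly [:beta G 0, beta G 1 - beta G 0:]" using beta_affine[OF assms] by blast
  show ?thesis by (subst e) (rule PS_poly, simp)
qed

text \<open>Degree and smoothness balance. Each derivative lowers the degree by one and comes with a
  factor \<beta> of degree one; each \<alpha> of degree d meets a trace function whose degree is
  lowered by d; and the smoothness r + 2, r + 1, r of the traces survives the two, one and zero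
  derivatives taken of them.\<close>

lemma gc_PS:
  assumes "bilinear_map A" "bilinear_map B"
  shows "gc p r k A B tau i j s \<in> PS p r k"
proof -
  define G where "G = (if tau then A else B)"
  define d where "d = dal A B"
  define \<phi> where "\<phi> = gphi p r k d i j"
  have d1: "d \<le> 1" using dal_le by (simp add: d_def)
  have bG: "bilinear_map G" using assms by (simp add: G_def)
  have be: "beta G \<in> PS 1 r k" by (rule beta_PS[OF bG])
  have al: "alpha A B tau \<in> PS d r k" unfolding d_def by (rule alpha_PS[OF assms])
  have be2: "(\<lambda>t. (beta G t)\<^sup>2) \<in> PS 2 r k" unfolding power2_eq_square by (rule PS_mult[OF be be]) simp
  have al2: "(\<lambda>t. (alpha A B tau t)\<^sup>2) \<in> PS (2*d) r k" unfolding power2_eq_square by (rule PS_mult[OF al al]) simp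
  have ab: "(\<lambda>t. 2 * alpha A B tau t * beta G t) \<in> PS (d+1) r k"
    by (rule PS_mult[OF PS_scale[OF al] be]) simp
  have f0: "\<phi> 0 \<in> PS p r k" "deriv (\<phi> 0) \<in> PS (p-1) r k" "deriv (deriv (\<phi> 0)) \<in> PS (p-2) r k"
    and f1: "\<phi> 1 \<in> PS (p-d) r k" "deriv (\<phi> 1) \<in> PS (p-d-1) r k" and f2: "\<phi> 2 \<in> PS (p-2*d) r k"
    unfolding \<phi>_def
    by (rule PS_mono[OF gphi_PS(1)[OF d1]] PS_mono[OF gphi_PS(2)[OF d1]] PS_mono[OF gphi_PS(3)[OF d1]]
        PS_mono[OF gphi_deriv_PS(1)[OF d1]] PS_mono[OF gphi_deriv_PS(2)[OF d1]] PS_mono[OF gphi_deriv_PS(3)[OF d1]]; simp)+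
  have g1: "(\<lambda>t. beta G t * deriv (\<phi> 0) t + alpha A B tau t * \<phi> 1 t) \<in> PS p r k"
    using p5 d1 by (intro PS_add PS_mult[OF be f0(2)] PS_mult[OF al f1(1)]) auto
  have g2: "(\<lambda>t. (beta G t)\<^sup>2 * deriv (deriv (\<phi> 0)) t + 2 * alpha A B tau t * beta G t * deriv (\<phi> 1) t + (alpha A B tau t)\<^sup>2 * \<phi> 2 t) \<in> PS p r k"
    using p5 d1 by (intro PS_add PS_mult[OF be2 f0(3)] PS_mult[OF ab f1(2)] PS_mult[OF al2 f2]) auto
  have "gc p r k A B tau i j s = (if s = 0 then \<phi> 0 else if s = 1 then (\<lambda>t. beta G t * deriv (\<phi> 0) t + alpha A B tau t * \<phi> 1 t)
     else (\<lambda>t. (beta G t)\<^sup>2 * deriv (deriv (\<phi> 0)) t + 2 * alpha A B tau t * beta G t * deriv (\<phi> 1) t + (alpha A B tau t)\<^sup>2 * \<phi> 2 t))"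
    by (auto simp: fun_eq_iff gc_def Let_def G_def \<phi>_def d_def)
  then show ?thesis using f0 g1 g2 by simp
qed

lemma gfun_MT:
  shows "gfun p r k A B tau i j = MT p r k (gc p r k A B tau i j)"
proof
  fix \<xi> :: pt
  have S: "MT p r k C \<xi> = M0 p r k (fst \<xi>) * C 0 (snd \<xi>) + M1 p r k (fst \<xi>) * C 1 (snd \<xi>) + M2 p r k (fst \<xi>) * C 2 (snd \<xi>)" for C
    by (simp add: MT_def MM_def numeral_2_eq_2 atMost_Suc)
  have dN: "deriv (\<lambda>t. c * Nsp (p-d) (r+1) k j t) x = c * deriv (Nsp (p-d) (r+1) k j) x" if "d \<le> 1" for c d x
    using Nsp_PS[of k "r+1" "p-d" j] rp(4)[OF that] by (intro DERIV_imp_deriv DERIV_cmult PS_DERIV) auto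
  show "gfun p r k A B tau i j \<xi> = MT p r k (gc p r k A B tau i j) \<xi>"
    unfolding S gfun_def gc_def gphi_def Let_def
    using dN[OF dal_le, of "real p / hh k" A B] by (simp add: deriv_zero_fun algebra_simps)
qed

lemma gfun_TS: "bilinear_map A \<Longrightarrow> bilinear_map B \<Longrightarrow> gfun p r k A B tau i j \<in> TS p r k"
  unfolding gfun_MT by (intro MT_TS gc_PS)

lemma gphi_van0:
  assumes "d \<le> 1" "m \<le> 2"
  shows "van0 k (i + j - m) (gphi p r k d i j m)"
proof (cases "m = i")
  case False then show ?thesis by (simp add: gphi_def van0_zero)
next
  case True
  have "i = 0 \<or> i = 1 \<or> i = 2" using True assms by auto
  then show ?thesis
  proof (elim disjE)
    assume "i = 0" then show ?thesis using True Nsp_van0[OF rp(3), of j] by (simp add: gphi_def)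
  next
    assume "i = 1" then show ?thesis using True van0_scale[OF Nsp_van0[OF rp(4)[OF assms(1)], of j], of "real p / hh k"] by (simp add: gphi_def)
  next
    assume "i = 2" then show ?thesis
      using True van0_scale[OF Nsp_van0[OF rp(5)[OF assms(1)], of j], of "real p * (real p - 1) / (hh k)\<^sup>2"] by (simp add: gphi_def)
  qed
qed

lemma gphi_van1:
  assumes "d = dal A B" "j < nE p r k A B i" "m \<le> 2"
  shows "van1 k (nE p r k A B i - 1 - j + i - m) (gphi p r k d i j m)"
proof (cases "m = i")
  case False then show ?thesis by (simp add: gphi_def van1_zero)
next
  case True
  have d1: "d \<le> 1" using dal_le assms by simp
  have "i = 0 \<or> i = 1 \<or> i = 2" using True assms by auto
  then show ?thesis
  proof (elim disjE)
    assume "i = 0" then show ?thesis using True assms(2) Nsp_van1[OF rp(3), of j] by (simp add: gphi_def nE_def Let_def assms(1))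
  next
    assume "i = 1" then show ?thesis
      using True assms(2) van1_scale[OF Nsp_van1[OF rp(4)[OF d1], of j], of "real p / hh k"] by (simp add: gphi_def nE_def Let_def assms(1))
  next
    assume "i = 2" then show ?thesis
      using True assms(2) van1_scale[OF Nsp_van1[OF rp(5)[OF d1], of j], of "real p * (real p - 1) / (hh k)\<^sup>2"]
      by (simp add: gphi_def nE_def Let_def assms(1))
  qed
qed

text \<open>The trace function with number m enters the coefficient of order s with at most s - m
  derivatives and with polynomial factors, so of its order i + j - m at least i + j - s remains,
  whatever m is.\<close>

lemma gc_van0:
  assumes "bilinear_map A" "bilinear_map B" "s \<le> 2"
  shows "van0 k (i + j - s) (gc p r k A B tau i j s)"
proof -
  define G where "G = (if tau then A else B)"
  define d where "d = dal A B"
  define \<phi> where "\<phi> = gphi p r k d i j"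
  have d1: "d \<le> 1" using dal_le by (simp add: d_def)
  have bG: "bilinear_map G" using assms by (simp add: G_def)
  obtain be al where be: "beta G = poly be" and al: "alpha A B tau = poly al"
    using beta_affine[OF bG] alpha_affine[OF assms(1,2)] by (metis ext)
  have v: "van0 k (i + j - m) (\<phi> m)" if "m \<le> 2" for m unfolding \<phi>_def by (rule gphi_van0[OF d1 that])
  have v0: "van0 k (i+j) (\<phi> 0)" "van0 k (i+j-1) (deriv (\<phi> 0))" "van0 k (i+j-1-1) (deriv (deriv (\<phi> 0)))"
    "van0 k (i+j-1) (\<phi> 1)" "van0 k (i+j-1-1) (deriv (\<phi> 1))" "van0 k (i+j-2) (\<phi> 2)"
    using v[of 0] v[of 1] v[of 2] van0_deriv'[OF van0_deriv'[OF v[of 0]]] van0_deriv'[OF v[of 0]] van0_deriv'[OF v[of 1]] by simp_all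
  have e: "i + j - 1 - 1 = i + j - 2" by simp
  have g1: "van0 k (i+j-1) (\<lambda>t. poly be t * deriv (\<phi> 0) t + poly al t * \<phi> 1 t)"
    by (intro van0_add van0_poly_mult v0)
  have g2: "van0 k (i+j-2) (\<lambda>t. poly (be^2) t * deriv (deriv (\<phi> 0)) t + poly (smult 2 (al * be)) t * deriv (\<phi> 1) t + poly (al^2) t * \<phi> 2 t)"
    using v0(3,5) unfolding e by (intro van0_add van0_poly_mult v0) auto
  have "gc p r k A B tau i j s = (if s = 0 then \<phi> 0 else if s = 1 then (\<lambda>t. poly be t * deriv (\<phi> 0) t + poly al t * \<phi> 1 t)
     else (\<lambda>t. poly (be^2) t * deriv (deriv (\<phi> 0)) t + poly (smult 2 (al * be)) t * deriv (\<phi> 1) t + poly (al^2) t * \<phi> 2 t))"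
    by (auto simp: fun_eq_iff gc_def Let_def G_def[symmetric] \<phi>_def d_def be al)
  moreover have "s = 0 \<or> s = 1 \<or> s = 2" using assms(3) by auto
  ultimately show ?thesis using v0(1) g1 g2 by auto
qed

text \<open>The same count from the other end, with n_i - 1 - j in place of j.\<close>

lemma gc_van1:
  assumes "bilinear_map A" "bilinear_map B" "s \<le> 2" "j < nE p r k A B i"
  shows "van1 k (nE p r k A B i - 1 - j + i - s) (gc p r k A B tau i j s)"
proof -
  define G where "G = (if tau then A else B)"
  define d where "d = dal A B"
  define \<phi> where "\<phi> = gphi p r k d i j"
  define e where "e = nE p r k A B i - 1 - j + i"
  have d1: "d \<le> 1" using dal_le by (simp add: d_def)
  have bG: "bilinear_map G" using assms by (simp add: G_def)
  obtain be al where be: "beta G = poly be" and al: "alpha A B tau = poly al"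
    using beta_affine[OF bG] alpha_affine[OF assms(1,2)] by (metis ext)
  have v: "van1 k (e - m) (\<phi> m)" if "m \<le> 2" for m unfolding \<phi>_def e_def by (rule gphi_van1[OF d_def assms(4) that])
  have w0: "van1 k e (\<phi> 0)" and w1: "van1 k (e-1) (\<phi> 1)" and w2: "van1 k (e-2) (\<phi> 2)" using v[of 0] v[of 1] v[of 2] by auto
  have x0: "van1 k (e-1) (deriv (\<phi> 0))"
    using w0 unfolding \<phi>_def by (intro van1_deriv'[OF gphi_PS(1)[OF d1]]) auto
  have x1: "van1 k (e-1-1) (deriv (deriv (\<phi> 0)))"
    using x0 unfolding \<phi>_def by (intro van1_deriv'[OF gphi_deriv_PS(1)[OF d1]]) auto
  have x2: "van1 k (e-1-1) (deriv (\<phi> 1))"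
    using w1 unfolding \<phi>_def by (intro van1_deriv'[OF gphi_PS(2)[OF d1]]) auto
  have ee: "e - 1 - 1 = e - 2" by simp
  have g1: "van1 k (e-1) (\<lambda>t. poly be t * deriv (\<phi> 0) t + poly al t * \<phi> 1 t)"
    by (intro van1_add van1_poly_mult x0 w1)
  have g2: "van1 k (e-2) (\<lambda>t. poly (be^2) t * deriv (deriv (\<phi> 0)) t + poly (smult 2 (al * be)) t * deriv (\<phi> 1) t + poly (al^2) t * \<phi> 2 t)"
    using x1 x2 unfolding ee by (intro van1_add van1_poly_mult w2) auto
  have "gc p r k A B tau i j s = (if s = 0 then \<phi> 0 else if s = 1 then (\<lambda>t. poly be t * deriv (\<phi> 0) t + poly al t * \<phi> 1 t)
     else (\<lambda>t. poly (be^2) t * deriv (deriv (\<phi> 0)) t + poly (smult 2 (al * be)) t * deriv (\<phi> 1) t + poly (al^2) t * \<phi> 2 t))"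
    by (auto simp: fun_eq_iff gc_def Let_def G_def[symmetric] \<phi>_def d_def be al)
  moreover have "s = 0 \<or> s = 1 \<or> s = 2" using assms(3) by auto
  ultimately show ?thesis using w0 g1 g2 unfolding e_def[symmetric] by auto
qed

text \<open>With the tangent T = (tx, ty) and n = (ty, -tx), the transversal direction of either
  patch is \<beta> T + (abar / L) n. In this frame the physical jet is written in terms of \<kappa>
  and the common trace functions, so it cannot distinguish the two patches.\<close>

lemma edge_jets:
  assumes "bilinear_map A" "bilinear_map B" "\<And>t. t \<in> {0..1} \<Longrightarrow> A (0,t) = B (0,t)" "pd2v A (0,t) \<noteq> 0"
  shows "\<exists>J. jetat A (gfun p r k A B True i j) (0,t) J \<and> jetat B (gfun p r k A B False i j) (0,t) J"
proof -
  define tx ty where "tx = fst (pd2v A (0,t))" and "ty = snd (pd2v A (0,t))"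
  define L where "L = tx * tx + ty * ty"
  have L0: "L \<noteq> 0" using assms(4) by (auto simp: L_def tx_def ty_def sum_squares_eq_zero_iff prod_eq_iff)
  define \<phi> where "\<phi> = gphi p r k (dal A B) i j"
  define X where "X = deriv (\<phi> 0) t / L"
  define Y where "Y = deriv (deriv (\<phi> 0)) t / (L * L)"
  define Z where "Z = deriv (\<phi> 1) t / L"
  define \<kappa> where "\<kappa> = c1 A B"
  define v1 where "v1 = \<phi> 1 t"
  define v2 where "v2 = \<phi> 2 t"
  \<comment> \<open>Gradient X T + \<kappa> v1 n, Hessian Y T T^t + \<kappa> Z (T n^t + n T^t) +
    \<kappa>^2 v2 n n^t.\<close>
  define J where "J = (\<phi> 0 t, X * tx + \<kappa> * v1 * ty, X * ty - \<kappa> * v1 * tx,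
     Y * tx * tx + 2 * \<kappa> * Z * tx * ty + \<kappa> * \<kappa> * v2 * ty * ty,
     Y * tx * ty + \<kappa> * Z * (ty * ty - tx * tx) - \<kappa> * \<kappa> * v2 * tx * ty,
     Y * ty * ty - 2 * \<kappa> * Z * tx * ty + \<kappa> * \<kappa> * v2 * tx * tx)"
  have XYZ: "deriv (\<phi> 0) t = X * L" "deriv (deriv (\<phi> 0)) t = Y * (L * L)" "deriv (\<phi> 1) t = Z * L"
    using L0 by (simp_all add: X_def Y_def Z_def)
  have "jetat G (gfun p r k A B tau i j) (0,t) J" if G: "G = (if tau then A else B)" for tau G
  proof -
    have bG: "bilinear_map G" using assms that by simp
    have e: "pd2v G (0,s) = pd2v A (0,s)" for s using common_edge_direction[OF assms(1-3)] that by (cases tau) auto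
    have e2: "pd2v G (0,s) = pd2v G (0,t)" for s using pd_affine(2)[OF bG, of "(0,s)" "(0,t)"] by simp
    define a b where "a = fst (pd1v G (0,t))" and "b = snd (pd1v G (0,t))"
    define e1 e2 where "e1 = fst (tw G)" and "e2 = snd (tw G)"
    have p2: "pd2v G (0,s) = (tx, ty)" for s using e[of t] \<open>\<And>s. pd2v G (0,s) = pd2v G (0,t)\<close> by (simp add: tx_def ty_def)
    have p1: "pd1v G (0,s) = (a + (s - t) * e1, b + (s - t) * e2)" for s
      using pd_affine(1)[OF bG, of "(0,s)" "(0,t)"] by (simp add: prod_eq_iff a_def b_def e1_def e2_def)
    have nL: "(norm (tx, ty))\<^sup>2 = L" by (simp add: norm_Pair L_def power2_eq_square)
    have be: "beta G s = ((a * tx + b * ty) + (s - t) * (e1 * tx + e2 * ty)) / L" for s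
      unfolding beta_def p1 p2 nL by (simp add: algebra_simps)
    have al: "alpha A B tau s = \<kappa> * ((a * ty - b * tx) + (s - t) * (e1 * ty - e2 * tx))" for s
      unfolding alpha_def abar_def G[symmetric] p1 p2 \<kappa>_def by (simp add: det2_def algebra_simps)
    have C: "\<And>s. s \<le> 2 \<Longrightarrow> gc p r k A B tau i j s \<in> PS p r k" by (rule gc_PS[OF assms(1,2)])
    have c0: "gc p r k A B tau i j 0 = \<phi> 0"
      and c1: "gc p r k A B tau i j 1 = (\<lambda>s. beta G s * deriv (\<phi> 0) s + alpha A B tau s * \<phi> 1 s)"
      and c2: "gc p r k A B tau i j 2 t = (beta G t)\<^sup>2 * deriv (deriv (\<phi> 0)) t + 2 * alpha A B tau t * beta G t * deriv (\<phi> 1) t + (alpha A B tau t)\<^sup>2 * \<phi> 2 t"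
      by (auto simp: fun_eq_iff gc_def Let_def G \<phi>_def)
    have D0: "(deriv (\<phi> 0) has_real_derivative deriv (deriv (\<phi> 0)) t) (at t)"
      unfolding \<phi>_def by (rule PS_DERIV[OF gphi_deriv_PS(1)[OF dal_le]]) simp
    have D1: "(\<phi> 1 has_real_derivative deriv (\<phi> 1) t) (at t)"
      unfolding \<phi>_def by (rule PS_DERIV[OF gphi_PS(2)[OF dal_le]]) simp
    have "deriv (gc p r k A B tau i j 1) t = (e1 * tx + e2 * ty) / L * deriv (\<phi> 0) t + beta G t * deriv (deriv (\<phi> 0)) t
        + (\<kappa> * (e1 * ty - e2 * tx) * \<phi> 1 t + alpha A B tau t * deriv (\<phi> 1) t)"
    proof (rule DERIV_imp_deriv)
      have db: "(beta G has_real_derivative (e1 * tx + e2 * ty) / L) (at t)"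
        unfolding be[abs_def] using L0 by (auto intro!: derivative_eq_intros)
      have da: "(alpha A B tau has_real_derivative \<kappa> * (e1 * ty - e2 * tx)) (at t)"
        unfolding al[abs_def] by (auto intro!: derivative_eq_intros)
      show "(gc p r k A B tau i j 1 has_real_derivative (e1 * tx + e2 * ty) / L * deriv (\<phi> 0) t + beta G t * deriv (deriv (\<phi> 0)) t
        + (\<kappa> * (e1 * ty - e2 * tx) * \<phi> 1 t + alpha A B tau t * deriv (\<phi> 1) t)) (at t)"
        unfolding c1 by (rule DERIV_cong[OF DERIV_add[OF DERIV_mult[OF db D0] DERIV_mult[OF da D1]]]) simp
    qed
    then have d11: "deriv (gc p r k A B tau i j 1) t = (e1 * tx + e2 * ty) * X + (a * tx + b * ty) * Y * L
        + (\<kappa> * (e1 * ty - e2 * tx) * v1 + \<kappa> * (a * ty - b * tx) * (Z * L))"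
      unfolding XYZ be al v1_def using L0 by simp
    have d10: "gc p r k A B tau i j 1 t = (a * tx + b * ty) * X + \<kappa> * (a * ty - b * tx) * v1"
      unfolding c1 XYZ be al v1_def using L0 by simp
    have d20: "gc p r k A B tau i j 2 t = (a * tx + b * ty)\<^sup>2 * Y + 2 * (\<kappa> * (a * ty - b * tx)) * (a * tx + b * ty) * Z + (\<kappa> * (a * ty - b * tx))\<^sup>2 * v2"
      unfolding c2 XYZ be al v2_def using L0 by (simp add: power2_eq_square field_simps)
    have dM: "dpart m n (MT p r k (gc p r k A B tau i j)) (0,t) = (deriv ^^ n) (gc p r k A B tau i j m) t" if "m \<le> 2" "n \<le> 2" for m n
      by (rule dpart_MT_0) (use C that in auto)
    have f: "gfun p r k A B tau i j (0,t) = \<phi> 0 t" "dpart 1 0 (gfun p r k A B tau i j) (0,t) = gc p r k A B tau i j 1 t"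
       "dpart 0 1 (gfun p r k A B tau i j) (0,t) = X * L" "dpart 2 0 (gfun p r k A B tau i j) (0,t) = gc p r k A B tau i j 2 t"
       "dpart 1 1 (gfun p r k A B tau i j) (0,t) = deriv (gc p r k A B tau i j 1) t" "dpart 0 2 (gfun p r k A B tau i j) (0,t) = Y * (L * L)"
      unfolding gfun_MT using dM[of 0 0] dM[of 1 0] dM[of 0 1] dM[of 2 0] dM[of 1 1] dM[of 0 2] XYZ
      by (simp_all add: c0 dpart_def[of 0 0] numeral_2_eq_2)
    \<comment> \<open>In the mixed derivative, the slopes of \<alpha> and \<beta> along the edge
      account exactly for the twist terms of the chain rule.\<close>
    show ?thesis
      unfolding jetat_def J_def prod.case Let_def f d10 d11 d20 p2 a_def[symmetric] b_def[symmetric] e1_def[symmetric] e2_def[symmetric] fst_conv snd_conv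
      by (intro conjI) (simp_all add: L_def power2_eq_square algebra_simps)
  qed
  from this[of A True] this[of B False]
  have "jetat A (gfun p r k A B True i j) (0,t) J" "jetat B (gfun p r k A B False i j) (0,t) J" by simp_all
  then show ?thesis by blast
qed

end

section \<open>Patch and edge functions on the domain\<close>

text \<open>The chain rule is an invertible linear system. At points in the interior of one patch
  this alone provides the jet.\<close>

lemma jetat_exists:
  assumes "jdet G \<xi> \<noteq> 0"
  shows "\<exists>J. jetat G \<phi> \<xi> J"
proof -
  define a b c d where "a = fst (pd1v G \<xi>)" and "b = snd (pd1v G \<xi>)" and "c = fst (pd2v G \<xi>)" and "d = snd (pd2v G \<xi>)"
  define D where "D = a * d - b * c"
  have D: "D \<noteq> 0" using assms by (simp add: D_def jdet_def det2_def a_def b_def c_def d_def)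
  define x y where "x = dpart 1 0 \<phi> \<xi> / D" and "y = dpart 0 1 \<phi> \<xi> / D"
  define g1 g2 where "g1 = x * d - y * b" and "g2 = y * a - x * c"
  define u v w where "u = dpart 2 0 \<phi> \<xi> / (D * D)" and "v = (dpart 1 1 \<phi> \<xi> - g1 * fst (tw G) - g2 * snd (tw G)) / (D * D)"
    and "w = dpart 0 2 \<phi> \<xi> / (D * D)"
  have e: "dpart 1 0 \<phi> \<xi> = x * D" "dpart 0 1 \<phi> \<xi> = y * D" "dpart 2 0 \<phi> \<xi> = u * (D * D)"
    "dpart 1 1 \<phi> \<xi> = v * (D * D) + g1 * fst (tw G) + g2 * snd (tw G)" "dpart 0 2 \<phi> \<xi> = w * (D * D)"
    using D by (simp_all add: x_def y_def u_def v_def w_def)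
  have "jetat G \<phi> \<xi> (\<phi> \<xi>, g1, g2, u * d * d - 2 * v * b * d + w * b * b,
     - u * c * d + v * (a * d + b * c) - w * a * b, u * c * c - 2 * v * a * c + w * a * a)"
    unfolding jetat_def prod.case Let_def e a_def[symmetric] b_def[symmetric] c_def[symmetric] d_def[symmetric]
    by (intro conjI) (simp_all add: g1_def g2_def D_def algebra_simps)
  then show ?thesis by blast
qed

lemma jetat_value: "jetat G \<phi> \<xi> J \<Longrightarrow> \<phi> \<xi> = fst J"
  unfolding jetat_def by (auto simp: Let_def split: prod.splits)

lemma jetat_0_zj:
  assumes "jetat G \<phi> \<xi> 0"
  shows "zj \<phi> \<xi>"
  unfolding zj_def
proof (intro allI impI)
  fix i j :: nat assume "i + j \<le> 2"
  then have "(i = 0 \<and> j = 0) \<or> (i = 1 \<and> j = 0) \<or> (i = 0 \<and> j = 1) \<or> (i = 2 \<and> j = 0) \<or> (i = 1 \<and> j = 1) \<or> (i = 0 \<and> j = 2)" by auto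
  moreover have "dpart 0 0 \<phi> \<xi> = \<phi> \<xi>" by (simp add: dpart_def)
  ultimately show "dpart i j \<phi> \<xi> = 0" using assms by (auto simp: jetat_def zero_prod_def Let_def)
qed

text \<open>An interior parameter, a jet shared by all patches at the point (meant for vertices) and
  a jet shared by two patches covering a neighbourhood (meant for edges) each yield J with x in the
  interior. If none of these occurs at any preimage of x, all jets there are zero and J = 0 serves,
  without any condition on x; hence the argument by contradiction.\<close>

lemma jets_common:
  assumes "\<And>i. i \<in> I \<Longrightarrow> patch (G i)"
    and dis: "\<And>i j. i \<in> I \<Longrightarrow> j \<in> I \<Longrightarrow> i \<noteq> j \<Longrightarrow> interior (G i ` unitsq) \<inter> interior (G j ` unitsq) = {}"
    and cases: "\<And>i \<xi>. i \<in> I \<Longrightarrow> \<xi> \<in> unitsq \<Longrightarrow> \<xi> \<in> opensq \<or> zj (\<phi> i) \<xi>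
      \<or> (\<exists>J. (\<forall>j\<in>I. \<forall>\<eta>\<in>unitsq. G j \<eta> = G i \<xi> \<longrightarrow> jetat (G j) (\<phi> j) \<eta> J) \<and> G i \<xi> \<in> interior (\<Union>i\<in>I. G i ` unitsq))
      \<or> (\<exists>i'\<in>I. \<exists>\<xi>'\<in>unitsq. \<exists>J. i' \<noteq> i \<and> G i' \<xi>' = G i \<xi> \<and> jetat (G i) (\<phi> i) \<xi> J \<and> jetat (G i') (\<phi> i') \<xi>' J
           \<and> G i \<xi> \<in> interior (G i ` unitsq \<union> G i' ` unitsq))"
    and x: "x \<in> (\<Union>i\<in>I. G i ` unitsq)"
  shows "\<exists>J. (\<forall>i\<in>I. \<forall>\<xi>\<in>unitsq. G i \<xi> = x \<longrightarrow> jetat (G i) (\<phi> i) \<xi> J) \<and> (J \<noteq> 0 \<longrightarrow> x \<in> interior (\<Union>i\<in>I. G i ` unitsq))"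
proof (rule ccontr)
  assume neg: "\<not> ?thesis"
  have inj: "\<xi> = \<eta>" if "i \<in> I" "\<xi> \<in> unitsq" "\<eta> \<in> unitsq" "G i \<xi> = G i \<eta>" for i \<xi> \<eta>
    using assms(1)[OF that(1)] that unfolding patch_def by (meson inj_onD)
  have "zj (\<phi> i) \<xi>" if i: "i \<in> I" "\<xi> \<in> unitsq" "G i \<xi> = x" for i \<xi>
  proof (rule ccontr)
    assume nz: "\<not> zj (\<phi> i) \<xi>"
    have nC: "\<not> (\<exists>J. (\<forall>j\<in>I. \<forall>\<eta>\<in>unitsq. G j \<eta> = G i \<xi> \<longrightarrow> jetat (G j) (\<phi> j) \<eta> J) \<and> G i \<xi> \<in> interior (\<Union>i\<in>I. G i ` unitsq))"
      using neg i(3) by blast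
    from cases[OF i(1,2)] nz nC consider (A) "\<xi> \<in> opensq"
      | (C) i' \<xi>' J where "i' \<in> I" "\<xi>' \<in> unitsq" "i' \<noteq> i" "G i' \<xi>' = G i \<xi>" "jetat (G i) (\<phi> i) \<xi> J" "jetat (G i') (\<phi> i') \<xi>' J"
           "G i \<xi> \<in> interior (G i ` unitsq \<union> G i' ` unitsq)" by blast
    then show False
    proof cases
      case A
      have xi: "x \<in> interior (G i ` unitsq)" using patch_interior[OF assms(1)[OF i(1)] A] i(3) by simp
      have "jdet (G i) \<xi> \<noteq> 0" using assms(1)[OF i(1)] i(2) by (simp add: patch_def)
      then obtain J where J: "jetat (G i) (\<phi> i) \<xi> J" using jetat_exists by blast
      have "jetat (G j) (\<phi> j) \<eta> J" if j: "j \<in> I" "\<eta> \<in> unitsq" "G j \<eta> = x" for j \<eta>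
      proof (cases "j = i")
        case True then show ?thesis using inj[OF i(1) i(2), of \<eta>] i(3) j J by auto
      next
        case False
        have "interior (G i ` unitsq) \<inter> G j ` unitsq = {}"
          using interior_disjoint_patch[OF assms(1)[OF j(1)] open_interior dis[OF i(1) j(1)]] False by auto
        then show ?thesis using xi j by blast
      qed
      moreover have "x \<in> interior (\<Union>i\<in>I. G i ` unitsq)"
        using xi i(1) interior_mono[of "G i ` unitsq" "\<Union>i\<in>I. G i ` unitsq"] by blast
      ultimately show False using neg by blast
    next
      case (C i' \<xi>' J)
      have "jetat (G j) (\<phi> j) \<eta> J" if j: "j \<in> I" "\<eta> \<in> unitsq" "G j \<eta> = x" for j \<eta>
      proof -
        have "j = i \<or> j = i'"
        proof (rule ccontr)
          assume "\<not> (j = i \<or> j = i')"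
          then have ne: "j \<noteq> i" "j \<noteq> i'" by auto
          have "x \<in> G j ` unitsq" using j by blast
          then show False
            using three_patches[OF assms(1)[OF i(1)] assms(1)[OF C(1)] assms(1)[OF j(1)], of x] C(7) i(3) dis[OF j(1) i(1) ne(1)] dis[OF j(1) C(1) ne(2)] by auto
        qed
        then show ?thesis
        proof
          assume "j = i" then show ?thesis using inj[OF i(1) i(2), of \<eta>] i(3) j C by auto
        next
          assume "j = i'" then show ?thesis using inj[OF C(1,2), of \<eta>] i(3) j C by auto
        qed
      qed
      moreover have "x \<in> interior (\<Union>i\<in>I. G i ` unitsq)"
        using C(1,7) i(1,3) interior_mono[of "G i ` unitsq \<union> G i' ` unitsq" "\<Union>i\<in>I. G i ` unitsq"] by blast
      ultimately show False using neg by blast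
    qed
  qed
  then have "\<forall>i\<in>I. \<forall>\<xi>\<in>unitsq. G i \<xi> = x \<longrightarrow> jetat (G i) (\<phi> i) \<xi> 0" using jetat_zj by blast
  then show False using neg by blast
qed

text \<open>The right and top sides are kept whole, corners included, because functions attached to
  the corner (0,0) or to the left side have zero jets there.\<close>

lemma square_cases:
  assumes "\<xi> \<in> unitsq"
  obtains "\<xi> \<in> opensq" | y where "\<xi> = (1, y)" "y \<in> {0..1}" | x where "\<xi> = (x, 1)" "x \<in> {0..1}" | "\<xi> = (0,0)"
    | t where "\<xi> = (0, t)" "0 < t" "t < 1" | t where "\<xi> = (t, 0)" "0 < t" "t < 1"
proof (cases \<xi>)
  case (Pair x y)
  have r: "0 \<le> x" "x \<le> 1" "0 \<le> y" "y \<le> 1" using assms Pair by (auto simp: unitsq_def)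
  consider "x = 1" | "y = 1" | "x = 0 \<and> y = 0" | "x = 0 \<and> 0 < y \<and> y < 1" | "y = 0 \<and> 0 < x \<and> x < 1" | "0 < x \<and> x < 1 \<and> 0 < y \<and> y < 1"
    using r by linarith
  then show ?thesis
    by cases (use that r Pair in \<open>auto simp: opensq_def\<close>)
qed

text \<open>These properties pass to linear combinations and imply membership in V_0h, so that only
  the generators have to be examined.\<close>

definition nice :: "nat \<Rightarrow> nat \<Rightarrow> nat \<Rightarrow> nat \<Rightarrow> (nat \<Rightarrow> pt \<Rightarrow> pt) \<Rightarrow> (pt \<Rightarrow> real) \<Rightarrow> bool" where
  "nice p r k P F f \<longleftrightarrow> C2plane f \<and> (\<forall>x. x \<notin> dom P F \<longrightarrow> f x = 0) \<and> (\<forall>l\<in>{1..P}. \<exists>\<phi>\<in>TS p r k. \<forall>\<xi>\<in>unitsq. f (F l \<xi>) = \<phi> \<xi>)"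

lemma nice_sum:
  assumes "finite S" "\<And>s. s \<in> S \<Longrightarrow> nice p r k P F (f s)"
  shows "nice p r k P F (\<lambda>x. \<Sum>s\<in>S. c s * f s x)"
  unfolding nice_def
proof (intro conjI allI impI ballI)
  show "C2plane (\<lambda>x. \<Sum>s\<in>S. c s * f s x)" using assms by (intro C2plane_sum) (auto simp: nice_def)
  fix x assume "x \<notin> dom P F"
  then have "\<forall>s\<in>S. f s x = 0" using assms(2) unfolding nice_def by blast
  then show "(\<Sum>s\<in>S. c s * f s x) = 0" by simp
next
  fix l assume l: "l \<in> {1..P}"
  have "\<forall>s\<in>S. \<exists>\<phi>. \<phi> \<in> TS p r k \<and> (\<forall>\<xi>\<in>unitsq. f s (F l \<xi>) = \<phi> \<xi>)" using assms(2) l unfolding nice_def by blast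
  then obtain \<phi> where \<phi>: "\<And>s. s \<in> S \<Longrightarrow> \<phi> s \<in> TS p r k" "\<And>s \<xi>. s \<in> S \<Longrightarrow> \<xi> \<in> unitsq \<Longrightarrow> f s (F l \<xi>) = \<phi> s \<xi>"
    by (metis bchoice)
  show "\<exists>\<phi>\<in>TS p r k. \<forall>\<xi>\<in>unitsq. (\<Sum>s\<in>S. c s * f s (F l \<xi>)) = \<phi> \<xi>"
    by (rule bexI[of _ "\<lambda>\<xi>. \<Sum>s\<in>S. c s * \<phi> s \<xi>"]) (use \<phi> assms(1) in \<open>auto intro!: TS_sum TS_cmul\<close>)
qed

lemma nice_V0h:
  assumes "multipatch P F" "k \<ge> 1 \<longrightarrow> r < p" "nice p r k P F f"
  shows "f \<in> V0h p r k P F"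
proof (rule V0hI[OF assms(1)])
  fix l assume "l \<in> {1..P}"
  then obtain \<phi> where "\<phi> \<in> TS p r k" "\<forall>\<xi>\<in>unitsq. f (F l \<xi>) = \<phi> \<xi>" using assms(3) unfolding nice_def by blast
  then show "inS2 p r k (f \<circ> F l)" using TS_inS2[OF assms(2), of \<phi> "f \<circ> F l"] by simp
qed (use assms(3) in \<open>auto simp: nice_def\<close>)

context c2_spline
begin

lemma patchwise_nice:
  assumes mp: "multipatch P F"
    and I: "finite I" "inj_on L I" "\<And>i. i \<in> I \<Longrightarrow> L i \<in> {1..P}" "\<And>i. i \<in> I \<Longrightarrow> psi i \<in> sqsym"
    and G: "\<And>i. i \<in> I \<Longrightarrow> G i = F (L i) \<circ> psi i"
    and \<phi>: "\<And>i. i \<in> I \<Longrightarrow> \<phi> i \<in> TS p r k"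
    and f: "\<And>i \<xi>. i \<in> I \<Longrightarrow> \<xi> \<in> unitsq \<Longrightarrow> f (G i \<xi>) = \<phi> i \<xi>"
    and f0: "\<And>x. x \<notin> (\<Union>i\<in>I. G i ` unitsq) \<Longrightarrow> f x = 0"
    and J: "\<And>x. x \<in> (\<Union>i\<in>I. G i ` unitsq) \<Longrightarrow> \<exists>J. (\<forall>i\<in>I. \<forall>\<xi>\<in>unitsq. G i \<xi> = x \<longrightarrow> jetat (G i) (\<phi> i) \<xi> J) \<and> (J \<noteq> 0 \<longrightarrow> x \<in> interior (\<Union>i\<in>I. G i ` unitsq))"
  shows "nice p r k P F f"
proof -
  have im: "G i ` unitsq = F (L i) ` unitsq" if "i \<in> I" for i
    unfolding G[OF that] by (rule image_sqsym[OF I(4)[OF that]])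
  have U: "(\<Union>i\<in>I. G i ` unitsq) = (\<Union>i\<in>I. F (L i) ` unitsq)" by (rule SUP_cong[OF refl im])
  show ?thesis unfolding nice_def
  proof (rule patchwise_C2plane[OF mp I \<phi>])
    show "f (F (L i) (psi i \<xi>)) = \<phi> i \<xi>" if "i \<in> I" "\<xi> \<in> unitsq" for i \<xi> using f[OF that] G[OF that(1)] by simp
    show "f x = 0" if "x \<notin> (\<Union>i\<in>I. F (L i) ` unitsq)" for x using f0[unfolded U, OF that] .
    show "\<exists>J. (\<forall>i\<in>I. \<forall>\<xi>\<in>unitsq. (F (L i) \<circ> psi i) \<xi> = x \<longrightarrow> jetat (F (L i) \<circ> psi i) (\<phi> i) \<xi> J) \<and> (J \<noteq> 0 \<longrightarrow> x \<in> interior (\<Union>i\<in>I. F (L i) ` unitsq))"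
      if x: "x \<in> (\<Union>i\<in>I. F (L i) ` unitsq)" for x
    proof -
      obtain J where J: "\<forall>i\<in>I. \<forall>\<xi>\<in>unitsq. G i \<xi> = x \<longrightarrow> jetat (G i) (\<phi> i) \<xi> J" "J \<noteq> 0 \<longrightarrow> x \<in> interior (\<Union>i\<in>I. F (L i) ` unitsq)"
        using J[unfolded U, OF x] by blast
      have "\<forall>i\<in>I. \<forall>\<xi>\<in>unitsq. (F (L i) \<circ> psi i) \<xi> = x \<longrightarrow> jetat (F (L i) \<circ> psi i) (\<phi> i) \<xi> J"
      proof (intro ballI impI)
        fix i \<xi> assume a: "i \<in> I" "\<xi> \<in> unitsq" "(F (L i) \<circ> psi i) \<xi> = x"
        then show "jetat (F (L i) \<circ> psi i) (\<phi> i) \<xi> J" using J(1) unfolding G[OF a(1), symmetric] by blast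
      qed
      with J(2) show ?thesis by blast
    qed
  qed
qed

lemma G_facts:
  assumes mp: "multipatch P F"
    and I: "inj_on L I" "\<And>i. i \<in> I \<Longrightarrow> L i \<in> {1..P}" "\<And>i. i \<in> I \<Longrightarrow> psi i \<in> sqsym"
    and G: "\<And>i. i \<in> I \<Longrightarrow> G i = F (L i) \<circ> psi i"
  shows "\<And>i. i \<in> I \<Longrightarrow> patch (G i)"
    "\<And>i j. i \<in> I \<Longrightarrow> j \<in> I \<Longrightarrow> i \<noteq> j \<Longrightarrow> interior (G i ` unitsq) \<inter> interior (G j ` unitsq) = {}"
proof -
  fix i assume i: "i \<in> I"
  show "patch (G i)" unfolding G[OF i] by (intro patch_sqsym multipatch_patch[OF mp I(2)] I(3) i)
  fix j assume j: "j \<in> I" "i \<noteq> j"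
  have "L i \<noteq> L j" using I(1) i j by (meson inj_onD)
  then show "interior (G i ` unitsq) \<inter> interior (G j ` unitsq) = {}"
    unfolding G[OF i] G[OF j(1)] image_sqsym[OF I(3)[OF i]] image_sqsym[OF I(3)[OF j(1)]]
    by (rule multipatch_disjoint[OF mp I(2)[OF i] I(2)[OF j(1)]])
qed

lemma Nprod_TS: "(\<lambda>\<xi>. Nsp p r k i (fst \<xi>) * Nsp p r k j (snd \<xi>)) \<in> TS p r k"
  using rp(1) by (intro TS_prod Nsp_PS) auto

lemma Nsp_flat:
  assumes "i \<in> {3..p + k*(p-r) - 3}" "m \<le> 2"
  shows "(deriv ^^ m) (Nsp p r k i) 0 = 0" "(deriv ^^ m) (Nsp p r k i) 1 = 0"
proof -
  have "van0 k 3 (Nsp p r k i)" using assms by (intro van0_mono[OF Nsp_van0[OF rp(1)]]) auto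
  then show "(deriv ^^ m) (Nsp p r k i) 0 = 0" using van0_jet assms(2) by blast
  have "i < dimS p r k" "3 \<le> dimS p r k - 1 - i" using assms dims(4) by (auto simp: dimS_def)
  then have "van1 k 3 (Nsp p r k i)" by (intro van1_mono[OF Nsp_van1[OF rp(1)]])
  then show "(deriv ^^ m) (Nsp p r k i) 1 = 0" using van1_jet[OF Nsp_PS[OF rp(1)] smooth] assms(2) by blast
qed

lemma Nprod_zj:
  assumes "i \<in> {3..p + k*(p-r) - 3}" "j \<in> {3..p + k*(p-r) - 3}" "\<xi> \<in> unitsq" "\<xi> \<notin> opensq"
  shows "zj (\<lambda>\<xi>. Nsp p r k i (fst \<xi>) * Nsp p r k j (snd \<xi>)) \<xi>"
  unfolding zj_def
proof (intro allI impI)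
  fix a b :: nat assume ab: "a + b \<le> 2"
  have "fst \<xi> = 0 \<or> fst \<xi> = 1 \<or> snd \<xi> = 0 \<or> snd \<xi> = 1"
    using assms(3,4) by (auto simp: unitsq_def opensq_def)
  then show "dpart a b (\<lambda>\<xi>. Nsp p r k i (fst \<xi>) * Nsp p r k j (snd \<xi>)) \<xi> = 0"
    using Nsp_flat[OF assms(1), of a] Nsp_flat[OF assms(2), of b] ab
    by (subst dpart_prod[OF Nsp_PS[OF rp(1)] Nsp_PS[OF rp(1)]]) auto
qed

lemma pfun_nice:
  assumes mp: "multipatch P F" and l: "l \<in> {1..P}"
    and ij: "i \<in> {3..p + k*(p-r) - 3}" "j \<in> {3..p + k*(p-r) - 3}"
  shows "nice p r k P F (pfun p r k (F l) i j)"
proof -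
  define \<phi> where "\<phi> = (\<lambda>\<xi>. Nsp p r k i (fst \<xi>) * Nsp p r k j (snd \<xi>))"
  have pt: "patch (F l)" by (rule multipatch_patch[OF mp l])
  have id: "(\<lambda>(x,y). (x,y)) \<in> sqsym" by (simp add: sqsym_def)
  show ?thesis
  proof (rule patchwise_nice[OF mp, where I="{l}" and L="\<lambda>l. l" and psi="\<lambda>_. (\<lambda>(x,y). (x,y))" and G=F and \<phi>="\<lambda>_. \<phi>"])
    show "\<phi> \<in> TS p r k" unfolding \<phi>_def by (rule Nprod_TS)
    have "pfun p r k (F l') i j (F l' \<xi>) = \<phi> \<xi>" if "l' \<in> {l}" "\<xi> \<in> unitsq" for l' \<xi>
      using that pt by (simp add: pfun_def \<phi>_def patch_def Let_def)
    then show "pfun p r k (F l) i j (F l' \<xi>) = \<phi> \<xi>" if "l' \<in> {l}" "\<xi> \<in> unitsq" for l' \<xi> using that by auto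
    show "pfun p r k (F l) i j x = 0" if "x \<notin> (\<Union>l'\<in>{l}. F l' ` unitsq)" for x using that by (simp add: pfun_def)
    show "\<exists>J. (\<forall>l'\<in>{l}. \<forall>\<xi>\<in>unitsq. F l' \<xi> = x \<longrightarrow> jetat (F l') \<phi> \<xi> J) \<and> (J \<noteq> 0 \<longrightarrow> x \<in> interior (\<Union>l'\<in>{l}. F l' ` unitsq))"
      if "x \<in> (\<Union>l'\<in>{l}. F l' ` unitsq)" for x
      by (rule jets_common[OF _ _ _ that]) (use pt Nprod_zj[OF ij] in \<open>auto simp: \<phi>_def\<close>)
  qed (use l id in \<open>auto simp: fun_eq_iff\<close>)
qed

text \<open>The range of j is made for this: i + j >= 5 and n_i - 1 - j + i >= 5 leave order at
  least 3 at both ends after up to two transversal derivatives.\<close>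

lemma gfun_zj:
  assumes "bilinear_map A" "bilinear_map B" "i \<le> 2" "j \<in> {5 - i .. nE p r k A B i + i - 6}"
  shows "zj (gfun p r k A B tau i j) (1, y)" "zj (gfun p r k A B tau i j) (x, 0)" "zj (gfun p r k A B tau i j) (x, 1)"
proof -
  have n: "8 \<le> nE p r k A B i" using dims(1) dims(2)[OF dal_le[of A B]] dims(3)[OF dal_le[of A B]] by (auto simp: nE_def Let_def)
  have C: "\<And>s. s \<le> 2 \<Longrightarrow> gc p r k A B tau i j s \<in> PS p r k" by (rule gc_PS[OF assms(1,2)])
  have v0: "van0 k 3 (gc p r k A B tau i j s)" if "s \<le> 2" for s
    using assms(3,4) that by (intro van0_mono[OF gc_van0[OF assms(1,2) that]]) auto
  have v1: "van1 k 3 (gc p r k A B tau i j s)" if "s \<le> 2" for s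
    using assms(3,4) that n by (intro van1_mono[OF gc_van1[OF assms(1,2) that]]) auto
  show "zj (gfun p r k A B tau i j) (1, y)" "zj (gfun p r k A B tau i j) (x, 0)" "zj (gfun p r k A B tau i j) (x, 1)"
    unfolding gfun_MT using zj_MT_right[OF C] zj_MT_bottom[OF C v0] zj_MT_top[OF C v1] by auto
qed

lemma patch_edge_nonzero:
  assumes "patch A" "t \<in> {0..1}"
  shows "pd2v A (0,t) \<noteq> 0"
proof
  assume "pd2v A (0,t) = 0"
  then have "jdet A (0,t) = 0" by (simp add: jdet_def det2_def)
  moreover have "(0,t) \<in> unitsq" using assms(2) by (simp add: unitsq_def)
  ultimately show False using assms(1) unfolding patch_def by blast
qed

lemma efun_jets:
  fixes A B :: "pt \<Rightarrow> pt"
  defines "G \<equiv> (\<lambda>tau. if tau then A else B)"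
  assumes A: "patch A" and B: "patch B" and e: "\<And>t. t \<in> {0..1} \<Longrightarrow> A (0,t) = B (0,t)"
    and dis: "interior (A ` unitsq) \<inter> interior (B ` unitsq) = {}"
    and ij: "i \<le> 2" "j \<in> {5 - i .. nE p r k A B i + i - 6}"
    and x: "x \<in> (\<Union>tau\<in>UNIV. G tau ` unitsq)"
  shows "\<exists>J. (\<forall>tau\<in>UNIV. \<forall>\<xi>\<in>unitsq. G tau \<xi> = x \<longrightarrow> jetat (G tau) (gfun p r k A B tau i j) \<xi> J)
     \<and> (J \<noteq> 0 \<longrightarrow> x \<in> interior (\<Union>tau\<in>UNIV. G tau ` unitsq))"
proof (rule jets_common[OF _ _ _ x])
  have bl: "bilinear_map A" "bilinear_map B" using A B by (auto simp: patch_def)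
  show "patch (G tau)" for tau using A B by (simp add: G_def)
  show "interior (G s ` unitsq) \<inter> interior (G tau ` unitsq) = {}" if "s \<noteq> tau" for s tau
    using that dis by (cases s; cases tau) (auto simp: G_def)
  fix tau and \<xi> :: pt assume "\<xi> \<in> unitsq"
  then show "\<xi> \<in> opensq \<or> zj (gfun p r k A B tau i j) \<xi>
      \<or> (\<exists>J. (\<forall>j'\<in>UNIV. \<forall>\<eta>\<in>unitsq. G j' \<eta> = G tau \<xi> \<longrightarrow> jetat (G j') (gfun p r k A B j' i j) \<eta> J) \<and> G tau \<xi> \<in> interior (\<Union>i\<in>UNIV. G i ` unitsq))
      \<or> (\<exists>i'\<in>UNIV. \<exists>\<xi>'\<in>unitsq. \<exists>J. i' \<noteq> tau \<and> G i' \<xi>' = G tau \<xi> \<and> jetat (G tau) (gfun p r k A B tau i j) \<xi> J \<and> jetat (G i') (gfun p r k A B i' i j) \<xi>' J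
           \<and> G tau \<xi> \<in> interior (G tau ` unitsq \<union> G i' ` unitsq))"
  proof (cases rule: square_cases)
    case (5 t)
    then have t: "t \<in> {0..1}" by simp
    obtain J where J: "jetat A (gfun p r k A B True i j) (0,t) J" "jetat B (gfun p r k A B False i j) (0,t) J"
      using edge_jets[OF bl e patch_edge_nonzero[OF A t]] by blast
    have "A (0,t) \<in> interior (A ` unitsq \<union> B ` unitsq)" using common_edge(2)[OF A B e dis 5(2,3)] .
    then show ?thesis using 5 J e[OF t] t
      by (intro disjI2 bexI[of _ "\<not> tau"] bexI[of _ "(0,t)"] exI[of _ J])
         (auto simp: G_def unitsq_def Un_commute)
  qed (use gfun_zj[OF bl ij] in auto)
qed

text \<open>At shared points \<open>efun\<close> evaluates through the first patch; the common jet
  shows that the second patch gives the same value.\<close>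

lemma efun_value:
  assumes A: "patch A" and B: "patch B" and e: "\<And>t. t \<in> {0..1} \<Longrightarrow> A (0,t) = B (0,t)"
    and dis: "interior (A ` unitsq) \<inter> interior (B ` unitsq) = {}"
    and ij: "i \<le> 2" "j \<in> {5 - i .. nE p r k A B i + i - 6}" and \<xi>: "\<xi> \<in> unitsq"
  shows "efun p r k A B i j (A \<xi>) = gfun p r k A B True i j \<xi>" "efun p r k A B i j (B \<xi>) = gfun p r k A B False i j \<xi>"
proof -
  have iA: "inv_into unitsq A (A \<eta>) = \<eta>" and iB: "inv_into unitsq B (B \<eta>) = \<eta>" if "\<eta> \<in> unitsq" for \<eta>
    using that A B by (auto simp: patch_def)
  show "efun p r k A B i j (A \<xi>) = gfun p r k A B True i j \<xi>" using \<xi> iA by (simp add: efun_def)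
  show "efun p r k A B i j (B \<xi>) = gfun p r k A B False i j \<xi>"
  proof (cases "B \<xi> \<in> A ` unitsq")
    case True
    then obtain \<eta> where \<eta>: "\<eta> \<in> unitsq" "B \<xi> = A \<eta>" by auto
    let ?G = "\<lambda>tau. if tau then A else B"
    have "B \<xi> \<in> (\<Union>tau\<in>UNIV. ?G tau ` unitsq)" using \<eta> by auto
    from efun_jets[OF A B e dis ij this] obtain J where
      "\<forall>tau\<in>UNIV. \<forall>\<eta>\<in>unitsq. ?G tau \<eta> = B \<xi> \<longrightarrow> jetat (?G tau) (gfun p r k A B tau i j) \<eta> J" by blast
    then have "\<And>tau \<eta>. \<eta> \<in> unitsq \<Longrightarrow> ?G tau \<eta> = B \<xi> \<Longrightarrow> jetat (?G tau) (gfun p r k A B tau i j) \<eta> J" by blast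
    from this[of \<eta> True] this[of \<xi> False] have "jetat A (gfun p r k A B True i j) \<eta> J" "jetat B (gfun p r k A B False i j) \<xi> J"
      using \<eta> \<xi> by simp_all
    from this[THEN jetat_value] have "gfun p r k A B True i j \<eta> = fst J" "gfun p r k A B False i j \<xi> = fst J" .
    then show ?thesis using \<eta> iA by (simp add: efun_def)
  next
    case False
    then show ?thesis using \<xi> iB by (simp add: efun_def)
  qed
qed

lemma efun_nice:
  assumes mp: "multipatch P F" and s: "s \<in> commonEdges P F" and ed: "edge_data P F s la lb pa pb"
    and ij: "i \<le> 2" "j \<in> {5 - i .. nE p r k (F la \<circ> pa) (F lb \<circ> pb) i + i - 6}"
  shows "nice p r k P F (efun p r k (F la \<circ> pa) (F lb \<circ> pb) i j)"
proof -
  define A B where "A = F la \<circ> pa" and "B = F lb \<circ> pb"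
  define G where "G = (\<lambda>tau. if tau then A else B)"
  have ls: "fst s \<in> {1..P}" "snd s \<in> {1..P}" "fst s \<noteq> snd s" using s by (auto simp: commonEdges_def)
  have e: "{la, lb} = {fst s, snd s}" "pa \<in> sqsym" "pb \<in> sqsym" "\<And>t. t \<in> {0..1} \<Longrightarrow> A (0,t) = B (0,t)"
    using ed by (auto simp: edge_data_def A_def B_def)
  have l: "la \<in> {1..P}" "lb \<in> {1..P}" "la \<noteq> lb" using e(1) ls by (auto simp: doubleton_eq_iff)
  let ?L = "\<lambda>tau. if tau then la else lb" and ?psi = "\<lambda>tau. if tau then pa else pb"
  have inj: "inj_on ?L UNIV" using l by (auto simp: inj_on_def)
  have Gd: "G tau = F (?L tau) \<circ> ?psi tau" for tau by (simp add: G_def A_def B_def)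
  have pA: "patch A" and pB: "patch B" unfolding A_def B_def by (auto intro!: patch_sqsym multipatch_patch[OF mp] l e)
  have dis: "interior (A ` unitsq) \<inter> interior (B ` unitsq) = {}"
    unfolding A_def B_def image_sqsym[OF e(2)] image_sqsym[OF e(3)] by (rule multipatch_disjoint[OF mp l])
  show ?thesis unfolding A_def[symmetric] B_def[symmetric]
  proof (rule patchwise_nice[OF mp, where I=UNIV and L="?L" and psi="?psi" and G=G and \<phi>="\<lambda>tau. gfun p r k A B tau i j"])
    show "gfun p r k A B tau i j \<in> TS p r k" for tau using pA pB by (intro gfun_TS) (auto simp: patch_def)
    show "efun p r k A B i j (G tau \<xi>) = gfun p r k A B tau i j \<xi>" if "\<xi> \<in> unitsq" for tau \<xi>
      using efun_value[OF pA pB e(4) dis ij(1) ij(2)[folded A_def B_def] that] by (cases tau) (auto simp: G_def)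
    show "efun p r k A B i j x = 0" if "x \<notin> (\<Union>tau\<in>UNIV. G tau ` unitsq)" for x
    proof -
      have "x \<notin> G True ` unitsq" "x \<notin> G False ` unitsq" using that by blast+
      then show ?thesis by (simp add: efun_def G_def)
    qed
    show "\<exists>J. (\<forall>tau\<in>UNIV. \<forall>\<xi>\<in>unitsq. G tau \<xi> = x \<longrightarrow> jetat (G tau) (gfun p r k A B tau i j) \<xi> J)
     \<and> (J \<noteq> 0 \<longrightarrow> x \<in> interior (\<Union>tau\<in>UNIV. G tau ` unitsq))" if "x \<in> (\<Union>tau\<in>UNIV. G tau ` unitsq)" for x
      using efun_jets[OF pA pB e(4) dis ij(1) ij(2)[folded A_def B_def]] that unfolding G_def by blast
  qed (use l e inj Gd in auto)
qed

end

section \<open>Vertex functions\<close>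

context c2_spline
begin

lemma zj_swap:
  assumes "\<phi> \<in> TS p r k" "zj \<phi> (y, x)"
  shows "zj (\<lambda>\<xi>. \<phi> (snd \<xi>, fst \<xi>)) (x, y)"
  unfolding zj_def
proof (intro allI impI)
  fix i j :: nat assume ij: "i + j \<le> 2"
  have "dpart i j (\<lambda>\<xi>. \<phi> (snd \<xi>, fst \<xi>)) (x, y) = dpart j i \<phi> (y, x)"
    using TS_swap(2)[OF assms(1), of i j "(x,y)"] ij by simp
  then show "dpart i j (\<lambda>\<xi>. \<phi> (snd \<xi>, fst \<xi>)) (x, y) = 0" using assms(2) ij unfolding zj_def by simp
qed

lemma MT_diff: "MT p r k (\<lambda>s t. C s t - D s t) = (\<lambda>\<xi>. MT p r k C \<xi> - MT p r k D \<xi>)"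
  by (simp add: fun_eq_iff MT_def right_diff_distrib sum_subtractf)

text \<open>On the whole side y = 0 such a function is governed by the 2-jets of its three
  coefficient functions at 0, and these are its partial derivatives at the corner. This is how the
  equations of \<open>kerH\<close> reach beyond the corner.\<close>

lemma MT_zj_bottomI:
  assumes "\<And>s. s \<le> 2 \<Longrightarrow> E s \<in> PS p r k" "\<And>i j. i \<le> 2 \<Longrightarrow> j \<le> 2 \<Longrightarrow> dpart i j (MT p r k E) (0,0) = 0"
  shows "zj (MT p r k E) (x, 0)"
proof (rule zj_MT_line[OF assms(1)])
  fix s j :: nat assume "s \<le> 2" "j \<le> 2"
  then show "(deriv ^^ j) (E s) 0 = 0" using dpart_MT_0[of E s j 0] assms by simp
qed

text \<open>Inversion of the triangular definition of M_0, M_1, M_2, so that the corner part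
  \<open>fOm\<close> also takes the form \<open>MT\<close>.\<close>

lemma Nsp_MM:
  assumes "i \<le> 2"
  shows "\<exists>m. \<forall>x. Nsp p r k i x = (\<Sum>s\<le>2. m s * MM p r k s x)"
proof -
  have h: "hh k \<noteq> 0" "real p \<noteq> 0" "real p - 1 \<noteq> 0" using hh_pos[of k] p5 by auto
  define c2 where "c2 = real p * (real p - 1) / (hh k)\<^sup>2"
  have S: "(\<Sum>s\<le>2. m s * MM p r k s x) = m 0 * M0 p r k x + m 1 * M1 p r k x + m 2 * M2 p r k x" for m :: "nat \<Rightarrow> real" and x
    by (simp add: MM_def numeral_2_eq_2 atMost_Suc)
  have e2: "Nsp p r k 2 x = c2 * M2 p r k x" for x using h by (simp add: M2_def c2_def)
  have e1: "Nsp p r k 1 x = real p / hh k * M1 p r k x - 2 * c2 * M2 p r k x" for x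
    using h e2[of x] by (simp add: M1_def algebra_simps)
  have e0: "Nsp p r k 0 x = M0 p r k x - Nsp p r k 1 x - Nsp p r k 2 x" for x
    by (simp add: M0_def numeral_2_eq_2 atMost_Suc)
  have "i = 0 \<or> i = 1 \<or> i = 2" using assms by auto
  then show ?thesis
  proof (elim disjE)
    assume i: "i = 0"
    show ?thesis unfolding i S e0 e1 e2
      by (rule exI[of _ "\<lambda>s. if s = 0 then 1 else if s = 1 then - (real p / hh k) else c2"]) (simp add: algebra_simps)
  next
    assume i: "i = 1"
    show ?thesis unfolding i S e1
      by (rule exI[of _ "\<lambda>s. if s = 0 then 0 else if s = 1 then real p / hh k else - 2 * c2"]) (simp add: algebra_simps)
  next
    assume i: "i = 2"
    show ?thesis unfolding i S e2
      by (rule exI[of _ "\<lambda>s. if s = 2 then c2 else 0"]) simp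
  qed
qed

lemma Nsp_corner_MT:
  "\<exists>W. (\<forall>s. W s \<in> PS p r k \<and> van1 k 3 (W s)) \<and>
     (\<lambda>\<xi>. \<Sum>i\<le>2. \<Sum>j\<le>2. c i j * Nsp p r k i (fst \<xi>) * Nsp p r k j (snd \<xi>)) = MT p r k W"
proof -
  have "\<forall>i. \<exists>m. i \<le> 2 \<longrightarrow> (\<forall>x. Nsp p r k i x = (\<Sum>s\<le>2. m s * MM p r k s x))" using Nsp_MM by metis
  then obtain m where m: "\<And>i x. i \<le> 2 \<Longrightarrow> Nsp p r k i x = (\<Sum>s\<le>2. m i s * MM p r k s x)" by metis
  define W where "W s t = (\<Sum>i\<le>2. \<Sum>j\<le>2. (c i j * m i s) * Nsp p r k j t)" for s t
  have "W s \<in> PS p r k \<and> van1 k 3 (W s)" for s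
    unfolding W_def[abs_def] by (intro conjI PS_sum PS_scale van1_sum van1_scale Nsp_PS[OF rp(1)] Nsp_van1_low) auto
  moreover have "(\<Sum>i\<le>2. \<Sum>j\<le>2. c i j * Nsp p r k i (fst \<xi>) * Nsp p r k j (snd \<xi>)) = MT p r k W \<xi>" for \<xi>
  proof -
    have "(\<Sum>i\<le>2. \<Sum>j\<le>2. c i j * Nsp p r k i (fst \<xi>) * Nsp p r k j (snd \<xi>))
       = (\<Sum>i\<le>2. \<Sum>j\<le>2. \<Sum>s\<le>2. MM p r k s (fst \<xi>) * (c i j * m i s * Nsp p r k j (snd \<xi>)))"
      by (intro sum.cong refl) (simp add: m sum_distrib_left sum_distrib_right mult_ac)
    also have "\<dots> = (\<Sum>i\<le>2. \<Sum>s\<le>2. \<Sum>j\<le>2. MM p r k s (fst \<xi>) * (c i j * m i s * Nsp p r k j (snd \<xi>)))"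
      by (intro sum.cong refl sum.swap)
    also have "\<dots> = (\<Sum>s\<le>2. \<Sum>i\<le>2. \<Sum>j\<le>2. MM p r k s (fst \<xi>) * (c i j * m i s * Nsp p r k j (snd \<xi>)))"
      by (rule sum.swap)
    finally show ?thesis unfolding MT_def W_def by (simp add: sum_distrib_left)
  qed
  ultimately show ?thesis by blast
qed

text \<open>For i = 0 and j = 4 this is n_0 - 5 >= 5: the bound on k is used to the full
  here.\<close>

lemma vertex_index: "i \<le> 2 \<Longrightarrow> j \<le> 4 - i \<Longrightarrow> j < nE p r k A B i \<and> 5 \<le> nE p r k A B i - 1 - j + i"
  using dims(1) dims(2)[OF dal_le[of A B]] dims(3)[OF dal_le[of A B]] by (auto simp: nE_def Let_def)

lemma MT_sum2:
  "MT p r k (\<lambda>s t. \<Sum>i\<le>2. \<Sum>j\<le>4-i. c i j * g i j s t) \<xi> = (\<Sum>i\<le>2. \<Sum>j\<le>4-i. c i j * MT p r k (g i j) \<xi>)"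
proof -
  have "MT p r k (\<lambda>s t. \<Sum>i\<le>2. \<Sum>j\<le>4-i. c i j * g i j s t) \<xi>
     = (\<Sum>s\<le>2. \<Sum>i\<le>2. \<Sum>j\<le>4-i. c i j * (MM p r k s (fst \<xi>) * g i j s (snd \<xi>)))"
    unfolding MT_def by (simp add: sum_distrib_left mult_ac)
  also have "\<dots> = (\<Sum>i\<le>2. \<Sum>s\<le>2. \<Sum>j\<le>4-i. c i j * (MM p r k s (fst \<xi>) * g i j s (snd \<xi>)))" by (rule sum.swap)
  also have "\<dots> = (\<Sum>i\<le>2. \<Sum>j\<le>4-i. \<Sum>s\<le>2. c i j * (MM p r k s (fst \<xi>) * g i j s (snd \<xi>)))"
    by (intro sum.cong refl sum.swap)
  finally show ?thesis unfolding MT_def by (simp add: sum_distrib_left)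
qed

end

section \<open>The functions f_l on the patches around one vertex\<close>

locale vertex_star = c2_spline +
  fixes isin :: bool and nu :: nat and Gs :: "nat \<Rightarrow> pt \<Rightarrow> pt" and a :: "vcoef \<Rightarrow> real"
  assumes pat: "l < nu \<Longrightarrow> patch (Gs l)"
    and dis: "l < nu \<Longrightarrow> l' < nu \<Longrightarrow> l \<noteq> l' \<Longrightarrow> interior (Gs l ` unitsq) \<inter> interior (Gs l' ` unitsq) = {}"
    and edge: "l < nu \<Longrightarrow> isin \<or> l + 1 < nu \<Longrightarrow> t \<in> {0..1} \<Longrightarrow> Gs l (0,t) = Gs ((l+1) mod nu) (t,0)"
    and ker: "a \<in> kerH p r k isin nu Gs"
begin

abbreviation "sw l \<equiv> Gs l \<circ> prod.swap"
abbreviation "fN \<equiv> fGnext p r k isin nu Gs a"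
abbreviation "fP \<equiv> fGprev p r k isin nu Gs a"
abbreviation "fO \<equiv> fOm p r k a"
abbreviation "fv \<equiv> fV p r k isin nu Gs a"

text \<open>\<open>An\<close> collects the coefficients of M_s along the side shared with the next
  patch, \<open>Ap\<close> those along the side shared with the previous one, where the coordinates
  are exchanged. Boundary edges contribute zero, as in \<open>gnextV\<close> and
  \<open>gprevV\<close>.\<close>

definition "An l s t = (\<Sum>i\<le>2. \<Sum>j\<le>4-i. a (CE (enxt isin nu l) i j) *
   (if \<not> isin \<and> l + 1 = nu then 0 else gc p r k (Gs l) (sw ((l+1) mod nu)) True i j s t))"

definition "Ap l s t = (\<Sum>i\<le>2. \<Sum>j\<le>4-i. a (CE l i j) *
   (if \<not> isin \<and> l = 0 then 0 else gc p r k (Gs ((l + nu - 1) mod nu)) (sw l) False i j s t))"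

lemma sw_eq: "sw l = (\<lambda>\<xi>. Gs l (snd \<xi>, fst \<xi>))" by (auto simp: fun_eq_iff)

lemma sw_patch: "l < nu \<Longrightarrow> patch (sw l)" unfolding sw_eq by (rule patch_swap[OF pat])

lemma bil: "l < nu \<Longrightarrow> bilinear_map (Gs l)" "l < nu \<Longrightarrow> bilinear_map (sw l)"
  using pat sw_patch by (auto simp: patch_def)

lemma modlt: "l < nu \<Longrightarrow> (x::nat) mod nu < nu" by simp

lemma fN_MT: "fN l = MT p r k (An l)"
proof
  fix \<xi>
  have "MT p r k (An l) \<xi> = (\<Sum>i\<le>2. \<Sum>j\<le>4-i. a (CE (enxt isin nu l) i j) *
     MT p r k (\<lambda>s t. if \<not> isin \<and> l + 1 = nu then 0 else gc p r k (Gs l) (sw ((l+1) mod nu)) True i j s t) \<xi>)"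
    unfolding An_def[abs_def] by (rule MT_sum2)
  also have "\<dots> = fN l \<xi>" unfolding fGnext_def gnextV_def
    by (intro sum.cong refl) (auto simp: gfun_MT MT_def)
  finally show "fN l \<xi> = MT p r k (An l) \<xi>" by simp
qed

lemma fP_MT: "fP l = (\<lambda>\<xi>. MT p r k (Ap l) (snd \<xi>, fst \<xi>))"
proof
  fix \<xi> :: pt
  have "MT p r k (Ap l) (snd \<xi>, fst \<xi>) = (\<Sum>i\<le>2. \<Sum>j\<le>4-i. a (CE l i j) *
     MT p r k (\<lambda>s t. if \<not> isin \<and> l = 0 then 0 else gc p r k (Gs ((l + nu - 1) mod nu)) (sw l) False i j s t) (snd \<xi>, fst \<xi>))"
    unfolding Ap_def[abs_def] by (rule MT_sum2)
  also have "\<dots> = fP l \<xi>" unfolding fGprev_def gprevV_def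
    by (intro sum.cong refl) (auto simp: gfun_MT MT_def)
  finally show "fP l \<xi> = MT p r k (Ap l) (snd \<xi>, fst \<xi>)" by simp
qed

lemma An_PS:
  assumes "l < nu"
  shows "An l s \<in> PS p r k"
proof -
  have "(\<lambda>t. if \<not> isin \<and> l + 1 = nu then 0 else gc p r k (Gs l) (sw ((l+1) mod nu)) True i j s t) \<in> PS p r k" for i j
    by (cases "\<not> isin \<and> l + 1 = nu")
       (simp_all only: simp_thms if_True if_False PS_const gc_PS[OF bil(1)[OF assms] bil(2)[OF modlt[OF assms]]])
  then show ?thesis unfolding An_def[abs_def] by (intro PS_sum PS_scale finite_atMost)
qed

lemma Ap_PS:
  assumes "l < nu"
  shows "Ap l s \<in> PS p r k"
proof -
  have "(\<lambda>t. if \<not> isin \<and> l = 0 then 0 else gc p r k (Gs ((l + nu - 1) mod nu)) (sw l) False i j s t) \<in> PS p r k" for i j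
    by (cases "\<not> isin \<and> l = 0")
       (simp_all only: simp_thms if_True if_False PS_const gc_PS[OF bil(1)[OF modlt[OF assms]] bil(2)[OF assms]])
  then show ?thesis unfolding Ap_def[abs_def] by (intro PS_sum PS_scale finite_atMost)
qed

lemma An_van1:
  assumes "l < nu" "s \<le> 2"
  shows "van1 k (5 - s) (An l s)"
proof -
  have *: "van1 k (5 - s) (gc p r k (Gs l) (sw ((l+1) mod nu)) True i j s)" if "i \<le> 2" "j \<le> 4 - i" for i j
    using vertex_index[OF that, of "Gs l" "sw ((l+1) mod nu)"] assms
    by (intro van1_mono[OF gc_van1[OF bil(1)[OF assms(1)] bil(2)[OF modlt[OF assms(1)]] assms(2)]]) auto
  have "van1 k (5 - s) (\<lambda>t. if \<not> isin \<and> l + 1 = nu then 0 else gc p r k (Gs l) (sw ((l+1) mod nu)) True i j s t)"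
    if "i \<in> {..2}" "j \<in> {..4-i}" for i j
    using that by (cases "\<not> isin \<and> l + 1 = nu") (simp_all only: simp_thms if_True if_False van1_zero * atMost_iff)
  then show ?thesis unfolding An_def[abs_def] by (intro van1_sum van1_scale finite_atMost)
qed

lemma Ap_van1:
  assumes "l < nu" "s \<le> 2"
  shows "van1 k (5 - s) (Ap l s)"
proof -
  have *: "van1 k (5 - s) (gc p r k (Gs ((l + nu - 1) mod nu)) (sw l) False i j s)" if "i \<le> 2" "j \<le> 4 - i" for i j
    using vertex_index[OF that, of "Gs ((l + nu - 1) mod nu)" "sw l"] assms
    by (intro van1_mono[OF gc_van1[OF bil(1)[OF modlt[OF assms(1)]] bil(2)[OF assms(1)] assms(2)]]) auto
  have "van1 k (5 - s) (\<lambda>t. if \<not> isin \<and> l = 0 then 0 else gc p r k (Gs ((l + nu - 1) mod nu)) (sw l) False i j s t)"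
    if "i \<in> {..2}" "j \<in> {..4-i}" for i j
    using that by (cases "\<not> isin \<and> l = 0") (simp_all only: simp_thms if_True if_False van1_zero * atMost_iff)
  then show ?thesis unfolding Ap_def[abs_def] by (intro van1_sum van1_scale finite_atMost)
qed

lemma fN_TS: "l < nu \<Longrightarrow> fN l \<in> TS p r k" unfolding fN_MT by (intro MT_TS An_PS)

lemma fP_TS: "l < nu \<Longrightarrow> fP l \<in> TS p r k" unfolding fP_MT by (intro TS_swap(1) MT_TS Ap_PS)

lemma fO_MT:
  "\<exists>W. (\<forall>s. W s \<in> PS p r k \<and> van1 k 3 (W s)) \<and> fO l = MT p r k W"
  using Nsp_corner_MT[of "\<lambda>i j. a (CP l i j)"] unfolding fOm_def[abs_def] by auto

lemma fO_MT':
  "\<exists>W. (\<forall>s. W s \<in> PS p r k \<and> van1 k 3 (W s)) \<and> fO l = (\<lambda>\<xi>. MT p r k W (snd \<xi>, fst \<xi>))"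
proof -
  obtain W where W: "\<forall>s. W s \<in> PS p r k \<and> van1 k 3 (W s)"
    "(\<lambda>\<xi>. \<Sum>i\<le>2. \<Sum>j\<le>2. a (CP l j i) * Nsp p r k i (fst \<xi>) * Nsp p r k j (snd \<xi>)) = MT p r k W"
    using Nsp_corner_MT[of "\<lambda>i j. a (CP l j i)"] by auto
  have "fO l \<xi> = MT p r k W (snd \<xi>, fst \<xi>)" for \<xi>
  proof -
    have "fO l \<xi> = (\<Sum>j\<le>2. \<Sum>i\<le>2. a (CP l i j) * Nsp p r k i (fst \<xi>) * Nsp p r k j (snd \<xi>))"
      unfolding fOm_def by (rule sum.swap)
    also have "\<dots> = (\<Sum>j\<le>2. \<Sum>i\<le>2. a (CP l i j) * Nsp p r k j (snd \<xi>) * Nsp p r k i (fst \<xi>))"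
      by (intro sum.cong refl) (simp add: mult_ac)
    finally show ?thesis using W(2)[THEN fun_cong, of "(snd \<xi>, fst \<xi>)"] by simp
  qed
  then show ?thesis using W(1) by blast
qed

lemma fO_TS: "fO l \<in> TS p r k"
  using fO_MT[of l] MT_TS by metis

lemma fv_TS: "l < nu \<Longrightarrow> fv l \<in> TS p r k"
  unfolding fV_def[abs_def] by (intro TS_diff TS_add fN_TS fP_TS fO_TS)

lemma ker_zero:
  assumes "l < nu" "i \<le> 2" "j \<le> 2"
  shows "dpart i j (\<lambda>\<xi>. fN l \<xi> - fO l \<xi>) (0,0) = 0" "dpart i j (\<lambda>\<xi>. fP l \<xi> - fO l \<xi>) (0,0) = 0"
proof -
  have k: "dpart i j (\<lambda>\<xi>. fN l \<xi> - fP l \<xi>) (0,0) = 0" "dpart i j (\<lambda>\<xi>. fN l \<xi> - fO l \<xi>) (0,0) = 0"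
    using ker assms unfolding kerH_def by auto
  show "dpart i j (\<lambda>\<xi>. fN l \<xi> - fO l \<xi>) (0,0) = 0" by (rule k)
  show "dpart i j (\<lambda>\<xi>. fP l \<xi> - fO l \<xi>) (0,0) = 0"
    using k dpart_diff[OF fN_TS[OF assms(1)] fP_TS[OF assms(1)] assms(2,3), of "(0,0)"]
      dpart_diff[OF fN_TS[OF assms(1)] fO_TS assms(2,3), of l "(0,0)"] dpart_diff[OF fP_TS[OF assms(1)] fO_TS assms(2,3), of l "(0,0)"]
    by simp
qed

text \<open>On the bottom side the next-edge part and the corner part cancel in f_l up to second
  order, so only the previous-edge part \<open>fP\<close> is left there; \<open>zj_left\<close> is
  the mirror statement.\<close>

lemma zj_bottom: "l < nu \<Longrightarrow> zj (\<lambda>\<xi>. fN l \<xi> - fO l \<xi>) (x, 0)"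
proof -
  assume l: "l < nu"
  obtain W where W: "\<forall>s. W s \<in> PS p r k \<and> van1 k 3 (W s)" "fO l = MT p r k W" using fO_MT[of l] by blast
  have e: "(\<lambda>\<xi>. fN l \<xi> - fO l \<xi>) = MT p r k (\<lambda>s t. An l s t - W s t)" unfolding MT_diff fN_MT W(2) ..
  have P: "(\<lambda>t. An l s t - W s t) \<in> PS p r k" for s
    using PS_add[OF An_PS[OF l] PS_scale[of "W s" p r k "-1"]] W(1) by simp
  show ?thesis unfolding e
    by (rule MT_zj_bottomI[OF P]) (use ker_zero(1)[OF l] e in simp)
qed

lemma zj_left: "l < nu \<Longrightarrow> zj (\<lambda>\<xi>. fP l \<xi> - fO l \<xi>) (0, y)"
proof -
  assume l: "l < nu"
  obtain W where W: "\<forall>s. W s \<in> PS p r k \<and> van1 k 3 (W s)" "fO l = (\<lambda>\<xi>. MT p r k W (snd \<xi>, fst \<xi>))" using fO_MT'[of l] by blast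
  have e: "(\<lambda>\<xi>. fP l \<xi> - fO l \<xi>) = (\<lambda>\<xi>. MT p r k (\<lambda>s t. Ap l s t - W s t) (snd \<xi>, fst \<xi>))" unfolding MT_diff fP_MT W(2) ..
  have P: "(\<lambda>t. Ap l s t - W s t) \<in> PS p r k" for s
    using PS_add[OF Ap_PS[OF l] PS_scale[of "W s" p r k "-1"]] W(1) by simp
  have T: "MT p r k (\<lambda>s t. Ap l s t - W s t) \<in> TS p r k" by (rule MT_TS[OF P])
  have "zj (MT p r k (\<lambda>s t. Ap l s t - W s t)) (y, 0)"
  proof (rule MT_zj_bottomI[OF P])
    fix i j :: nat assume ij: "i \<le> 2" "j \<le> 2"
    show "dpart i j (MT p r k (\<lambda>s t. Ap l s t - W s t)) (0,0) = 0"
      using ker_zero(2)[OF l ij(2,1)] TS_swap(2)[OF T ij(2,1), of "(0,0)"] unfolding e by simp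
  qed
  then show ?thesis unfolding e by (rule zj_swap[OF T])
qed

lemma fv_diff: "(\<lambda>\<xi>. fv l \<xi> - fN l \<xi>) = (\<lambda>\<xi>. fP l \<xi> - fO l \<xi>)" "(\<lambda>\<xi>. fv l \<xi> - fP l \<xi>) = (\<lambda>\<xi>. fN l \<xi> - fO l \<xi>)"
  by (simp_all add: fV_def fun_eq_iff)

lemma zj_fv_right: "l < nu \<Longrightarrow> zj (fv l) (1, y)"
proof -
  assume l: "l < nu"
  obtain W where W: "\<forall>s. W s \<in> PS p r k \<and> van1 k 3 (W s)" "fO l = MT p r k W" using fO_MT[of l] by blast
  have 1: "zj (fN l) (1, y)" unfolding fN_MT by (rule zj_MT_right[OF An_PS[OF l]])
  have 2: "zj (fO l) (1, y)" unfolding W(2) by (rule zj_MT_right) (use W in auto)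
  have "van1 k 3 (Ap l s)" if "s \<le> 2" for s using that by (intro van1_mono[OF Ap_van1[OF l that]]) auto
  then have "zj (MT p r k (Ap l)) (y, 1)" by (intro zj_MT_top[OF Ap_PS[OF l]])
  then have 3: "zj (fP l) (1, y)" unfolding fP_MT by (rule zj_swap[OF MT_TS[OF Ap_PS[OF l]]])
  show ?thesis unfolding fV_def[abs_def] by (intro zj_diff zj_add TS_add fN_TS fP_TS fO_TS l 1 2 3)
qed

lemma zj_fv_top: "l < nu \<Longrightarrow> zj (fv l) (x, 1)"
proof -
  assume l: "l < nu"
  obtain W where W: "\<forall>s. W s \<in> PS p r k \<and> van1 k 3 (W s)" "fO l = MT p r k W" using fO_MT[of l] by blast
  have "van1 k 3 (An l s)" if "s \<le> 2" for s using that by (intro van1_mono[OF An_van1[OF l that]]) auto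
  then have 1: "zj (fN l) (x, 1)" unfolding fN_MT by (intro zj_MT_top[OF An_PS[OF l]])
  have 2: "zj (fO l) (x, 1)" unfolding W(2) by (rule zj_MT_top) (use W in auto)
  have "zj (MT p r k (Ap l)) (1, x)" by (rule zj_MT_right[OF Ap_PS[OF l]])
  then have 3: "zj (fP l) (x, 1)" unfolding fP_MT by (rule zj_swap[OF MT_TS[OF Ap_PS[OF l]]])
  show ?thesis unfolding fV_def[abs_def] by (intro zj_diff zj_add TS_add fN_TS fP_TS fO_TS l 1 2 3)
qed

text \<open>Along this side f_l has the jets of a combination of edge functions, for which two-patch
  smoothness is known from \<open>edge_jets\<close>.\<close>

lemma jet_fv_left:
  assumes "l < nu" "jetat (Gs l) (fN l) (0,t) J"
  shows "jetat (Gs l) (fv l) (0,t) J"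
proof -
  have "zj (\<lambda>\<xi>. fv l \<xi> - fN l \<xi>) (0,t)" unfolding fv_diff by (rule zj_left[OF assms(1)])
  from jetat_add[OF fN_TS[OF assms(1)] TS_diff[OF fv_TS[OF assms(1)] fN_TS[OF assms(1)]] assms(2) jetat_zj[OF this]]
  show ?thesis by simp
qed

lemma jet_fv_bottom:
  assumes "l < nu" "jetat (Gs l) (fP l) (t,0) J"
  shows "jetat (Gs l) (fv l) (t,0) J"
proof -
  have "zj (\<lambda>\<xi>. fv l \<xi> - fP l \<xi>) (t,0)" unfolding fv_diff by (rule zj_bottom[OF assms(1)])
  from jetat_add[OF fP_TS[OF assms(1)] TS_diff[OF fv_TS[OF assms(1)] fP_TS[OF assms(1)]] assms(2) jetat_zj[OF this]]
  show ?thesis by simp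
qed

lemma sw_edge: "l < nu \<Longrightarrow> isin \<or> l + 1 < nu \<Longrightarrow> t \<in> {0..1} \<Longrightarrow> Gs l (0,t) = sw ((l+1) mod nu) (0,t)"
  using edge by simp

text \<open>Both patches use the same coefficients of the shared edge, so the same combination of
  the common jets of the edge functions serves for both.\<close>

lemma edge_jet:
  assumes l: "l < nu" "isin \<or> l + 1 < nu" and t: "t \<in> {0..1}"
  shows "\<exists>J. jetat (Gs l) (fv l) (0,t) J \<and> jetat (Gs ((l+1) mod nu)) (fv ((l+1) mod nu)) (t,0) J"
proof -
  define l' where "l' = (l+1) mod nu"
  have l'n: "l' < nu" using l by (simp add: l'_def)
  have pl: "(l' + nu - 1) mod nu = l"
  proof (cases "l + 1 = nu")
    case True then show ?thesis by (simp add: l'_def)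
  next
    case False then have "l' = l + 1" using l by (simp add: l'_def)
    then show ?thesis using l by simp
  qed
  have nb: "\<not> (\<not> isin \<and> l + 1 = nu)" "\<not> (\<not> isin \<and> l' = 0)" using l by (auto simp: l'_def)
  have en: "enxt isin nu l = l'" using l by (auto simp: enxt_def l'_def)
  let ?g = "\<lambda>tau i j. gfun p r k (Gs l) (sw l') tau i j"
  have "\<forall>i j. \<exists>J. jetat (Gs l) (?g True i j) (0,t) J \<and> jetat (sw l') (?g False i j) (0,t) J"
    using edge_jets[OF bil(1)[OF l(1)] bil(2)[OF l'n] _ patch_edge_nonzero[OF pat[OF l(1)] t]] sw_edge[OF l] unfolding l'_def by blast
  then obtain J where J: "\<And>i j. jetat (Gs l) (?g True i j) (0,t) (J i j)" "\<And>i j. jetat (sw l') (?g False i j) (0,t) (J i j)" by metis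
  define J0 where "J0 = (\<Sum>i\<le>2. \<Sum>j\<le>4-i. a (CE l' i j) *\<^sub>R J i j)"
  have T: "?g tau i j \<in> TS p r k" for tau i j by (rule gfun_TS[OF bil(1)[OF l(1)] bil(2)[OF l'n]])
  have "jetat (Gs l) (\<lambda>\<xi>. \<Sum>i\<le>2. \<Sum>j\<le>4-i. a (CE l' i j) * ?g True i j \<xi>) (0,t) J0"
    unfolding J0_def by (intro jetat_sum jetat_cmul T J TS_sum TS_cmul) auto
  moreover have "fN l = (\<lambda>\<xi>. \<Sum>i\<le>2. \<Sum>j\<le>4-i. a (CE l' i j) * ?g True i j \<xi>)"
    by (simp only: fGnext_def[abs_def] gnextV_def en if_not_P[OF nb(1)]) (simp only: l'_def)
  ultimately have 1: "jetat (Gs l) (fv l) (0,t) J0" by (intro jet_fv_left[OF l(1)]) simp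
  have J': "jetat (Gs l') (\<lambda>\<xi>. ?g False i j (snd \<xi>, fst \<xi>)) (t,0) (J i j)" for i j
    using jetat_swap[OF T bil(1)[OF l'n], of False i j "(0,t)" "J i j"] J(2)[of i j] unfolding sw_eq by simp
  have "jetat (Gs l') (\<lambda>\<xi>. \<Sum>i\<le>2. \<Sum>j\<le>4-i. a (CE l' i j) * ?g False i j (snd \<xi>, fst \<xi>)) (t,0) J0"
    unfolding J0_def by (intro jetat_sum jetat_cmul TS_swap(1)[OF T] J' TS_sum TS_cmul) auto
  moreover have "fP l' = (\<lambda>\<xi>. \<Sum>i\<le>2. \<Sum>j\<le>4-i. a (CE l' i j) * ?g False i j (snd \<xi>, fst \<xi>))"
    by (simp only: fGprev_def[abs_def] gprevV_def pl if_not_P[OF nb(2)])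
  ultimately have 2: "jetat (Gs l') (fv l') (t,0) J0" by (intro jet_fv_bottom[OF l'n]) simp
  show ?thesis using 1 2 unfolding l'_def by blast
qed

text \<open>On a boundary edge the edge part of f_l is zero, and f_l inherits its zero jets.\<close>

lemma zj_boundary_left: "l < nu \<Longrightarrow> \<not> isin \<Longrightarrow> l + 1 = nu \<Longrightarrow> zj (fv l) (0,t)"
proof -
  assume l: "l < nu" "\<not> isin" "l + 1 = nu"
  then have "fN l = (\<lambda>\<xi>. 0)" by (simp add: fGnext_def[abs_def] gnextV_def)
  then have "jetat (Gs l) (fN l) (0,t) 0" using jetat_zj[OF zj_zero] by simp
  then show ?thesis by (rule jetat_0_zj[OF jet_fv_left[OF l(1)]])
qed

lemma zj_boundary_bottom: "0 < nu \<Longrightarrow> \<not> isin \<Longrightarrow> zj (fv 0) (t,0)"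
proof -
  assume l: "0 < nu" "\<not> isin"
  then have "fP 0 = (\<lambda>\<xi>. 0)" by (simp add: fGprev_def[abs_def] gprevV_def)
  then have "jetat (Gs 0) (fP 0) (t,0) 0" using jetat_zj[OF zj_zero] by simp
  then show ?thesis by (rule jetat_0_zj[OF jet_fv_bottom[OF l(1)]])
qed

text \<open>The jet at the vertex is carried from patch to patch across the shared edges by
  uniqueness of jets. For a boundary vertex the chain starts at a boundary edge, where the jet is
  zero.\<close>

lemma corner_jet:
  assumes "0 < nu"
  shows "\<exists>J. (\<forall>l<nu. jetat (Gs l) (fv l) (0,0) J) \<and> (\<not> isin \<longrightarrow> J = 0)"
proof -
  have j: "jdet (Gs l) (0,0) \<noteq> 0" if "l < nu" for l using pat[OF that] by (auto simp: patch_def unitsq_def)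
  obtain J where J: "jetat (Gs 0) (fv 0) (0,0) J" "\<not> isin \<longrightarrow> J = 0"
  proof (cases isin)
    case True then show ?thesis using that jetat_exists[OF j[OF assms]] by blast
  next
    case False then show ?thesis using that[of 0] jetat_zj[OF zj_boundary_bottom[OF assms False]] by blast
  qed
  have "jetat (Gs l) (fv l) (0,0) J" if "l < nu" for l
    using that
  proof (induction l)
    case (Suc l)
    then have l: "l < nu" "isin \<or> l + 1 < nu" "(l+1) mod nu = Suc l" by auto
    obtain J' where J': "jetat (Gs l) (fv l) (0,0) J'" "jetat (Gs (Suc l)) (fv (Suc l)) (0,0) J'"
      using edge_jet[OF l(1,2), of 0] unfolding l(3) by auto
    have "jetat (Gs l) (fv l) (0,0) J" using Suc.IH[OF l(1)] .
    then have "J' = J" by (rule jetat_unique[OF J'(1) _ j[OF l(1)]])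
    then show ?case using J'(2) by simp
  qed (rule J(1))
  then show ?thesis using J(2) by blast
qed

lemma edge_interior:
  assumes l: "l < nu" "isin \<or> l + 1 < nu" and t: "0 < t" "t < 1" and ne: "(l+1) mod nu \<noteq> l"
  shows "Gs l (0,t) \<in> interior (Gs l ` unitsq \<union> Gs ((l+1) mod nu) ` unitsq)"
proof -
  define l' where "l' = (l+1) mod nu"
  have l'n: "l' < nu" using l by (simp add: l'_def)
  have im: "sw l' ` unitsq = Gs l' ` unitsq"
  proof -
    have "prod.swap ` unitsq = unitsq" by (auto simp: unitsq_def image_iff)
    then show ?thesis by (metis image_comp)
  qed
  have "Gs l (0,t) \<in> interior (Gs l ` unitsq \<union> sw l' ` unitsq)"
    by (rule common_edge(2)[OF pat[OF l(1)] sw_patch[OF l'n] _ _ t])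
       (use sw_edge[OF l] dis[OF l(1) l'n] ne im in \<open>auto simp: l'_def\<close>)
  then show ?thesis unfolding im by (simp add: l'_def)
qed

text \<open>A patch glued to itself would identify the images of (0,1/2) and (1/2,0), against
  injectivity.\<close>

lemma next_neq:
  assumes "l < nu" "isin \<or> l + 1 < nu"
  shows "(l+1) mod nu \<noteq> l"
proof
  assume e: "(l+1) mod nu = l"
  have "nu = 1" using e assms(1) by (cases "l + 1 = nu") auto
  then have l: "l = 0" "nu = 1" using assms by auto
  then have q: "Gs 0 (0, 1/2) = Gs 0 (1/2, 0)" using edge[of 0 "1/2"] assms by simp
  have i: "inj_on (Gs 0) unitsq" using pat[of 0] l by (simp add: patch_def)
  have "(0::real, 1/2::real) = (1/2, 0)" by (rule inj_onD[OF i q]) (simp_all add: unitsq_def)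
  then show False by simp
qed

lemma pred_exists:
  assumes "l < nu" "isin \<or> 0 < l"
  shows "\<exists>l0<nu. (isin \<or> l0 + 1 < nu) \<and> (l0 + 1) mod nu = l"
proof (cases "l = 0")
  case True then show ?thesis using assms by (intro exI[of _ "nu - 1"]) auto
next
  case False then show ?thesis using assms by (intro exI[of _ "l - 1"]) auto
qed

text \<open>At the vertex itself an inner vertex uses the jet shared by all patches, a boundary
  vertex the zero jet; points inside the edges are shared by exactly two patches or lie on the
  boundary.\<close>

lemma star_jets:
  assumes v: "\<And>l. l < nu \<Longrightarrow> Gs l (0,0) = v" and vin: "isin \<Longrightarrow> v \<in> interior (\<Union>l\<in>{..<nu}. Gs l ` unitsq)"
    and x: "x \<in> (\<Union>l\<in>{..<nu}. Gs l ` unitsq)"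
  shows "\<exists>J. (\<forall>l\<in>{..<nu}. \<forall>\<xi>\<in>unitsq. Gs l \<xi> = x \<longrightarrow> jetat (Gs l) (fv l) \<xi> J) \<and> (J \<noteq> 0 \<longrightarrow> x \<in> interior (\<Union>l\<in>{..<nu}. Gs l ` unitsq))"
proof (rule jets_common[OF _ _ _ x])
  show "patch (Gs l)" if "l \<in> {..<nu}" for l using pat that by simp
  show "interior (Gs l ` unitsq) \<inter> interior (Gs l' ` unitsq) = {}" if "l \<in> {..<nu}" "l' \<in> {..<nu}" "l \<noteq> l'" for l l' using dis that by simp
  fix l \<xi> assume l': "l \<in> {..<nu}" and "\<xi> \<in> unitsq"
  then have l: "l < nu" by simp
  have inj: "\<And>l \<xi> \<eta>. l < nu \<Longrightarrow> \<xi> \<in> unitsq \<Longrightarrow> \<eta> \<in> unitsq \<Longrightarrow> Gs l \<xi> = Gs l \<eta> \<Longrightarrow> \<xi> = \<eta>"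
    using pat unfolding patch_def by (meson inj_onD)
  from \<open>\<xi> \<in> unitsq\<close> show "\<xi> \<in> opensq \<or> zj (fv l) \<xi>
      \<or> (\<exists>J. (\<forall>j\<in>{..<nu}. \<forall>\<eta>\<in>unitsq. Gs j \<eta> = Gs l \<xi> \<longrightarrow> jetat (Gs j) (fv j) \<eta> J) \<and> Gs l \<xi> \<in> interior (\<Union>i\<in>{..<nu}. Gs i ` unitsq))
      \<or> (\<exists>i'\<in>{..<nu}. \<exists>\<xi>'\<in>unitsq. \<exists>J. i' \<noteq> l \<and> Gs i' \<xi>' = Gs l \<xi> \<and> jetat (Gs l) (fv l) \<xi> J \<and> jetat (Gs i') (fv i') \<xi>' J
           \<and> Gs l \<xi> \<in> interior (Gs l ` unitsq \<union> Gs i' ` unitsq))"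
  proof (cases rule: square_cases)
    case 4
    have "0 < nu" using l by simp
    from corner_jet[OF this] obtain J where J: "\<forall>l<nu. jetat (Gs l) (fv l) (0,0) J" "\<not> isin \<longrightarrow> J = 0" by blast
    show ?thesis
    proof (cases isin)
      case True
      have "jetat (Gs j) (fv j) \<eta> J" if "j \<in> {..<nu}" "\<eta> \<in> unitsq" "Gs j \<eta> = Gs l \<xi>" for j \<eta>
      proof -
        have "\<eta> = (0,0)" using inj[of j \<eta> "(0,0)"] that v 4 l by (simp add: unitsq_def)
        then show ?thesis using J that by simp
      qed
      moreover have "Gs l \<xi> \<in> interior (\<Union>i\<in>{..<nu}. Gs i ` unitsq)" using vin[OF True] v[OF l] 4 by simp
      ultimately show ?thesis by blast
    next
      case False
      then show ?thesis using J l 4 jetat_0_zj by auto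
    qed
  next
    case (5 t)
    show ?thesis
    proof (cases "isin \<or> l + 1 < nu")
      case True
      have t: "t \<in> {0..1}" using 5 by simp
      obtain J where J: "jetat (Gs l) (fv l) (0,t) J" "jetat (Gs ((l+1) mod nu)) (fv ((l+1) mod nu)) (t,0) J"
        using edge_jet[OF l True t] by blast
      have "(l+1) mod nu \<in> {..<nu}" "(t,0) \<in> unitsq" using l t by (auto simp: unitsq_def)
      moreover have "Gs l (0,t) \<in> interior (Gs l ` unitsq \<union> Gs ((l+1) mod nu) ` unitsq)"
        by (rule edge_interior[OF l True 5(2,3) next_neq[OF l True]])
      ultimately show ?thesis unfolding 5(1) using J next_neq[OF l True] edge[OF l True t] by metis
    next
      case False
      then have "\<not> isin" "l + 1 = nu" using l by auto
      then show ?thesis using zj_boundary_left[OF l] 5 by simp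
    qed
  next
    case (6 t)
    show ?thesis
    proof (cases "isin \<or> 0 < l")
      case True
      have t: "t \<in> {0..1}" using 6 by simp
      obtain l0 where l0: "l0 < nu" "isin \<or> l0 + 1 < nu" "(l0 + 1) mod nu = l" using pred_exists[OF l True] by blast
      obtain J where J: "jetat (Gs l0) (fv l0) (0,t) J" "jetat (Gs l) (fv l) (t,0) J"
        using edge_jet[OF l0(1,2) t] l0(3) by metis
      have "l0 \<in> {..<nu}" "(0,t) \<in> unitsq" using l0 t by (auto simp: unitsq_def)
      moreover have "Gs l0 (0,t) \<in> interior (Gs l0 ` unitsq \<union> Gs l ` unitsq)"
        using edge_interior[OF l0(1,2) 6(2,3) next_neq[OF l0(1,2)]] l0(3) by simp
      moreover have "Gs l0 (0,t) = Gs l (t,0)" using edge[OF l0(1,2) t] l0(3) by simp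
      moreover have "l0 \<noteq> l" using next_neq[OF l0(1,2)] l0(3) by simp
      ultimately show ?thesis unfolding 6(1) using J by (metis Un_commute)
    next
      case False
      then show ?thesis using zj_boundary_bottom 6 l by simp
    qed
  qed (use zj_fv_right[OF l] zj_fv_top[OF l] in auto)
qed

lemma vfun_value:
  assumes v: "\<And>l. l < nu \<Longrightarrow> Gs l (0,0) = v" and vin: "isin \<Longrightarrow> v \<in> interior (\<Union>l\<in>{..<nu}. Gs l ` unitsq)"
    and l: "l < nu" and \<xi>: "\<xi> \<in> unitsq"
  shows "vfun p r k isin nu Gs a (Gs l \<xi>) = fv l \<xi>"
proof -
  define x where "x = Gs l \<xi>"
  define m where "m = (LEAST l. l < nu \<and> x \<in> Gs l ` unitsq)"
  have ex: "l < nu \<and> x \<in> Gs l ` unitsq" using l \<xi> by (simp add: x_def)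
  have m: "m < nu \<and> x \<in> Gs m ` unitsq" unfolding m_def by (rule LeastI[of "\<lambda>l. l < nu \<and> x \<in> Gs l ` unitsq", OF ex])
  define \<eta> where "\<eta> = inv_into unitsq (Gs m) x"
  have \<eta>: "\<eta> \<in> unitsq" "Gs m \<eta> = x" using m unfolding \<eta>_def by (auto simp: inv_into_into f_inv_into_f)
  have "x \<in> (\<Union>l\<in>{..<nu}. Gs l ` unitsq)" using ex by blast
  from star_jets[OF v vin this] obtain J where J: "\<forall>l\<in>{..<nu}. \<forall>\<xi>\<in>unitsq. Gs l \<xi> = x \<longrightarrow> jetat (Gs l) (fv l) \<xi> J" by blast
  have "jetat (Gs l) (fv l) \<xi> J" "jetat (Gs m) (fv m) \<eta> J" using J l m \<xi> \<eta> by (auto simp: x_def)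
  from this[THEN jetat_value] have "fv l \<xi> = fv m \<eta>" by simp
  moreover have "vfun p r k isin nu Gs a x = fv m \<eta>" unfolding vfun_def \<eta>_def m_def Let_def using ex by auto
  ultimately show ?thesis by (simp add: x_def)
qed

end

text \<open>The patches not containing v form a closed set that misses v, so near v the domain is
  covered by the others.\<close>

lemma vertex_interior:
  assumes mp: "multipatch P F" and v: "v \<in> interior (dom P F)"
  shows "v \<in> interior (\<Union>l\<in>{l\<in>{1..P}. v \<in> F l ` unitsq}. F l ` unitsq)"
proof -
  define R where "R = (\<Union>l\<in>{l\<in>{1..P}. v \<notin> F l ` unitsq}. F l ` unitsq)"
  have "closed R" unfolding R_def using compact_imp_closed[OF patch_compact[OF multipatch_patch[OF mp]]] by (intro closed_UN) auto
  then have "open (interior (dom P F) - R)" by (intro open_Diff open_interior)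
  moreover have "v \<in> interior (dom P F) - R" using v by (auto simp: R_def)
  moreover have "interior (dom P F) - R \<subseteq> (\<Union>l\<in>{l\<in>{1..P}. v \<in> F l ` unitsq}. F l ` unitsq)"
  proof
    fix x assume x: "x \<in> interior (dom P F) - R"
    then have "x \<in> dom P F" using interior_subset by blast
    then obtain l where l: "l \<in> {1..P}" "x \<in> F l ` unitsq" by (auto simp: dom_def)
    then have "v \<in> F l ` unitsq" using x by (auto simp: R_def)
    then show "x \<in> (\<Union>l\<in>{l\<in>{1..P}. v \<in> F l ` unitsq}. F l ` unitsq)" using l by blast
  qed
  ultimately show ?thesis by (meson interiorI)
qed

context c2_spline
begin

lemma vertex_star_of_data:
  assumes mp: "multipatch P F" and vd: "vertex_data p r k P F v n L psi m b"
    and a: "a \<in> kerH p r k (v \<in> interior (dom P F)) n (\<lambda>l. F (L l) \<circ> psi l)"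
  shows "vertex_star p r k (v \<in> interior (dom P F)) n (\<lambda>l. F (L l) \<circ> psi l) a"
    and "\<And>l. l < n \<Longrightarrow> (F (L l) \<circ> psi l) (0,0) = v"
    and "v \<in> interior (dom P F) \<Longrightarrow> v \<in> interior (\<Union>l\<in>{..<n}. (F (L l) \<circ> psi l) ` unitsq)"
    and "inj_on L {..<n}" "\<And>l. l < n \<Longrightarrow> L l \<in> {1..P}" "\<And>l. l < n \<Longrightarrow> psi l \<in> sqsym"
    and "L ` {..<n} = {l\<in>{1..P}. v \<in> F l ` unitsq}"
proof -
  let ?G = "\<lambda>l. F (L l) \<circ> psi l"
  note V = vd[unfolded vertex_data_def Let_def]
  have d: "bij_betw L {..<n} {l\<in>{1..P}. v \<in> F l ` unitsq}" "\<And>l. l < n \<Longrightarrow> psi l \<in> sqsym" "\<And>l. l < n \<Longrightarrow> ?G l (0,0) = v"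
    "\<And>l t. l < n \<Longrightarrow> v \<in> interior (dom P F) \<or> l + 1 < n \<Longrightarrow> t \<in> {0..1} \<Longrightarrow> ?G l (0,t) = ?G ((l+1) mod n) (t,0)"
       apply (rule V[THEN conjunct1])
      apply (erule V[THEN conjunct2, THEN conjunct1, rule_format, THEN conjunct1])
     apply (erule V[THEN conjunct2, THEN conjunct1, rule_format, THEN conjunct2, THEN conjunct1])
    apply (rule V[THEN conjunct2, THEN conjunct2, THEN conjunct1, rule_format], assumption+)
    done
  show inj: "inj_on L {..<n}" and im: "L ` {..<n} = {l\<in>{1..P}. v \<in> F l ` unitsq}" using d(1) by (auto simp: bij_betw_def)
  show LP: "L l \<in> {1..P}" if "l < n" for l using im that by blast
  show "psi l \<in> sqsym" if "l < n" for l using d(2) that .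
  show "?G l (0,0) = v" if "l < n" for l using d(3) that .
  have gf: "\<And>l. l \<in> {..<n} \<Longrightarrow> patch (?G l)"
    "\<And>l l'. l \<in> {..<n} \<Longrightarrow> l' \<in> {..<n} \<Longrightarrow> l \<noteq> l' \<Longrightarrow> interior (?G l ` unitsq) \<inter> interior (?G l' ` unitsq) = {}"
    using G_facts[OF mp inj, of psi ?G] LP d(2) by simp_all
  show "vertex_star p r k (v \<in> interior (dom P F)) n ?G a"
    by (intro vertex_star.intro vertex_star_axioms.intro c2_spline_axioms) (use gf d a in auto)
  have U: "(\<Union>l\<in>{..<n}. ?G l ` unitsq) = (\<Union>l\<in>{l\<in>{1..P}. v \<in> F l ` unitsq}. F l ` unitsq)"
  proof -
    have "(\<Union>l\<in>{..<n}. ?G l ` unitsq) = (\<Union>l\<in>{..<n}. F (L l) ` unitsq)"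
      by (rule SUP_cong[OF refl]) (simp only: image_sqsym[OF d(2)] lessThan_iff)
    also have "\<dots> = (\<Union>l\<in>L ` {..<n}. F l ` unitsq)" by simp
    finally show ?thesis unfolding im .
  qed
  show "v \<in> interior (\<Union>l\<in>{..<n}. ?G l ` unitsq)" if "v \<in> interior (dom P F)"
    unfolding U by (rule vertex_interior[OF mp that])
qed

lemma vfun_nice:
  assumes mp: "multipatch P F" and vd: "vertex_data p r k P F v n L psi m b"
    and a: "a \<in> kerH p r k (v \<in> interior (dom P F)) n (\<lambda>l. F (L l) \<circ> psi l)"
  shows "nice p r k P F (vfun p r k (v \<in> interior (dom P F)) n (\<lambda>l. F (L l) \<circ> psi l) a)"
proof -
  let ?G = "\<lambda>l. F (L l) \<circ> psi l" and ?in = "v \<in> interior (dom P F)"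
  note vs = vertex_star_of_data[OF assms]
  interpret vertex_star p r k ?in n ?G a by (rule vs(1))
  show ?thesis
  proof (rule patchwise_nice[OF mp, where I="{..<n}" and L=L and psi=psi and G="?G" and \<phi>="\<lambda>l. fV p r k ?in n ?G a l"])
    show "vfun p r k ?in n ?G a (?G l \<xi>) = fV p r k ?in n ?G a l \<xi>" if "l \<in> {..<n}" "\<xi> \<in> unitsq" for l \<xi>
      using vfun_value[OF vs(2,3)] that by blast
    show "vfun p r k ?in n ?G a x = 0" if "x \<notin> (\<Union>l\<in>{..<n}. ?G l ` unitsq)" for x
      using that unfolding vfun_def by auto
    show "\<exists>J. (\<forall>l\<in>{..<n}. \<forall>\<xi>\<in>unitsq. ?G l \<xi> = x \<longrightarrow> jetat (?G l) (fV p r k ?in n ?G a l) \<xi> J)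
       \<and> (J \<noteq> 0 \<longrightarrow> x \<in> interior (\<Union>l\<in>{..<n}. ?G l ` unitsq))" if "x \<in> (\<Union>l\<in>{..<n}. ?G l ` unitsq)" for x
      using star_jets[OF vs(2,3) that] by blast
  qed (use vs fv_TS in auto)
qed

end

section \<open>Orders of vanishing at a vertex\<close>

text \<open>Near 0 the j-th B-spline has order exactly j, so the lowest term of the combination
  cannot cancel. The factor q does not change this order, while the right-hand side has order M +
  1.\<close>

lemma Nsp_triangular:
  fixes q w :: "real poly"
  assumes rp: "k \<ge> 1 \<longrightarrow> r < p" and M: "M \<le> p" and q: "poly q 0 \<noteq> 0"
    and eq: "\<And>t. 0 < t \<Longrightarrow> t < hh k \<Longrightarrow> poly q t * (\<Sum>j\<le>M. c j * Nsp p r k j t) = t ^ (M+1) * poly w t"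
    and j: "j \<le> M"
  shows "c j = 0"
proof -
  have "\<forall>j. \<exists>u. j \<le> M \<longrightarrow> (\<forall>x<hh k. Nsp p r k j x = x ^ j * poly u x) \<and> poly u 0 > 0"
    using Nsp_lead0[OF rp] M by (meson le_trans)
  then obtain u where u: "\<And>j x. j \<le> M \<Longrightarrow> x < hh k \<Longrightarrow> Nsp p r k j x = x ^ j * poly (u j) x" "\<And>j. j \<le> M \<Longrightarrow> poly (u j) 0 > 0" by metis
  have P: "q * (\<Sum>j\<le>M. smult (c j) ([:0,1:]^j * u j)) - [:0,1:]^(M+1) * w = 0"
  proof (rule poly_zero_on_interval[of 0 "hh k"])
    show "0 < hh k" by (rule hh_pos)
    fix x assume x: "0 < x" "x < hh k"
    then have "(\<Sum>j\<le>M. c j * Nsp p r k j x) = (\<Sum>j\<le>M. c j * (x ^ j * poly (u j) x))" using u(1) by (intro sum.cong) auto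
    then show "poly (q * (\<Sum>j\<le>M. smult (c j) ([:0,1:]^j * u j)) - [:0,1:]^(M+1) * w) x = 0"
      using eq[OF x] by (simp add: poly_sum del: power_Suc)
  qed
  show ?thesis using j
  proof (induction j rule: less_induct)
    case (less j)
    have "(\<Sum>i\<le>M. smult (c i) ([:0,1:]^i * u i)) = (\<Sum>i\<in>{j..M}. smult (c i) ([:0,1:]^i * u i))"
      using less by (intro sum.mono_neutral_right) auto
    also have "\<dots> = smult (c j) ([:0,1:]^j * u j) + (\<Sum>i\<in>{Suc j..M}. smult (c i) ([:0,1:]^i * u i))"
      using less.prems by (simp add: sum.atLeast_Suc_atMost)
    also have "(\<Sum>i\<in>{Suc j..M}. smult (c i) ([:0,1:]^i * u i)) = [:0,1:]^j * ([:0,1:] * (\<Sum>i\<in>{Suc j..M}. smult (c i) ([:0,1:]^(i - Suc j) * u i)))"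
      unfolding sum_distrib_left
    proof (intro sum.cong refl)
      fix i assume "i \<in> {Suc j..M}"
      then obtain m where m: "i = j + Suc m" by (metis add_Suc_right atLeastAtMost_iff le_Suc_ex add_Suc)
      have "[:0,1::real:]^i = [:0,1:]^j * ([:0,1:] * [:0,1:]^(i - Suc j))"
        unfolding m power_add power_Suc by simp
      then show "smult (c i) ([:0,1:]^i * u i) = [:0,1:]^j * ([:0,1:] * smult (c i) ([:0,1:]^(i - Suc j) * u i))"
        by (simp only: mult_smult_right mult.assoc)
    qed
    finally have S: "(\<Sum>i\<le>M. smult (c i) ([:0,1:]^i * u i))
        = [:0,1:]^j * (smult (c j) (u j) + [:0,1:] * (\<Sum>i\<in>{Suc j..M}. smult (c i) ([:0,1:]^(i - Suc j) * u i)))"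
      by (simp only: distrib_left mult_smult_right)
    have E: "[:0,1::real:]^(M+1) = [:0,1:]^j * ([:0,1:] * [:0,1:]^(M-j))"
    proof -
      obtain m where m: "M = j + m" using less.prems by (metis le_Suc_ex)
      show ?thesis unfolding m Suc_eq_plus1[symmetric] power_Suc power_add by (simp only: diff_add_inverse mult.left_commute)
    qed
    have "[:0,1:]^j * (q * (smult (c j) (u j) + [:0,1:] * (\<Sum>i\<in>{Suc j..M}. smult (c i) ([:0,1:]^(i - Suc j) * u i))) - [:0,1:] * [:0,1:]^(M-j) * w) = 0"
      using P unfolding S E by (simp only: right_diff_distrib mult.assoc mult.left_commute)
    then have "q * (smult (c j) (u j) + [:0,1:] * (\<Sum>i\<in>{Suc j..M}. smult (c i) ([:0,1:]^(i - Suc j) * u i))) - [:0,1:] * [:0,1:]^(M-j) * w = 0"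
      by (simp only: mult_eq_0_iff power_eq_0_iff pCons_eq_0_iff one_neq_zero simp_thms)
    then have "poly (q * (smult (c j) (u j) + [:0,1:] * (\<Sum>i\<in>{Suc j..M}. smult (c i) ([:0,1:]^(i - Suc j) * u i))) - [:0,1:] * [:0,1:]^(M-j) * w) 0 = 0" by simp
    then show ?case using q u(2)[OF less.prems] by simp
  qed
qed

text \<open>The matrix of derivatives of N_0, N_1, N_2 at 0 is triangular with nonzero
  diagonal.\<close>

lemma Nsp_corner_deriv:
  assumes rp: "k \<ge> 1 \<longrightarrow> r < p" and p: "2 \<le> p" and eq: "\<And>b. b \<le> 2 \<Longrightarrow> (\<Sum>j\<le>2. c j * (deriv ^^ b) (Nsp p r k j) 0) = 0" and j: "j \<le> 2"
  shows "c j = 0"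
proof -
  have z: "(deriv ^^ b) (Nsp p r k j) 0 = 0" if "b < j" "j \<le> 2" for b j
  proof -
    have "van0 k (j - b) ((deriv ^^ b) (Nsp p r k j))" for b
    proof (induction b)
      case (Suc b)
      then have "van0 k (j - b - 1) (deriv ((deriv ^^ b) (Nsp p r k j)))" by (rule van0_deriv')
      then show ?case by simp
    qed (simp add: Nsp_van0[OF rp])
    moreover have e: "j - b = Suc (j - b - 1)" using that by simp
    ultimately have "van0 k (Suc (j - b - 1)) ((deriv ^^ b) (Nsp p r k j))" by metis
    then show ?thesis by (rule van0_value)
  qed
  have nz: "(deriv ^^ j) (Nsp p r k j) 0 \<noteq> 0" if "j \<le> 2" for j
  proof -
    have jp: "j \<le> p" using that p by simp
    from Nsp_lead0[OF rp jp] obtain w where w: "\<And>x. x < hh k \<Longrightarrow> Nsp p r k j x = x ^ j * poly w x" "poly w 0 > 0" by blast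
    have "(deriv ^^ j) (Nsp p r k j) 0 = poly ((pderiv ^^ j) ([:0,1:]^j * w)) 0"
      by (rule deriv_pow_local_poly[of "hh k"]) (use w hh_pos[of k] in auto)
    moreover have "j = 0 \<or> j = 1 \<or> j = 2" using that by auto
    ultimately show ?thesis using w(2)
      by (elim disjE) (simp_all add: numeral_2_eq_2 pderiv_pCons pderiv_add)
  qed
  have S: "(\<Sum>j\<le>2. c j * (deriv ^^ b) (Nsp p r k j) 0) = c 0 * (deriv ^^ b) (Nsp p r k 0) 0 + c 1 * (deriv ^^ b) (Nsp p r k 1) 0 + c 2 * (deriv ^^ b) (Nsp p r k 2) 0" for b
    by (simp add: numeral_2_eq_2 atMost_Suc)
  have 0: "c 0 = 0" using eq[of 0] z[of 0 1] z[of 0 2] nz[of 0] unfolding S by simp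
  have 1: "c 1 = 0" using eq[of 1] z[of 1 2] nz[of 1] 0 unfolding S by simp
  have 2: "c 2 = 0" using eq[of 2] nz[of 2] 0 1 unfolding S by simp
  have "j = 0 \<or> j = 1 \<or> j = 2" using j by auto
  then show ?thesis using 0 1 2 by auto
qed

text \<open>Functions attached to other vertices, to edges or to patch interiors are flat near a vertex,
  whereas the coefficients of a vertex function with index \<open>(i,j)\<close>, \<open>j \<le> 4 - i\<close>, contribute the terms
  of order at most \<open>4 - s\<close>.\<close>

definition flat :: "nat \<Rightarrow> (pt \<Rightarrow> real) \<Rightarrow> bool" where
  "flat k \<psi> \<longleftrightarrow> (\<forall>s\<le>2. \<exists>w::real poly. \<forall>t. 0 < t \<and> t < hh k \<longrightarrow> dpart s 0 \<psi> (0,t) = t ^ (5 - s) * poly w t)"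

lemma hh_le: "hh k \<le> 1" by (simp add: hh_def)

lemma flat_zj: "(\<And>t. 0 < t \<Longrightarrow> t < 1 \<Longrightarrow> zj \<psi> (0,t)) \<Longrightarrow> flat k \<psi>"
  unfolding flat_def
proof (intro allI impI)
  fix s :: nat assume z: "\<And>t. 0 < t \<Longrightarrow> t < 1 \<Longrightarrow> zj \<psi> (0,t)" and s: "s \<le> 2"
  have "dpart s 0 \<psi> (0,t) = t ^ (5 - s) * poly 0 t" if "0 < t" "t < hh k" for t
    using z[of t] that hh_le[of k] s unfolding zj_def by auto
  then show "\<exists>w::real poly. \<forall>t. 0 < t \<and> t < hh k \<longrightarrow> dpart s 0 \<psi> (0,t) = t ^ (5 - s) * poly w t" by blast
qed

text \<open>Either the patch is one of the pieces, and passing to the parameterization by \<sigma>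
  costs a symmetry \<tau>, or its interior misses all the pieces.\<close>

lemma patch_restrict:
  assumes mp: "multipatch P F"
    and I: "\<And>i. i \<in> I \<Longrightarrow> L i \<in> {1..P}" "\<And>i. i \<in> I \<Longrightarrow> psi i \<in> sqsym"
    and f: "\<And>i \<eta>. i \<in> I \<Longrightarrow> \<eta> \<in> unitsq \<Longrightarrow> f (F (L i) (psi i \<eta>)) = \<phi> i \<eta>"
    and f0: "\<And>x. x \<notin> (\<Union>i\<in>I. F (L i) ` unitsq) \<Longrightarrow> f x = (0::real)"
    and l: "l \<in> {1..P}" and \<sigma>: "\<sigma> \<in> sqsym"
  shows "(\<exists>i\<in>I. L i = l \<and> (\<exists>\<tau>\<in>sqsym. (\<forall>\<xi>. psi i (\<tau> \<xi>) = \<sigma> \<xi>) \<and> (\<forall>\<xi>\<in>unitsq. f (F l (\<sigma> \<xi>)) = (\<phi> i \<circ> \<tau>) \<xi>)))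
    \<or> (\<forall>\<xi>\<in>opensq. f (F l (\<sigma> \<xi>)) = 0)"
proof (cases "l \<in> L ` I")
  case True
  then obtain i where i: "i \<in> I" "L i = l" by auto
  obtain \<rho> where \<rho>: "\<rho> \<in> sqsym" "\<And>\<xi>. psi i (\<rho> \<xi>) = \<xi>" using sqsym_inverse[OF I(2)[OF i(1)]] by blast
  have \<tau>: "\<rho> \<circ> \<sigma> \<in> sqsym" by (rule sqsym_comp[OF \<rho>(1) \<sigma>])
  have "f (F l (\<sigma> \<xi>)) = (\<phi> i \<circ> (\<rho> \<circ> \<sigma>)) \<xi>" if "\<xi> \<in> unitsq" for \<xi>
    using f[OF i(1), of "\<rho> (\<sigma> \<xi>)"] \<rho>(2) i(2) that sqsym_mem(1)[OF \<tau>, of \<xi>] by simp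
  then show ?thesis using i \<tau> \<rho>(2) by (intro disjI1 bexI[of _ i] conjI bexI[of _ "\<rho> \<circ> \<sigma>"]) auto
next
  case False
  have "f (F l (\<sigma> \<xi>)) = 0" if "\<xi> \<in> opensq" for \<xi>
  proof (rule f0, rule notI)
    have x: "F l (\<sigma> \<xi>) \<in> interior (F l ` unitsq)"
      using patch_interior[OF multipatch_patch[OF mp l]] sqsym_mem(2)[OF \<sigma>] that by blast
    assume "F l (\<sigma> \<xi>) \<in> (\<Union>i\<in>I. F (L i) ` unitsq)"
    then obtain i where i: "i \<in> I" "F l (\<sigma> \<xi>) \<in> F (L i) ` unitsq" by auto
    then have "interior (F l ` unitsq) \<inter> interior (F (L i) ` unitsq) = {}"
      using multipatch_disjoint[OF mp l I(1)[OF i(1)]] False by auto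
    then show False
      using interior_disjoint_patch[OF multipatch_patch[OF mp I(1)[OF i(1)]] open_interior] x i(2) by blast
  qed
  then show ?thesis by blast
qed

text \<open>The left side is kept or reversed, goes to the bottom in one of two directions, or goes
  to the right or top side. For the last two the direction is left unspecified, as the functions to
  be examined have zero jets there.\<close>

lemma sqsym_left_side:
  assumes "\<tau> \<in> sqsym"
  shows "(\<forall>t. \<tau> (0,t) = (0,t)) \<or> (\<forall>t. \<tau> (0,t) = (0,1-t)) \<or> (\<exists>g. \<forall>t. \<tau> (0,t) = (1, g t)) \<or> (\<forall>t. \<tau> (0,t) = (t,0))
     \<or> (\<forall>t. \<tau> (0,t) = (1-t,0)) \<or> (\<exists>g. \<forall>t. \<tau> (0,t) = (g t, 1))"
  using assms unfolding sqsym_def by (elim insertE emptyE) auto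

context c2_spline
begin

lemma zj_sqsym:
  assumes "\<phi> \<in> TS p r k" "\<tau> \<in> sqsym" "zj \<phi> (\<tau> \<xi>)"
  shows "zj (\<phi> \<circ> \<tau>) \<xi>"
proof -
  obtain \<epsilon> where "(\<forall>i\<le>2. \<forall>j\<le>2. \<forall>\<xi>. dpart i j (\<phi> \<circ> \<tau>) \<xi> = \<epsilon> i j * dpart i j \<phi> (\<tau> \<xi>))
     \<or> (\<forall>i\<le>2. \<forall>j\<le>2. \<forall>\<xi>. dpart i j (\<phi> \<circ> \<tau>) \<xi> = \<epsilon> i j * dpart j i \<phi> (\<tau> \<xi>))"
    using TS_sqsym(2)[OF assms(1,2)] by blast
  then show ?thesis
  proof
    assume *: "\<forall>i\<le>2. \<forall>j\<le>2. \<forall>\<xi>. dpart i j (\<phi> \<circ> \<tau>) \<xi> = \<epsilon> i j * dpart i j \<phi> (\<tau> \<xi>)"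
    show ?thesis unfolding zj_def
    proof (intro allI impI)
      fix i j :: nat assume ij: "i + j \<le> 2"
      then have "dpart i j \<phi> (\<tau> \<xi>) = 0" using assms(3) unfolding zj_def by simp
      then show "dpart i j (\<phi> \<circ> \<tau>) \<xi> = 0" using *[rule_format, of i j \<xi>] ij by simp
    qed
  next
    assume *: "\<forall>i\<le>2. \<forall>j\<le>2. \<forall>\<xi>. dpart i j (\<phi> \<circ> \<tau>) \<xi> = \<epsilon> i j * dpart j i \<phi> (\<tau> \<xi>)"
    show ?thesis unfolding zj_def
    proof (intro allI impI)
      fix i j :: nat assume ij: "i + j \<le> 2"
      then have "dpart j i \<phi> (\<tau> \<xi>) = 0" using assms(3) unfolding zj_def by simp
      then show "dpart i j (\<phi> \<circ> \<tau>) \<xi> = 0" using *[rule_format, of i j \<xi>] ij by simp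
    qed
  qed
qed

lemma dpart_sqsym_left:
  assumes "\<phi> \<in> TS p r k" "\<tau> \<in> sqsym" "s \<le> 2"
  shows "fst (\<tau> (0,0)) = fst (\<tau> (0,1)) \<Longrightarrow> \<exists>\<epsilon>. \<forall>\<xi>. dpart s 0 (\<phi> \<circ> \<tau>) \<xi> = \<epsilon> * dpart s 0 \<phi> (\<tau> \<xi>)"
    and "snd (\<tau> (0,0)) = snd (\<tau> (0,1)) \<Longrightarrow> \<exists>\<epsilon>. \<forall>\<xi>. dpart s 0 (\<phi> \<circ> \<tau>) \<xi> = \<epsilon> * dpart 0 s \<phi> (\<tau> \<xi>)"
proof -
  have ne: "\<not> (fst (\<tau> (0,0)) = fst (\<tau> (0,1)) \<and> snd (\<tau> (0,0)) = snd (\<tau> (0,1)))"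
    using sqsym_inverse[OF assms(2)] by (metis prod.inject prod_eqI zero_neq_one)
  show "fst (\<tau> (0,0)) = fst (\<tau> (0,1)) \<Longrightarrow> \<exists>\<epsilon>. \<forall>\<xi>. dpart s 0 (\<phi> \<circ> \<tau>) \<xi> = \<epsilon> * dpart s 0 \<phi> (\<tau> \<xi>)"
    "snd (\<tau> (0,0)) = snd (\<tau> (0,1)) \<Longrightarrow> \<exists>\<epsilon>. \<forall>\<xi>. dpart s 0 (\<phi> \<circ> \<tau>) \<xi> = \<epsilon> * dpart 0 s \<phi> (\<tau> \<xi>)"
    using TS_sqsym(2)[OF assms(1,2)] ne assms(3) by blast+
qed

lemma flatI_van0:
  assumes "\<And>s. s \<le> 2 \<Longrightarrow> van0 k (5 - s) (C s)" "\<And>s. s \<le> 2 \<Longrightarrow> \<exists>\<epsilon>. \<forall>t. 0 < t \<and> t < 1 \<longrightarrow> dpart s 0 \<psi> (0,t) = \<epsilon> * C s t"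
  shows "flat k \<psi>"
  unfolding flat_def
proof (intro allI impI)
  fix s :: nat assume s: "s \<le> 2"
  obtain \<epsilon> where e: "\<And>t. 0 < t \<and> t < 1 \<Longrightarrow> dpart s 0 \<psi> (0,t) = \<epsilon> * C s t" using assms(2)[OF s] by blast
  obtain w where w: "\<And>x. x < hh k \<Longrightarrow> C s x = x ^ (5 - s) * poly w x" using assms(1)[OF s] unfolding van0_def by blast
  have "dpart s 0 \<psi> (0,t) = t ^ (5 - s) * poly (smult \<epsilon> w) t" if "0 < t" "t < hh k" for t
    using e[of t] w[of t] that hh_le[of k] by simp
  then show "\<exists>w::real poly. \<forall>t. 0 < t \<and> t < hh k \<longrightarrow> dpart s 0 \<psi> (0,t) = t ^ (5 - s) * poly w t" by blast
qed

text \<open>On its own edge, traversed in either direction, the range of j gives order 5 - s at the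
  starting end; on the other three sides all jets are zero.\<close>

lemma gfun_sqsym_flat:
  assumes A: "bilinear_map A" "bilinear_map B" and ij: "i \<le> 2" "j \<in> {5 - i .. nE p r k A B i + i - 6}" and \<tau>: "\<tau> \<in> sqsym"
  shows "flat k (gfun p r k A B tau i j \<circ> \<tau>)"
proof -
  have T: "gfun p r k A B tau i j \<in> TS p r k" by (rule gfun_TS[OF A])
  have n: "8 \<le> nE p r k A B i" using dims(1) dims(2)[OF dal_le[of A B]] dims(3)[OF dal_le[of A B]] by (auto simp: nE_def Let_def)
  have C: "\<And>s. s \<le> 2 \<Longrightarrow> gc p r k A B tau i j s \<in> PS p r k" by (rule gc_PS[OF A])
  have d: "dpart s 0 (gfun p r k A B tau i j) (0,t) = gc p r k A B tau i j s t" if "s \<le> 2" for s t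
    unfolding gfun_MT by (subst dpart_MT_0) (use C that in auto)
  have v0: "van0 k (5 - s) (gc p r k A B tau i j s)" if "s \<le> 2" for s
    using ij by (intro van0_mono[OF gc_van0[OF A that]]) auto
  have v1: "van0 k (5 - s) (\<lambda>t. gc p r k A B tau i j s (1 - t))" if "s \<le> 2" for s
    unfolding van1_def[symmetric] using ij n by (intro van1_mono[OF gc_van1[OF A that]]) auto
  from sqsym_left_side[OF \<tau>] show ?thesis
  proof (elim disjE exE)
    assume *: "\<forall>t. \<tau> (0,t) = (0,t)"
    show ?thesis using v0
    proof (rule flatI_van0)
      fix s :: nat assume s: "s \<le> 2"
      obtain \<epsilon> where "\<forall>\<xi>. dpart s 0 (gfun p r k A B tau i j \<circ> \<tau>) \<xi> = \<epsilon> * dpart s 0 (gfun p r k A B tau i j) (\<tau> \<xi>)"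
        using dpart_sqsym_left(1)[OF T \<tau> s] * by auto
      then show "\<exists>\<epsilon>. \<forall>t. 0 < t \<and> t < 1 \<longrightarrow> dpart s 0 (gfun p r k A B tau i j \<circ> \<tau>) (0,t) = \<epsilon> * gc p r k A B tau i j s t"
        using * d[OF s] by (intro exI[of _ \<epsilon>]) simp
    qed
  next
    assume *: "\<forall>t. \<tau> (0,t) = (0,1-t)"
    show ?thesis using v1
    proof (rule flatI_van0)
      fix s :: nat assume s: "s \<le> 2"
      obtain \<epsilon> where "\<forall>\<xi>. dpart s 0 (gfun p r k A B tau i j \<circ> \<tau>) \<xi> = \<epsilon> * dpart s 0 (gfun p r k A B tau i j) (\<tau> \<xi>)"
        using dpart_sqsym_left(1)[OF T \<tau> s] * by auto
      then show "\<exists>\<epsilon>. \<forall>t. 0 < t \<and> t < 1 \<longrightarrow> dpart s 0 (gfun p r k A B tau i j \<circ> \<tau>) (0,t) = \<epsilon> * gc p r k A B tau i j s (1 - t)"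
        using * d[OF s] by (intro exI[of _ \<epsilon>]) simp
    qed
  qed (rule flat_zj, rule zj_sqsym[OF T \<tau>], use gfun_zj[OF A ij] in simp)+
qed

lemma Nprod_sqsym_zj:
  assumes ij: "i \<in> {3..p + k*(p-r) - 3}" "j \<in> {3..p + k*(p-r) - 3}" and \<tau>: "\<tau> \<in> sqsym" and t: "0 < t" "t < 1"
  shows "zj ((\<lambda>\<xi>. Nsp p r k i (fst \<xi>) * Nsp p r k j (snd \<xi>)) \<circ> \<tau>) (0,t)"
proof (rule zj_sqsym[OF Nprod_TS \<tau> Nprod_zj[OF ij]])
  show "\<tau> (0,t) \<in> unitsq" using sqsym_mem(1)[OF \<tau>, of "(0,t)"] t by (simp add: unitsq_def)
  show "\<tau> (0,t) \<notin> opensq" using sqsym_mem(2)[OF \<tau>, of "(0,t)"] by (simp add: opensq_def)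
qed

end

context vertex_star
begin

lemma dpart_fv_left:
  assumes "l < nu" "s \<le> 2"
  shows "dpart s 0 (fv l) (0,t) = An l s t"
proof -
  have "zj (\<lambda>\<xi>. fv l \<xi> - fN l \<xi>) (0,t)" unfolding fv_diff by (rule zj_left[OF assms(1)])
  then have "dpart s 0 (\<lambda>\<xi>. fv l \<xi> - fN l \<xi>) (0,t) = 0" using assms(2) unfolding zj_def by simp
  then have "dpart s 0 (fv l) (0,t) = dpart s 0 (fN l) (0,t)"
    using dpart_diff[OF fv_TS[OF assms(1)] fN_TS[OF assms(1)] assms(2), of 0 "(0,t)"] by simp
  also have "\<dots> = An l s t" unfolding fN_MT by (subst dpart_MT_0) (use An_PS[OF assms(1)] assms(2) in auto)
  finally show ?thesis .
qed

lemma dpart_fv_bottom: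
  assumes "l < nu" "s \<le> 2"
  shows "dpart 0 s (fv l) (t,0) = Ap l s t"
proof -
  have "zj (\<lambda>\<xi>. fv l \<xi> - fP l \<xi>) (t,0)" unfolding fv_diff by (rule zj_bottom[OF assms(1)])
  then have "dpart 0 s (\<lambda>\<xi>. fv l \<xi> - fP l \<xi>) (t,0) = 0" using assms(2) unfolding zj_def by simp
  then have "dpart 0 s (fv l) (t,0) = dpart 0 s (fP l) (t,0)"
    using dpart_diff[OF fv_TS[OF assms(1)] fP_TS[OF assms(1)] le0 assms(2)] by simp
  also have "\<dots> = dpart s 0 (MT p r k (Ap l)) (0,t)" unfolding fP_MT
    using TS_swap(2)[OF MT_TS[OF Ap_PS[OF assms(1)]] le0 assms(2), of "\<lambda>s. s" "(t,0)"] by simp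
  also have "\<dots> = Ap l s t" by (subst dpart_MT_0) (use Ap_PS[OF assms(1)] assms(2) in auto)
  finally show ?thesis .
qed

text \<open>Seen from a corner other than its own, a vertex function shows either the far end of one
  of its two edges, with order 5 - s by \<open>An_van1\<close> and \<open>Ap_van1\<close>, or a side
  on which its jets vanish.\<close>

lemma fv_sqsym_flat:
  assumes l: "l < nu" and \<tau>: "\<tau> \<in> sqsym" "\<tau> (0,0) \<noteq> (0,0)"
  shows "flat k (fv l \<circ> \<tau>)"
proof -
  note T = fv_TS[OF l]
  from sqsym_left_side[OF \<tau>(1)] show ?thesis
  proof (elim disjE exE)
    assume *: "\<forall>t. \<tau> (0,t) = (0,1-t)"
    show ?thesis
    proof (rule flatI_van0)
      show "van0 k (5 - s) (\<lambda>t. An l s (1 - t))" if "s \<le> 2" for s using An_van1[OF l that] by (simp add: van1_def)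
      fix s :: nat assume s: "s \<le> 2"
      show "\<exists>\<epsilon>. \<forall>t. 0 < t \<and> t < 1 \<longrightarrow> dpart s 0 (fv l \<circ> \<tau>) (0,t) = \<epsilon> * An l s (1 - t)"
      proof -
        obtain \<epsilon> where "\<forall>\<xi>. dpart s 0 (fv l \<circ> \<tau>) \<xi> = \<epsilon> * dpart s 0 (fv l) (\<tau> \<xi>)"
          using dpart_sqsym_left(1)[OF T \<tau>(1) s] * by auto
        then show ?thesis using * dpart_fv_left[OF l s] by (intro exI[of _ \<epsilon>]) simp
      qed
    qed
  next
    assume *: "\<forall>t. \<tau> (0,t) = (1-t,0)"
    show ?thesis
    proof (rule flatI_van0)
      show "van0 k (5 - s) (\<lambda>t. Ap l s (1 - t))" if "s \<le> 2" for s using Ap_van1[OF l that] by (simp add: van1_def)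
      fix s :: nat assume s: "s \<le> 2"
      show "\<exists>\<epsilon>. \<forall>t. 0 < t \<and> t < 1 \<longrightarrow> dpart s 0 (fv l \<circ> \<tau>) (0,t) = \<epsilon> * Ap l s (1 - t)"
      proof -
        obtain \<epsilon> where "\<forall>\<xi>. dpart s 0 (fv l \<circ> \<tau>) \<xi> = \<epsilon> * dpart 0 s (fv l) (\<tau> \<xi>)"
          using dpart_sqsym_left(2)[OF T \<tau>(1) s] * by auto
        then show ?thesis using * dpart_fv_bottom[OF l s] by (intro exI[of _ \<epsilon>]) simp
      qed
    qed
  next
    fix g assume "\<forall>t. \<tau> (0,t) = (1, g t)"
    then show ?thesis using zj_fv_right[OF l] by (intro flat_zj zj_sqsym[OF T \<tau>(1)]) simp
  next
    fix g assume "\<forall>t. \<tau> (0,t) = (g t, 1)"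
    then show ?thesis using zj_fv_top[OF l] by (intro flat_zj zj_sqsym[OF T \<tau>(1)]) simp
  qed (use \<tau>(2) in auto)
qed

lemma star_alpha_nonzero:
  assumes l: "l < nu" "isin \<or> l + 1 < nu"
  shows "alpha (Gs l) (sw ((l+1) mod nu)) True 0 \<noteq> 0"
proof -
  define l' where "l' = (l+1) mod nu"
  have l'n: "l' < nu" using l by (simp add: l'_def)
  have im: "sw l' ` unitsq = Gs l' ` unitsq"
  proof -
    have "prod.swap ` unitsq = unitsq" by (auto simp: unitsq_def image_iff)
    then show ?thesis by (metis image_comp)
  qed
  have "abar (Gs l) (1/2) * abar (sw l') (1/2) < 0"
    by (rule common_edge(1)[OF pat[OF l(1)] sw_patch[OF l'n]])
       (use sw_edge[OF l] dis[OF l(1) l'n] next_neq[OF l] im in \<open>auto simp: l'_def\<close>)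
  then have "c1 (Gs l) (sw l') \<noteq> 0" by (rule c1_nonzero[OF bil(1)[OF l(1)] bil(2)[OF l'n]])
  moreover have "abar (Gs l) 0 \<noteq> 0" unfolding abar_jdet using pat[OF l(1)] by (auto simp: patch_def unitsq_def)
  ultimately show ?thesis by (simp add: alpha_def l'_def)
qed

text \<open>The transversal orders s = 0, 1, 2 are treated in turn. In order s only the coefficients
  with i = s are left, multiplied by the power s of \<open>alpha\<close>, which is nonzero at the
  vertex. Flatness provides t^(5-s), one power above the top index 4 - s, as
  \<open>Nsp_triangular\<close> requires.\<close>

lemma edge_coeffs_zero:
  assumes l: "l < nu" "isin \<or> l + 1 < nu" and fl: "flat k (fv l)" and ij: "i \<le> 2" "j \<le> 4 - i"
  shows "a (CE (enxt isin nu l) i j) = 0"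
proof -
  define A B e where "A = Gs l" and "B = sw ((l+1) mod nu)" and "e = enxt isin nu l"
  define d where "d = dal A B"
  have d1: "d \<le> 1" using dal_le by (simp add: d_def)
  have bl: "bilinear_map A" "bilinear_map B" using bil(1)[OF l(1)] bil(2)[OF modlt[OF l(1)]] by (auto simp: A_def B_def)
  have nb: "\<not> (\<not> isin \<and> l + 1 = nu)" using l by auto
  have An: "An l s t = (\<Sum>i\<le>2. \<Sum>j\<le>4-i. a (CE e i j) * gc p r k A B True i j s t)" for s t
    unfolding An_def by (simp only: if_not_P[OF nb] A_def B_def e_def)
  have S: "(\<Sum>i\<le>2. \<Sum>j\<le>4-i. f i j) = (\<Sum>j\<le>4. f 0 j) + (\<Sum>j\<le>3. f 1 j) + (\<Sum>j\<le>2. f 2 j)" for f :: "nat \<Rightarrow> nat \<Rightarrow> real"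
  proof -
    have "{..2} = {0,1,2::nat}" by auto
    then show ?thesis by (simp add: numeral_eq_Suc)
  qed
  have W: "\<exists>w::real poly. \<forall>t. 0 < t \<and> t < hh k \<longrightarrow> An l s t = t ^ (5 - s) * poly w t" if "s \<le> 2" for s
    using fl[unfolded flat_def, rule_format, OF that] unfolding dpart_fv_left[OF l(1) that] .
  define al' where "al' = [:alpha A B True 0, alpha A B True 1 - alpha A B True 0:]"
  have al: "alpha A B True t = poly al' t" for t unfolding al'_def by (rule alpha_affine[OF bl])
  have a0: "poly al' 0 \<noteq> 0" using star_alpha_nonzero[OF l] by (simp add: al'_def A_def B_def)
  have ph: "hh k \<noteq> 0" "real p \<noteq> 0" "real p - 1 \<noteq> 0" using hh_pos[of k] p5 by auto
  have dz: "deriv (gphi p r k d i j 0) = (\<lambda>t. 0)" "deriv (deriv (gphi p r k d i j 0)) = (\<lambda>t. 0)" if "i \<noteq> 0" for i j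
    using that by (simp_all add: gphi_def deriv_zero_fun)
  have dz1: "deriv (gphi p r k d i j 1) = (\<lambda>t. 0)" if "i \<noteq> 1" for i j
    using that by (simp add: gphi_def deriv_zero_fun)
  have Z0: "a (CE e 0 j) = 0" if "j \<le> 4" for j
  proof -
    obtain w where w: "\<And>t. 0 < t \<and> t < hh k \<Longrightarrow> An l 0 t = t ^ 5 * poly w t" using W[of 0] by auto
    have "An l 0 t = (\<Sum>j\<le>4. a (CE e 0 j) * Nsp p (r+2) k j t)" for t
      unfolding An S by (simp add: gc_def gphi_def Let_def)
    then show ?thesis
      using Nsp_triangular[of k "r+2" p 4 1 "\<lambda>j. a (CE e 0 j)" w j] rp(3) p5 w that by simp
  qed
  have Z1: "a (CE e 1 j) = 0" if "j \<le> 3" for j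
  proof -
    obtain w where w: "\<And>t. 0 < t \<and> t < hh k \<Longrightarrow> An l 1 t = t ^ 4 * poly w t" using W[of 1] by auto
    have "An l 1 t = poly (smult (real p / hh k) al') t * (\<Sum>j\<le>3. a (CE e 1 j) * Nsp (p-d) (r+1) k j t)" for t
    proof -
      have "An l 1 t = (\<Sum>j\<le>3. a (CE e 1 j) * gc p r k A B True 1 j 1 t)"
        unfolding An S by (simp add: Z0 gc_def Let_def gphi_def deriv_zero_fun)
      also have "\<dots> = (\<Sum>j\<le>3. a (CE e 1 j) * (alpha A B True t * (real p / hh k * Nsp (p-d) (r+1) k j t)))"
        by (intro sum.cong refl) (simp add: gc_def Let_def d_def[symmetric] dz, simp add: gphi_def)
      finally show ?thesis unfolding al by (simp add: sum_distrib_left mult_ac)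
    qed
    then show ?thesis
      using Nsp_triangular[of k "r+1" "p-d" 3 "smult (real p / hh k) al'" "\<lambda>j. a (CE e 1 j)" w j] rp(4)[OF d1] p5 d1 w that a0 ph by simp
  qed
  have Z2: "a (CE e 2 j) = 0" if "j \<le> 2" for j
  proof -
    obtain w where w: "\<And>t. 0 < t \<and> t < hh k \<Longrightarrow> An l 2 t = t ^ 3 * poly w t" using W[of 2] by auto
    have "An l 2 t = poly (smult (real p * (real p - 1) / (hh k)\<^sup>2) (al' ^ 2)) t * (\<Sum>j\<le>2. a (CE e 2 j) * Nsp (p-2*d) r k j t)" for t
    proof -
      have "An l 2 t = (\<Sum>j\<le>2. a (CE e 2 j) * gc p r k A B True 2 j 2 t)"
        unfolding An S by (simp add: Z0 Z1[unfolded One_nat_def])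
      also have "\<dots> = (\<Sum>j\<le>2. a (CE e 2 j) * ((alpha A B True t)\<^sup>2 * (real p * (real p - 1) / (hh k)\<^sup>2 * Nsp (p-2*d) r k j t)))"
        by (intro sum.cong refl) (simp add: gc_def Let_def d_def[symmetric] dz dz1[unfolded One_nat_def], simp add: gphi_def)
      finally show ?thesis unfolding al poly_smult poly_power by (simp add: sum_distrib_left mult_ac)
    qed
    then show ?thesis
      using Nsp_triangular[of k r "p-2*d" 2 "smult (real p * (real p - 1) / (hh k)\<^sup>2) (al' ^ 2)" "\<lambda>j. a (CE e 2 j)" w j] rp(5)[OF d1] p5 d1 w that a0 ph by simp
  qed
  have "i = 0 \<or> i = 1 \<or> i = 2" using ij by auto
  then show ?thesis using Z0[of j] Z1[of j] Z2[of j] ij unfolding e_def by auto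
qed

text \<open>With the edge coefficients gone, the kernel equations say that the corner part has
  vanishing derivatives of order up to (2,2) at the corner, and \<open>Nsp_corner_deriv\<close>,
  applied in each variable, removes its coefficients. At a boundary vertex these are zero by
  definition.\<close>

lemma kernel_zero:
  assumes fl: "\<And>l. l < nu \<Longrightarrow> isin \<or> l + 1 < nu \<Longrightarrow> flat k (fv l)"
  shows "a x = 0"
proof (cases "validV isin nu x")
  case False
  then show ?thesis using ker unfolding kerH_def by auto
next
  case True
  have K: "\<And>c. \<not> validV isin nu c \<Longrightarrow> a c = 0" "\<not> isin \<Longrightarrow> a (CE 0 i j) = 0" "\<not> isin \<Longrightarrow> a (CE nu i j) = 0" "\<not> isin \<Longrightarrow> a (CP l i j) = 0" for l i j
    using ker unfolding kerH_def by auto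
  have E: "a (CE e i j) = 0" for e i j
  proof (cases "validV isin nu (CE e i j)")
    case True
    then have ij: "i \<le> 2" "j \<le> 4 - i" and e: "if isin then e < nu else e \<le> nu" by auto
    show ?thesis
    proof (cases "\<not> isin \<and> (e = 0 \<or> e = nu)")
      case True then show ?thesis using K by auto
    next
      case False
      then have en: "e < nu" "isin \<or> 0 < e" using e by (auto split: if_splits)
      obtain l where l: "l < nu" "isin \<or> l + 1 < nu" "(l+1) mod nu = e" using pred_exists[OF en] by blast
      have "enxt isin nu l = e" using l by (auto simp: enxt_def)
      then show ?thesis using edge_coeffs_zero[OF l(1,2) fl[OF l(1,2)] ij] by simp
    qed
  qed (rule K)
  show ?thesis
  proof (cases x)
    case (CE e i j) then show ?thesis using E by simp
  next
    case (CP l i j)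
    show ?thesis
    proof (cases isin)
      case False then show ?thesis using K CP by simp
    next
      case isin: True
      have l: "l < nu" "i \<le> 2" "j \<le> 2" using True CP by auto
      have "fN l = (\<lambda>\<xi>. 0)" by (simp add: fGnext_def[abs_def] E)
      then have z: "dpart i j (fO l) (0,0) = 0" if "i \<le> 2" "j \<le> 2" for i j
        using ker_zero(1)[OF l(1) that] dpart_diff[OF TS_zero fO_TS that, of l "(0,0)"] dpart_zero[OF that] by simp
      have D: "dpart i j (fO l) (0,0) = (\<Sum>i'\<le>2. (\<Sum>j'\<le>2. a (CP l i' j') * (deriv ^^ j) (Nsp p r k j') 0) * (deriv ^^ i) (Nsp p r k i') 0)"
        if "i \<le> 2" "j \<le> 2" for i j
      proof -
        have T: "(\<lambda>\<xi>. a (CP l i' j') * (Nsp p r k i' (fst \<xi>) * Nsp p r k j' (snd \<xi>))) \<in> TS p r k" for i' j'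
          by (rule TS_cmul[OF Nprod_TS])
        have "dpart i j (fO l) (0,0) = (\<Sum>i'\<le>2. \<Sum>j'\<le>2. dpart i j (\<lambda>\<xi>. a (CP l i' j') * (Nsp p r k i' (fst \<xi>) * Nsp p r k j' (snd \<xi>))) (0,0))"
          unfolding fOm_def[abs_def] mult.assoc
          by (subst dpart_sum) (use that T in \<open>auto intro!: TS_sum sum.cong dpart_sum\<close>)
        also have "\<dots> = (\<Sum>i'\<le>2. \<Sum>j'\<le>2. a (CP l i' j') * ((deriv ^^ i) (Nsp p r k i') 0 * (deriv ^^ j) (Nsp p r k j') 0))"
          using dpart_cmul[OF Nprod_TS that] dpart_prod[OF Nsp_PS[OF rp(1)] Nsp_PS[OF rp(1)] that] by simp
        finally show ?thesis by (simp only: sum_distrib_left sum_distrib_right mult_ac)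
      qed
      have 1: "(\<Sum>j'\<le>2. a (CP l i' j') * (deriv ^^ j) (Nsp p r k j') 0) = 0" if "i' \<le> 2" "j \<le> 2" for i' j
        by (rule Nsp_corner_deriv[OF rp(1) _ _ that(1)]) (use p5 z D that in auto)
      have "a (CP l i j) = 0"
        by (rule Nsp_corner_deriv[OF rp(1) _ _ l(3), of "\<lambda>j. a (CP l i j)"]) (use p5 1 l in auto)
      then show ?thesis using CP by simp
    qed
  qed
qed

end

section \<open>Linear independence\<close>

lemma double_sum_lin:
  fixes B :: "'m \<Rightarrow> nat \<Rightarrow> nat \<Rightarrow> real"
  shows "(\<Sum>i\<le>q. \<Sum>j\<le>n i. (\<Sum>m\<in>M. c m * B m i j) * g i j) = (\<Sum>m\<in>M. c m * (\<Sum>i\<le>q. \<Sum>j\<le>n i. B m i j * g i j))"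
proof -
  have "(\<Sum>m\<in>M. c m * (\<Sum>i\<le>q. \<Sum>j\<le>n i. B m i j * g i j)) = (\<Sum>m\<in>M. \<Sum>i\<le>q. \<Sum>j\<le>n i. c m * (B m i j * g i j))"
    by (simp only: sum_distrib_left)
  also have "\<dots> = (\<Sum>i\<le>q. \<Sum>m\<in>M. \<Sum>j\<le>n i. c m * (B m i j * g i j))" by (rule sum.swap)
  also have "\<dots> = (\<Sum>i\<le>q. \<Sum>j\<le>n i. \<Sum>m\<in>M. c m * (B m i j * g i j))" by (intro sum.cong refl sum.swap)
  finally show ?thesis by (simp only: sum_distrib_right mult.assoc)
qed

lemma vertex_lin:
  fixes b :: "'m \<Rightarrow> vcoef \<Rightarrow> real"
  shows "fGnext p r k isin n Gs (\<lambda>x. \<Sum>m\<in>M. c m * b m x) l \<xi> = (\<Sum>m\<in>M. c m * fGnext p r k isin n Gs (b m) l \<xi>)" (is ?N)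
    and "fGprev p r k isin n Gs (\<lambda>x. \<Sum>m\<in>M. c m * b m x) l \<xi> = (\<Sum>m\<in>M. c m * fGprev p r k isin n Gs (b m) l \<xi>)" (is ?Q)
    and "fOm p r k (\<lambda>x. \<Sum>m\<in>M. c m * b m x) l \<xi> = (\<Sum>m\<in>M. c m * fOm p r k (b m) l \<xi>)" (is ?O)
    and "fV p r k isin n Gs (\<lambda>x. \<Sum>m\<in>M. c m * b m x) l \<xi> = (\<Sum>m\<in>M. c m * fV p r k isin n Gs (b m) l \<xi>)" (is ?V)
proof -
  show N: ?N unfolding fGnext_def by (rule double_sum_lin)
  show Q: ?Q unfolding fGprev_def by (rule double_sum_lin)
  show O: ?O
    using double_sum_lin[where g = "\<lambda>i j. Nsp p r k i (fst \<xi>) * Nsp p r k j (snd \<xi>)" and n = "\<lambda>_. 2" and c = c and B = "\<lambda>m i j. b m (CP l i j)" and M = M and q = 2]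
    unfolding fOm_def by (simp only: mult.assoc)
  show ?V unfolding fV_def N Q O by (simp only: distrib_left right_diff_distrib sum.distrib sum_subtractf)
qed

lemma sqsym_id: "(\<lambda>\<xi>. \<xi>) \<in> sqsym" by (rule sqsymI[of _ False False False]) simp

lemma GV_eq: "GV F Lv psiV v = (\<lambda>l. F (Lv v l) \<circ> psiV v l)" by (simp add: fun_eq_iff GV_def)

lemma patch_bilinear: "patch G \<Longrightarrow> bilinear_map G" by (simp add: patch_def)

locale multipatch_family = c2_spline +
  fixes P :: nat and F :: "nat \<Rightarrow> pt \<Rightarrow> pt"
    and eA eB :: "nat \<times> nat \<Rightarrow> nat"
    and psiA psiB :: "nat \<times> nat \<Rightarrow> pt \<Rightarrow> pt"
    and nu :: "pt \<Rightarrow> nat" and Lv :: "pt \<Rightarrow> nat \<Rightarrow> nat" and psiV :: "pt \<Rightarrow> nat \<Rightarrow> pt \<Rightarrow> pt"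
    and mV :: "pt \<Rightarrow> nat" and bV :: "pt \<Rightarrow> nat \<Rightarrow> vcoef \<Rightarrow> real"
  assumes mp: "multipatch P F"
    and ed: "s \<in> commonEdges P F \<Longrightarrow> edge_data P F s (eA s) (eB s) (psiA s) (psiB s)"
    and vd: "v \<in> vertSet P F \<Longrightarrow> vertex_data p r k P F v (nu v) (Lv v) (psiV v) (mV v) (bV v)"
begin

abbreviation "idx \<equiv> Iset p r k P F eA eB psiA psiB mV"
abbreviation "bf \<equiv> fam p r k P F eA eB psiA psiB nu Lv psiV bV"
abbreviation "EA s \<equiv> F (eA s) \<circ> psiA s"
abbreviation "EB s \<equiv> F (eB s) \<circ> psiB s"
abbreviation "isin v \<equiv> v \<in> interior (dom P F)"
abbreviation "GG v \<equiv> (\<lambda>l. F (Lv v l) \<circ> psiV v l)"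
abbreviation "NN i j \<equiv> (\<lambda>\<xi>::pt. Nsp p r k i (fst \<xi>) * Nsp p r k j (snd \<xi>))"
abbreviation "Pidx \<equiv> {3..p + k*(p-r) - 3}"
abbreviation "Eidx s i \<equiv> {5 - i .. nE p r k (EA s) (EB s) i + i - 6}"

lemma idx_mem:
  "IP l i j \<in> idx \<longleftrightarrow> l \<in> {1..P} \<and> i \<in> Pidx \<and> j \<in> Pidx"
  "IE s i j \<in> idx \<longleftrightarrow> s \<in> commonEdges P F \<and> i \<le> 2 \<and> j \<in> Eidx s i"
  "IV v m \<in> idx \<longleftrightarrow> v \<in> vertSet P F \<and> m \<in> {1..mV v}"
  unfolding Iset_def by (auto simp del: split_paired_Ex split_paired_All)

lemma edge_facts:
  assumes "s \<in> commonEdges P F"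
  shows "eA s \<in> {1..P}" "eB s \<in> {1..P}" "eA s \<noteq> eB s" "psiA s \<in> sqsym" "psiB s \<in> sqsym" "patch (EA s)" "patch (EB s)"
    "\<And>t. t \<in> {0..1} \<Longrightarrow> EA s (0,t) = EB s (0,t)" "interior (EA s ` unitsq) \<inter> interior (EB s ` unitsq) = {}"
    "{eA s, eB s} = {fst s, snd s}" "fst s < snd s"
proof -
  have d: "{eA s, eB s} = {fst s, snd s}" "psiA s \<in> sqsym" "psiB s \<in> sqsym" "\<And>t. t \<in> {0..1} \<Longrightarrow> EA s (0,t) = EB s (0,t)"
    using ed[OF assms] unfolding edge_data_def by auto
  have s: "1 \<le> fst s" "fst s < snd s" "snd s \<le> P" using assms unfolding commonEdges_def by auto
  have i: "eA s \<in> {fst s, snd s}" "eB s \<in> {fst s, snd s}" using d(1) by blast+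
  have l: "eA s \<in> {1..P}" "eB s \<in> {1..P}" using i s by auto
  have ne: "eA s \<noteq> eB s" using d(1) s(2) by (metis insert_absorb2 doubleton_eq_iff less_irrefl)
  show "eA s \<in> {1..P}" "eB s \<in> {1..P}" "eA s \<noteq> eB s" "psiA s \<in> sqsym" "psiB s \<in> sqsym"
    "{eA s, eB s} = {fst s, snd s}" "fst s < snd s" by fact+
  show "\<And>t. t \<in> {0..1} \<Longrightarrow> EA s (0,t) = EB s (0,t)" by fact
  show "patch (EA s)" "patch (EB s)" using patch_sqsym multipatch_patch[OF mp] l d by auto
  show "interior (EA s ` unitsq) \<inter> interior (EB s ` unitsq) = {}"
    unfolding image_sqsym[OF d(2)] image_sqsym[OF d(3)] by (rule multipatch_disjoint[OF mp l ne])
qed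

lemma bV_ker:
  assumes "v \<in> vertSet P F" "m \<in> {1..mV v}"
  shows "bV v m \<in> kerH p r k (isin v) (nu v) (GG v)"
  using vd[OF assms(1)] assms(2) unfolding vertex_data_def Let_def basis_of_def by blast

lemma bV_indep:
  assumes "v \<in> vertSet P F"
  shows "lin_indep {1..mV v} (bV v)"
  using vd[OF assms(1)] unfolding vertex_data_def Let_def basis_of_def by blast

lemma bf_IV: "bf (IV v m) = vfun p r k (isin v) (nu v) (GG v) (bV v m)" by (simp add: GV_eq)

lemma bf_nice:
  assumes "I \<in> idx"
  shows "nice p r k P F (bf I)"
proof (cases I)
  case (IP l i j)
  then show ?thesis using assms pfun_nice[OF mp, of l i j] by (simp add: idx_mem)
next
  case (IE s i j)
  then have "s \<in> commonEdges P F" "i \<le> 2" "j \<in> Eidx s i" using assms by (auto simp: idx_mem)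
  then show ?thesis using efun_nice[OF mp _ ed] unfolding IE fam.simps by blast
next
  case (IV v m)
  then have vm: "v \<in> vertSet P F" "m \<in> {1..mV v}" using assms by (auto simp: idx_mem)
  show ?thesis unfolding IV bf_IV by (rule vfun_nice[OF mp vd[OF vm(1)] bV_ker[OF vm]])
qed

lemma finite_idx: "finite idx"
proof -
  have 1: "finite (commonEdges P F)" by (rule finite_subset[of _ "{1..P} \<times> {1..P}"]) (auto simp: commonEdges_def)
  have "finite (corners P F)" by (auto simp: corners_def sqcorners_def)
  then have 2: "finite (vertSet P F)" by (auto intro: finite_subset simp: vertSet_def)
  have "idx \<subseteq> (\<lambda>(l,i,j). IP l i j) ` ({1..P} \<times> Pidx \<times> Pidx)
      \<union> (\<lambda>(s,i,j). IE s i j) ` (SIGMA s:commonEdges P F. SIGMA i:{..2}. Eidx s i)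
      \<union> (\<lambda>(v,m). IV v m) ` (SIGMA v:vertSet P F. {1..mV v})"
    unfolding Iset_def by (force simp: image_iff)
  then show ?thesis by (rule finite_subset) (use 1 2 in auto)
qed

lemma span_V0h: "fspan idx bf \<subseteq> V0h p r k P F"
  using nice_V0h[OF mp rp(1) nice_sum[OF finite_idx bf_nice]] unfolding fspan_def by auto

section \<open>The generators pulled back to one patch\<close>

lemma pfun_restrict:
  assumes l: "l \<in> {1..P}" "l' \<in> {1..P}" and \<sigma>: "\<sigma> \<in> sqsym"
  shows "(l' = l \<and> (\<forall>\<xi>\<in>unitsq. bf (IP l' i j) (F l (\<sigma> \<xi>)) = (NN i j \<circ> \<sigma>) \<xi>)) \<or> (\<forall>\<xi>\<in>opensq. bf (IP l' i j) (F l (\<sigma> \<xi>)) = 0)"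
proof -
  have inj: "inj_on (F l') unitsq" using multipatch_patch[OF mp l(2)] by (simp add: patch_def)
  have R: "(\<exists>u\<in>UNIV::unit set. l' = l \<and> (\<exists>\<tau>\<in>sqsym. (\<forall>\<xi>. \<tau> \<xi> = \<sigma> \<xi>) \<and> (\<forall>\<xi>\<in>unitsq. bf (IP l' i j) (F l (\<sigma> \<xi>)) = (NN i j \<circ> \<tau>) \<xi>)))
    \<or> (\<forall>\<xi>\<in>opensq. bf (IP l' i j) (F l (\<sigma> \<xi>)) = 0)"
    by (rule patch_restrict[OF mp, where I = "UNIV :: unit set" and L = "\<lambda>_. l'" and psi = "\<lambda>_ \<xi>. \<xi>" and \<phi> = "\<lambda>_. NN i j"])
       (use l \<sigma> sqsym_id inj in \<open>auto simp: pfun_def Let_def\<close>)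
  then show ?thesis
  proof (elim disjE bexE conjE)
    fix \<tau> assume 1: "l' = l" "\<forall>\<xi>. \<tau> \<xi> = \<sigma> \<xi>" "\<forall>\<xi>\<in>unitsq. bf (IP l' i j) (F l (\<sigma> \<xi>)) = (NN i j \<circ> \<tau>) \<xi>"
    then have "\<tau> = \<sigma>" by (simp add: fun_eq_iff)
    then show ?thesis using 1 by blast
  qed blast
qed

lemma efun_restrict:
  assumes l: "l \<in> {1..P}" and s: "s \<in> commonEdges P F" and ij: "i \<le> 2" "j \<in> Eidx s i" and \<sigma>: "\<sigma> \<in> sqsym"
  shows "(\<exists>tau. (if tau then eA s else eB s) = l \<and> (\<exists>\<tau>\<in>sqsym. (\<forall>\<xi>. (if tau then psiA s else psiB s) (\<tau> \<xi>) = \<sigma> \<xi>)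
       \<and> (\<forall>\<xi>\<in>unitsq. bf (IE s i j) (F l (\<sigma> \<xi>)) = (gfun p r k (EA s) (EB s) tau i j \<circ> \<tau>) \<xi>)))
     \<or> (\<forall>\<xi>\<in>opensq. bf (IE s i j) (F l (\<sigma> \<xi>)) = 0)"
proof -
  note f = edge_facts[OF s]
  have v: "bf (IE s i j) (F (if tau then eA s else eB s) ((if tau then psiA s else psiB s) \<xi>)) = gfun p r k (EA s) (EB s) tau i j \<xi>"
    if "\<xi> \<in> unitsq" for tau \<xi>
    using efun_value[OF f(6,7,8,9) ij that] by (cases tau) simp_all
  have z: "bf (IE s i j) x = 0" if "x \<notin> (\<Union>tau\<in>UNIV. F (if tau then eA s else eB s) ` unitsq)" for x
  proof -
    have "x \<notin> EA s ` unitsq" "x \<notin> EB s ` unitsq"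
      unfolding image_sqsym[OF f(4)] image_sqsym[OF f(5)] using that by (auto split: if_splits)
    then show ?thesis by (simp add: efun_def)
  qed
  have "(\<exists>tau\<in>UNIV. (if tau then eA s else eB s) = l \<and> (\<exists>\<tau>\<in>sqsym. (\<forall>\<xi>. (if tau then psiA s else psiB s) (\<tau> \<xi>) = \<sigma> \<xi>)
       \<and> (\<forall>\<xi>\<in>unitsq. bf (IE s i j) (F l (\<sigma> \<xi>)) = (gfun p r k (EA s) (EB s) tau i j \<circ> \<tau>) \<xi>)))
     \<or> (\<forall>\<xi>\<in>opensq. bf (IE s i j) (F l (\<sigma> \<xi>)) = 0)"
    by (rule patch_restrict[OF mp, where I = UNIV and L = "\<lambda>tau. if tau then eA s else eB s"
          and psi = "\<lambda>tau. if tau then psiA s else psiB s" and \<phi> = "\<lambda>tau. gfun p r k (EA s) (EB s) tau i j" and f = "bf (IE s i j)", OF _ _ v z l \<sigma>])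
       (use f in auto)
  then show ?thesis by blast
qed

lemma vfun_star_value:
  assumes v: "v \<in> vertSet P F" and a: "a \<in> kerH p r k (isin v) (nu v) (GG v)" and l: "l < nu v" "\<xi> \<in> unitsq"
  shows "vfun p r k (isin v) (nu v) (GG v) a (F (Lv v l) (psiV v l \<xi>)) = fV p r k (isin v) (nu v) (GG v) a l \<xi>"
proof -
  note f = vertex_star_of_data[OF mp vd[OF v] a]
  show ?thesis using vertex_star.vfun_value[OF f(1) f(2) f(3) l] by (simp only: comp_apply[of "F (Lv v l)" "psiV v l" \<xi>])
qed

lemma vfun_restrict:
  assumes l: "l \<in> {1..P}" and v: "v \<in> vertSet P F" and a: "a \<in> kerH p r k (isin v) (nu v) (GG v)" and \<sigma>: "\<sigma> \<in> sqsym"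
  shows "(\<exists>l'<nu v. Lv v l' = l \<and> (\<exists>\<tau>\<in>sqsym. (\<forall>\<xi>. psiV v l' (\<tau> \<xi>) = \<sigma> \<xi>)
       \<and> (\<forall>\<xi>\<in>unitsq. vfun p r k (isin v) (nu v) (GG v) a (F l (\<sigma> \<xi>)) = (fV p r k (isin v) (nu v) (GG v) a l' \<circ> \<tau>) \<xi>)))
     \<or> (\<forall>\<xi>\<in>opensq. vfun p r k (isin v) (nu v) (GG v) a (F l (\<sigma> \<xi>)) = 0)"
proof -
  note f = vertex_star_of_data[OF mp vd[OF v] a]
  have z: "vfun p r k (isin v) (nu v) (GG v) a x = 0" if "x \<notin> (\<Union>l\<in>{..<nu v}. F (Lv v l) ` unitsq)" for x
  proof -
    have "GG v l ` unitsq = F (Lv v l) ` unitsq" if "l < nu v" for l by (rule image_sqsym[OF f(6)[OF that]])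
    then have "\<not> (\<exists>l<nu v. x \<in> GG v l ` unitsq)" using that by blast
    then show ?thesis unfolding vfun_def by (rule if_not_P)
  qed
  have "(\<exists>l'\<in>{..<nu v}. Lv v l' = l \<and> (\<exists>\<tau>\<in>sqsym. (\<forall>\<xi>. psiV v l' (\<tau> \<xi>) = \<sigma> \<xi>)
       \<and> (\<forall>\<xi>\<in>unitsq. vfun p r k (isin v) (nu v) (GG v) a (F l (\<sigma> \<xi>)) = (fV p r k (isin v) (nu v) (GG v) a l' \<circ> \<tau>) \<xi>)))
     \<or> (\<forall>\<xi>\<in>opensq. vfun p r k (isin v) (nu v) (GG v) a (F l (\<sigma> \<xi>)) = 0)"
    by (rule patch_restrict[OF mp, where I = "{..<nu v}" and L = "Lv v" and psi = "psiV v"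
          and \<phi> = "fV p r k (isin v) (nu v) (GG v) a" and f = "vfun p r k (isin v) (nu v) (GG v) a", OF _ _ _ z l \<sigma>])
       (use f(5,6) vfun_star_value[OF v a] in auto)
  then show ?thesis by blast
qed

text \<open>A vanishing combination is pulled back by H, in use a parameterization of one patch. The
  group T is collected in \<Phi>, each remaining function has property Q or coefficient 0, and the
  derivatives of \<Phi> on the closed square become combinations of derivatives of functions with Q.
  Q will be flatness at a corner or a zero jet at a point.\<close>

lemma focus:
  assumes z: "\<And>y. (\<Sum>I\<in>idx. c I * bf I y) = 0" and T: "T \<subseteq> idx" and \<Phi>: "\<Phi> \<in> TS p r k" "\<And>\<xi>. \<xi> \<in> opensq \<Longrightarrow> (\<Sum>I\<in>T. c I * bf I (H \<xi>)) = \<Phi> \<xi>"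
    and rest: "\<And>I. I \<in> idx - T \<Longrightarrow> c I = 0 \<or> (\<exists>\<psi>\<in>TS p r k. (\<forall>\<xi>\<in>opensq. bf I (H \<xi>) = \<psi> \<xi>) \<and> Q \<psi>)"
    and Q0: "Q (\<lambda>\<xi>. 0)"
  shows "\<exists>\<psi>. (\<forall>I\<in>idx-T. Q (\<psi> I)) \<and> (\<forall>\<xi>\<in>unitsq. \<forall>i\<le>2. \<forall>j\<le>2. dpart i j \<Phi> \<xi> = (\<Sum>I\<in>idx-T. - c I * dpart i j (\<psi> I) \<xi>))"
proof -
  have "\<forall>I\<in>idx-T. \<exists>\<psi>\<in>TS p r k. (\<forall>\<xi>\<in>opensq. c I * bf I (H \<xi>) = c I * \<psi> \<xi>) \<and> Q \<psi>"
  proof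
    fix I assume "I \<in> idx - T"
    from rest[OF this] show "\<exists>\<psi>\<in>TS p r k. (\<forall>\<xi>\<in>opensq. c I * bf I (H \<xi>) = c I * \<psi> \<xi>) \<and> Q \<psi>"
    proof
      assume "c I = 0" then show ?thesis using Q0 TS_zero by (intro bexI[of _ "\<lambda>\<xi>. 0"]) auto
    qed force
  qed
  then obtain \<psi> where \<psi>: "\<And>I. I \<in> idx - T \<Longrightarrow> \<psi> I \<in> TS p r k" "\<And>I \<xi>. I \<in> idx - T \<Longrightarrow> \<xi> \<in> opensq \<Longrightarrow> c I * bf I (H \<xi>) = c I * \<psi> I \<xi>" "\<And>I. I \<in> idx - T \<Longrightarrow> Q (\<psi> I)"
    by metis
  have fin: "finite (idx - T)" using finite_idx by simp
  have t: "(\<lambda>\<xi>. \<Sum>I\<in>idx-T. c I * \<psi> I \<xi>) \<in> TS p r k" by (rule TS_sum[OF fin TS_cmul[OF \<psi>(1)]])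
  have o: "\<Phi> \<xi> + (\<Sum>I\<in>idx-T. c I * \<psi> I \<xi>) = 0" if "\<xi> \<in> opensq" for \<xi>
  proof -
    have "(\<Sum>I\<in>idx. c I * bf I (H \<xi>)) = (\<Sum>I\<in>idx-T. c I * bf I (H \<xi>)) + (\<Sum>I\<in>T. c I * bf I (H \<xi>))"
      by (rule sum.subset_diff[OF T finite_idx])
    also have "(\<Sum>I\<in>idx-T. c I * bf I (H \<xi>)) = (\<Sum>I\<in>idx-T. c I * \<psi> I \<xi>)" using \<psi>(2) that by (intro sum.cong) auto
    finally show ?thesis using z[of "H \<xi>"] \<Phi>(2)[OF that] by simp
  qed
  have "dpart i j \<Phi> \<xi> = (\<Sum>I\<in>idx-T. - c I * dpart i j (\<psi> I) \<xi>)" if "\<xi> \<in> unitsq" and ij: "i \<le> 2" "j \<le> 2" for \<xi> i j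
  proof -
    have "0 = dpart i j (\<lambda>\<xi>. \<Phi> \<xi> + (\<Sum>I\<in>idx-T. c I * \<psi> I \<xi>)) \<xi>"
      by (rule TS_zero_open[OF TS_add[OF \<Phi>(1) t] o that, symmetric]) (simp add: opensq_def)
    also have "\<dots> = dpart i j \<Phi> \<xi> + dpart i j (\<lambda>\<xi>. \<Sum>I\<in>idx-T. c I * \<psi> I \<xi>) \<xi>" by (rule dpart_add[OF \<Phi>(1) t ij])
    also have "dpart i j (\<lambda>\<xi>. \<Sum>I\<in>idx-T. c I * \<psi> I \<xi>) \<xi> = (\<Sum>I\<in>idx-T. dpart i j (\<lambda>\<xi>. c I * \<psi> I \<xi>) \<xi>)"
      by (rule dpart_sum[OF fin TS_cmul[OF \<psi>(1)] ij])
    also have "\<dots> = (\<Sum>I\<in>idx-T. c I * dpart i j (\<psi> I) \<xi>)" by (intro sum.cong refl dpart_cmul[OF \<psi>(1) ij])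
    finally show ?thesis by (simp add: sum_negf)
  qed
  then show ?thesis using \<psi>(3) by blast
qed

lemma focus_flat:
  assumes "\<And>y. (\<Sum>I\<in>idx. c I * bf I y) = 0" "T \<subseteq> idx" "\<Phi> \<in> TS p r k" "\<And>\<xi>. \<xi> \<in> opensq \<Longrightarrow> (\<Sum>I\<in>T. c I * bf I (H \<xi>)) = \<Phi> \<xi>"
    and rest: "\<And>I. I \<in> idx - T \<Longrightarrow> c I = 0 \<or> (\<exists>\<psi>\<in>TS p r k. (\<forall>\<xi>\<in>opensq. bf I (H \<xi>) = \<psi> \<xi>) \<and> flat k \<psi>)"
  shows "flat k \<Phi>"
proof -
  have "flat k (\<lambda>\<xi>. 0)" by (rule flat_zj) (simp add: zj_def dpart_zero)
  from focus[OF assms this] obtain \<psi> where f: "\<And>I. I \<in> idx-T \<Longrightarrow> flat k (\<psi> I)"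
    and d: "\<And>\<xi> i j. \<xi> \<in> unitsq \<Longrightarrow> i \<le> 2 \<Longrightarrow> j \<le> 2 \<Longrightarrow> dpart i j \<Phi> \<xi> = (\<Sum>I\<in>idx-T. - c I * dpart i j (\<psi> I) \<xi>)" by blast
  show ?thesis unfolding flat_def
  proof (intro allI impI)
    fix s :: nat assume s: "s \<le> 2"
    have "\<forall>I\<in>idx-T. \<exists>w::real poly. \<forall>t. 0 < t \<and> t < hh k \<longrightarrow> dpart s 0 (\<psi> I) (0,t) = t ^ (5 - s) * poly w t"
      using f s unfolding flat_def by blast
    then obtain w :: "bidx \<Rightarrow> real poly" where w: "\<And>I t. I \<in> idx-T \<Longrightarrow> 0 < t \<and> t < hh k \<Longrightarrow> dpart s 0 (\<psi> I) (0,t) = t ^ (5 - s) * poly (w I) t"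
      by metis
    have "dpart s 0 \<Phi> (0,t) = t ^ (5 - s) * poly (\<Sum>I\<in>idx-T. smult (- c I) (w I)) t" if t: "0 < t \<and> t < hh k" for t
    proof -
      have "(0,t) \<in> unitsq" using t hh_le[of k] by (simp add: unitsq_def)
      then have "dpart s 0 \<Phi> (0,t) = (\<Sum>I\<in>idx-T. - c I * dpart s 0 (\<psi> I) (0,t))" using d s by simp
      also have "\<dots> = (\<Sum>I\<in>idx-T. - c I * (t ^ (5 - s) * poly (w I) t))" using w t by (intro sum.cong) auto
      finally show ?thesis by (simp add: poly_sum sum_distrib_left mult_ac)
    qed
    then show "\<exists>w::real poly. \<forall>t. 0 < t \<and> t < hh k \<longrightarrow> dpart s 0 \<Phi> (0,t) = t ^ (5 - s) * poly w t" by blast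
  qed
qed

lemma focus_zj:
  assumes "\<And>y. (\<Sum>I\<in>idx. c I * bf I y) = 0" "T \<subseteq> idx" "\<Phi> \<in> TS p r k" "\<And>\<xi>. \<xi> \<in> opensq \<Longrightarrow> (\<Sum>I\<in>T. c I * bf I (H \<xi>)) = \<Phi> \<xi>"
    and rest: "\<And>I. I \<in> idx - T \<Longrightarrow> c I = 0 \<or> (\<exists>\<psi>\<in>TS p r k. (\<forall>\<xi>\<in>opensq. bf I (H \<xi>) = \<psi> \<xi>) \<and> zj \<psi> \<eta>)"
    and \<eta>: "\<eta> \<in> unitsq"
  shows "zj \<Phi> \<eta>"
proof -
  have "zj (\<lambda>\<xi>. 0) \<eta>" by (simp add: zj_def dpart_zero)
  from focus[OF assms(1-5) this] obtain \<psi> where f: "\<And>I. I \<in> idx-T \<Longrightarrow> zj (\<psi> I) \<eta>"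
    and d: "\<And>\<xi> i j. \<xi> \<in> unitsq \<Longrightarrow> i \<le> 2 \<Longrightarrow> j \<le> 2 \<Longrightarrow> dpart i j \<Phi> \<xi> = (\<Sum>I\<in>idx-T. - c I * dpart i j (\<psi> I) \<xi>)" by blast
  show ?thesis unfolding zj_def
  proof (intro allI impI)
    fix i j :: nat assume ij: "i + j \<le> 2"
    then have "(\<Sum>I\<in>idx-T. - c I * dpart i j (\<psi> I) \<eta>) = 0" using f unfolding zj_def by (intro sum.neutral) auto
    then show "dpart i j \<Phi> \<eta> = 0" using d[OF \<eta>, of i j] ij by simp
  qed
qed

lemma kerH_lincomb:
  assumes v: "v \<in> vertSet P F"
  shows "(\<lambda>x. \<Sum>m\<in>{1..mV v}. c m * bV v m x) \<in> kerH p r k (isin v) (nu v) (GG v)" (is "?a \<in> _")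
proof -
  have K: "bV v m \<in> kerH p r k (isin v) (nu v) (GG v)" if "m \<in> {1..mV v}" for m by (rule bV_ker[OF v that])
  have VS: "vertex_star p r k (isin v) (nu v) (GG v) (bV v m)" if "m \<in> {1..mV v}" for m
    by (rule vertex_star_of_data(1)[OF mp vd[OF v] K[OF that]])
  have D: "dpart i j (\<lambda>\<xi>. \<Sum>m\<in>{1..mV v}. c m * X m \<xi>) (0,0) = 0"
    if X: "\<And>m. m \<in> {1..mV v} \<Longrightarrow> X m \<in> TS p r k" "\<And>m. m \<in> {1..mV v} \<Longrightarrow> dpart i j (X m) (0,0) = 0" and ij: "i \<le> 2" "j \<le> 2" for i j X
  proof -
    have "dpart i j (\<lambda>\<xi>. \<Sum>m\<in>{1..mV v}. c m * X m \<xi>) (0,0) = (\<Sum>m\<in>{1..mV v}. dpart i j (\<lambda>\<xi>. c m * X m \<xi>) (0,0))"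
      by (rule dpart_sum[OF _ TS_cmul[OF X(1)] ij]) auto
    also have "\<dots> = 0" using dpart_cmul[OF X(1) ij] X(2) by (intro sum.neutral) auto
    finally show ?thesis .
  qed
  show ?thesis unfolding kerH_def
  proof (intro CollectI conjI allI impI)
    fix x assume "\<not> validV (isin v) (nu v) x"
    then show "?a x = 0" using K unfolding kerH_def by (intro sum.neutral) auto
  next
    fix l i j assume l: "l < nu v" and ij: "i \<le> (2::nat)" "j \<le> (2::nat)"
    show "dpart i j (\<lambda>\<xi>. fGnext p r k (isin v) (nu v) (GG v) ?a l \<xi> - fGprev p r k (isin v) (nu v) (GG v) ?a l \<xi>) (0,0) = 0"
      unfolding vertex_lin sum_subtractf[symmetric] right_diff_distrib[symmetric]
      using K l ij vertex_star.fN_TS[OF VS l] vertex_star.fP_TS[OF VS l] unfolding kerH_def by (intro D TS_diff) auto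
    show "dpart i j (\<lambda>\<xi>. fGnext p r k (isin v) (nu v) (GG v) ?a l \<xi> - fOm p r k ?a l \<xi>) (0,0) = 0"
      unfolding vertex_lin sum_subtractf[symmetric] right_diff_distrib[symmetric]
      using K l ij vertex_star.fN_TS[OF VS l] vertex_star.fO_TS[OF VS] unfolding kerH_def by (intro D TS_diff) auto
  qed (use K in \<open>auto simp: kerH_def intro!: sum.neutral\<close>)
qed

end

text \<open>Pads the index ranges of the generators with zero coefficients to full ranges, where
  independence of all B-splines applies.\<close>

lemma sum_double_extend:
  fixes c :: "nat \<Rightarrow> nat \<Rightarrow> real"
  assumes "finite A" "\<And>i. i \<in> A \<Longrightarrow> finite (B i)" "A' \<subseteq> A" "\<And>i. i \<in> A' \<Longrightarrow> B' i \<subseteq> B i"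
  shows "(\<Sum>i\<in>A'. \<Sum>j\<in>B' i. c i j * g i j) = (\<Sum>i\<in>A. \<Sum>j\<in>B i. (if i \<in> A' \<and> j \<in> B' i then c i j else 0) * g i j)"
proof (rule sum.mono_neutral_cong_left[OF assms(1,3)])
  fix i assume i: "i \<in> A'"
  show "(\<Sum>j\<in>B' i. c i j * g i j) = (\<Sum>j\<in>B i. (if i \<in> A' \<and> j \<in> B' i then c i j else 0) * g i j)"
    using assms(2)[of i] assms(3) assms(4)[OF i] i by (intro sum.mono_neutral_cong_left) auto
qed auto

section \<open>Coefficients of a vanishing combination\<close>

context multipatch_family
begin

text \<open>All functions at v are merged into the single kernel element \<open>a\<close>. The other
  generators are flat in every patch at v, hence so is the function of \<open>a\<close>;
  \<open>kernel_zero\<close> gives a = 0, and independence of the chosen kernel basis separates the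
  coefficients.\<close>

lemma vertex_coeff_zero:
  assumes z: "\<And>y. (\<Sum>I\<in>idx. c I * bf I y) = 0" and v: "v \<in> vertSet P F" and m: "m \<in> {1..mV v}"
  shows "c (IV v m) = 0"
proof -
  define a where "a = (\<lambda>x. \<Sum>m\<in>{1..mV v}. c (IV v m) * bV v m x)"
  have aK: "a \<in> kerH p r k (isin v) (nu v) (GG v)" unfolding a_def by (rule kerH_lincomb[OF v])
  note f = vertex_star_of_data[OF mp vd[OF v] aK]
  have fl: "flat k (fV p r k (isin v) (nu v) (GG v) a l)" if l: "l < nu v" for l
  proof (rule focus_flat[OF z, where T = "IV v ` {1..mV v}" and H = "\<lambda>\<xi>. F (Lv v l) (psiV v l \<xi>)"])
    show "IV v ` {1..mV v} \<subseteq> idx" using v by (auto simp: idx_mem)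
    show "fV p r k (isin v) (nu v) (GG v) a l \<in> TS p r k" by (rule vertex_star.fv_TS[OF f(1) l])
    note lP = f(5)[OF l] and \<sigma> = f(6)[OF l]
    show "(\<Sum>I\<in>IV v ` {1..mV v}. c I * bf I (F (Lv v l) (psiV v l \<xi>))) = fV p r k (isin v) (nu v) (GG v) a l \<xi>" if "\<xi> \<in> opensq" for \<xi>
    proof -
      have \<xi>: "\<xi> \<in> unitsq" using that opensq_unitsq by blast
      have "(\<Sum>I\<in>IV v ` {1..mV v}. c I * bf I (F (Lv v l) (psiV v l \<xi>))) = (\<Sum>m\<in>{1..mV v}. c (IV v m) * bf (IV v m) (F (Lv v l) (psiV v l \<xi>)))"
        by (subst sum.reindex) (auto simp: inj_on_def)
      also have "\<dots> = (\<Sum>m\<in>{1..mV v}. c (IV v m) * fV p r k (isin v) (nu v) (GG v) (bV v m) l \<xi>)"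
        unfolding bf_IV by (intro sum.cong refl arg_cong2[where f = times] vfun_star_value[OF v bV_ker[OF v] l \<xi>])
      finally show ?thesis unfolding a_def vertex_lin .
    qed
    fix I assume I: "I \<in> idx - IV v ` {1..mV v}"
    have zr: "\<exists>\<psi>\<in>TS p r k. (\<forall>\<xi>\<in>opensq. bf I (F (Lv v l) (psiV v l \<xi>)) = \<psi> \<xi>) \<and> flat k \<psi>"
      if "\<forall>\<xi>\<in>opensq. bf I (F (Lv v l) (psiV v l \<xi>)) = 0"
      using that by (intro bexI[of _ "\<lambda>\<xi>. 0"] conjI flat_zj TS_zero) (auto simp: zj_def dpart_zero)
    have pr: "\<exists>\<psi>\<in>TS p r k. (\<forall>\<xi>\<in>opensq. bf I (F (Lv v l) (psiV v l \<xi>)) = \<psi> \<xi>) \<and> flat k \<psi>"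
      if "\<forall>\<xi>\<in>unitsq. bf I (F (Lv v l) (psiV v l \<xi>)) = (\<phi> \<circ> \<tau>) \<xi>" "\<tau> \<in> sqsym" "\<phi> \<in> TS p r k" "flat k (\<phi> \<circ> \<tau>)" for \<phi> \<tau>
      using that TS_sqsym(1)[OF that(3,2)] opensq_unitsq by (intro bexI[of _ "\<phi> \<circ> \<tau>"] conjI) auto
    have "\<exists>\<psi>\<in>TS p r k. (\<forall>\<xi>\<in>opensq. bf I (F (Lv v l) (psiV v l \<xi>)) = \<psi> \<xi>) \<and> flat k \<psi>"
    proof (cases I)
      case (IP l' i j)
      then have m: "l' \<in> {1..P}" "i \<in> Pidx" "j \<in> Pidx" using I by (auto simp: idx_mem)
      from pfun_restrict[OF lP m(1) \<sigma>, of i j, folded IP] show ?thesis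
      proof
        assume "l' = Lv v l \<and> (\<forall>\<xi>\<in>unitsq. bf I (F (Lv v l) (psiV v l \<xi>)) = (NN i j \<circ> psiV v l) \<xi>)"
        moreover have "flat k (NN i j \<circ> psiV v l)" by (rule flat_zj[OF Nprod_sqsym_zj[OF m(2,3) \<sigma>]])
        ultimately show ?thesis using pr[OF _ \<sigma> Nprod_TS] by blast
      qed (rule zr)
    next
      case (IE s i j)
      then have m: "s \<in> commonEdges P F" "i \<le> 2" "j \<in> Eidx s i" using I by (auto simp: idx_mem)
      note b = patch_bilinear[OF edge_facts(6)[OF m(1)]] patch_bilinear[OF edge_facts(7)[OF m(1)]]
      from efun_restrict[OF lP m \<sigma>, folded IE] show ?thesis
      proof (elim disjE exE conjE bexE)
        fix tau \<tau> assume \<tau>: "\<tau> \<in> sqsym" and d: "\<forall>\<xi>\<in>unitsq. bf I (F (Lv v l) (psiV v l \<xi>)) = (gfun p r k (EA s) (EB s) tau i j \<circ> \<tau>) \<xi>"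
        show ?thesis by (rule pr[OF d \<tau> gfun_TS[OF b] gfun_sqsym_flat[OF b m(2,3) \<tau>]])
      qed (rule zr)
    next
      case (IV v' m')
      then have m: "v' \<in> vertSet P F" "m' \<in> {1..mV v'}" and ne: "v' \<noteq> v" using I by (auto simp: idx_mem)
      note g = vertex_star_of_data[OF mp vd[OF m(1)] bV_ker[OF m]]
      from vfun_restrict[OF lP m(1) bV_ker[OF m] \<sigma>, folded bf_IV, folded IV] show ?thesis
      proof (elim disjE exE conjE bexE)
        fix l' \<tau> assume l': "l' < nu v'" "Lv v' l' = Lv v l" and \<tau>: "\<tau> \<in> sqsym" "\<forall>\<xi>. psiV v' l' (\<tau> \<xi>) = psiV v l \<xi>"
          and e: "\<forall>\<xi>\<in>unitsq. bf I (F (Lv v l) (psiV v l \<xi>)) = (fV p r k (isin v') (nu v') (GG v') (bV v' m') l' \<circ> \<tau>) \<xi>"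
        \<comment> \<open>If \<tau> fixed the origin, both parameterizations of this patch would
          start at the same corner, so v' = v.\<close>
        have "\<tau> (0,0) \<noteq> (0,0)"
        proof
          assume "\<tau> (0,0) = (0,0)"
          then have "psiV v' l' (0,0) = psiV v l (0,0)" using \<tau>(2) by metis
          then have "v' = v" using f(2)[OF l] g(2)[OF l'(1)] l'(2) by simp
          then show False using ne by simp
        qed
        then show ?thesis by (intro pr[OF e \<tau>(1)] vertex_star.fv_TS[OF g(1) l'(1)] vertex_star.fv_sqsym_flat[OF g(1) l'(1) \<tau>(1)])
      qed (rule zr)
    qed
    then show "c I = 0 \<or> (\<exists>\<psi>\<in>TS p r k. (\<forall>\<xi>\<in>opensq. bf I (F (Lv v l) (psiV v l \<xi>)) = \<psi> \<xi>) \<and> flat k \<psi>)" ..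
  qed
  have "a x = 0" for x by (rule vertex_star.kernel_zero[OF f(1) fl])
  then have "\<forall>x. (\<Sum>m\<in>{1..mV v}. c (IV v m) * bV v m x) = 0" by (simp add: a_def)
  then show ?thesis using bV_indep[OF v, unfolded lin_indep_def, rule_format, of "\<lambda>m. c (IV v m)" m] m by blast
qed

text \<open>An inner point of the edge s would also lie in the other patch of s'. By
  \<open>three_patches\<close> that patch cannot be a third one, and if it were \<open>eB s\<close>,
  both edges would join the same two patches and be equal as index pairs.\<close>

lemma edge_third_patch:
  assumes s: "s \<in> commonEdges P F" "s' \<in> commonEdges P F" "s' \<noteq> s" and t: "0 < t" "t < 1" and t': "t' \<in> {0..1}"
    and e: "(if tau then eA s' else eB s') = eA s" "(if tau then psiA s' else psiB s') (0,t') = psiA s (0,t)"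
  shows False
proof -
  note f = edge_facts[OF s(1)] and g = edge_facts[OF s(2)]
  define l where "l = (if tau then eB s' else eA s')"
  have lP: "l \<in> {1..P}" using g(1,2) by (simp add: l_def)
  have ne: "l \<noteq> eA s" using e(1) g(3) by (auto simp: l_def split: if_splits)
  have ne': "l \<noteq> eB s"
  proof
    assume "l = eB s"
    then have "{fst s', snd s'} = {fst s, snd s}" unfolding f(10)[symmetric] g(10)[symmetric] using e(1) by (auto simp: l_def split: if_splits)
    then show False using f(11) g(11) s(3) by (auto simp: doubleton_eq_iff prod_eq_iff)
  qed
  have x: "EA s (0,t) = F l ((if tau then psiB s' else psiA s') (0,t'))"
    using e g(8)[OF t'] by (auto simp: l_def split: if_splits)
  have q: "(if tau then psiB s' else psiA s') \<in> sqsym" using g by simp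
  have u: "(0,t') \<in> unitsq" using t' by (simp add: unitsq_def)
  have x': "EA s (0,t) \<in> F l ` unitsq" unfolding x using sqsym_mem(1)[OF q, of "(0,t')"] u by blast
  show False
    by (rule three_patches[OF f(6,7) multipatch_patch[OF mp lP] common_edge(2)[OF f(6,7,8,9) t] x'])
       (simp_all only: image_sqsym[OF f(4)] image_sqsym[OF f(5)] multipatch_disjoint[OF mp lP f(1) ne] multipatch_disjoint[OF mp lP f(2) ne'])
qed

lemma edge_sum_zj:
  assumes z: "\<And>y. (\<Sum>I\<in>idx. c I * bf I y) = 0" and s: "s \<in> commonEdges P F"
    and C: "\<And>v m. IV v m \<in> idx \<Longrightarrow> c (IV v m) = 0" and t: "0 < t" "t < 1"
  shows "zj (\<lambda>\<xi>. \<Sum>i\<le>2. \<Sum>j\<in>Eidx s i. c (IE s i j) * gfun p r k (EA s) (EB s) True i j \<xi>) (0,t)"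
proof -
  note f = edge_facts[OF s]
  note b = patch_bilinear[OF f(6)] patch_bilinear[OF f(7)]
  note \<sigma> = f(4) and lP = f(1)
  let ?D = "SIGMA i:{..2}. Eidx s i"
  show ?thesis
  proof (rule focus_zj[OF z, where T = "(\<lambda>(i,j). IE s i j) ` ?D" and H = "\<lambda>\<xi>. F (eA s) (psiA s \<xi>)"])
    show "(\<lambda>(i,j). IE s i j) ` ?D \<subseteq> idx" using s by (auto simp: idx_mem)
    show "(\<lambda>\<xi>. \<Sum>i\<le>2. \<Sum>j\<in>Eidx s i. c (IE s i j) * gfun p r k (EA s) (EB s) True i j \<xi>) \<in> TS p r k"
      by (intro TS_sum TS_cmul gfun_TS[OF b]) auto
    show "(0,t) \<in> unitsq" using t by (simp add: unitsq_def)
    show "(\<Sum>I\<in>(\<lambda>(i,j). IE s i j) ` ?D. c I * bf I (F (eA s) (psiA s \<xi>))) = (\<Sum>i\<le>2. \<Sum>j\<in>Eidx s i. c (IE s i j) * gfun p r k (EA s) (EB s) True i j \<xi>)"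
      if "\<xi> \<in> opensq" for \<xi>
    proof -
      have \<xi>: "\<xi> \<in> unitsq" using that opensq_unitsq by blast
      have "(\<Sum>I\<in>(\<lambda>(i,j). IE s i j) ` ?D. c I * bf I (F (eA s) (psiA s \<xi>))) = (\<Sum>(i,j)\<in>?D. c (IE s i j) * bf (IE s i j) (F (eA s) (psiA s \<xi>)))"
        by (subst sum.reindex) (auto simp: inj_on_def intro!: sum.cong)
      also have "\<dots> = (\<Sum>i\<le>2. \<Sum>j\<in>Eidx s i. c (IE s i j) * bf (IE s i j) (F (eA s) (psiA s \<xi>)))"
        by (rule sum.Sigma[symmetric]) auto
      also have "\<dots> = (\<Sum>i\<le>2. \<Sum>j\<in>Eidx s i. c (IE s i j) * gfun p r k (EA s) (EB s) True i j \<xi>)"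
      proof (intro sum.cong refl)
        fix i j assume "i \<in> {..2::nat}" and j: "j \<in> Eidx s i"
        then have i: "i \<le> 2" by simp
        show "c (IE s i j) * bf (IE s i j) (F (eA s) (psiA s \<xi>)) = c (IE s i j) * gfun p r k (EA s) (EB s) True i j \<xi>"
          using efun_value(1)[OF f(6,7,8,9) i j \<xi>] by simp
      qed
      finally show ?thesis .
    qed
    fix I assume I: "I \<in> idx - (\<lambda>(i,j). IE s i j) ` ?D"
    have zr: "\<exists>\<psi>\<in>TS p r k. (\<forall>\<xi>\<in>opensq. bf I (F (eA s) (psiA s \<xi>)) = \<psi> \<xi>) \<and> zj \<psi> (0,t)"
      if "\<forall>\<xi>\<in>opensq. bf I (F (eA s) (psiA s \<xi>)) = 0"
      using that by (intro bexI[of _ "\<lambda>\<xi>. 0"] conjI TS_zero) (auto simp: zj_def dpart_zero)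
    have pr: "\<exists>\<psi>\<in>TS p r k. (\<forall>\<xi>\<in>opensq. bf I (F (eA s) (psiA s \<xi>)) = \<psi> \<xi>) \<and> zj \<psi> (0,t)"
      if "\<forall>\<xi>\<in>unitsq. bf I (F (eA s) (psiA s \<xi>)) = (\<phi> \<circ> \<tau>) \<xi>" "\<tau> \<in> sqsym" "\<phi> \<in> TS p r k" "zj (\<phi> \<circ> \<tau>) (0,t)" for \<phi> \<tau>
      using that TS_sqsym(1)[OF that(3,2)] opensq_unitsq by (intro bexI[of _ "\<phi> \<circ> \<tau>"] conjI) auto
    show "c I = 0 \<or> (\<exists>\<psi>\<in>TS p r k. (\<forall>\<xi>\<in>opensq. bf I (F (eA s) (psiA s \<xi>)) = \<psi> \<xi>) \<and> zj \<psi> (0,t))"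
    proof (cases I)
      case (IP l' i j)
      then have m: "l' \<in> {1..P}" "i \<in> Pidx" "j \<in> Pidx" using I by (auto simp: idx_mem)
      from pfun_restrict[OF lP m(1) \<sigma>, of i j, folded IP] show ?thesis
      proof
        assume "l' = eA s \<and> (\<forall>\<xi>\<in>unitsq. bf I (F (eA s) (psiA s \<xi>)) = (NN i j \<circ> psiA s) \<xi>)"
        moreover have "zj (NN i j \<circ> psiA s) (0,t)" by (rule Nprod_sqsym_zj[OF m(2,3) \<sigma> t])
        ultimately show ?thesis using pr[OF _ \<sigma> Nprod_TS] by blast
      qed (intro disjI2 zr)
    next
      case (IE s' i j)
      then have m: "s' \<in> commonEdges P F" "i \<le> 2" "j \<in> Eidx s' i" and ne: "s' \<noteq> s" using I by (auto simp: idx_mem)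
      note b' = patch_bilinear[OF edge_facts(6)[OF m(1)]] patch_bilinear[OF edge_facts(7)[OF m(1)]]
      from efun_restrict[OF lP m \<sigma>, folded IE] show ?thesis
      proof (elim disjE exE conjE bexE)
        fix tau \<tau> assume e: "(if tau then eA s' else eB s') = eA s" and \<tau>: "\<tau> \<in> sqsym" "\<forall>\<xi>. (if tau then psiA s' else psiB s') (\<tau> \<xi>) = psiA s \<xi>"
          and d: "\<forall>\<xi>\<in>unitsq. bf I (F (eA s) (psiA s \<xi>)) = (gfun p r k (EA s') (EB s') tau i j \<circ> \<tau>) \<xi>"
        \<comment> \<open>An inner point of s does not lie on the edge s', so \<tau> leads to a side
          on which the functions of s' have zero jets.\<close>
        have no: "\<tau> (0,t) \<noteq> (0,t')" if "t' \<in> {0..1}" for t'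
        proof
          assume "\<tau> (0,t) = (0,t')"
          then have "(if tau then psiA s' else psiB s') (0,t') = psiA s (0,t)" using \<tau>(2)[rule_format, of "(0,t)"] by simp
          then show False by (rule edge_third_patch[OF s m(1) ne t that e])
        qed
        have "zj (gfun p r k (EA s') (EB s') tau i j) (\<tau> (0,t))"
          using sqsym_left_side[OF \<tau>(1)] no[of t] no[of "1-t"] t gfun_zj[OF b' m(2,3)] by (elim disjE exE) simp_all
        then show ?thesis using zj_sqsym[OF gfun_TS[OF b'] \<tau>(1)] by (intro disjI2 pr[OF d \<tau>(1) gfun_TS[OF b']])
      qed (intro disjI2 zr)
    next
      case (IV v' m')
      then show ?thesis using C I by auto
    qed
  qed
qed

text \<open>The transversal derivatives of order q = 0, 1, 2 on the open edge separate the families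
  i = 0, 1, 2 in turn. As \<open>alpha\<close> has no zero on the edge, it can be divided out before
  \<open>Nsp_indep\<close> is applied.\<close>

lemma edge_coeff_zero:
  assumes z: "\<And>y. (\<Sum>I\<in>idx. c I * bf I y) = 0" and s: "s \<in> commonEdges P F"
    and C: "\<And>v m. IV v m \<in> idx \<Longrightarrow> c (IV v m) = 0" and ij: "i \<le> 2" "j \<in> Eidx s i"
  shows "c (IE s i j) = 0"
proof -
  note f = edge_facts[OF s]
  define A B where "A = EA s" and "B = EB s"
  define n where "n = nE p r k A B"
  define d where "d = dal A B"
  define C' where "C' i j = (if i \<in> {..2} \<and> j \<in> Eidx s i then c (IE s i j) else 0)" for i j
  have d1: "d \<le> 1" using dal_le by (simp add: d_def)
  have bl: "bilinear_map A" "bilinear_map B" using patch_bilinear f(6,7) by (auto simp: A_def B_def)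
  have n: "n 0 = dimS p (r+2) k" "n 1 = dimS (p-d) (r+1) k" "n 2 = dimS (p-2*d) r k" by (simp_all add: n_def nE_def d_def)
  have n8: "8 \<le> n i" for i using dims(1) dims(2)[OF dal_le[of A B]] dims(3)[OF dal_le[of A B]] by (auto simp: n_def nE_def Let_def)
  have sub: "Eidx s i \<subseteq> {..<n i}" if "i \<in> {..2}" for i
    using that n8[of i] by (auto simp: n_def A_def B_def)
  have E: "(\<Sum>i\<le>2. \<Sum>j<n i. C' i j * gc p r k A B True i j q t) = 0" if q: "q \<le> 2" and t: "0 < t" "t < 1" for q t
  proof -
    have T: "(\<lambda>\<xi>. c (IE s i j) * gfun p r k A B True i j \<xi>) \<in> TS p r k" for i j by (rule TS_cmul[OF gfun_TS[OF bl]])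
    have D: "dpart q 0 (\<lambda>\<xi>. c (IE s i j) * gfun p r k A B True i j \<xi>) (0,t) = c (IE s i j) * gc p r k A B True i j q t" for i j
      unfolding dpart_cmul[OF gfun_TS[OF bl] q le0] unfolding gfun_MT by (subst dpart_MT_0) (use gc_PS[OF bl] q in auto)
    have "0 = dpart q 0 (\<lambda>\<xi>. \<Sum>i\<le>2. \<Sum>j\<in>Eidx s i. c (IE s i j) * gfun p r k A B True i j \<xi>) (0,t)"
      using edge_sum_zj[OF z s C t] q unfolding zj_def A_def B_def by auto
    also have "\<dots> = (\<Sum>i\<le>2. dpart q 0 (\<lambda>\<xi>. \<Sum>j\<in>Eidx s i. c (IE s i j) * gfun p r k A B True i j \<xi>) (0,t))"
      by (rule dpart_sum[OF _ TS_sum[OF _ T] q le0]) auto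
    also have "\<dots> = (\<Sum>i\<le>2. \<Sum>j\<in>Eidx s i. dpart q 0 (\<lambda>\<xi>. c (IE s i j) * gfun p r k A B True i j \<xi>) (0,t))"
      by (intro sum.cong refl dpart_sum[OF _ T q le0]) auto
    also have "\<dots> = (\<Sum>i\<le>2. \<Sum>j<n i. C' i j * gc p r k A B True i j q t)"
      unfolding D C'_def by (rule sum_double_extend) (use sub in auto)
    finally show ?thesis by simp
  qed
  have S: "(\<Sum>i\<le>2. \<Sum>j<n i. f i j) = (\<Sum>j<n 0. f 0 j) + (\<Sum>j<n 1. f 1 j) + (\<Sum>j<n 2. f 2 j)" for f :: "nat \<Rightarrow> nat \<Rightarrow> real"
    by (simp add: numeral_2_eq_2 atMost_Suc)
  have al: "alpha A B True t \<noteq> 0" if "0 < t" "t < 1" for t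
  proof -
    have "abar A (1/2) * abar B (1/2) < 0" unfolding A_def B_def by (rule common_edge(1)[OF f(6,7,8,9)]) auto
    then have "c1 A B \<noteq> 0" by (rule c1_nonzero[OF bl])
    moreover have "abar A t \<noteq> 0" unfolding abar_jdet A_def using f(6) that by (auto simp: patch_def unitsq_def)
    ultimately show ?thesis by (simp add: alpha_def)
  qed
  have ph: "hh k \<noteq> 0" "real p \<noteq> 0" "real p - 1 \<noteq> 0" using hh_pos[of k] p5 by auto
  have dz: "deriv (gphi p r k d i j 0) = (\<lambda>t. 0)" "deriv (deriv (gphi p r k d i j 0)) = (\<lambda>t. 0)" if "i \<noteq> 0" for i j
    using that by (simp_all add: gphi_def deriv_zero_fun)
  have dz1: "deriv (gphi p r k d i j 1) = (\<lambda>t. 0)" if "i \<noteq> 1" for i j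
    using that by (simp add: gphi_def deriv_zero_fun)
  have Z0: "C' 0 j = 0" if "j < n 0" for j
  proof (rule Nsp_indep[where c = "C' 0", OF rp(3)])
    fix t :: real assume t: "0 < t" "t < 1"
    show "(\<Sum>j<dimS p (r+2) k. C' 0 j * Nsp p (r+2) k j t) = 0"
      using E[OF le0 t] unfolding S n(1)[symmetric] by (simp add: gc_def gphi_def Let_def)
  qed (use that n in simp)
  have Z1: "C' 1 j = 0" if "j < n 1" for j
  proof (rule Nsp_indep[where c = "C' 1", OF rp(4)[OF d1]])
    fix t :: real assume t: "0 < t" "t < 1"
    have "0 = (\<Sum>j<n 1. C' 1 j * gc p r k A B True 1 j 1 t)"
      using E[of 1 t] t unfolding S by (simp add: Z0 gc_def Let_def gphi_def deriv_zero_fun)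
    also have "\<dots> = (\<Sum>j<n 1. alpha A B True t * (real p / hh k) * (C' 1 j * Nsp (p-d) (r+1) k j t))"
      by (intro sum.cong refl) (simp add: gc_def Let_def d_def[symmetric] dz, simp add: gphi_def)
    also have "\<dots> = alpha A B True t * (real p / hh k) * (\<Sum>j<n 1. C' 1 j * Nsp (p-d) (r+1) k j t)"
      by (simp only: sum_distrib_left)
    finally show "(\<Sum>j<dimS (p-d) (r+1) k. C' 1 j * Nsp (p-d) (r+1) k j t) = 0"
      using al[OF t] ph unfolding n(2)[symmetric] by simp
  qed (use that n in simp)
  have Z2: "C' 2 j = 0" if "j < n 2" for j
  proof (rule Nsp_indep[where c = "C' 2", OF rp(5)[OF d1]])
    fix t :: real assume t: "0 < t" "t < 1"
    have "0 = (\<Sum>j<n 2. C' 2 j * gc p r k A B True 2 j 2 t)"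
      using E[of 2 t] t unfolding S by (simp add: Z0 Z1[unfolded One_nat_def])
    also have "\<dots> = (\<Sum>j<n 2. (alpha A B True t)\<^sup>2 * (real p * (real p - 1) / (hh k)\<^sup>2) * (C' 2 j * Nsp (p-2*d) r k j t))"
      by (intro sum.cong refl) (simp add: gc_def Let_def d_def[symmetric] dz dz1[unfolded One_nat_def], simp add: gphi_def)
    also have "\<dots> = (alpha A B True t)\<^sup>2 * (real p * (real p - 1) / (hh k)\<^sup>2) * (\<Sum>j<n 2. C' 2 j * Nsp (p-2*d) r k j t)"
      by (simp only: sum_distrib_left)
    finally show "(\<Sum>j<dimS (p-2*d) r k. C' 2 j * Nsp (p-2*d) r k j t) = 0"
      using al[OF t] ph unfolding n(3)[symmetric] by simp
  qed (use that n in simp)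
  have "i = 0 \<or> i = 1 \<or> i = 2" using ij by auto
  moreover have "j < n i" using sub[of i] ij by auto
  ultimately have "C' i j = 0" using Z0[of j] Z1[of j] Z2[of j] by auto
  then show ?thesis using ij by (simp add: C'_def)
qed

text \<open>In the interior of a patch only its own functions are left. Independence is used first
  in x for fixed y, then in y.\<close>

lemma patch_coeff_zero:
  assumes z: "\<And>y. (\<Sum>I\<in>idx. c I * bf I y) = 0" and l: "l \<in> {1..P}"
    and C: "\<And>v m. IV v m \<in> idx \<Longrightarrow> c (IV v m) = 0" "\<And>s i j. IE s i j \<in> idx \<Longrightarrow> c (IE s i j) = 0"
    and ij: "i \<in> Pidx" "j \<in> Pidx"
  shows "c (IP l i j) = 0"
proof -
  define C' where "C' i j = (if i \<in> Pidx \<and> j \<in> Pidx then c (IP l i j) else 0)" for i j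
  define n where "n = dimS p r k"
  let ?T = "(\<lambda>(i,j). IP l i j) ` (Pidx \<times> Pidx)"
  have "n \<ge> 6" unfolding n_def by (rule dims(4))
  then have sub: "Pidx \<subseteq> {..<n}" by (auto simp: n_def dimS_def)
  have E: "(\<Sum>i<n. \<Sum>j<n. C' i j * (Nsp p r k i x * Nsp p r k j y)) = 0" if "0 < x" "x < 1" "0 < y" "y < 1" for x y
  proof -
    have o: "(x,y) \<in> opensq" using that by (simp add: opensq_def)
    then have u: "(x,y) \<in> unitsq" using opensq_unitsq by blast
    have inj: "inj_on (F l) unitsq" using multipatch_patch[OF mp l] by (simp add: patch_def)
    have "0 = (\<Sum>I\<in>idx. c I * bf I (F l (x,y)))" using z by simp
    also have "\<dots> = (\<Sum>I\<in>?T. c I * bf I (F l (x,y)))"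
    proof (rule sum.mono_neutral_right[OF finite_idx])
      show "?T \<subseteq> idx" using l by (auto simp: idx_mem)
      show "\<forall>I\<in>idx - ?T. c I * bf I (F l (x,y)) = 0"
      proof
        fix I assume I: "I \<in> idx - ?T"
        show "c I * bf I (F l (x,y)) = 0"
        proof (cases I)
          case (IP l' i j)
          then have "l' \<in> {1..P}" "l' \<noteq> l" using I by (auto simp: idx_mem)
          then have "bf I (F l (x,y)) = 0" using pfun_restrict[OF l _ sqsym_id, of l' i j] o unfolding IP by blast
          then show ?thesis by simp
        qed (use I C in auto)
      qed
    qed
    also have "\<dots> = (\<Sum>(i,j)\<in>Pidx \<times> Pidx. c (IP l i j) * bf (IP l i j) (F l (x,y)))"
      by (subst sum.reindex) (auto simp: inj_on_def intro!: sum.cong)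
    also have "\<dots> = (\<Sum>i\<in>Pidx. \<Sum>j\<in>Pidx. c (IP l i j) * bf (IP l i j) (F l (x,y)))"
      by (rule sum.cartesian_product[symmetric])
    also have "\<dots> = (\<Sum>i\<in>Pidx. \<Sum>j\<in>Pidx. c (IP l i j) * (Nsp p r k i x * Nsp p r k j y))"
      using inj u by (simp add: pfun_def)
    also have "\<dots> = (\<Sum>i<n. \<Sum>j<n. C' i j * (Nsp p r k i x * Nsp p r k j y))"
      unfolding C'_def by (rule sum_double_extend) (use sub in auto)
    finally show ?thesis by simp
  qed
  have 1: "(\<Sum>j<n. C' i j * Nsp p r k j y) = 0" if "0 < y" "y < 1" "i < n" for i y
  proof (rule Nsp_indep[where c = "\<lambda>i. \<Sum>j<n. C' i j * Nsp p r k j y", OF rp(1)])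
    show "(\<Sum>i<dimS p r k. (\<Sum>j<n. C' i j * Nsp p r k j y) * Nsp p r k i x) = 0" if "0 < x" "x < 1" for x
      using E[OF that \<open>0 < y\<close> \<open>y < 1\<close>] unfolding n_def by (simp only: sum_distrib_left sum_distrib_right mult_ac)
  qed (use that in \<open>simp add: n_def\<close>)
  have in': "i < n" "j < n" using ij sub by auto
  have "C' i j = 0"
    by (rule Nsp_indep[where c = "C' i", OF rp(1)]) (use 1 in' in \<open>auto simp: n_def\<close>)
  then show ?thesis using ij by (simp add: C'_def)
qed

lemma bf_lin_indep: "lin_indep idx bf"
  unfolding lin_indep_def
proof (intro allI impI ballI)
  fix c I assume z: "\<forall>y. (\<Sum>I\<in>idx. c I * bf I y) = 0" and I: "I \<in> idx"
  have V: "c (IV v m) = 0" if "IV v m \<in> idx" for v m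
    using vertex_coeff_zero[of c] z that by (auto simp: idx_mem)
  have E: "c (IE s i j) = 0" if "IE s i j \<in> idx" for s i j
    using edge_coeff_zero[of c s i j] z V that by (simp add: idx_mem)
  have Q: "c (IP l i j) = 0" if "IP l i j \<in> idx" for l i j
    using patch_coeff_zero[of c l i j] z V E that by (simp add: idx_mem(1))
  show "c I = 0" using I V E Q by (cases I) auto
qed

theorem basis: "fspan idx bf \<subseteq> V0h p r k P F \<and> basis_of (fspan idx bf) idx bf"
  unfolding basis_of_def
proof (intro conjI ballI span_V0h finite_idx bf_lin_indep subset_refl)
  fix I assume I: "I \<in> idx"
  have "bf I = (\<lambda>y. \<Sum>i\<in>idx. (if i = I then 1 else 0) * bf i y)"
    using I finite_idx by (simp add: fun_eq_iff if_distrib[of "\<lambda>x. x * _"] sum.delta cong: if_cong)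
  then show "bf I \<in> fspan idx bf" unfolding fspan_def by (intro CollectI exI[of _ "\<lambda>i. if i = I then 1 else 0"])
qed

end

theorem theorem1:
  fixes p r k P :: nat
    and F :: "nat \<Rightarrow> pt \<Rightarrow> pt"
    and eA eB :: "nat \<times> nat \<Rightarrow> nat"
    and psiA psiB :: "nat \<times> nat \<Rightarrow> pt \<Rightarrow> pt"
    and nu :: "pt \<Rightarrow> nat" and Lv :: "pt \<Rightarrow> nat \<Rightarrow> nat" and psiV :: "pt \<Rightarrow> nat \<Rightarrow> pt \<Rightarrow> pt"
    and mV :: "pt \<Rightarrow> nat" and bV :: "pt \<Rightarrow> nat \<Rightarrow> vcoef \<Rightarrow> real"
  assumes "p \<ge> 5"
    and "k \<ge> 1 \<longrightarrow> 2 \<le> r \<and> r \<le> p - 3"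
    and "int k * (int p - int r - 2) \<ge> 9 - int p"
    and "multipatch P F"
    and "\<forall>s\<in>commonEdges P F. edge_data P F s (eA s) (eB s) (psiA s) (psiB s)"
    and "\<forall>v\<in>vertSet P F. vertex_data p r k P F v (nu v) (Lv v) (psiV v) (mV v) (bV v)"
  shows "fspan (Iset p r k P F eA eB psiA psiB mV) (fam p r k P F eA eB psiA psiB nu Lv psiV bV)
           \<subseteq> V0h p r k P F
       \<and> basis_of (fspan (Iset p r k P F eA eB psiA psiB mV) (fam p r k P F eA eB psiA psiB nu Lv psiV bV))
           (Iset p r k P F eA eB psiA psiB mV) (fam p r k P F eA eB psiA psiB nu Lv psiV bV)"
proof -
  interpret multipatch_family p r k P F eA eB psiA psiB nu Lv psiV mV bV
    using assms by unfold_locales auto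
  show ?thesis by (rule basis)
qed

end
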